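(* Let $k\ge 3$. The subgroup $\tilde G_{k+1}^{k}$ of the group $G_{k+1}^{k}$ has index $2^{k-1}$ in $G_{k+1}^{k}$ and is isomorphic to the fundamental group $\pi_1(\tilde C'_{k+1}(\mathbb{R}P^{k-1}))$.
   Context: The group $G_{k+1}^{k}$. Let $[k+1]=\{1,\dots,k+1\}$. $G_{k+1}^{k}$ is generated by elements $a_m$, one for each $k$-element subset $m\subset[k+1]$, with relations $a_m^2=1$ for every $m$, and $(a_{m^1}a_{m^2}\cdots a_{m^{k+1}})^2=1$ for every ordering $m^1,\dots,m^{k+1}$ of all the $k$-element subsets of $[k+1]$. The configuration spaces. $C'_{k+1}(\mathbb{R}P^{k-1})$ is the space of ordered $(k+1)$-tuples $(x_1,\dots,x_{k+1})$ of pairwise distinct points of $\mathbb{R}P^{k-1}$ such that any $k-1$ of them are in general position, i.e. no $k-1$ of them lie in a common projective $(k-3)$-plane. Let $y_j\in\mathbb{R}P^{k-1}$ ($1\le j\le k$) be the point whose homogeneous coordinates $(a_1:\dots:a_k)$ are $a_i(y_j)=\delta_i^j$. Then $\tilde C'_{k+1}(\mathbb{R}P^{k-1})\subset C'_{k+1}(\mathbb{R}P^{k-1})$ is the subspace of tuples with $x_i=y_i$ for $i=1,\dots,k-1$ (so only $x_k$ and $x_{k+1}$ move). Singular values. A point of the configuration space is singular if some $k$ of the points $x_1,\dots,x_{k+1}$ lie in a common projective $(k-2)$-plane. For a smooth path $\gamma$ with parameter $t\in[0,1]$ in the configuration space, $t$ is a singular value if $\gamma(t)$ is singular. A singular value $t$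 at which exactly one $k$-element subset $m$ of the points lies in a $(k-2)$-plane is said to be of type $m$. It is stable if for every sufficiently small perturbation of $\gamma$ there is exactly one parameter value near $t$ at which the $k$ points indexed by $m$ lie in a common $(k-2)$-plane. A path with nonsingular endpoints is good and stable if it has finitely many singular values, each of them has a type (only one $k$-subset of the points lies in a $(k-2)$-plane), and each is stable. The word of such a path is $a_{m_1}\cdots a_{m_l}$, where $m_1,\dots,m_l$ are the types of its successive singular values. The subgroup $\tilde G_{k+1}^{k}$. Let $z=(y_1,\dots,y_k,(1:1:\dots:1))\in\tilde C'_{k+1}(\mathbb{R}P^{k-1})$. Then $\tilde G_{k+1}^{k}$ is the subgroup of $G_{k+1}^{k}$ consisting of the elements represented by words $a_{m_1}\cdots a_{m_l}$ that are the word of some good and stable path in $\tilde C'_{k+1}(\mathbb{R}P^{k-1})$ which both starts and ends at $z$. *)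

theory Defs
  imports "HOL-Analysis.Analysis" "HOL-Algebra.Coset" "HOL-Library.Function_Algebras"
begin

section \<open>Groups given by generators and relators\<close>

text \<open>
  A word over \<open>S\<close> is a list of signed letters: \<open>(x, True)\<close> stands for \<open>x\<close> and \<open>(x, False)\<close> for
  the formal inverse of \<open>x\<close>. The relation below is the smallest congruence on words which makes
  the signed letters of each generator mutually inverse and every relator trivial.
\<close>

inductive pres_eq :: "'a set \<Rightarrow> ('a \<times> bool) list set \<Rightarrow> ('a \<times> bool) list \<Rightarrow> ('a \<times> bool) list \<Rightarrow> bool"
  for S R where
  refl: "set w \<subseteq> S \<times> UNIV \<Longrightarrow> pres_eq S R w w"
| sym: "pres_eq S R u v \<Longrightarrow> pres_eq S R v u"
| trans: "pres_eq S R u v \<Longrightarrow> pres_eq S R v w \<Longrightarrow> pres_eq S R u w"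
| cancel: "x \<in> S \<Longrightarrow> set u \<subseteq> S \<times> UNIV \<Longrightarrow> set v \<subseteq> S \<times> UNIV \<Longrightarrow>
    pres_eq S R (u @ [(x, b), (x, \<not> b)] @ v) (u @ v)"
| relator: "r \<in> R \<Longrightarrow> set r \<subseteq> S \<times> UNIV \<Longrightarrow> set u \<subseteq> S \<times> UNIV \<Longrightarrow> set v \<subseteq> S \<times> UNIV \<Longrightarrow>
    pres_eq S R (u @ r @ v) (u @ v)"

definition pres_class :: "'a set \<Rightarrow> ('a \<times> bool) list set \<Rightarrow> ('a \<times> bool) list \<Rightarrow> ('a \<times> bool) list set" where
  "pres_class S R w = {w'. pres_eq S R w w'}"

definition presented_group :: "'a set \<Rightarrow> ('a \<times> bool) list set \<Rightarrow> ('a \<times> bool) list set monoid" where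
  "presented_group S R =
    \<lparr>carrier = pres_class S R ` {w. set w \<subseteq> S \<times> UNIV},
     mult = (\<lambda>A B. {w. \<exists>u\<in>A. \<exists>v\<in>B. pres_eq S R (u @ v) w}),
     one = pres_class S R []\<rparr>"

lemma pres_eq_set:
  "pres_eq S R u v \<Longrightarrow> set u \<subseteq> S \<times> UNIV \<and> set v \<subseteq> S \<times> UNIV"
  by (induction rule: pres_eq.induct) auto

lemma pres_eq_append_left:
  "pres_eq S R u v \<Longrightarrow> set w \<subseteq> S \<times> UNIV \<Longrightarrow> pres_eq S R (w @ u) (w @ v)"
proof (induction rule: pres_eq.induct)
  case (refl w')
  then show ?case by (intro pres_eq.refl) auto
next
  case (cancel x u v b)
  then show ?case using pres_eq.cancel[of x S "w @ u" v R b] by simp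
next
  case (relator r u v)
  then show ?case using pres_eq.relator[of r R S "w @ u" v] by simp
qed (auto intro: pres_eq.refl pres_eq.sym pres_eq.trans)

lemma pres_eq_append_right:
  "pres_eq S R u v \<Longrightarrow> set w \<subseteq> S \<times> UNIV \<Longrightarrow> pres_eq S R (u @ w) (v @ w)"
proof (induction rule: pres_eq.induct)
  case (refl w')
  then show ?case by (intro pres_eq.refl) auto
next
  case (cancel x u v b)
  then show ?case using pres_eq.cancel[of x S u "v @ w" R b] by simp
next
  case (relator r u v)
  then show ?case using pres_eq.relator[of r R S u "v @ w"] by simp
qed (auto intro: pres_eq.refl pres_eq.sym pres_eq.trans)

lemma pres_eq_append:
  assumes "pres_eq S R u u'" "pres_eq S R v v'"
  shows "pres_eq S R (u @ v) (u' @ v')"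
  by (meson assms pres_eq.trans pres_eq_append_left pres_eq_append_right pres_eq_set)

lemma pres_class_eq_iff:
  assumes "set u \<subseteq> S \<times> UNIV"
  shows "pres_class S R u = pres_class S R v \<longleftrightarrow> pres_eq S R u v"
proof
  assume "pres_class S R u = pres_class S R v"
  moreover have "u \<in> pres_class S R u"
    unfolding pres_class_def using assms by (auto intro: pres_eq.refl)
  ultimately show "pres_eq S R u v"
    unfolding pres_class_def by (auto intro: pres_eq.sym)
next
  assume "pres_eq S R u v"
  then show "pres_class S R u = pres_class S R v"
    unfolding pres_class_def by (auto intro: pres_eq.sym pres_eq.trans)
qed

lemma presented_group_mult:
  assumes "set u \<subseteq> S \<times> UNIV" "set v \<subseteq> S \<times> UNIV"
  shows "pres_class S R u \<otimes>\<^bsub>presented_group S R\<^esub> pres_class S R v = pres_class S R (u @ v)"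
  using assms unfolding presented_group_def pres_class_def
  by (auto intro: pres_eq.refl pres_eq.sym pres_eq.trans pres_eq_append)

lemma pres_eq_inverse:
  assumes "set w \<subseteq> S \<times> UNIV"
  shows "pres_eq S R (map (\<lambda>(x, b). (x, \<not> b)) (rev w) @ w) []"
  using assms
proof (induction w)
  case Nil
  then show ?case by (auto intro: pres_eq.refl)
next
  case (Cons y w)
  obtain x b where y: "y = (x, b)" by (cases y)
  let ?w = "map (\<lambda>(x, b). (x, \<not> b)) (rev w)"
  have x: "x \<in> S" and w: "set w \<subseteq> S \<times> UNIV" using Cons.prems y by auto
  then have w': "set ?w \<subseteq> S \<times> UNIV" by auto
  have "pres_eq S R (?w @ [(x, \<not> b), (x, \<not> \<not> b)] @ w) (?w @ w)"
    by (rule pres_eq.cancel) (use x w w' in auto)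
  then show ?case
    using Cons.IH[OF w] y by (auto intro: pres_eq.trans)
qed

lemma group_presented_group: "group (presented_group S R)"
proof (rule groupI)
  let ?G = "presented_group S R"
  note [simp] = presented_group_mult
  have carr: "carrier ?G = pres_class S R ` {w. set w \<subseteq> S \<times> UNIV}" and one: "\<one>\<^bsub>?G\<^esub> = pres_class S R []"
    by (simp_all add: presented_group_def)
  show "x \<otimes>\<^bsub>?G\<^esub> y \<in> carrier ?G" if "x \<in> carrier ?G" "y \<in> carrier ?G" for x y
    using that unfolding carr by auto
  show "\<one>\<^bsub>?G\<^esub> \<in> carrier ?G" unfolding carr one by auto
  show "x \<otimes>\<^bsub>?G\<^esub> y \<otimes>\<^bsub>?G\<^esub> z = x \<otimes>\<^bsub>?G\<^esub> (y \<otimes>\<^bsub>?G\<^esub> z)"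
    if "x \<in> carrier ?G" "y \<in> carrier ?G" "z \<in> carrier ?G" for x y z
    using that unfolding carr by auto
  show "\<one>\<^bsub>?G\<^esub> \<otimes>\<^bsub>?G\<^esub> x = x" if "x \<in> carrier ?G" for x
    using that unfolding carr one by auto
  show "\<exists>y\<in>carrier ?G. y \<otimes>\<^bsub>?G\<^esub> x = \<one>\<^bsub>?G\<^esub>" if x: "x \<in> carrier ?G" for x
  proof -
    obtain w where w: "set w \<subseteq> S \<times> UNIV" "x = pres_class S R w" using x unfolding carr by auto
    let ?w = "map (\<lambda>(x, b). (x, \<not> b)) (rev w)"
    have w': "set ?w \<subseteq> S \<times> UNIV" using w by auto
    have "pres_class S R ?w \<otimes>\<^bsub>?G\<^esub> x = \<one>\<^bsub>?G\<^esub>"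
      using w w' pres_eq_inverse[OF w(1), of R]
      by (simp add: one pres_class_eq_iff)
    then show ?thesis using w' unfolding carr by blast
  qed
qed


section \<open>The group \<open>G\<^sup>k\<^sub>k\<^sub>+\<^sub>1\<close>\<close>

definition Gk_gens :: "nat \<Rightarrow> nat set set" where
  "Gk_gens k = {m. m \<subseteq> {1..k+1} \<and> card m = k}"

definition pos_word :: "'a list \<Rightarrow> ('a \<times> bool) list" where
  "pos_word ms = map (\<lambda>m. (m, True)) ms"

definition Gk_rels :: "nat \<Rightarrow> (nat set \<times> bool) list set" where
  "Gk_rels k = {pos_word [m, m] | m. m \<in> Gk_gens k}
             \<union> {pos_word (ms @ ms) | ms. distinct ms \<and> set ms = Gk_gens k}"

definition Gk :: "nat \<Rightarrow> (nat set \<times> bool) list set monoid" where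
  "Gk k = presented_group (Gk_gens k) (Gk_rels k)"

definition Gk_elem :: "nat \<Rightarrow> nat set list \<Rightarrow> (nat set \<times> bool) list set" where
  "Gk_elem k ms = pres_class (Gk_gens k) (Gk_rels k) (pos_word ms)"


section \<open>The fundamental group of an abstract topology\<close>

definition loops_at :: "'a topology \<Rightarrow> 'a \<Rightarrow> (real \<Rightarrow> 'a) set" where
  "loops_at X x0 = {p. pathin X p \<and> p 0 = x0 \<and> p 1 = x0}"

definition loop_homotopic :: "'a topology \<Rightarrow> 'a \<Rightarrow> (real \<Rightarrow> 'a) \<Rightarrow> (real \<Rightarrow> 'a) \<Rightarrow> bool" where
  "loop_homotopic X x0 = homotopic_with (\<lambda>h. h 0 = x0 \<and> h 1 = x0) (top_of_set {0..1}) X"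

text \<open>\<^const>\<open>joinpaths\<close> is not applicable, since it requires a type of class
  \<^class>\<open>topological_space\<close>.\<close>

definition path_join :: "(real \<Rightarrow> 'a) \<Rightarrow> (real \<Rightarrow> 'a) \<Rightarrow> real \<Rightarrow> 'a" where
  "path_join p q = (\<lambda>t. if t \<le> 1/2 then p (2 * t) else q (2 * t - 1))"

definition fundamental_group :: "'a topology \<Rightarrow> 'a \<Rightarrow> (real \<Rightarrow> 'a) set monoid" where
  "fundamental_group X x0 =
    \<lparr>carrier = loops_at X x0 // {(p, q). loop_homotopic X x0 p q},
     mult = (\<lambda>A B. {r. \<exists>p\<in>A. \<exists>q\<in>B. loop_homotopic X x0 (path_join p q) r}),
     one = {r. loop_homotopic X x0 (\<lambda>_. x0) r}\<rparr>"


section \<open>Real projective space\<close>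

definition quotient_topology :: "'a topology \<Rightarrow> ('a \<Rightarrow> 'b) \<Rightarrow> 'b topology" where
  "quotient_topology X f =
    topology (\<lambda>U. U \<subseteq> f ` topspace X \<and> openin X {x \<in> topspace X. f x \<in> U})"

lemma openin_quotient_topology:
  "openin (quotient_topology X f) U \<longleftrightarrow>
    U \<subseteq> f ` topspace X \<and> openin X {x \<in> topspace X. f x \<in> U}"
proof -
  let ?P = "\<lambda>U. U \<subseteq> f ` topspace X \<and> openin X {x \<in> topspace X. f x \<in> U}"
  have "istopology ?P"
    unfolding istopology_def
  proof (intro conjI allI impI)
    fix U V assume UV: "?P U" "?P V"
    have "{x \<in> topspace X. f x \<in> U \<inter> V} = {x \<in> topspace X. f x \<in> U} \<inter> {x \<in> topspace X. f x \<in> V}"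
      by auto
    then show "openin X {x \<in> topspace X. f x \<in> U \<inter> V}" using UV by auto
    show "U \<inter> V \<subseteq> f ` topspace X" using UV by auto
  next
    fix \<K> assume K: "\<forall>K\<in>\<K>. ?P K"
    have "{x \<in> topspace X. f x \<in> \<Union>\<K>} = (\<Union>K\<in>\<K>. {x \<in> topspace X. f x \<in> K})" by auto
    then show "openin X {x \<in> topspace X. f x \<in> \<Union>\<K>}" using K by auto
    show "\<Union>\<K> \<subseteq> f ` topspace X" using K by auto
  qed
  then show ?thesis unfolding quotient_topology_def by (simp add: topology_inverse')
qed

lemma topspace_quotient_topology: "topspace (quotient_topology X f) = f ` topspace X"
proof
  show "topspace (quotient_topology X f) \<subseteq> f ` topspace X"
    using openin_quotient_topology[of X f] by (auto simp: topspace_def)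
  have "{x \<in> topspace X. f x \<in> f ` topspace X} = topspace X" by auto
  then have "openin (quotient_topology X f) (f ` topspace X)"
    by (simp add: openin_quotient_topology)
  then show "f ` topspace X \<subseteq> topspace (quotient_topology X f)" by (rule openin_subset)
qed

lemma quotient_map_quotient_topology: "quotient_map X (quotient_topology X f) f"
  unfolding quotient_map_def by (auto simp: topspace_quotient_topology openin_quotient_topology)

global_interpretation funvec: vector_space "\<lambda>(c::real) (x::nat \<Rightarrow> real) i. c * x i"
  by unfold_locales (auto simp: fun_eq_iff algebra_simps)

text \<open>
  The space \<open>\<real>\<^sup>n\<^sup>+\<^sup>1\<close> is the library's \<^term>\<open>Euclidean_space (Suc n)\<close>: its
  vectors are functions on \<open>nat\<close> vanishing outside \<open>{0..n}\<close>, so the homogeneous coordinates of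
  a point of \<open>\<real>P\<^sup>n\<close> are numbered from \<open>0\<close>. A point of \<open>\<real>P\<^sup>n\<close> is a line through the origin.
\<close>

definition nonzero_vectors :: "nat \<Rightarrow> (nat \<Rightarrow> real) set" where
  "nonzero_vectors n = topspace (Euclidean_space (Suc n)) - {0}"

definition hline :: "(nat \<Rightarrow> real) \<Rightarrow> (nat \<Rightarrow> real) set" where
  "hline v = funvec.span {v}"

definition RP :: "nat \<Rightarrow> (nat \<Rightarrow> real) set topology" where
  "RP n = quotient_topology (subtopology (Euclidean_space (Suc n)) (nonzero_vectors n)) hline"

text \<open>A projective \<open>d\<close>-plane in \<open>\<real>P\<^sup>n\<close> is represented by the linear subspace of dimension \<open>d + 1\<close>
  formed by the lines that are its points.\<close>

definition proj_plane :: "nat \<Rightarrow> nat \<Rightarrow> (nat \<Rightarrow> real) set \<Rightarrow> bool" where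
  "proj_plane n d W \<longleftrightarrow>
    funvec.subspace W \<and> W \<subseteq> topspace (Euclidean_space (Suc n)) \<and> funvec.dim W = d + 1"

definition in_common_plane :: "nat \<Rightarrow> nat \<Rightarrow> (nat \<Rightarrow> real) set set \<Rightarrow> bool" where
  "in_common_plane n d P \<longleftrightarrow> (\<exists>W. proj_plane n d W \<and> (\<forall>L\<in>P. L \<subseteq> W))"


section \<open>The configuration spaces\<close>

definition config_space :: "nat \<Rightarrow> (nat \<Rightarrow> (nat \<Rightarrow> real) set) topology" where
  "config_space k =
    subtopology (product_topology (\<lambda>_. RP (k - 1)) {1..k+1})
      {x. inj_on x {1..k+1} \<and>
          (\<forall>J. J \<subseteq> {1..k+1} \<and> card J = k - 1 \<longrightarrow> \<not> in_common_plane (k - 1) (k - 3) (x ` J))}"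

definition ypt :: "nat \<Rightarrow> (nat \<Rightarrow> real) set" where
  "ypt j = hline (\<lambda>i. if i + 1 = j then 1 else 0)"

definition reduced_config_space :: "nat \<Rightarrow> (nat \<Rightarrow> (nat \<Rightarrow> real) set) topology" where
  "reduced_config_space k = subtopology (config_space k) {x. \<forall>i\<in>{1..k-1}. x i = ypt i}"

definition base_config :: "nat \<Rightarrow> nat \<Rightarrow> (nat \<Rightarrow> real) set" where
  "base_config k =
    (\<lambda>i\<in>{1..k+1}. if i \<le> k then ypt i else hline (\<lambda>i. if i < k then 1 else 0))"


section \<open>Singular values and words of paths\<close>

definition flat_subsets :: "nat \<Rightarrow> (nat \<Rightarrow> (nat \<Rightarrow> real) set) \<Rightarrow> nat set set" where
  "flat_subsets k x =
    {m. m \<subseteq> {1..k+1} \<and> card m = k \<and> in_common_plane (k - 1) (k - 2) (x ` m)}"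

definition singular_config :: "nat \<Rightarrow> (nat \<Rightarrow> (nat \<Rightarrow> real) set) \<Rightarrow> bool" where
  "singular_config k x \<longleftrightarrow> flat_subsets k x \<noteq> {}"

definition smooth_fun :: "(real \<Rightarrow> real) \<Rightarrow> bool" where
  "smooth_fun f \<longleftrightarrow> (\<forall>n x. (deriv ^^ n) f differentiable (at x))"

text \<open>
  A path of configurations, parametrised by \<open>[0,1]\<close>, is smooth iff its points have homogeneous
  coordinates which depend smoothly on the parameter: paths in \<open>\<real>P\<^sup>n\<close> lift along the submersion
  \<open>\<real>\<^sup>n\<^sup>+\<^sup>1 - {0} \<rightarrow> \<real>P\<^sup>n\<close>. Smoothness on the closed interval means that of some extension to \<open>\<real>\<close>;
  only the values and derivatives on \<open>[0,1]\<close> matter.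
\<close>

definition smooth_lift ::
  "nat \<Rightarrow> (real \<Rightarrow> nat \<Rightarrow> (nat \<Rightarrow> real) set) \<Rightarrow> (real \<Rightarrow> nat \<Rightarrow> nat \<Rightarrow> real) \<Rightarrow> bool" where
  "smooth_lift k \<gamma> v \<longleftrightarrow>
    (\<forall>i\<in>{1..k+1}. \<forall>j<k. smooth_fun (\<lambda>t. v t i j)) \<and>
    (\<forall>t\<in>{0..1}. \<forall>i\<in>{1..k+1}. v t i \<in> nonzero_vectors (k - 1) \<and> \<gamma> t i = hline (v t i))"

definition smooth_path ::
  "nat \<Rightarrow> (nat \<Rightarrow> (nat \<Rightarrow> real) set) topology \<Rightarrow> (real \<Rightarrow> nat \<Rightarrow> (nat \<Rightarrow> real) set) \<Rightarrow> bool" where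
  "smooth_path k X \<gamma> \<longleftrightarrow> \<gamma> ` {0..1} \<subseteq> topspace X \<and> (\<exists>v. smooth_lift k \<gamma> v)"

definition lifts_close ::
  "nat \<Rightarrow> nat \<Rightarrow> real \<Rightarrow> (real \<Rightarrow> nat \<Rightarrow> nat \<Rightarrow> real) \<Rightarrow> (real \<Rightarrow> nat \<Rightarrow> nat \<Rightarrow> real) \<Rightarrow> bool" where
  "lifts_close k r \<epsilon> v w \<longleftrightarrow>
    (\<forall>n\<le>r. \<forall>i\<in>{1..k+1}. \<forall>j<k. \<forall>t\<in>{0..1}.
      \<bar>(deriv ^^ n) (\<lambda>t. w t i j) t - (deriv ^^ n) (\<lambda>t. v t i j) t\<bar> < \<epsilon>)"

text \<open>
  Small perturbations are taken in the \<open>C\<^sup>\<infinity>\<close> topology on smooth paths in the space \<open>X\<close>: for a fixed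
  lift \<open>v\<close> of \<open>\<gamma>\<close>, the paths possessing a lift that is \<open>\<epsilon>\<close>-close to \<open>v\<close> together with its first
  \<open>r\<close> derivatives form, for varying \<open>r\<close> and \<open>\<epsilon> > 0\<close>, a neighbourhood basis of \<open>\<gamma>\<close>, which does not
  depend on \<open>v\<close>. (With respect to uniform closeness alone no singular value would be stable.)
\<close>

definition stable_value ::
  "nat \<Rightarrow> (nat \<Rightarrow> (nat \<Rightarrow> real) set) topology \<Rightarrow> (real \<Rightarrow> nat \<Rightarrow> (nat \<Rightarrow> real) set) \<Rightarrow> nat set \<Rightarrow> real \<Rightarrow> bool" where
  "stable_value k X \<gamma> m t \<longleftrightarrow>
    (\<exists>v. smooth_lift k \<gamma> v \<and>
      (\<exists>\<delta>>0. \<exists>r. \<exists>\<epsilon>>0. \<forall>\<gamma>' w.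
        smooth_path k X \<gamma>' \<and> smooth_lift k \<gamma>' w \<and> lifts_close k r \<epsilon> v w \<longrightarrow>
        (\<exists>!s. s \<in> {0..1} \<and> \<bar>s - t\<bar> < \<delta> \<and> m \<in> flat_subsets k (\<gamma>' s))))"

definition singular_values :: "nat \<Rightarrow> (real \<Rightarrow> nat \<Rightarrow> (nat \<Rightarrow> real) set) \<Rightarrow> real set" where
  "singular_values k \<gamma> = {t \<in> {0..1}. singular_config k (\<gamma> t)}"

definition has_type :: "nat \<Rightarrow> (real \<Rightarrow> nat \<Rightarrow> (nat \<Rightarrow> real) set) \<Rightarrow> real \<Rightarrow> nat set \<Rightarrow> bool" where
  "has_type k \<gamma> t m \<longleftrightarrow> flat_subsets k (\<gamma> t) = {m}"

definition good_stable_path ::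
  "nat \<Rightarrow> (nat \<Rightarrow> (nat \<Rightarrow> real) set) topology \<Rightarrow> (real \<Rightarrow> nat \<Rightarrow> (nat \<Rightarrow> real) set) \<Rightarrow> bool" where
  "good_stable_path k X \<gamma> \<longleftrightarrow>
    smooth_path k X \<gamma> \<and>
    \<not> singular_config k (\<gamma> 0) \<and> \<not> singular_config k (\<gamma> 1) \<and>
    finite (singular_values k \<gamma>) \<and>
    (\<forall>t\<in>singular_values k \<gamma>. \<exists>m. has_type k \<gamma> t m \<and> stable_value k X \<gamma> m t)"

definition path_word :: "nat \<Rightarrow> (real \<Rightarrow> nat \<Rightarrow> (nat \<Rightarrow> real) set) \<Rightarrow> nat set list" where
  "path_word k \<gamma> = map (\<lambda>t. THE m. has_type k \<gamma> t m) (sorted_list_of_set (singular_values k \<gamma>))"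

definition Gk_tilde :: "nat \<Rightarrow> (nat set \<times> bool) list set set" where
  "Gk_tilde k =
    {Gk_elem k (path_word k \<gamma>) | \<gamma>.
      good_stable_path k (reduced_config_space k) \<gamma> \<and> \<gamma> 0 = base_config k \<and> \<gamma> 1 = base_config k}"

end

(*
  Put n = k - 1. A point of the reduced configuration space is given by the last two points a and b.
  Its maximal minors are, up to sign, b_n, a_n and a_j b_n - a_n b_j (j < n), so the walls cut the
  space into chambers that are labelled, via the signs of a_n b_n (a_j b_n - a_n b_j), by the subsets
  S of {0..<n}. Two adjacent chambers S and S' share a wall for every letter that takes S to S': the
  j-th letter flips the j-th sign (j < n), and the letters n and n + 1 flip all signs. Hence G acts on
  the subsets, transitively, and the stabiliser H of a subset has index 2^n.

  Chambers, and pairs of chambers joined along one wall, have a unique homotopy class of paths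
  between any two points. So the homotopy class of a path is determined by the sequence of walls that
  it crosses, apart from passing through the strata of higher codimension; around the only stratum of
  codimension two, a_n = b_n = 0, all walls are met twice, which is the second relation of G. The
  letters of the crossed walls define a local system (a holonomy with values in G), and choosing a path
  through each wall gives its inverse. Therefore the fundamental group is H.

  The parity of the crossings puts the words of closed paths into H. Conversely, an explicit
  polynomial path with prescribed simple zeros of the minors realises any word that represents an
  element of H.
*)

theory Submission
  imports Defs "HOL-Computational_Algebra.Polynomial"
begin

subsection \<open>Path homotopy in an abstract topology\<close>

text \<open>A continuous loop may meet the walls infinitely often, so its crossings cannot be
  counted, and no loop is ever put into general position. The holonomy replaces the count: it is
  defined for every continuous path and is homotopy invariant by construction. It is compared with
  the map from words to path classes on short pieces of a path, where one and the same word
  describes both. The second relation of the group therefore enters twice, in opposite roles: in the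
  group it makes the holonomy around the stratum a_n = b_n = 0 consistent, whereas for path classes
  it has to be proved, by going around the stratum inside a region with unique path classes. Points
  have no preferred homogeneous coordinates, so the sign of a single minor means nothing; sign
  conditions use products that have even degree in each of the two moving points. General position
  guarantees that two different minors vanish together only if a_n = b_n = 0, so no other
  intersection of walls has to be examined. Stability of a crossing is used through its consequence
  that the minor changes its sign; conversely simple zeros are stable.\<close>

abbreviation I01 :: "real topology" where "I01 \<equiv> top_of_set {0..1}"

text \<open>The condition refers to the ends of \<open>p\<close> only, so that the general results
  on \<open>homotopic_with\<close> apply; symmetry then needs the remark that \<open>q\<close> has
  the same ends.\<close>

definition phom :: "'a topology \<Rightarrow> (real \<Rightarrow> 'a) \<Rightarrow> (real \<Rightarrow> 'a) \<Rightarrow> bool" where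
  "phom X p q \<longleftrightarrow> homotopic_with (\<lambda>h. h 0 = p 0 \<and> h 1 = p 1) I01 X p q"

definition path_rev :: "(real \<Rightarrow> 'a) \<Rightarrow> real \<Rightarrow> 'a" where
  "path_rev p = (\<lambda>t. p (1 - t))"

lemma phom_iff:
  "phom X p q \<longleftrightarrow> (\<exists>h. continuous_map (prod_topology I01 I01) X h \<and>
     (\<forall>t\<in>{0..1}. h (0, t) = p t) \<and> (\<forall>t\<in>{0..1}. h (1, t) = q t) \<and>
     (\<forall>s\<in>{0..1}. h (s, 0) = p 0 \<and> h (s, 1) = p 1))"
proof -
  have *: "(h 0 = p 0 \<and> h 1 = p 1) \<longleftrightarrow> (k 0 = p 0 \<and> k 1 = p 1)"
    if "\<And>x. x \<in> topspace I01 \<Longrightarrow> h x = k x" for h k :: "real \<Rightarrow> 'a"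
    using that[of 0] that[of 1] by simp
  have "homotopic_with (\<lambda>h. h 0 = p 0 \<and> h 1 = p 1) I01 X p q \<longleftrightarrow>
    (\<exists>h. continuous_map (prod_topology I01 I01) X h \<and>
     (\<forall>t\<in>topspace I01. h (0, t) = p t) \<and> (\<forall>t\<in>topspace I01. h (1, t) = q t) \<and>
     (\<forall>s\<in>{0..1}. h (s, 0) = p 0 \<and> h (s, 1) = p 1))"
    by (rule homotopic_with) (rule *)
  then show ?thesis by (simp add: phom_def)
qed

lemma phom_endpoints: "phom X p q \<Longrightarrow> q 0 = p 0 \<and> q 1 = p 1"
  unfolding phom_def
  using homotopic_with_imp_property[of "\<lambda>h. h 0 = p 0 \<and> h 1 = p 1" I01 X p q] by simp

lemma phom_pathin: "phom X p q \<Longrightarrow> pathin X p \<and> pathin X q"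
  unfolding phom_def pathin_def by (rule homotopic_with_imp_continuous_maps)

lemma phom_sym: "phom X p q \<Longrightarrow> phom X q p"
  using homotopic_with_symD[of "\<lambda>h. h 0 = p 0 \<and> h 1 = p 1" I01 X p q] phom_endpoints[of X p q]
  unfolding phom_def by simp

lemma phom_trans [trans]: "phom X p q \<Longrightarrow> phom X q r \<Longrightarrow> phom X p r"
  using homotopic_with_trans[of "\<lambda>h. h 0 = p 0 \<and> h 1 = p 1" I01 X p q r] phom_endpoints[of X p q]
  unfolding phom_def by simp

lemma phom_eq:
  assumes "pathin X p" "\<And>t. t \<in> {0..1} \<Longrightarrow> p t = q t"
  shows "phom X p q"
  unfolding phom_def
  by (rule homotopic_with_equal) (use assms assms(2)[of 0] assms(2)[of 1] in \<open>auto simp: pathin_def\<close>)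

lemma phom_refl: "pathin X p \<Longrightarrow> phom X p p"
  by (rule phom_eq) auto

lemma loop_homotopic_iff: "loop_homotopic X x0 p q \<longleftrightarrow> phom X p q \<and> p 0 = x0 \<and> p 1 = x0"
proof
  assume *: "loop_homotopic X x0 p q"
  then have "p 0 = x0 \<and> p 1 = x0"
    using homotopic_with_imp_property[of "\<lambda>h. h 0 = x0 \<and> h 1 = x0" I01 X p q]
    unfolding loop_homotopic_def by simp
  with * show "phom X p q \<and> p 0 = x0 \<and> p 1 = x0"
    unfolding loop_homotopic_def phom_def by simp
qed (auto simp: loop_homotopic_def phom_def)

section \<open>Reparametrisation and concatenation of paths\<close>

lemma continuous_map_I01_I01:
  "continuous_map I01 I01 f \<longleftrightarrow> continuous_on {0..1} f \<and> f ` {0..1} \<subseteq> {0..1}"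
  by (auto simp: continuous_map_in_subtopology)

lemma pathin_reparam:
  assumes "pathin X p" "continuous_on {0..1} f" "f ` {0..1} \<subseteq> {0..1}"
  shows "pathin X (p \<circ> f)"
  using assms unfolding pathin_def
  by (metis continuous_map_I01_I01 continuous_map_compose)

text \<open>The interval is convex: interpolating linearly between \<open>f\<close> and
  \<open>g\<close> and then applying \<open>p\<close> is a homotopy with fixed ends. The groupoid
  laws below are instances in which one path is a reparametrisation of the other.\<close>

lemma phom_reparam:
  assumes p: "pathin X p" and f: "continuous_on {0..1} f" "f ` {0..1} \<subseteq> {0..1}"
    and g: "continuous_on {0..1} g" "g ` {0..1} \<subseteq> {0..1}"
    and e: "f 0 = g 0" "f 1 = g 1"
  shows "phom X (p \<circ> f) (p \<circ> g)"
  unfolding phom_iff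
proof (intro exI conjI)
  let ?k = "\<lambda>z::real\<times>real. (1 - fst z) * f (snd z) + fst z * g (snd z)"
  have k: "continuous_on ({0..1} \<times> {0..1}) ?k"
    by (intro continuous_intros continuous_on_compose2[OF f(1)] continuous_on_compose2[OF g(1)]) auto
  have "?k z \<in> {0..1}" if "z \<in> {0..1} \<times> {0..1}" for z
  proof -
    have "f (snd z) \<in> {0..1}" "g (snd z) \<in> {0..1}" "fst z \<in> {0..1}" using that f g by auto
    then show ?thesis
      using convexD[OF convex_real_interval(5)[of 0 1], of "f (snd z)" "g (snd z)" "1 - fst z" "fst z"]
      by auto
  qed
  with k have "continuous_map (prod_topology I01 I01) I01 ?k"
    by (auto simp: prod_topology_subtopology_eu continuous_map_in_subtopology)
  then show "continuous_map (prod_topology I01 I01) X (p \<circ> ?k)"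
    using p continuous_map_compose unfolding pathin_def by blast
qed (auto simp: e algebra_simps)

lemma pathin_join:
  assumes p: "pathin X p" and q: "pathin X q" and e: "p 1 = q 0"
  shows "pathin X (path_join p q)"
  unfolding pathin_def path_join_def
proof (rule continuous_map_cases_le)
  show "continuous_map (subtopology I01 {x \<in> topspace I01. x \<le> 1/2}) X (\<lambda>x. p (2 * x))"
    by (rule continuous_map_compose[OF _ p[unfolded pathin_def], of _ "\<lambda>x. 2 * x", unfolded o_def])
      (auto simp: continuous_map_in_subtopology subtopology_subtopology intro!: continuous_intros)
  show "continuous_map (subtopology I01 {x \<in> topspace I01. 1/2 \<le> x}) X (\<lambda>x. q (2 * x - 1))"
    by (rule continuous_map_compose[OF _ q[unfolded pathin_def], of _ "\<lambda>x. 2 * x - 1", unfolded o_def])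
      (auto simp: continuous_map_in_subtopology subtopology_subtopology intro!: continuous_intros)
  show "p (2 * x) = q (2 * x - 1)" if "x \<in> topspace I01" "x = 1/2" for x
    using e unfolding that(2) by simp
qed (auto simp: continuous_map_from_subtopology)

lemma phom_join:
  assumes p: "phom X p p'" and q: "phom X q q'" and e: "p 1 = q 0"
  shows "phom X (path_join p q) (path_join p' q')"
proof -
  obtain h where h: "continuous_map (prod_topology I01 I01) X h"
    "\<forall>t\<in>{0..1}. h (0, t) = p t" "\<forall>t\<in>{0..1}. h (1, t) = p' t"
    "\<forall>s\<in>{0..1}. h (s, 0) = p 0 \<and> h (s, 1) = p 1" using p phom_iff by metis
  obtain k where k: "continuous_map (prod_topology I01 I01) X k"
    "\<forall>t\<in>{0..1}. k (0, t) = q t" "\<forall>t\<in>{0..1}. k (1, t) = q' t"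
    "\<forall>s\<in>{0..1}. k (s, 0) = q 0 \<and> k (s, 1) = q 1" using q phom_iff by metis
  let ?P = "prod_topology I01 I01"
  let ?H = "\<lambda>z. if snd z \<le> 1/2 then h (fst z, 2 * snd z) else k (fst z, 2 * snd z - 1)"
  have "continuous_map ?P X ?H"
  proof (rule continuous_map_cases_le)
    show "continuous_map (subtopology ?P {x \<in> topspace ?P. snd x \<le> 1/2}) X (\<lambda>x. h (fst x, 2 * snd x))"
      by (rule continuous_map_compose[OF _ h(1), of _ "\<lambda>x. (fst x, 2 * snd x)", unfolded o_def])
        (auto simp: continuous_map_in_subtopology subtopology_subtopology
          prod_topology_subtopology_eu intro!: continuous_intros)
    show "continuous_map (subtopology ?P {x \<in> topspace ?P. 1/2 \<le> snd x}) X (\<lambda>x. k (fst x, 2 * snd x - 1))"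
      by (rule continuous_map_compose[OF _ k(1), of _ "\<lambda>x. (fst x, 2 * snd x - 1)", unfolded o_def])
        (auto simp: continuous_map_in_subtopology subtopology_subtopology
          prod_topology_subtopology_eu intro!: continuous_intros)
    show "h (fst x, 2 * snd x) = k (fst x, 2 * snd x - 1)" if "x \<in> topspace ?P" "snd x = 1/2" for x
    proof -
      have "fst x \<in> {0..1}" using that by auto
      then show ?thesis using h(4) k(4) e unfolding that(2) by simp
    qed
  qed (auto simp: continuous_map_from_subtopology prod_topology_subtopology_eu intro!: continuous_intros)
  then show ?thesis
    unfolding phom_iff
    by (intro exI[of _ ?H]) (use h k in \<open>auto simp: path_join_def\<close>)
qed

lemma join_ends [simp]: "path_join p q 0 = p 0" "path_join p q 1 = q 1"
  by (auto simp: path_join_def)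

lemma rev_ends [simp]: "path_rev p 0 = p 1" "path_rev p 1 = p 0"
  by (auto simp: path_rev_def)

lemma pathin_rev: "pathin X p \<Longrightarrow> pathin X (path_rev p)"
  unfolding path_rev_def
  by (rule pathin_reparam[of X p "\<lambda>t. 1 - t", unfolded o_def]) (auto intro!: continuous_intros)

lemma continuous_on_if_le_real:
  fixes f g :: "real \<Rightarrow> real"
  assumes "continuous_on UNIV f" "continuous_on UNIV g" "f c = g c"
  shows "continuous_on S (\<lambda>t. if t \<le> c then f t else g t)"
proof -
  have "continuous_on UNIV (\<lambda>t. if t \<le> c then f t else g t)"
    by (rule continuous_on_cases_le) (use assms in \<open>auto intro: continuous_on_subset continuous_intros\<close>)
  then show ?thesis using continuous_on_subset by blast
qed

section \<open>Groupoid laws up to homotopy\<close>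

lemma phom_assoc:
  assumes "pathin X p" "pathin X q" "pathin X r" "p 1 = q 0" "q 1 = r 0"
  shows "phom X (path_join (path_join p q) r) (path_join p (path_join q r))"
proof -
  let ?P = "path_join (path_join p q) r"
  \<comment> \<open>Piecewise linear, taking the breakpoints 1/2 and 3/4 of the right bracketing to
    the breakpoints 1/4 and 1/2 of the left one.\<close>
  let ?f = "\<lambda>t::real. if t \<le> 1/2 then t / 2 else if t \<le> 3/4 then t - 1/4 else 2 * t - 1"
  have P: "pathin X ?P" using assms by (intro pathin_join) auto
  have c: "continuous_on S ?f" for S
    by (intro continuous_on_if_le_real continuous_intros) auto
  have "phom X (?P \<circ> (\<lambda>t. t)) (?P \<circ> ?f)"
    by (rule phom_reparam[OF P _ _ c]) auto
  moreover have "?P \<circ> ?f = path_join p (path_join q r)"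
    by (rule ext) (auto simp: path_join_def field_simps intro!: arg_cong[of _ _ q])
  ultimately show ?thesis by (simp add: o_def)
qed

lemma phom_const_right:
  assumes "pathin X p"
  shows "phom X (path_join p (\<lambda>_. p 1)) p"
proof -
  have "phom X (p \<circ> (\<lambda>t. if t \<le> 1/2 then 2 * t else 1)) (p \<circ> (\<lambda>t. t))"
    by (rule phom_reparam[OF assms continuous_on_if_le_real]) (auto intro!: continuous_intros)
  moreover have "p \<circ> (\<lambda>t. if t \<le> 1/2 then 2 * t else 1) = path_join p (\<lambda>_. p 1)"
    by (auto simp: path_join_def)
  ultimately show ?thesis by (simp add: o_def)
qed

lemma phom_const_left:
  assumes "pathin X p"
  shows "phom X (path_join (\<lambda>_. p 0) p) p"
proof -
  have "phom X (p \<circ> (\<lambda>t. if t \<le> 1/2 then 0 else 2 * t - 1)) (p \<circ> (\<lambda>t. t))"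
    by (rule phom_reparam[OF assms continuous_on_if_le_real]) (auto intro!: continuous_intros)
  moreover have "p \<circ> (\<lambda>t. if t \<le> 1/2 then 0 else 2 * t - 1) = path_join (\<lambda>_. p 0) p"
    by (auto simp: path_join_def)
  ultimately show ?thesis by (simp add: o_def)
qed

text \<open>The tent map agrees with the constant map 0 at both ends, so going out and back is
  homotopic to standing still.\<close>

lemma phom_rev_right:
  assumes "pathin X p"
  shows "phom X (path_join p (path_rev p)) (\<lambda>_. p 0)"
proof -
  have "phom X (p \<circ> (\<lambda>t. if t \<le> 1/2 then 2 * t else 2 - 2 * t)) (p \<circ> (\<lambda>t. 0))"
    by (rule phom_reparam[OF assms continuous_on_if_le_real]) (auto intro!: continuous_intros)
  moreover have "p \<circ> (\<lambda>t. if t \<le> 1/2 then 2 * t else 2 - 2 * t) = path_join p (path_rev p)"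
    by (auto simp: path_join_def path_rev_def intro!: arg_cong[of _ _ p])
  ultimately show ?thesis by (simp add: o_def)
qed

lemma path_rev_rev [simp]: "path_rev (path_rev p) = p"
  by (simp add: path_rev_def)

lemma phom_rev_left:
  assumes "pathin X p"
  shows "phom X (path_join (path_rev p) p) (\<lambda>_. p 1)"
  using phom_rev_right[OF pathin_rev[OF assms]] by simp

lemma pathin_const_eq: "pathin X (\<lambda>_. x) \<longleftrightarrow> x \<in> topspace X"
  by (simp add: pathin_def)

lemma pathin_topspace: "pathin X p \<Longrightarrow> t \<in> {0..1} \<Longrightarrow> p t \<in> topspace X"
  unfolding pathin_def using continuous_map_image_subset_topspace by fastforce

subsection \<open>The fundamental group and classes of paths\<close>

definition loop_class :: "'a topology \<Rightarrow> 'a \<Rightarrow> (real \<Rightarrow> 'a) \<Rightarrow> (real \<Rightarrow> 'a) set" where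
  "loop_class X x0 p = {r. loop_homotopic X x0 p r}"

lemma loops_at_iff: "p \<in> loops_at X x0 \<longleftrightarrow> pathin X p \<and> p 0 = x0 \<and> p 1 = x0"
  by (simp add: loops_at_def)

lemma loop_class_eq_iff:
  assumes "p \<in> loops_at X x0"
  shows "loop_class X x0 p = loop_class X x0 q \<longleftrightarrow> phom X p q"
proof
  have "p \<in> loop_class X x0 p"
    using assms by (auto simp: loop_class_def loop_homotopic_iff loops_at_iff phom_refl)
  moreover assume "loop_class X x0 p = loop_class X x0 q"
  ultimately have "p \<in> loop_class X x0 q" by simp
  then show "phom X p q" by (simp add: loop_class_def loop_homotopic_iff phom_sym)
next
  assume "phom X p q"
  then show "loop_class X x0 p = loop_class X x0 q"
    unfolding loop_class_def loop_homotopic_iff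
    by (metis phom_endpoints phom_sym phom_trans)
qed

lemma fundamental_group_carrier:
  "carrier (fundamental_group X x0) = loop_class X x0 ` loops_at X x0"
  by (auto simp: fundamental_group_def quotient_def loop_class_def)

lemma fundamental_group_one: "\<one>\<^bsub>fundamental_group X x0\<^esub> = loop_class X x0 (\<lambda>_. x0)"
  by (simp add: fundamental_group_def loop_class_def)

lemma join_loops: "p \<in> loops_at X x0 \<Longrightarrow> q \<in> loops_at X x0 \<Longrightarrow> path_join p q \<in> loops_at X x0"
  by (simp add: loops_at_iff pathin_join)

lemma fundamental_group_mult:
  assumes "p \<in> loops_at X x0" "q \<in> loops_at X x0"
  shows "loop_class X x0 p \<otimes>\<^bsub>fundamental_group X x0\<^esub> loop_class X x0 q
       = loop_class X x0 (path_join p q)"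
proof -
  have "loop_homotopic X x0 (path_join p q) r"
    if "loop_homotopic X x0 p p'" "loop_homotopic X x0 q q'" "loop_homotopic X x0 (path_join p' q') r"
    for p' q' r
    using that unfolding loop_homotopic_iff by (metis join_ends phom_join phom_trans)
  moreover have "loop_homotopic X x0 p p" "loop_homotopic X x0 q q"
    using assms by (auto simp: loop_homotopic_iff loops_at_iff phom_refl)
  ultimately show ?thesis
    unfolding fundamental_group_def loop_class_def by auto
qed

lemma group_fundamental_group:
  assumes x0: "x0 \<in> topspace X"
  shows "group (fundamental_group X x0)"
proof (rule groupI)
  let ?G = "fundamental_group X x0"
  note [simp] = fundamental_group_mult fundamental_group_one join_loops
  have c: "(\<lambda>_. x0) \<in> loops_at X x0" using x0 by (simp add: loops_at_iff pathin_const_eq)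
  note [simp] = c
  show "x \<otimes>\<^bsub>?G\<^esub> y \<in> carrier ?G" if "x \<in> carrier ?G" "y \<in> carrier ?G" for x y
    using that unfolding fundamental_group_carrier by auto
  show "\<one>\<^bsub>?G\<^esub> \<in> carrier ?G" unfolding fundamental_group_carrier by auto
  show "x \<otimes>\<^bsub>?G\<^esub> y \<otimes>\<^bsub>?G\<^esub> z = x \<otimes>\<^bsub>?G\<^esub> (y \<otimes>\<^bsub>?G\<^esub> z)"
    if xyz: "x \<in> carrier ?G" "y \<in> carrier ?G" "z \<in> carrier ?G" for x y z
  proof -
    obtain p q r where "p \<in> loops_at X x0" "q \<in> loops_at X x0" "r \<in> loops_at X x0"
      "x = loop_class X x0 p" "y = loop_class X x0 q" "z = loop_class X x0 r"
      using xyz unfolding fundamental_group_carrier by auto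
    then show ?thesis by (simp add: loop_class_eq_iff) (simp add: loops_at_iff phom_assoc)
  qed
  show "\<one>\<^bsub>?G\<^esub> \<otimes>\<^bsub>?G\<^esub> x = x" if x: "x \<in> carrier ?G" for x
  proof -
    obtain p where "p \<in> loops_at X x0" "x = loop_class X x0 p"
      using x unfolding fundamental_group_carrier by auto
    then show ?thesis
      using phom_const_left[of X p] by (simp add: loop_class_eq_iff) (simp add: loops_at_iff)
  qed
  show "\<exists>y\<in>carrier ?G. y \<otimes>\<^bsub>?G\<^esub> x = \<one>\<^bsub>?G\<^esub>" if x: "x \<in> carrier ?G" for x
  proof -
    obtain p where p: "p \<in> loops_at X x0" "x = loop_class X x0 p"
      using x unfolding fundamental_group_carrier by auto
    then have r: "path_rev p \<in> loops_at X x0" by (simp add: loops_at_iff pathin_rev)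
    then have "loop_class X x0 (path_rev p) \<otimes>\<^bsub>?G\<^esub> x = \<one>\<^bsub>?G\<^esub>"
      using p phom_rev_left[of X p] by (simp add: loop_class_eq_iff) (simp add: loops_at_iff)
    then show ?thesis using r unfolding fundamental_group_carrier by blast
  qed
qed

text \<open>Conjugating by chosen paths from the base point turns the fundamental groupoid into a
  subset of the fundamental group, on which the product is total.\<close>

definition base_path :: "'a topology \<Rightarrow> 'a \<Rightarrow> 'a \<Rightarrow> real \<Rightarrow> 'a" where
  "base_path X x0 x = (if x = x0 then \<lambda>_. x0 else SOME p. pathin X p \<and> p 0 = x0 \<and> p 1 = x)"

definition path_class :: "'a topology \<Rightarrow> 'a \<Rightarrow> (real \<Rightarrow> 'a) \<Rightarrow> (real \<Rightarrow> 'a) set" where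
  "path_class X x0 p = loop_class X x0
     (path_join (path_join (base_path X x0 (p 0)) p) (path_rev (base_path X x0 (p 1))))"

lemma base_path:
  assumes "path_connected_space X" "x0 \<in> topspace X" "x \<in> topspace X"
  shows "pathin X (base_path X x0 x)" "base_path X x0 x 0 = x0" "base_path X x0 x 1 = x"
proof -
  have "\<exists>p. pathin X p \<and> p 0 = x0 \<and> p 1 = x"
    using assms unfolding path_connected_space_def by blast
  then have "pathin X (base_path X x0 x) \<and> base_path X x0 x 0 = x0 \<and> base_path X x0 x 1 = x"
    unfolding base_path_def using someI_ex[of "\<lambda>p. pathin X p \<and> p 0 = x0 \<and> p 1 = x"]
    by (auto simp: pathin_const_eq assms)
  then show "pathin X (base_path X x0 x)" "base_path X x0 x 0 = x0" "base_path X x0 x 1 = x" by auto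
qed

context
  fixes X :: "'a topology" and x0 :: 'a
  assumes X: "path_connected_space X" and x0: "x0 \<in> topspace X"
begin

lemma path_class_loop_in:
  assumes "pathin X p"
  shows "path_join (path_join (base_path X x0 (p 0)) p) (path_rev (base_path X x0 (p 1))) \<in> loops_at X x0"
  using assms base_path[OF X x0] pathin_topspace[OF assms, of 0] pathin_topspace[OF assms, of 1]
  by (simp add: loops_at_iff pathin_join pathin_rev)

lemma path_class_closed:
  assumes "pathin X p"
  shows "path_class X x0 p \<in> carrier (fundamental_group X x0)"
  unfolding path_class_def fundamental_group_carrier using path_class_loop_in[OF assms] by blast

lemma path_class_cong:
  assumes "phom X p q"
  shows "path_class X x0 p = path_class X x0 q"
proof -
  have pq: "pathin X p" "pathin X q" "q 0 = p 0" "q 1 = p 1"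
    using assms phom_pathin phom_endpoints by metis+
  note tp = pathin_topspace[OF pq(1)]
  show ?thesis
    unfolding path_class_def pq
    by (subst loop_class_eq_iff[OF path_class_loop_in[OF pq(1)]])
      (use tp[of 0] tp[of 1] assms in \<open>intro phom_join phom_refl pathin_rev; simp add: base_path[OF X x0]\<close>)
qed

text \<open>The chosen return path from the common point to the base point and the same path
  outwards cancel.\<close>

lemma path_class_join:
  assumes p: "pathin X p" and q: "pathin X q" and e: "p 1 = q 0"
  shows "path_class X x0 (path_join p q) =
         path_class X x0 p \<otimes>\<^bsub>fundamental_group X x0\<^esub> path_class X x0 q"
proof -
  let ?b = "base_path X x0" and ?r = "\<lambda>x. path_rev (base_path X x0 x)"
  have tp: "p 0 \<in> topspace X" "q 0 \<in> topspace X" "q 1 \<in> topspace X"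
    using pathin_topspace[OF p, of 0] pathin_topspace[OF q, of 0] pathin_topspace[OF q, of 1] by auto
  note b = base_path[OF X x0]
  note [simp] = b pathin_join pathin_rev p q tp e phom_refl
  let ?x = "p 0" and ?y = "q 0" and ?z = "q 1"
  have 1: "phom X (path_join (path_join (?b ?x) p) (path_join (?r ?y) (path_join (path_join (?b ?y) q) (?r ?z))))
     (path_join (path_join (?b ?x) p) (path_join q (?r ?z)))"
  proof (rule phom_join)
    have "phom X (path_join (?r ?y) (path_join (path_join (?b ?y) q) (?r ?z)))
      (path_join (?r ?y) (path_join (?b ?y) (path_join q (?r ?z))))"
      by (intro phom_join phom_refl phom_assoc) auto
    also have "phom X \<dots> (path_join (path_join (?r ?y) (?b ?y)) (path_join q (?r ?z)))"
      by (rule phom_sym, rule phom_assoc) auto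
    also have "phom X \<dots> (path_join (\<lambda>_. ?y) (path_join q (?r ?z)))"
      using phom_rev_left[of X "?b ?y"] by (intro phom_join phom_refl) auto
    also have "phom X \<dots> (path_join q (?r ?z))"
      using phom_const_left[of X "path_join q (?r ?z)"] by simp
    finally show "phom X (path_join (?r ?y) (path_join (path_join (?b ?y) q) (?r ?z))) (path_join q (?r ?z))" .
  qed auto
  have "phom X (path_join (path_join (path_join (?b ?x) p) (?r ?y)) (path_join (path_join (?b ?y) q) (?r ?z)))
     (path_join (path_join (?b ?x) p) (path_join (?r ?y) (path_join (path_join (?b ?y) q) (?r ?z))))"
    by (rule phom_assoc) auto
  also note 1
  also have "phom X (path_join (path_join (?b ?x) p) (path_join q (?r ?z)))
     (path_join (path_join (path_join (?b ?x) p) q) (?r ?z))"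
    by (rule phom_sym, rule phom_assoc) auto
  also have "phom X \<dots> (path_join (path_join (?b ?x) (path_join p q)) (?r ?z))"
    by (intro phom_join phom_refl phom_assoc) auto
  finally have *: "phom X (path_join (path_join (path_join (?b ?x) p) (?r ?y)) (path_join (path_join (?b ?y) q) (?r ?z)))
     (path_join (path_join (?b ?x) (path_join p q)) (?r ?z))" .
  show ?thesis
    unfolding path_class_def
    apply (subst fundamental_group_mult)
    using path_class_loop_in[OF p] apply simp
    using path_class_loop_in[OF q] apply simp
    apply (subst eq_commute, subst loop_class_eq_iff)
    using path_class_loop_in[OF p] path_class_loop_in[OF q] apply (auto simp: join_loops)[1]
    using * by simp
qed

text \<open>This relies on \<open>base_path\<close> being constant at \<open>x0\<close>; with
  another loop there, a conjugate of the class would result.\<close>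

lemma path_class_loop:
  assumes p: "p \<in> loops_at X x0"
  shows "path_class X x0 p = loop_class X x0 p"
proof -
  have p': "pathin X p" "p 0 = x0" "p 1 = x0" using p by (auto simp: loops_at_iff)
  have r: "path_rev (\<lambda>_. x0) = (\<lambda>_. x0)" by (simp add: path_rev_def)
  have b: "base_path X x0 x0 = (\<lambda>_. x0)" by (simp add: base_path_def)
  have j: "pathin X (path_join (\<lambda>_. x0) p)" using p' x0 by (simp add: pathin_join pathin_const_eq)
  have "phom X (path_join (path_join (\<lambda>_. x0) p) (\<lambda>_. x0)) (path_join (\<lambda>_. x0) p)"
    using phom_const_right[OF j] p' by simp
  also have "phom X \<dots> p" using phom_const_left[OF p'(1)] p' by simp
  finally have "phom X p (path_join (path_join (\<lambda>_. x0) p) (\<lambda>_. x0))" by (rule phom_sym)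
  then show ?thesis
    unfolding path_class_def p' b r using loop_class_eq_iff[OF p] by metis
qed

text \<open>A constant path is idempotent under concatenation, and the only idempotent of a group is
  its unit.\<close>

lemma path_class_const:
  assumes "x \<in> topspace X"
  shows "path_class X x0 (\<lambda>_. x) = \<one>\<^bsub>fundamental_group X x0\<^esub>"
proof -
  interpret group "fundamental_group X x0" by (rule group_fundamental_group[OF x0])
  have c: "pathin X (\<lambda>_. x)" by (simp add: pathin_const_eq assms)
  have "phom X (path_join (\<lambda>_. x) (\<lambda>_. x)) (\<lambda>_. x)" by (rule phom_const_left[OF c])
  then have "path_class X x0 (\<lambda>_. x) \<otimes>\<^bsub>fundamental_group X x0\<^esub> path_class X x0 (\<lambda>_. x) = path_class X x0 (\<lambda>_. x)"
    using path_class_join[OF c c] path_class_cong by simp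
  then show ?thesis using path_class_closed[OF c] by simp
qed

end

text \<open>The case \<open>b < a\<close> is allowed and gives the piece run backwards. So
  subdivision (\<open>phom_part_join\<close>) holds for points in any order, and reversal is the
  case \<open>a = 1\<close>, \<open>b = 0\<close>.\<close>

definition path_part :: "real \<Rightarrow> real \<Rightarrow> (real \<Rightarrow> 'a) \<Rightarrow> real \<Rightarrow> 'a" where
  "path_part a b p = (\<lambda>t. p (a + t * (b - a)))"

lemma part_ends [simp]: "path_part a b p 0 = p a" "path_part a b p 1 = p b"
  by (auto simp: path_part_def)

lemma affine_in_01:
  assumes "a \<in> {0..1}" "b \<in> {0..1::real}" "t \<in> {0..1}"
  shows "a + t * (b - a) \<in> {0..1}"
  using convexD[OF convex_real_interval(5)[of 0 1], of a b "1 - t" t] assms by (auto simp: algebra_simps)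

lemma pathin_part:
  assumes "pathin X p" "a \<in> {0..1}" "b \<in> {0..1}"
  shows "pathin X (path_part a b p)"
proof -
  have "pathin X (p \<circ> (\<lambda>t. a + t * (b - a)))"
    using assms affine_in_01 by (intro pathin_reparam continuous_intros) auto
  then show ?thesis by (simp add: path_part_def o_def)
qed

lemma phom_part_join:
  assumes p: "pathin X p" and abc: "a \<in> {0..1}" "b \<in> {0..1}" "c \<in> {0..1}"
  shows "phom X (path_join (path_part a b p) (path_part b c p)) (path_part a c p)"
proof -
  let ?f = "\<lambda>t. if t \<le> 1/2 then a + (2 * t) * (b - a) else b + (2 * t - 1) * (c - b)"
  have f: "continuous_on {0..1} ?f"
    by (intro continuous_on_if_le_real continuous_intros) (auto simp: algebra_simps)
  have fi: "?f ` {0..1} \<subseteq> {0..1}"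
    using affine_in_01[OF abc(1,2)] affine_in_01[OF abc(2,3)] by fastforce
  have "phom X (p \<circ> ?f) (p \<circ> (\<lambda>t. a + t * (c - a)))"
    by (rule phom_reparam[OF p f fi]) (use affine_in_01[OF abc(1,3)] in \<open>auto intro!: continuous_intros\<close>)
  moreover have "p \<circ> ?f = path_join (path_part a b p) (path_part b c p)"
    by (auto simp: path_join_def path_part_def)
  ultimately show ?thesis by (simp add: path_part_def o_def)
qed

lemma path_part_01 [simp]: "path_part 0 1 p = p"
  by (simp add: path_part_def)

subsection \<open>Holonomy of a local system\<close>

text \<open>
  A local system with structure group \<open>G\<close> is given by \<open>\<eta> x y\<close>, the transition from \<open>x\<close> to nearby
  points \<open>y\<close>; only its germ at \<open>x\<close> matters. A solution over a map \<open>h\<close> is a flat section of the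
  pulled back system.
\<close>

lemma (in group) mult_inv_cancel:
  assumes "x \<in> carrier G" "y \<in> carrier G"
  shows "x \<otimes> (inv x \<otimes> y) = y" "inv x \<otimes> (x \<otimes> y) = y"
  using assms by (simp_all add: m_assoc[symmetric])

locale local_system = group G for G :: "('g, 'm) monoid_scheme" (structure) +
  fixes X :: "'a topology" and \<eta> :: "'a \<Rightarrow> 'a \<Rightarrow> 'g"
  assumes eta_closed: "x \<in> topspace X \<Longrightarrow> y \<in> topspace X \<Longrightarrow> \<eta> x y \<in> carrier G"
    and eta_cocycle: "x \<in> topspace X \<Longrightarrow> \<exists>V. openin X V \<and> x \<in> V \<and>
      (\<forall>y\<in>V. \<exists>V'. openin X V' \<and> y \<in> V' \<and> (\<forall>y'\<in>V'. \<eta> x y' = \<eta> x y \<otimes> \<eta> y y'))"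
begin

section \<open>Flat sections along maps\<close>

definition solution :: "('z::topological_space \<Rightarrow> 'a) \<Rightarrow> 'z set \<Rightarrow> ('z \<Rightarrow> 'g) \<Rightarrow> bool" where
  "solution h S g \<longleftrightarrow> continuous_map (top_of_set S) X h \<and> g ` S \<subseteq> carrier G \<and>
     (\<forall>z\<in>S. \<exists>N. open N \<and> z \<in> N \<and> (\<forall>z'\<in>N \<inter> S. g z' = g z \<otimes> \<eta> (h z) (h z')))"

text \<open>The cocycle law with all points equal to \<open>x\<close> makes this element
  idempotent.\<close>

lemma eta_refl:
  assumes x: "x \<in> topspace X" shows "\<eta> x x = \<one>"
proof -
  obtain V where V: "x \<in> V" "openin X V"
    "\<forall>y\<in>V. \<exists>V'. openin X V' \<and> y \<in> V' \<and> (\<forall>y'\<in>V'. \<eta> x y' = \<eta> x y \<otimes> \<eta> y y')"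
    using eta_cocycle[OF x] by blast
  obtain V' where "openin X V'" "x \<in> V'" "\<forall>y'\<in>V'. \<eta> x y' = \<eta> x x \<otimes> \<eta> x y'"
    using V(3)[rule_format, OF V(1)] by blast
  then have "\<eta> x x = \<eta> x x \<otimes> \<eta> x x" by blast
  then show ?thesis using eta_closed[OF x x] by (metis r_cancel_one')
qed

lemma continuous_map_nbhd:
  assumes h: "continuous_map (top_of_set S) X h" and V: "openin X V" "h z \<in> V" and z: "z \<in> S"
  obtains N where "open N" "z \<in> N" "\<And>z'. z' \<in> N \<inter> S \<Longrightarrow> h z' \<in> V"
proof -
  have "openin (top_of_set S) {x \<in> topspace (top_of_set S). h x \<in> V}"
    using openin_continuous_map_preimage[OF h V(1)] .
  then obtain N where "open N" "{x \<in> S. h x \<in> V} = S \<inter> N" by (auto simp: openin_open)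
  then show ?thesis using that[of N] V z by blast
qed

lemma solutionD:
  "solution h S g \<Longrightarrow> z \<in> S \<Longrightarrow> \<exists>N. open N \<and> z \<in> N \<and> (\<forall>z'\<in>N \<inter> S. g z' = g z \<otimes> \<eta> (h z) (h z'))"
  by (simp add: solution_def)

lemma solution_closed: "solution h S g \<Longrightarrow> z \<in> S \<Longrightarrow> g z \<in> carrier G"
  by (auto simp: solution_def)

lemma solution_topspace: "solution h S g \<Longrightarrow> z \<in> S \<Longrightarrow> h z \<in> topspace X"
  unfolding solution_def using continuous_map_image_subset_topspace by fastforce

text \<open>The transitions from \<open>h z0\<close> form a flat section near \<open>z0\<close>. The
  conclusion covers all subsets \<open>T\<close> at once because the pieces of a subdivision need
  not be neighbourhoods of \<open>z0\<close>.\<close>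

lemma solution_local:
  assumes h: "continuous_map (top_of_set S) X h" and z0: "z0 \<in> S"
  obtains N where "open N" "z0 \<in> N" "\<And>T. T \<subseteq> S \<inter> N \<Longrightarrow> \<exists>g. solution h T g"
proof -
  have top: "h z \<in> topspace X" if "z \<in> S" for z
    using h that continuous_map_image_subset_topspace by fastforce
  obtain V where V: "openin X V" "h z0 \<in> V"
    "\<And>y. y \<in> V \<Longrightarrow> \<exists>V'. openin X V' \<and> y \<in> V' \<and> (\<forall>y'\<in>V'. \<eta> (h z0) y' = \<eta> (h z0) y \<otimes> \<eta> y y')"
    using eta_cocycle[OF top[OF z0]] by blast
  obtain N where N: "open N" "z0 \<in> N" "\<And>z'. z' \<in> N \<inter> S \<Longrightarrow> h z' \<in> V"
    using continuous_map_nbhd[OF h V(1,2) z0] by blast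
  have "solution h T (\<lambda>z. \<eta> (h z0) (h z))" if T: "T \<subseteq> S \<inter> N" for T
    unfolding solution_def
  proof (intro conjI ballI)
    show cT: "continuous_map (top_of_set T) X h"
      using continuous_map_from_subtopology_mono[OF h] T by blast
    show "(\<lambda>z. \<eta> (h z0) (h z)) ` T \<subseteq> carrier G" using T top z0 eta_closed by blast
    fix z assume z: "z \<in> T"
    then have "h z \<in> V" using N(3) T by blast
    then obtain V' where V': "openin X V'" "h z \<in> V'"
      "\<forall>y'\<in>V'. \<eta> (h z0) y' = \<eta> (h z0) (h z) \<otimes> \<eta> (h z) y'" using V(3) by blast
    obtain M where "open M" "z \<in> M" "\<And>z'. z' \<in> M \<inter> T \<Longrightarrow> h z' \<in> V'"
      using continuous_map_nbhd[OF cT V'(1,2) z] by blast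
    then show "\<exists>N. open N \<and> z \<in> N \<and> (\<forall>z'\<in>N \<inter> T. \<eta> (h z0) (h z') = \<eta> (h z0) (h z) \<otimes> \<eta> (h z) (h z'))"
      using V'(3) by blast
  qed
  then show ?thesis using that[OF N(1,2)] by blast
qed

lemma solution_pullback:
  assumes g: "solution h S g" and f: "continuous_on T f" "f ` T \<subseteq> S"
  shows "solution (\<lambda>z. h (f z)) T (\<lambda>z. g (f z))"
  unfolding solution_def
proof (intro conjI ballI)
  have "continuous_map (top_of_set T) (top_of_set S) f"
    using f by (auto simp: continuous_map_in_subtopology)
  then show "continuous_map (top_of_set T) X (\<lambda>z. h (f z))"
    using g continuous_map_compose[of _ _ f X h] unfolding solution_def o_def by blast
  show "(\<lambda>z. g (f z)) ` T \<subseteq> carrier G" using g f by (auto simp: solution_def)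
  fix z assume z: "z \<in> T"
  then have "f z \<in> S" using f(2) by blast
  from solutionD[OF g this]
  obtain N where N: "open N" "f z \<in> N" "\<forall>z'\<in>N \<inter> S. g z' = g (f z) \<otimes> \<eta> (h (f z)) (h z')"
    by (elim exE conjE) (rule that)
  have "openin (top_of_set T) (T \<inter> f -` N)" by (rule continuous_openin_preimage_gen[OF f(1) N(1)])
  then obtain M where M: "open M" "T \<inter> f -` N = T \<inter> M" unfolding openin_open by blast
  then have "z \<in> M" "\<forall>y\<in>T \<inter> M. f y \<in> N" using z N(2) by blast+
  then show "\<exists>M. open M \<and> z \<in> M \<and> (\<forall>z'\<in>M \<inter> T. g (f z') = g (f z) \<otimes> \<eta> (h (f z)) (h (f z')))"
    using N(3) f(2) M(1) by blast
qed

lemma solution_mono: "solution h S g \<Longrightarrow> T \<subseteq> S \<Longrightarrow> solution h T g"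
  using solution_pullback[of h S g T "\<lambda>z. z"] by auto

lemma solution_cong:
  assumes g: "solution h S g" and e: "\<And>z. z \<in> S \<Longrightarrow> h z = h' z"
  shows "solution h' S g"
proof -
  have "continuous_map (top_of_set S) X h'"
    using g e by (auto simp: solution_def intro: continuous_map_eq)
  then show ?thesis using g e unfolding solution_def by (metis IntD2)
qed

lemma solution_left_mult:
  assumes g: "solution h S g" and c: "c \<in> carrier G"
  shows "solution h S (\<lambda>z. c \<otimes> g z)"
  unfolding solution_def
proof (intro conjI ballI)
  show "continuous_map (top_of_set S) X h" "(\<lambda>z. c \<otimes> g z) ` S \<subseteq> carrier G"
    using g c by (auto simp: solution_def)
  fix z assume z: "z \<in> S"
  then obtain N where N: "open N" "z \<in> N" "\<forall>z'\<in>N \<inter> S. g z' = g z \<otimes> \<eta> (h z) (h z')"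
    using solutionD[OF g z] by blast
  have "c \<otimes> g z' = c \<otimes> g z \<otimes> \<eta> (h z) (h z')" if "z' \<in> N \<inter> S" for z'
    using N(3) that solution_closed[OF g] solution_topspace[OF g] z c eta_closed
    by (auto simp: m_assoc)
  then show "\<exists>N. open N \<and> z \<in> N \<and> (\<forall>z'\<in>N \<inter> S. c \<otimes> g z' = c \<otimes> g z \<otimes> \<eta> (h z) (h z'))"
    using N by blast
qed

text \<open>The quotient of \<open>g' z\<close> by \<open>g z\<close> is locally constant: the
  transition to a nearby point multiplies both on the right and cancels.\<close>

lemma solution_unique:
  assumes g: "solution h S g" and g': "solution h S g'" and S: "connected S"
  shows "\<exists>c\<in>carrier G. \<forall>z\<in>S. g' z = c \<otimes> g z"
proof (cases "S = {}")
  case False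
  let ?k = "\<lambda>z. g' z \<otimes> inv (g z)"
  note cl = solution_closed[OF g] solution_closed[OF g']
  have loc: "\<forall>z\<in>S. eventually (\<lambda>z'. ?k z = ?k z') (at z within S)"
  proof
    fix z assume z: "z \<in> S"
    obtain N where N: "open N" "z \<in> N" "\<forall>z'\<in>N \<inter> S. g z' = g z \<otimes> \<eta> (h z) (h z')"
      using solutionD[OF g z] by blast
    obtain M where M: "open M" "z \<in> M" "\<forall>z'\<in>M \<inter> S. g' z' = g' z \<otimes> \<eta> (h z) (h z')"
      using solutionD[OF g' z] by blast
    have "?k z = ?k z'" if "z' \<in> N \<inter> M" "z' \<in> S" for z'
    proof -
      have e: "\<eta> (h z) (h z') \<in> carrier G"
        using solution_topspace[OF g] that z eta_closed by blast
      have "g' z \<otimes> \<eta> (h z) (h z') \<otimes> (inv \<eta> (h z) (h z') \<otimes> inv g z) = g' z \<otimes> inv g z"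
        using e cl[OF z] by (simp add: m_assoc mult_inv_cancel)
      then show ?thesis using that N(3) M(3) e cl[OF z] by (simp add: inv_mult_group)
    qed
    then show "eventually (\<lambda>z'. ?k z = ?k z') (at z within S)"
      unfolding eventually_at_topological using N M
      by (intro exI[of _ "N \<inter> M"]) auto
  qed
  obtain z0 where z0: "z0 \<in> S" using False by blast
  have "g' z = ?k z0 \<otimes> g z" if z: "z \<in> S" for z
  proof -
    have "?k z0 = ?k z" using connected_local_const[OF S z0 z loc] .
    then show ?thesis using cl[OF z] by (simp add: m_assoc)
  qed
  then show ?thesis using cl[OF z0] by blast
qed (use one_closed in blast)

text \<open>On the connected overlap the two solutions differ by one left factor, and correcting
  \<open>g'\<close> by it makes them agree. Closedness lets a point outside one piece avoid that
  piece in a neighbourhood.\<close>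

lemma solution_glue:
  assumes g: "solution h S g" and g': "solution h T g'"
    and ST: "closed S" "closed T" "connected (S \<inter> T)"
    and h: "continuous_map (top_of_set (S \<union> T)) X h"
  shows "\<exists>k. solution h (S \<union> T) k"
proof -
  obtain c where c: "c \<in> carrier G" "\<And>z. z \<in> S \<inter> T \<Longrightarrow> g z = c \<otimes> g' z"
    using solution_unique[OF solution_mono[OF g', of "S \<inter> T"] solution_mono[OF g, of "S \<inter> T"] ST(3)]
    by blast
  have k': "solution h T (\<lambda>z. c \<otimes> g' z)" by (rule solution_left_mult[OF g' c(1)])
  let ?k = "\<lambda>z. if z \<in> S then g z else c \<otimes> g' z"
  have kT: "?k z = c \<otimes> g' z" if "z \<in> T" for z using c that by auto
  have "solution h (S \<union> T) ?k"
    unfolding solution_def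
  proof (intro conjI ballI)
    show "?k ` (S \<union> T) \<subseteq> carrier G"
      using solution_closed[OF g] solution_closed[OF k'] by auto
    fix z assume z: "z \<in> S \<union> T"
    obtain N where N: "open N" "z \<in> N" "\<forall>z'\<in>N \<inter> S. z \<in> S \<longrightarrow> ?k z' = ?k z \<otimes> \<eta> (h z) (h z')"
      "z \<notin> S \<Longrightarrow> N \<inter> S = {}"
    proof (cases "z \<in> S")
      case True
      from solutionD[OF g True]
      obtain N where "open N" "z \<in> N" "\<forall>z'\<in>N \<inter> S. g z' = g z \<otimes> \<eta> (h z) (h z')"
        by (elim exE conjE) (rule that)
      moreover have "?k z' = ?k z \<otimes> \<eta> (h z) (h z')" if "z' \<in> N \<inter> S" for z'
        using calculation(3)[rule_format, OF that] that True by simp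
      ultimately show thesis using True by (intro that[of N]) blast+
    next
      case False
      then show thesis by (intro that[of "- S"]) (use ST(1) in \<open>simp_all add: open_Compl\<close>)
    qed
    obtain M where M: "open M" "z \<in> M" "\<forall>z'\<in>M \<inter> T. z \<in> T \<longrightarrow> ?k z' = ?k z \<otimes> \<eta> (h z) (h z')"
      "z \<notin> T \<Longrightarrow> M \<inter> T = {}"
    proof (cases "z \<in> T")
      case True
      from solutionD[OF k' True]
      obtain M where "open M" "z \<in> M" "\<forall>z'\<in>M \<inter> T. c \<otimes> g' z' = c \<otimes> g' z \<otimes> \<eta> (h z) (h z')"
        by (elim exE conjE) (rule that)
      moreover have "?k z' = ?k z \<otimes> \<eta> (h z) (h z')" if "z' \<in> M \<inter> T" for z'
        using calculation(3)[rule_format, OF that] kT[OF True] kT[of z'] that by simp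
      ultimately show thesis using True by (intro that[of M]) blast+
    next
      case False
      then show thesis by (intro that[of "- T"]) (use ST(2) in \<open>simp_all add: open_Compl\<close>)
    qed
    have "?k z' = ?k z \<otimes> \<eta> (h z) (h z')" if z': "z' \<in> (N \<inter> M) \<inter> (S \<union> T)" for z'
    proof (cases "z' \<in> S")
      case True
      then have "z \<in> S" using N(4) z' by blast
      then show ?thesis using N(3) z' True by blast
    next
      case False
      then have "z' \<in> T" using z' by blast
      then have "z \<in> T" using M(4) z' by blast
      then show ?thesis using M(3) z' \<open>z' \<in> T\<close> by blast
    qed
    then show "\<exists>N. open N \<and> z \<in> N \<and> (\<forall>z'\<in>N \<inter> (S \<union> T). ?k z' = ?k z \<otimes> \<eta> (h z) (h z'))"
      using N(1,2) M(1,2) by (intro exI[of _ "N \<inter> M"]) blast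
  qed (rule h)
  then show ?thesis by blast
qed

text \<open>Bisection is used twice: around a fixed first coordinate the second one is subdivided,
  which yields a solution over a full vertical strip, and then the strips are glued. All pieces are
  rectangles, so the overlaps are convex, hence connected.\<close>

lemma solution_square:
  fixes h :: "real \<times> real \<Rightarrow> 'a"
  assumes h: "continuous_map (top_of_set ({0..1} \<times> {0..1})) X h"
  shows "\<exists>g. solution h ({0..1} \<times> {0..1}) g"
proof -
  let ?U = "{0..1} \<times> {0..1::real} :: (real \<times> real) set"
  have U: "closed ?U" "convex ?U" by (simp_all add: closed_Times convex_Times)
  have cont: "continuous_map (top_of_set (S \<inter> ?U)) X h" for S
    using continuous_map_from_subtopology_mono[OF h] by blast
  have glue: "\<exists>g. solution h ((S \<union> T) \<inter> ?U) g"
    if "\<exists>g. solution h (S \<inter> ?U) g" "\<exists>g. solution h (T \<inter> ?U) g" "closed S" "closed T" "convex (S \<inter> T)"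
    for S T
  proof -
    have "convex ((S \<inter> T) \<inter> ?U)" using that(5) U(2) by (rule convex_Int)
    moreover have "(S \<inter> T) \<inter> ?U = (S \<inter> ?U) \<inter> (T \<inter> ?U)" by blast
    ultimately have "connected ((S \<inter> ?U) \<inter> (T \<inter> ?U))" by (simp add: convex_connected)
    then show ?thesis
      using that U cont[of "S \<union> T"] solution_glue[of h "S \<inter> ?U" _ "T \<inter> ?U"]
      by (metis Int_Un_distrib2 closed_Int)
  qed
  have "\<exists>g. solution h (({0..1} \<times> UNIV) \<inter> ?U) g"
  proof (rule Bolzano[of 0 1 "\<lambda>a b. \<exists>g. solution h (({a..b} \<times> UNIV) \<inter> ?U) g"])
    fix a b c :: real
    assume ab: "\<exists>g. solution h (({a..b} \<times> UNIV) \<inter> ?U) g" and bc: "\<exists>g. solution h (({b..c} \<times> UNIV) \<inter> ?U) g"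
      and le: "a \<le> b" "b \<le> c"
    have e: "{a..b} \<times> UNIV \<union> {b..c} \<times> UNIV = {a..c} \<times> UNIV" using le by auto
    have "convex (({a..b} \<inter> {b..c}) \<times> (UNIV :: real set))"
      by (intro convex_Times convex_Int convex_real_interval convex_UNIV)
    then have "convex ({a..b} \<times> (UNIV :: real set) \<inter> {b..c} \<times> UNIV)" by (simp add: Times_Int_Times)
    then show "\<exists>g. solution h (({a..c} \<times> UNIV) \<inter> ?U) g"
      unfolding e[symmetric] by (intro glue ab bc) (auto intro: closed_Times)
  next
    fix x :: real assume x: "0 \<le> x" "x \<le> 1"
    let ?Q = "\<lambda>c e. \<exists>d>0. \<forall>a b. a \<le> x \<and> x \<le> b \<and> b - a < d \<longrightarrow> (\<exists>g. solution h (({a..b} \<times> {c..e}) \<inter> ?U) g)"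
    have "?Q 0 1"
    proof (rule Bolzano[of 0 1 ?Q])
      fix c d e :: real assume Q: "?Q c d" "?Q d e" and le: "c \<le> d" "d \<le> e"
      obtain r where r: "r > 0" "\<And>a b. a \<le> x \<and> x \<le> b \<and> b - a < r \<Longrightarrow> (\<exists>g. solution h (({a..b} \<times> {c..d}) \<inter> ?U) g)"
        using Q(1) by blast
      obtain s where s: "s > 0" "\<And>a b. a \<le> x \<and> x \<le> b \<and> b - a < s \<Longrightarrow> (\<exists>g. solution h (({a..b} \<times> {d..e}) \<inter> ?U) g)"
        using Q(2) by blast
      have "\<exists>g. solution h (({a..b} \<times> {c..e}) \<inter> ?U) g" if "a \<le> x \<and> x \<le> b \<and> b - a < min r s" for a b
      proof -
        have e: "{a..b} \<times> {c..d} \<union> {a..b} \<times> {d..e} = {a..b} \<times> {c..e}" using le by auto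
        have "convex ({a..b} \<times> ({c..d} \<inter> {d..e}))"
          by (intro convex_Times convex_Int convex_real_interval)
        then have "convex ({a..b} \<times> {c..d} \<inter> {a..b} \<times> {d..e})" by (simp add: Times_Int_Times)
        then show ?thesis
          unfolding e[symmetric] by (intro glue r(2) s(2)) (use that in \<open>auto intro: closed_Times\<close>)
      qed
      then show "?Q c e" using r(1) s(1) by (intro exI[of _ "min r s"]) auto
    next
      fix t :: real assume t: "0 \<le> t" "t \<le> 1"
      obtain N where N: "open N" "(x, t) \<in> N" "\<And>T. T \<subseteq> ?U \<inter> N \<Longrightarrow> \<exists>g. solution h T g"
        by (rule solution_local[OF h, of "(x,t)"]) (use x t in auto)
      obtain A B where AB: "open A" "open B" "x \<in> A" "t \<in> B" "A \<times> B \<subseteq> N"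
        using open_prod_elim[OF N(1,2)] by (metis mem_Sigma_iff)
      obtain r where r: "r > 0" "ball x r \<subseteq> A" using AB open_contains_ball by blast
      obtain s where s: "s > 0" "ball t s \<subseteq> B" using AB open_contains_ball by blast
      have "\<exists>g. solution h (({a..b} \<times> {c..e}) \<inter> ?U) g"
        if ab: "a \<le> x \<and> x \<le> b \<and> b - a < r" and ce: "c \<le> t \<and> t \<le> e \<and> e - c < s" for a b c e
      proof -
        have "{a..b} \<subseteq> ball x r" "{c..e} \<subseteq> ball t s" using ab ce by (auto simp: dist_real_def)
        then have "{a..b} \<times> {c..e} \<subseteq> N" using r s AB by blast
        then show ?thesis by (intro N(3)) blast
      qed
      then show "\<exists>s>0. \<forall>c e. c \<le> t \<and> t \<le> e \<and> e - c < s \<longrightarrow> ?Q c e"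
        using r(1) s(1) by (intro exI[of _ s]) blast
    qed auto
    then obtain d where d: "d > 0" "\<And>a b. a \<le> x \<and> x \<le> b \<and> b - a < d \<Longrightarrow> \<exists>g. solution h (({a..b} \<times> {0..1}) \<inter> ?U) g"
      by blast
    have "({a..b} \<times> {0..1}) \<inter> ?U = ({a..b} \<times> UNIV) \<inter> ?U" for a b by auto
    then show "\<exists>d>0. \<forall>a b. a \<le> x \<and> x \<le> b \<and> b - a < d \<longrightarrow> (\<exists>g. solution h (({a..b} \<times> UNIV) \<inter> ?U) g)"
      using d by metis
  qed auto
  moreover have "({0..1} \<times> UNIV) \<inter> ?U = ?U" by auto
  ultimately show ?thesis by simp
qed

text \<open>A path is regarded as a square that is constant in the first direction.\<close>

lemma solution_path:
  assumes "pathin X p" shows "\<exists>g. solution p {0..1} g"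
proof -
  have "continuous_map (top_of_set ({0..1} \<times> {0..1})) I01 (snd :: real \<times> real \<Rightarrow> real)"
    by (auto simp: continuous_map_in_subtopology intro!: continuous_intros)
  then have "continuous_map (top_of_set ({0..1} \<times> {0..1})) X (\<lambda>z :: real \<times> real. p (snd z))"
    using assms continuous_map_compose[of _ I01 snd X p] unfolding pathin_def o_def by blast
  then obtain g where g: "solution (\<lambda>z :: real \<times> real. p (snd z)) ({0..1} \<times> {0..1}) g"
    using solution_square by blast
  have "solution (\<lambda>t. p (snd (0::real, t))) {0..1} (\<lambda>t. g (0, t))"
    by (rule solution_pullback[OF g]) (auto intro!: continuous_intros)
  then show ?thesis by auto
qed

section \<open>Holonomy of paths\<close>

definition hol :: "(real \<Rightarrow> 'a) \<Rightarrow> 'g" where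
  "hol p = (let g = SOME g. solution p {0..1} g in inv (g 0) \<otimes> g 1)"

text \<open>Two solutions over the interval differ by a left factor, which cancels in the quotient
  of the end values; so the choice made in \<open>hol\<close> has no effect.\<close>

lemma hol_eq:
  assumes g: "solution p {0..1} g"
  shows "hol p = inv (g 0) \<otimes> g 1"
proof -
  define g' where "g' = (SOME g. solution p {0..1} g)"
  have g': "solution p {0..1} g'" unfolding g'_def using g by (rule someI[of "solution p {0..1}"])
  obtain c where c: "c \<in> carrier G" "\<forall>z\<in>{0..1}. g' z = c \<otimes> g z"
    using solution_unique[OF g g'] by auto
  have "inv (g' 0) \<otimes> g' 1 = inv (g 0) \<otimes> g 1"
    using c solution_closed[OF g, of 0] solution_closed[OF g, of 1]
    by (simp add: inv_mult_group m_assoc mult_inv_cancel)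
  then show ?thesis by (simp add: hol_def g'_def Let_def)
qed

lemma hol_part:
  assumes g: "solution p {0..1} g" and ab: "a \<in> {0..1}" "b \<in> {0..1}"
  shows "hol (path_part a b p) = inv (g a) \<otimes> g b"
proof -
  have "solution (path_part a b p) {0..1} (\<lambda>t. g (a + t * (b - a)))"
    unfolding path_part_def
    by (rule solution_pullback[OF g]) (use affine_in_01[OF ab] in \<open>auto intro!: continuous_intros\<close>)
  then show ?thesis using hol_eq by fastforce
qed

text \<open>One solution is taken over the whole square of the homotopy. On the two sides where the
  homotopy rests at an endpoint the transitions are trivial, so the solution is constant there, and
  the edges carrying \<open>p\<close> and \<open>q\<close> have the same end values.\<close>

lemma hol_phom:
  assumes "phom X p q" shows "hol p = hol q"
proof -
  obtain h where h: "continuous_map (prod_topology I01 I01) X h"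
    "\<forall>t\<in>{0..1}. h (0, t) = p t" "\<forall>t\<in>{0..1}. h (1, t) = q t"
    "\<forall>s\<in>{0..1}. h (s, 0) = p 0 \<and> h (s, 1) = p 1" using assms phom_iff by metis
  obtain g where g: "solution h ({0..1} \<times> {0..1}) g"
    using solution_square h(1) by (auto simp: prod_topology_subtopology_eu)
  have edge: "solution (\<lambda>t. h (s, t)) {0..1} (\<lambda>t. g (s, t))" if "s \<in> {0..1}" for s
    by (rule solution_pullback[OF g]) (use that in \<open>auto intro!: continuous_intros\<close>)
  have p: "hol p = inv (g (0,0)) \<otimes> g (0,1)"
    using hol_eq[OF solution_cong[OF edge[of 0], of p]] h(2) by auto
  have q: "hol q = inv (g (1,0)) \<otimes> g (1,1)"
    using hol_eq[OF solution_cong[OF edge[of 1], of q]] h(3) by auto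
  have "g (0, t) = g (1, t)" if t: "t = 0 \<or> t = 1" for t
  proof -
    have e: "solution (\<lambda>s. h (s, t)) {0..1} (\<lambda>s. g (s, t))"
      by (rule solution_pullback[OF g]) (use t in \<open>auto intro!: continuous_intros\<close>)
    have c: "h (s, t) = h (0, t)" if "s \<in> {0..1}" for s
      using h(4) t that by (metis atLeastAtMost_iff order_refl zero_le_one)
    have top: "h (0,t) \<in> topspace X" using solution_topspace[OF e, of 0] by simp
    have "\<forall>s\<in>{0..1}. eventually (\<lambda>s'. g (s, t) = g (s', t)) (at s within {0..1})"
    proof
      fix s :: real assume s: "s \<in> {0..1}"
      obtain N where N: "open N" "s \<in> N" "\<forall>s'\<in>N \<inter> {0..1}. g (s', t) = g (s, t) \<otimes> \<eta> (h (s, t)) (h (s', t))"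
        using solutionD[OF e s] by blast
      have "g (s', t) = g (s, t)" if "s' \<in> N \<inter> {0..1}" for s'
        using N(3)[rule_format, OF that] c[OF s] c[of s'] that eta_refl[OF top] solution_closed[OF e s] by simp
      then show "eventually (\<lambda>s'. g (s, t) = g (s', t)) (at s within {0..1})"
        unfolding eventually_at_topological using N by (intro exI[of _ N]) auto
    qed
    then show ?thesis using connected_local_const[of "{0..1::real}" 0 1 "\<lambda>s. g (s, t)"] by simp
  qed
  then show ?thesis using p q by simp
qed

lemma hol_join:
  assumes "pathin X p" "pathin X q" "p 1 = q 0"
  shows "hol (path_join p q) = hol p \<otimes> hol q"
proof -
  obtain g where g: "solution (path_join p q) {0..1} g"
    using solution_path pathin_join assms by blast
  have e: "path_part 0 (1/2) (path_join p q) t = p t" "path_part (1/2) 1 (path_join p q) t = q t"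
    if "t \<in> {0..1}" for t
    using that assms(3) by (auto simp: path_part_def path_join_def field_simps)
  have "pathin X (path_part 0 (1/2) (path_join p q))" "pathin X (path_part (1/2) 1 (path_join p q))"
    using pathin_part[OF pathin_join[OF assms]] by auto
  then have "hol p = hol (path_part 0 (1/2) (path_join p q))" "hol q = hol (path_part (1/2) 1 (path_join p q))"
    using e by (auto intro!: hol_phom[symmetric] phom_eq)
  then have "hol p = inv (g 0) \<otimes> g (1/2)" "hol q = inv (g (1/2)) \<otimes> g 1"
    using hol_part[OF g] by auto
  then show ?thesis
    using hol_eq[OF g] solution_closed[OF g, of 0] solution_closed[OF g, of 1] solution_closed[OF g, of "1/2"]
    by (simp add: m_assoc mult_inv_cancel)
qed

text \<open>The function \<tau> is a flat section over \<open>U\<close> itself, so composing it with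
  \<open>p\<close> gives a solution along any path inside \<open>U\<close>.\<close>

lemma hol_trivial:
  assumes p: "pathin X p" "p ` {0..1} \<subseteq> U"
    and t: "\<And>y. y \<in> U \<Longrightarrow> \<tau> y \<in> carrier G"
    and loc: "\<And>y. y \<in> U \<Longrightarrow> \<exists>V. openin X V \<and> y \<in> V \<and> (\<forall>y'\<in>V \<inter> U. \<tau> y' = \<tau> y \<otimes> \<eta> y y')"
  shows "hol p = inv (\<tau> (p 0)) \<otimes> \<tau> (p 1)"
proof -
  have "solution p {0..1} (\<lambda>t. \<tau> (p t))"
    unfolding solution_def
  proof (intro conjI ballI)
    show c: "continuous_map (top_of_set {0..1}) X p" using p by (simp add: pathin_def)
    show "(\<lambda>t. \<tau> (p t)) ` {0..1} \<subseteq> carrier G" using p t by auto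
    fix z :: real assume z: "z \<in> {0..1}"
    then have "p z \<in> U" using p by blast
    then obtain V where V: "openin X V" "p z \<in> V" "\<forall>y'\<in>V \<inter> U. \<tau> y' = \<tau> (p z) \<otimes> \<eta> (p z) y'"
      using loc by blast
    obtain N where "open N" "z \<in> N" "\<And>z'. z' \<in> N \<inter> {0..1} \<Longrightarrow> p z' \<in> V"
      using continuous_map_nbhd[OF c V(1,2) z] by blast
    then show "\<exists>N. open N \<and> z \<in> N \<and> (\<forall>z'\<in>N \<inter> {0..1}. \<tau> (p z') = \<tau> (p z) \<otimes> \<eta> (p z) (p z'))"
      using V(3) p by blast
  qed
  then show ?thesis by (rule hol_eq)
qed

end

subsection \<open>The group \<open>G\<close> and its action on sign patterns\<close>

text \<open>From here on \<open>k = n + 1\<close>, and the \<open>k\<close>-subset omitting \<open>j + 1\<close> is referred to by \<open>j \<le> n + 1\<close>.\<close>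

definition gen :: "nat \<Rightarrow> nat \<Rightarrow> nat set" where
  "gen n j = {1..n+2} - {Suc j}"

section \<open>Elements of the group as plain words\<close>

definition gel :: "nat \<Rightarrow> nat list \<Rightarrow> (nat set \<times> bool) list set" where
  "gel n js = Gk_elem (Suc n) (map (gen n) js)"

lemma inj_on_gen: "inj_on (gen n) {..n+1}"
proof (rule inj_onI)
  fix i j assume "i \<in> {..n+1}" "j \<in> {..n+1}" "gen n i = gen n j"
  then have "Suc i \<notin> {1..n+2} - {Suc j}" "Suc i \<in> {1..n+2}" unfolding gen_def by (blast, auto)
  then show "i = j" by blast
qed

lemma gen_in_gens: "j \<le> n+1 \<Longrightarrow> gen n j \<in> Gk_gens (Suc n)"
  by (auto simp: gen_def Gk_gens_def card_Diff_singleton)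

lemma Gk_gens_eq: "Gk_gens (Suc n) = gen n ` {..n+1}"
proof (intro equalityI subsetI)
  fix m assume "m \<in> Gk_gens (Suc n)"
  then have m: "m \<subseteq> {1..n+2}" "card m = Suc n" by (auto simp: Gk_gens_def)
  then have "card ({1..n+2} - m) = 1" by (simp add: card_Diff_subset finite_subset[OF m(1)])
  then obtain i where i: "{1..n+2} - m = {i}" using card_1_singletonE by blast
  then have i': "i \<in> {1..n+2}" by blast
  then have "Suc (i - 1) = i" by auto
  then have "m = gen n (i - 1)" unfolding gen_def using m(1) i by (metis double_diff subset_refl)
  moreover have "i - 1 \<in> {..n+1}" using i' by auto
  ultimately show "m \<in> gen n ` {..n+1}" by blast
qed (use gen_in_gens in auto)

definition gidx :: "nat \<Rightarrow> nat set \<Rightarrow> nat" where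
  "gidx n = the_inv_into {..n+1} (gen n)"

lemma gidx_gen [simp]: "j \<le> n+1 \<Longrightarrow> gidx n (gen n j) = j"
  unfolding gidx_def by (rule the_inv_into_f_f[OF inj_on_gen]) auto

lemma gidx_le: "m \<in> Gk_gens (Suc n) \<Longrightarrow> gidx n m \<le> n+1"
  unfolding Gk_gens_eq by auto

lemma gen_gidx: "m \<in> Gk_gens (Suc n) \<Longrightarrow> gen n (gidx n m) = m"
  unfolding Gk_gens_eq by auto

lemma pos_word_set: "set js \<subseteq> {..n+1} \<Longrightarrow> set (pos_word (map (gen n) js)) \<subseteq> Gk_gens (Suc n) \<times> UNIV"
  unfolding Gk_gens_eq by (auto simp: pos_word_def)

lemma pos_word_append [simp]: "pos_word (xs @ ys) = pos_word xs @ pos_word ys"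
  by (simp add: pos_word_def)

lemma gel_append:
  "set xs \<subseteq> {..n+1} \<Longrightarrow> set ys \<subseteq> {..n+1} \<Longrightarrow> gel n (xs @ ys) = gel n xs \<otimes>\<^bsub>Gk (Suc n)\<^esub> gel n ys"
  unfolding gel_def Gk_elem_def Gk_def using pos_word_set by (subst presented_group_mult) auto

lemma gel_Nil: "gel n [] = \<one>\<^bsub>Gk (Suc n)\<^esub>"
  by (simp add: gel_def Gk_elem_def Gk_def presented_group_def pos_word_def)

lemma gel_relator:
  assumes "pos_word (map (gen n) js) \<in> Gk_rels (Suc n)" "set js \<subseteq> {..n+1}"
  shows "gel n js = gel n []"
proof -
  have "pres_eq (Gk_gens (Suc n)) (Gk_rels (Suc n)) ([] @ pos_word (map (gen n) js) @ []) ([] @ [])"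
    by (rule pres_eq.relator) (use assms pos_word_set in auto)
  then show ?thesis
    unfolding gel_def Gk_elem_def using pos_word_set[OF assms(2)]
    by (subst pres_class_eq_iff) (auto simp: pos_word_def)
qed

lemma gel_square: "j \<le> n+1 \<Longrightarrow> gel n [j, j] = gel n []"
  by (rule gel_relator) (use gen_in_gens in \<open>auto simp: Gk_rels_def\<close>)

lemma gel_ordering_square:
  assumes "distinct js" "set js = {..n+1}"
  shows "gel n (js @ js) = gel n []"
proof (rule gel_relator)
  have "distinct (map (gen n) js) \<and> set (map (gen n) js) = Gk_gens (Suc n)"
    unfolding Gk_gens_eq using assms inj_on_gen[of n] by (simp add: distinct_map)
  then show "pos_word (map (gen n) (js @ js)) \<in> Gk_rels (Suc n)"
    unfolding Gk_rels_def map_append by blast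
qed (use assms in auto)

lemma group_Gk: "group (Gk k)"
  unfolding Gk_def by (rule group_presented_group)

lemma gel_signed:
  assumes "set w \<subseteq> Gk_gens (Suc n) \<times> UNIV"
  shows "pres_class (Gk_gens (Suc n)) (Gk_rels (Suc n)) w = gel n (map (gidx n \<circ> fst) w)"
  using assms
proof (induction w)
  case Nil then show ?case by (simp add: gel_def Gk_elem_def pos_word_def)
next
  case (Cons y w)
  let ?S = "Gk_gens (Suc n)" and ?R = "Gk_rels (Suc n)"
  obtain m b where y: "y = (m, b)" by force
  have m: "m \<in> ?S" and w: "set w \<subseteq> ?S \<times> UNIV" using Cons.prems y by auto
  have 1: "pres_eq ?S ?R [(m, b)] [(m, True)]"
  proof (cases b)
    case False
    have "pres_eq ?S ?R ([] @ pos_word [m, m] @ [(m, False)]) ([] @ [(m, False)])"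
      by (rule pres_eq.relator) (use m in \<open>auto simp: Gk_rels_def pos_word_def\<close>)
    moreover have "pres_eq ?S ?R ([(m, True)] @ [(m, True), (m, \<not> True)] @ []) ([(m, True)] @ [])"
      by (rule pres_eq.cancel) (use m in auto)
    ultimately show ?thesis using False by (auto simp: pos_word_def intro: pres_eq.sym pres_eq.trans)
  qed (use m in \<open>auto intro: pres_eq.refl\<close>)
  have "pres_class ?S ?R (y # w) = pres_class ?S ?R [(m,b)] \<otimes>\<^bsub>Gk (Suc n)\<^esub> pres_class ?S ?R w"
    unfolding Gk_def using m w y by (subst presented_group_mult) auto
  also have "pres_class ?S ?R [(m,b)] = pres_class ?S ?R [(m,True)]"
    using 1 m by (subst pres_class_eq_iff) auto
  also have "\<dots> = gel n [gidx n m]" using gen_gidx[OF m] by (simp add: gel_def Gk_elem_def pos_word_def)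
  also have "pres_class ?S ?R w = gel n (map (gidx n \<circ> fst) w)" by (rule Cons.IH[OF w])
  also have "gel n [gidx n m] \<otimes>\<^bsub>Gk (Suc n)\<^esub> gel n (map (gidx n \<circ> fst) w) = gel n (map (gidx n \<circ> fst) (y # w))"
    using m w gidx_le y by (subst gel_append[symmetric]) fastforce+
  finally show ?case .
qed

lemma carrier_Gk: "carrier (Gk (Suc n)) = gel n ` {js. set js \<subseteq> {..n+1}}"
proof (intro equalityI subsetI)
  fix g assume "g \<in> carrier (Gk (Suc n))"
  then obtain w where w: "set w \<subseteq> Gk_gens (Suc n) \<times> UNIV" "g = pres_class (Gk_gens (Suc n)) (Gk_rels (Suc n)) w"
    by (auto simp: Gk_def presented_group_def)
  moreover have "set (map (gidx n \<circ> fst) w) \<subseteq> {..n+1}" using w gidx_le by fastforce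
  ultimately show "g \<in> gel n ` {js. set js \<subseteq> {..n+1}}" using gel_signed by blast
next
  fix g assume "g \<in> gel n ` {js. set js \<subseteq> {..n+1}}"
  then show "g \<in> carrier (Gk (Suc n))"
    using pos_word_set by (auto simp: Gk_def presented_group_def gel_def Gk_elem_def)
qed

lemma gel_closed: "set js \<subseteq> {..n+1} \<Longrightarrow> gel n js \<in> carrier (Gk (Suc n))"
  unfolding carrier_Gk by blast

text \<open>A device for maps out of the group: a function of plain words that ignores inserted
  relators depends on the group element only. Free cancellation turns into the insertion of a square
  once signs are dropped. It is applied to sign patterns (\<open>acts_gel_eq\<close>) and to path
  classes (\<open>Psi_gel\<close>).\<close>

lemma gel_eq_imp:
  assumes sq: "\<And>u v j. set u \<subseteq> {..n+1} \<Longrightarrow> set v \<subseteq> {..n+1} \<Longrightarrow> j \<le> n+1 \<Longrightarrow> f (u @ [j, j] @ v) = f (u @ v)"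
    and ord: "\<And>u v js. set u \<subseteq> {..n+1} \<Longrightarrow> set v \<subseteq> {..n+1} \<Longrightarrow> distinct js \<Longrightarrow> set js = {..n+1} \<Longrightarrow>
      f (u @ (js @ js) @ v) = f (u @ v)"
    and xs: "set xs \<subseteq> {..n+1}" and ys: "set ys \<subseteq> {..n+1}" and eq: "gel n xs = gel n ys"
  shows "f xs = f ys"
proof -
  let ?S = "Gk_gens (Suc n)" and ?R = "Gk_rels (Suc n)"
  let ?u = "map (gidx n \<circ> fst) :: (nat set \<times> bool) list \<Rightarrow> nat list"
  have u: "set (?u w) \<subseteq> {..n+1}" if "set w \<subseteq> ?S \<times> UNIV" for w using that gidx_le by fastforce
  have "f (?u w) = f (?u w')" if "pres_eq ?S ?R w w'" for w w'
    using that
  proof (induction rule: pres_eq.induct)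
    case (cancel x p q b)
    then show ?case using sq[OF u[of p] u[of q], of "gidx n x"] gidx_le by (simp add: o_def)
  next
    case (relator r p q)
    consider m where "m \<in> ?S" "r = pos_word [m, m]"
      | ms where "distinct ms" "set ms = ?S" "r = pos_word (ms @ ms)"
      using relator(1) unfolding Gk_rels_def by blast
    then show ?case
    proof cases
      case 1
      then show ?thesis using sq[OF u[of p] u[of q], of "gidx n m"] gidx_le relator by (simp add: pos_word_def o_def)
    next
      case 2
      have g: "gidx n ` ?S = {..n+1}" unfolding Gk_gens_eq image_image by simp
      have inj: "inj_on (gidx n) ?S" by (metis gen_gidx inj_onI)
      have "distinct (map (gidx n) ms)" "set (map (gidx n) ms) = {..n+1}"
        using 2 inj g by (auto simp: distinct_map)
      then show ?thesis
        using ord[OF u[of p] u[of q], of "map (gidx n) ms"] 2 relator by (simp add: pos_word_def o_def)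
    qed
  qed auto
  moreover have "pres_eq ?S ?R (pos_word (map (gen n) xs)) (pos_word (map (gen n) ys))"
    using eq pres_class_eq_iff[OF pos_word_set[OF xs]] by (simp add: gel_def Gk_elem_def)
  moreover have "?u (pos_word (map (gen n) zs)) = zs" if "set zs \<subseteq> {..n+1}" for zs
    using that by (induction zs) (auto simp: pos_word_def)
  ultimately show ?thesis using xs ys by metis
qed

text \<open>A crossing of wall \<open>j < n\<close> flips the \<open>j\<close>-th sign, a crossing of wall \<open>n\<close> or \<open>n + 1\<close> all signs.\<close>

definition flips :: "nat \<Rightarrow> nat list \<Rightarrow> nat \<Rightarrow> bool" where
  "flips n js i \<longleftrightarrow> odd (count_list js i + count_list js n + count_list js (Suc n))"

text \<open>Which signs a word flips does not depend on \<open>S\<close>: a word acts as symmetric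
  difference with a fixed subset. Therefore all subsets have the same stabiliser
  (\<open>acts_trivial_iff'\<close>).\<close>

definition acts :: "nat \<Rightarrow> nat list \<Rightarrow> nat set \<Rightarrow> nat set" where
  "acts n js S = {i. i < n \<and> (i \<in> S) \<noteq> flips n js i}"

lemma acts_append: "acts n (xs @ ys) S = acts n ys (acts n xs S)"
  by (auto simp: acts_def flips_def)

lemma acts_subset: "acts n js S \<subseteq> {..<n}"
  by (auto simp: acts_def)

lemma acts_Nil: "S \<subseteq> {..<n} \<Longrightarrow> acts n [] S = S"
  by (auto simp: acts_def flips_def)

lemma acts_single_less: "j < n \<Longrightarrow> i \<in> acts n [j] S \<longleftrightarrow> i < n \<and> (i \<in> S \<longleftrightarrow> i \<noteq> j)"
  by (auto simp: acts_def flips_def)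

lemma acts_single_ge: "j = n \<or> j = Suc n \<Longrightarrow> i \<in> acts n [j] S \<longleftrightarrow> i < n \<and> i \<notin> S"
  by (auto simp: acts_def flips_def)

text \<open>Crossing a wall always changes the chamber label, so the transition across a wall can be
  read off from the labels alone.\<close>

lemma acts_single_ne:
  assumes "n > 0" "j \<le> n+1" "S \<subseteq> {..<n}" shows "acts n [j] S \<noteq> S"
proof (cases "j < n")
  case True
  then have "(j \<in> acts n [j] S) \<noteq> (j \<in> S)" using assms by (auto simp: acts_single_less)
  then show ?thesis by blast
next
  case False
  then have "(0 \<in> acts n [j] S) \<noteq> (0 \<in> S)" using assms by (subst acts_single_ge) auto
  then show ?thesis by blast
qed

lemma acts_double: "acts n [j, j] S = acts n [] S"
  by (auto simp: acts_def flips_def)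

lemma acts_single_twice: "S \<subseteq> {..<n} \<Longrightarrow> acts n [j] (acts n [j] S) = S"
  using acts_append[of n "[j]" "[j]" S] acts_double[of n j S] acts_Nil[of S n] by simp

lemma acts_gel_eq:
  assumes "set xs \<subseteq> {..n+1}" "set ys \<subseteq> {..n+1}" "gel n xs = gel n ys"
  shows "acts n xs S = acts n ys S"
proof -
  have "flips n xs = flips n ys"
    by (rule gel_eq_imp[of n "flips n" xs ys, OF _ _ assms]) (auto simp: flips_def fun_eq_iff)
  then show ?thesis by (simp add: acts_def)
qed

lemma acts_trivial_iff: "acts n js {} = {} \<longleftrightarrow> (\<forall>i<n. \<not> flips n js i)"
  by (auto simp: acts_def)

lemma acts_trivial_iff': "S \<subseteq> {..<n} \<Longrightarrow> acts n js S = S \<longleftrightarrow> acts n js {} = {}"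
  unfolding acts_trivial_iff by (auto simp: acts_def)

lemma count_list_distinct: "distinct xs \<Longrightarrow> count_list xs i = (if i \<in> set xs then 1 else 0)"
  by (induction xs) auto

section \<open>The stabiliser and its index\<close>

definition sign_stab :: "nat \<Rightarrow> (nat set \<times> bool) list set set" where
  "sign_stab n = gel n ` {js. set js \<subseteq> {..n+1} \<and> acts n js {} = {}}"

lemma gel_in_sign_stab_iff:
  "set js \<subseteq> {..n+1} \<Longrightarrow> gel n js \<in> sign_stab n \<longleftrightarrow> acts n js {} = {}"
  unfolding sign_stab_def using acts_gel_eq[of js n] by blast

lemma gel_rev:
  assumes "set js \<subseteq> {..n+1}"
  shows "inv\<^bsub>Gk (Suc n)\<^esub> gel n js = gel n (rev js)"
proof -
  interpret group "Gk (Suc n)" by (rule group_Gk)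
  have *: "gel n (js @ rev js) = \<one>\<^bsub>Gk (Suc n)\<^esub>" if "set js \<subseteq> {..n+1}" for js
    using that
  proof (induction js)
    case (Cons j js)
    have "gel n ([j] @ (js @ rev js) @ [j]) = gel n [j] \<otimes>\<^bsub>Gk (Suc n)\<^esub> gel n (js @ rev js) \<otimes>\<^bsub>Gk (Suc n)\<^esub> gel n [j]"
      using Cons.prems gel_append[of "[j]" n "(js @ rev js) @ [j]"] gel_append[of "js @ rev js" n "[j]"]
      by (simp add: m_assoc gel_closed)
    also have "\<dots> = gel n [j, j]"
      using Cons gel_append[of "[j]" n "[j]"] by (simp add: gel_closed)
    also have "\<dots> = \<one>\<^bsub>Gk (Suc n)\<^esub>" using Cons.prems by (subst gel_square) (auto simp: gel_Nil)
    finally show ?case by simp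
  qed (simp add: gel_Nil)
  then show ?thesis
    using assms *[of "rev js"] gel_append[of "rev js" n js] by (intro inv_equality) (auto simp: gel_closed)
qed

lemma subgroup_sign_stab: "subgroup (sign_stab n) (Gk (Suc n))"
proof -
  interpret group "Gk (Suc n)" by (rule group_Gk)
  show ?thesis
  proof (rule subgroupI)
    show "sign_stab n \<subseteq> carrier (Gk (Suc n))" unfolding sign_stab_def carrier_Gk by blast
    have "gel n [] \<in> sign_stab n" by (subst gel_in_sign_stab_iff) (auto simp: acts_def flips_def)
    then show "sign_stab n \<noteq> {}" by blast
    fix a assume "a \<in> sign_stab n"
    then obtain xs where xs: "set xs \<subseteq> {..n+1}" "acts n xs {} = {}" "a = gel n xs" unfolding sign_stab_def by blast
    have "acts n (rev xs) {} = {}" using xs(2) unfolding acts_trivial_iff flips_def by simp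
    then show "inv\<^bsub>Gk (Suc n)\<^esub> a \<in> sign_stab n" using xs gel_rev gel_in_sign_stab_iff by simp
    fix b assume "b \<in> sign_stab n"
    then obtain ys where ys: "set ys \<subseteq> {..n+1}" "acts n ys {} = {}" "b = gel n ys" unfolding sign_stab_def by blast
    have "gel n (xs @ ys) \<in> sign_stab n" using xs ys by (subst gel_in_sign_stab_iff) (auto simp: acts_append)
    then show "a \<otimes>\<^bsub>Gk (Suc n)\<^esub> b \<in> sign_stab n" using gel_append xs ys by simp
  qed
qed

text \<open>A right coset consists of all elements that move the empty set to the same subset. The
  word listing the members of a subset moves the empty set to it, so the cosets correspond to all
  subsets of \<open>{..<n}\<close>.\<close>

lemma card_rcosets_sign_stab: "card (rcosets\<^bsub>Gk (Suc n)\<^esub> (sign_stab n)) = 2 ^ n"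
proof -
  interpret group "Gk (Suc n)" by (rule group_Gk)
  define C where "C S = gel n ` {ys. set ys \<subseteq> {..n+1} \<and> acts n ys {} = S}" for S
  have coset: "sign_stab n #>\<^bsub>Gk (Suc n)\<^esub> gel n xs = C (acts n xs {})" if xs: "set xs \<subseteq> {..n+1}" for xs
  proof (intro equalityI subsetI)
    fix g assume "g \<in> sign_stab n #>\<^bsub>Gk (Suc n)\<^esub> gel n xs"
    then obtain ys where ys: "set ys \<subseteq> {..n+1}" "acts n ys {} = {}" "g = gel n ys \<otimes>\<^bsub>Gk (Suc n)\<^esub> gel n xs"
      unfolding r_coset_def sign_stab_def by blast
    then have "g = gel n (ys @ xs)" "acts n (ys @ xs) {} = acts n xs {}" "set (ys @ xs) \<subseteq> {..n+1}"
      using gel_append xs by (auto simp: acts_append)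
    then show "g \<in> C (acts n xs {})" unfolding C_def by blast
  next
    fix g assume "g \<in> C (acts n xs {})"
    then obtain ys where ys: "set ys \<subseteq> {..n+1}" "acts n ys {} = acts n xs {}" "g = gel n ys" unfolding C_def by blast
    have "flips n ys i = flips n xs i" if "i < n" for i
      using ys(2) that unfolding acts_def by blast
    then have "acts n (ys @ rev xs) {} = {}"
      unfolding acts_trivial_iff by (simp add: flips_def) (metis even_add)
    then have "gel n (ys @ rev xs) \<in> sign_stab n" using xs ys by (subst gel_in_sign_stab_iff) auto
    moreover have "g = gel n (ys @ rev xs) \<otimes>\<^bsub>Gk (Suc n)\<^esub> gel n xs"
    proof -
      have "gel n (ys @ rev xs) = g \<otimes>\<^bsub>Gk (Suc n)\<^esub> inv\<^bsub>Gk (Suc n)\<^esub> gel n xs"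
        using xs ys gel_rev by (subst gel_append) auto
      then show ?thesis using xs ys by (simp add: m_assoc gel_closed)
    qed
    ultimately show "g \<in> sign_stab n #>\<^bsub>Gk (Suc n)\<^esub> gel n xs" unfolding r_coset_def by blast
  qed
  have surj: "\<exists>xs. set xs \<subseteq> {..n+1} \<and> acts n xs {} = S" if S: "S \<subseteq> {..<n}" for S
  proof -
    have f: "finite S" using S finite_subset by blast
    let ?xs = "sorted_list_of_set S"
    have "count_list ?xs i = (if i \<in> S then 1 else 0)" for i
      using f by (simp add: count_list_distinct)
    then have "acts n ?xs {} = S" using S by (auto simp: acts_def flips_def)
    then show ?thesis using f S by (intro exI[of _ ?xs]) auto
  qed
  have "rcosets\<^bsub>Gk (Suc n)\<^esub> (sign_stab n) = C ` Pow {..<n}"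
  proof (intro equalityI subsetI)
    fix K assume "K \<in> rcosets\<^bsub>Gk (Suc n)\<^esub> (sign_stab n)"
    then obtain xs where "set xs \<subseteq> {..n+1}" "K = sign_stab n #>\<^bsub>Gk (Suc n)\<^esub> gel n xs"
      unfolding RCOSETS_def carrier_Gk by blast
    then show "K \<in> C ` Pow {..<n}" using coset acts_subset by blast
  next
    fix K assume "K \<in> C ` Pow {..<n}"
    then obtain xs where "set xs \<subseteq> {..n+1}" "K = C (acts n xs {})" using surj by blast
    then show "K \<in> rcosets\<^bsub>Gk (Suc n)\<^esub> (sign_stab n)"
      unfolding RCOSETS_def carrier_Gk using coset by blast
  qed
  moreover have "inj_on C (Pow {..<n})"
  proof (rule inj_onI)
    fix S T assume ST: "S \<in> Pow {..<n}" "T \<in> Pow {..<n}" "C S = C T"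
    obtain xs where xs: "set xs \<subseteq> {..n+1}" "acts n xs {} = S" using surj ST by blast
    then have "gel n xs \<in> C T" using ST(3) unfolding C_def by blast
    then show "S = T" unfolding C_def using xs acts_gel_eq[of xs n _ "{}"] by blast
  qed
  ultimately show ?thesis by (simp add: card_image card_Pow)
qed

subsection \<open>Points in a common plane\<close>

lemma sum_fun_apply: "(\<Sum>i\<in>I. f i) l = (\<Sum>i\<in>I. f i l)" for f :: "'i \<Rightarrow> 'l \<Rightarrow> 'a::comm_monoid_add"
  by (induction I rule: infinite_finite_induct) auto

lemma hline_eq: "hline v = range (\<lambda>c i. c * v i)"
  by (simp add: hline_def funvec.span_singleton)

lemma mem_hline: "v \<in> hline v"
  unfolding hline_eq by (rule range_eqI[of _ _ 1]) simp

lemma hline_subset_iff: "funvec.subspace W \<Longrightarrow> hline v \<subseteq> W \<longleftrightarrow> v \<in> W"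
  using mem_hline unfolding hline_eq by (auto dest: funvec.subspace_scale)

definition evec :: "nat \<Rightarrow> nat \<Rightarrow> real" where "evec j = (\<lambda>i. if i = j then 1 else 0)"

lemma subspace_Euclidean_space: "funvec.subspace (topspace (Euclidean_space m))"
  by (auto simp: funvec.subspace_def topspace_Euclidean_space)

lemma span_evec: "topspace (Euclidean_space m) \<subseteq> funvec.span (evec ` {..<m})"
proof
  fix x assume x: "x \<in> topspace (Euclidean_space m)"
  have "x = (\<Sum>j<m. (\<lambda>i. x j * evec j i))"
  proof
    fix l
    have "(\<Sum>j<m. (\<lambda>i. x j * evec j i)) l = (\<Sum>j<m. if j = l then x j else 0)"
      unfolding sum_fun_apply by (rule sum.cong) (auto simp: evec_def)
    then show "x l = (\<Sum>j<m. (\<lambda>i. x j * evec j i)) l"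
      using x by (auto simp: topspace_Euclidean_space)
  qed
  moreover have "(\<Sum>j<m. (\<lambda>i. x j * evec j i)) \<in> funvec.span (evec ` {..<m})"
    by (intro funvec.span_sum funvec.span_scale funvec.span_base) auto
  ultimately show "x \<in> funvec.span (evec ` {..<m})" by simp
qed

lemma inj_evec: "inj evec"
  by (rule injI) (metis evec_def zero_neq_one)

lemma independent_evec: "funvec.independent (evec ` {..<m})"
proof
  assume "funvec.dependent (evec ` {..<m})"
  then obtain u v where uv: "v \<in> evec ` {..<m}" "u v \<noteq> 0" "(\<Sum>v\<in>evec ` {..<m}. (\<lambda>i. u v * v i)) = 0"
    by (auto simp: funvec.dependent_finite)
  obtain j where j: "j < m" "v = evec j" using uv by auto
  have "(\<Sum>v\<in>evec ` {..<m}. (\<lambda>i. u v * v i)) j = (\<Sum>l<m. u (evec l) * evec l j)"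
    by (subst sum.reindex) (auto simp: sum_fun_apply inj_on_subset[OF inj_evec])
  also have "\<dots> = (\<Sum>l<m. if l = j then u (evec l) else 0)" by (rule sum.cong) (auto simp: evec_def)
  also have "\<dots> = u v" using j by simp
  finally show False using uv by simp
qed

text \<open>A plane has dimension exactly \<open>d + 1\<close>, while dependent vectors may span
  less, so their span has to be enlarged; \<open>d < m\<close> leaves room for this. The relation is
  indexed by \<open>I\<close> and not by vectors, so that coinciding vectors count as
  dependent.\<close>

lemma in_common_plane_iff_relation:
  assumes I: "finite I" "card I = d + 2" "d < m" and v: "\<And>i. i \<in> I \<Longrightarrow> v i \<in> topspace (Euclidean_space (Suc m))"
  shows "in_common_plane m d ((\<lambda>i. hline (v i)) ` I) \<longleftrightarrow>
    (\<exists>c. (\<exists>i\<in>I. c i \<noteq> 0) \<and> (\<forall>l. (\<Sum>i\<in>I. c i * v i l) = 0))"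
proof
  assume "in_common_plane m d ((\<lambda>i. hline (v i)) ` I)"
  then obtain W where W: "funvec.subspace W" "funvec.dim W = d + 1" "\<And>i. i \<in> I \<Longrightarrow> v i \<in> W"
    unfolding in_common_plane_def proj_plane_def by (auto simp: hline_subset_iff)
  obtain B where B: "B \<subseteq> W" "funvec.independent B" "W \<subseteq> funvec.span B" "card B = d + 1"
    using funvec.basis_exists[of W] W(2) by metis
  then have fB: "finite B" by (metis add_is_0 card.infinite zero_neq_one)
  show "\<exists>c. (\<exists>i\<in>I. c i \<noteq> 0) \<and> (\<forall>l. (\<Sum>i\<in>I. c i * v i l) = 0)"
  proof (rule ccontr)
    assume no: "\<not> ?thesis"
    have inj: "inj_on v I"
    proof (rule inj_onI, rule ccontr)
      fix i j assume ij: "i \<in> I" "j \<in> I" "v i = v j" "i \<noteq> j"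
      \<comment> \<open>Equal vectors at two indices give the relation with coefficients 1 and
        -1.\<close>
      let ?c = "\<lambda>l. if l = i then 1 else if l = j then -1 else (0::real)"
      have "(\<Sum>l\<in>I. ?c l * v l p) = 0" for p
      proof -
        have "(\<Sum>l\<in>I. ?c l * v l p) = (\<Sum>l\<in>{i,j}. ?c l * v l p)"
          by (rule sum.mono_neutral_right) (use ij I in auto)
        then show ?thesis using ij by simp
      qed
      then have "(\<exists>l\<in>I. ?c l \<noteq> 0) \<and> (\<forall>p. (\<Sum>l\<in>I. ?c l * v l p) = 0)"
        by (intro conjI allI bexI[OF _ ij(1)]) simp_all
      then show False by (rule notE[OF no, OF exI])
    qed
    have "funvec.independent (v ` I)"
    proof
      assume "funvec.dependent (v ` I)"
      then obtain u i where u: "i \<in> I" "u (v i) \<noteq> 0" "(\<Sum>x\<in>v ` I. (\<lambda>l. u x * x l)) = 0"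
        using I by (auto simp: funvec.dependent_finite)
      have "(\<Sum>i\<in>I. u (v i) * v i l) = 0" for l
        using fun_cong[OF u(3), of l] by (simp add: sum.reindex[OF inj] sum_fun_apply)
      then have "(\<exists>i\<in>I. u (v i) \<noteq> 0) \<and> (\<forall>l. (\<Sum>i\<in>I. u (v i) * v i l) = 0)" using u(1,2) by blast
      then show False by (rule notE[OF no, OF exI[of _ "\<lambda>i. u (v i)"]])
    qed
    moreover have "v ` I \<subseteq> funvec.span B" using W B by blast
    ultimately have "card (v ` I) \<le> card B" using funvec.independent_span_bound[OF fB] by blast
    then show False using card_image[OF inj] I B by simp
  qed
next
  assume "\<exists>c. (\<exists>i\<in>I. c i \<noteq> 0) \<and> (\<forall>l. (\<Sum>i\<in>I. c i * v i l) = 0)"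
  then obtain c i0 where c: "i0 \<in> I" "c i0 \<noteq> 0" "\<And>l. (\<Sum>i\<in>I. c i * v i l) = 0" by blast
  let ?E = "topspace (Euclidean_space (Suc m))" and ?V = "v ` (I - {i0})"
  have "v i0 = (\<Sum>i\<in>I - {i0}. (\<lambda>l. (- c i / c i0) * v i l))"
  proof
    fix l
    have "c i0 * v i0 l + (\<Sum>i\<in>I - {i0}. c i * v i l) = 0" using c I by (simp add: sum.remove)
    then have "v i0 l = - (\<Sum>i\<in>I - {i0}. c i * v i l) / c i0" using c(2) by (simp add: field_simps)
    also have "\<dots> = (\<Sum>i\<in>I - {i0}. (- c i / c i0) * v i l)"
      by (simp add: sum_divide_distrib sum_negf)
    finally show "v i0 l = (\<Sum>i\<in>I - {i0}. (\<lambda>l. (- c i / c i0) * v i l)) l" by (simp add: sum_fun_apply)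
  qed
  moreover have "(\<Sum>i\<in>I - {i0}. (\<lambda>l. (- c i / c i0) * v i l)) \<in> funvec.span ?V"
    by (intro funvec.span_sum funvec.span_scale funvec.span_base) auto
  ultimately have vi0: "v i0 \<in> funvec.span ?V" by simp
  obtain B0 where B0: "B0 \<subseteq> ?V" "funvec.independent B0" "?V \<subseteq> funvec.span B0"
    using funvec.maximal_independent_subset by blast
  have "B0 \<subseteq> ?E" using B0(1) v by blast
  then obtain B where B: "B0 \<subseteq> B" "B \<subseteq> ?E" "funvec.independent B" "?E \<subseteq> funvec.span B"
    using funvec.maximal_independent_subset_extend[OF _ B0(2)] by blast
  have fB: "finite B" "card B \<le> Suc m"
  proof -
    have "finite B \<and> card B \<le> card (evec ` {..<Suc m})"
      by (rule funvec.independent_span_bound) (use B span_evec[of "Suc m"] in \<open>blast+\<close>)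
    then show "finite B" "card B \<le> Suc m" by (auto simp: card_image inj_on_subset[OF inj_evec])
  qed
  have "card (evec ` {..<Suc m}) \<le> card B"
  proof -
    have "evec ` {..<Suc m} \<subseteq> ?E" by (auto simp: topspace_Euclidean_space evec_def)
    then show ?thesis using funvec.independent_span_bound[OF fB(1) independent_evec] B by blast
  qed
  then have cB: "card B = Suc m" using fB by (simp add: card_image inj_on_subset[OF inj_evec])
  have "card B0 \<le> d + 1"
  proof -
    have "card B0 \<le> card ?V" using B0 I by (intro card_mono) auto
    also have "\<dots> \<le> card (I - {i0})" using I by (intro card_image_le) auto
    finally show ?thesis using I c by simp
  qed
  \<comment> \<open>A basis of the span has at most \<open>d + 1\<close> elements, since
    \<open>v i0\<close> lies in the span of the others; it is enlarged within a basis of the whole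
    space to exactly that many.\<close>
  then obtain C where C: "B0 \<subseteq> C" "C \<subseteq> B" "card C = d + 1"
    using exists_subset_between[of B0 "d + 1" B] B fB(1) cB I(3) by auto
  have indC: "funvec.independent C" using funvec.independent_mono B C by blast
  have "proj_plane m d (funvec.span C)"
    unfolding proj_plane_def
  proof (intro conjI)
    show "funvec.span C \<subseteq> ?E"
      using funvec.span_minimal[OF _ subspace_Euclidean_space] C B by (meson subset_trans)
    show "funvec.dim (funvec.span C) = d + 1" using indC C by (simp add: funvec.dim_span funvec.dim_eq_card_independent)
  qed auto
  moreover have "v i \<in> funvec.span C" if "i \<in> I" for i
  proof -
    have s: "funvec.span B0 \<subseteq> funvec.span C" using C(1) funvec.span_mono by blast
    have "funvec.span ?V \<subseteq> funvec.span C"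
      using funvec.span_minimal[OF _ funvec.subspace_span] B0(3) s by (meson subset_trans)
    then show ?thesis using vi0 that funvec.span_base[of "v i" ?V] by blast
  qed
  ultimately show "in_common_plane m d ((\<lambda>i. hline (v i)) ` I)"
    unfolding in_common_plane_def by (intro exI[of _ "funvec.span C"]) (auto simp: hline_subset_iff)
qed

subsection \<open>Coordinates on the reduced configuration space\<close>

definition supported :: "nat \<Rightarrow> (nat \<Rightarrow> real) \<Rightarrow> bool" where
  "supported n a \<longleftrightarrow> (\<forall>i>n. a i = 0)"

definition cfg :: "nat \<Rightarrow> (nat \<Rightarrow> real) \<Rightarrow> (nat \<Rightarrow> real) \<Rightarrow> nat \<Rightarrow> (nat \<Rightarrow> real) set" where
  "cfg n a b = (\<lambda>i\<in>{1..n+2}. if i \<le> n then ypt i else if i = Suc n then hline a else hline b)"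

text \<open>General position in coordinates, by the two omitted points: a fixed point and
  \<open>b\<close>, a fixed point and \<open>a\<close>, or two fixed points. In the last case rows
  \<open>i\<close>, \<open>j\<close>, \<open>n\<close> of the columns \<open>a\<close>,
  \<open>b\<close> must have rank two. Omitting both \<open>a\<close> and \<open>b\<close> leaves
  independent points and hence gives no clause.\<close>

definition good :: "nat \<Rightarrow> (nat \<Rightarrow> real) \<Rightarrow> (nat \<Rightarrow> real) \<Rightarrow> bool" where
  "good n a b \<longleftrightarrow> (\<forall>j<n. a j \<noteq> 0 \<or> a n \<noteq> 0) \<and> (\<forall>j<n. b j \<noteq> 0 \<or> b n \<noteq> 0) \<and>
    (\<forall>i<n. \<forall>j<n. i \<noteq> j \<longrightarrow> a i * b n \<noteq> a n * b i \<or> a j * b n \<noteq> a n * b j \<or> a i * b j \<noteq> a j * b i)"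

text \<open>The maximal minors of the matrix of all \<open>k + 1\<close> points, up to sign.\<close>

definition minor :: "nat \<Rightarrow> nat \<Rightarrow> (nat \<Rightarrow> real) \<Rightarrow> (nat \<Rightarrow> real) \<Rightarrow> real" where
  "minor n j a b = (if j < n then a j * b n - a n * b j else if j = n then b n else a n)"

definition cvec :: "nat \<Rightarrow> (nat \<Rightarrow> real) \<Rightarrow> (nat \<Rightarrow> real) \<Rightarrow> nat \<Rightarrow> nat \<Rightarrow> real" where
  "cvec n a b i = (if i \<le> n then evec (i - 1) else if i = Suc n then a else b)"

lemma ypt_eq: "i \<ge> 1 \<Longrightarrow> ypt i = hline (evec (i - 1))"
  unfolding ypt_def evec_def by (rule arg_cong[of _ _ hline], rule ext) auto

lemma cfg_apply: "i \<in> {1..n+2} \<Longrightarrow> cfg n a b i = hline (cvec n a b i)"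
  by (auto simp: cfg_def cvec_def ypt_eq)

text \<open>The coefficient of a unit vector is determined by its own coordinate. So a relation
  amounts to coefficients \<open>s\<close>, \<open>t\<close> of \<open>a\<close> and
  \<open>b\<close> that kill every coordinate without a unit vector in the family. Coordinate
  \<open>n\<close> is always among these, as the fixed points only use coordinates below
  \<open>n\<close>.\<close>

lemma cvec_relation_iff:
  assumes "J \<subseteq> {1..n+2}"
  shows "(\<exists>c. (\<exists>i\<in>J. c i \<noteq> 0) \<and> (\<forall>l. (\<Sum>i\<in>J. c i * cvec n a b i l) = 0)) \<longleftrightarrow>
    (\<exists>s t. (s \<noteq> 0 \<or> t \<noteq> 0) \<and> (Suc n \<notin> J \<longrightarrow> s = 0) \<and> (n + 2 \<notin> J \<longrightarrow> t = 0) \<and>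
      (\<forall>l. l \<ge> n \<or> Suc l \<notin> J \<longrightarrow> s * a l + t * b l = 0))" (is "?L \<longleftrightarrow> ?R")
proof -
  have fJ: "finite J" using assms finite_subset by blast
  have e: "(\<Sum>i\<in>J. c i * cvec n a b i l) = (if l < n \<and> Suc l \<in> J then c (Suc l) else 0) +
      (if Suc n \<in> J then c (Suc n) else 0) * a l + (if n + 2 \<in> J then c (n + 2) else 0) * b l" for c l
  proof -
    have "(\<Sum>i\<in>J. c i * cvec n a b i l) =
      (\<Sum>i\<in>J. (if i = Suc l then if l < n then c i else 0 else 0) +
        ((if i = Suc n then c i * a l else 0) + (if i = n + 2 then c i * b l else 0)))"
      using assms by (intro sum.cong) (auto simp: cvec_def evec_def)
    then show ?thesis using fJ by (simp add: sum.distrib)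
  qed
  show ?thesis
  proof
    assume ?L
    then obtain c i where c: "i \<in> J" "c i \<noteq> 0" "\<And>l. (\<Sum>i\<in>J. c i * cvec n a b i l) = 0" by blast
    let ?s = "if Suc n \<in> J then c (Suc n) else 0" and ?t = "if n + 2 \<in> J then c (n + 2) else 0"
    have z: "(if l < n \<and> Suc l \<in> J then c (Suc l) else 0) + ?s * a l + ?t * b l = 0" for l
      using c(3)[of l] unfolding e by simp
    have "?s \<noteq> 0 \<or> ?t \<noteq> 0"
    proof (rule ccontr)
      assume *: "\<not> (?s \<noteq> 0 \<or> ?t \<noteq> 0)"
      have "i \<noteq> Suc n" "i \<noteq> n + 2" using * c(1,2) by auto
      moreover have "i \<in> {1..n+2}" using assms c(1) by blast
      ultimately have "i - 1 < n" "Suc (i - 1) = i" by auto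
      then show False using z[of "i - 1"] * c(1,2) by simp
    qed
    moreover have "?s * a l + ?t * b l = 0" if "l \<ge> n \<or> Suc l \<notin> J" for l
    proof -
      have "\<not> (l < n \<and> Suc l \<in> J)" using that by auto
      then show ?thesis using z[of l] by (simp only: if_False)
    qed
    ultimately show ?R by (intro exI[of _ ?s] exI[of _ ?t]) auto
  next
    assume ?R
    then obtain s t where st: "s \<noteq> 0 \<or> t \<noteq> 0" "Suc n \<notin> J \<longrightarrow> s = 0" "n + 2 \<notin> J \<longrightarrow> t = 0"
      "\<And>l. l \<ge> n \<or> Suc l \<notin> J \<Longrightarrow> s * a l + t * b l = 0" by blast
    let ?c = "\<lambda>i. if i = Suc n then s else if i = n + 2 then t else - (s * a (i - 1) + t * b (i - 1))"
    have "(\<Sum>i\<in>J. ?c i * cvec n a b i l) = 0" for l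
      unfolding e using st by (cases "l < n \<and> Suc l \<in> J") (auto simp: not_less)
    moreover have "\<exists>i\<in>J. ?c i \<noteq> 0"
    proof (cases "s = 0")
      case True
      then show ?thesis using st(1,3) by (intro bexI[of _ "n + 2"]) auto
    next
      case False
      then show ?thesis using st(2) by (intro bexI[of _ "Suc n"]) auto
    qed
    ultimately have "(\<exists>i\<in>J. ?c i \<noteq> 0) \<and> (\<forall>l. (\<Sum>i\<in>J. ?c i * cvec n a b i l) = 0)" by blast
    then show ?L by (rule exI[of _ ?c])
  qed
qed

lemma cvec_in: "supported n a \<Longrightarrow> supported n b \<Longrightarrow> i \<in> {1..n+2} \<Longrightarrow> cvec n a b i \<in> topspace (Euclidean_space (Suc n))"
  by (auto simp: supported_def cvec_def evec_def topspace_Euclidean_space)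

lemma in_common_plane_cfg:
  assumes ab: "supported n a" "supported n b" and J: "J \<subseteq> {1..n+2}" "card J = d + 2" "d < n"
  shows "in_common_plane n d (cfg n a b ` J) \<longleftrightarrow>
    (\<exists>s t. (s \<noteq> 0 \<or> t \<noteq> 0) \<and> (Suc n \<notin> J \<longrightarrow> s = 0) \<and> (n + 2 \<notin> J \<longrightarrow> t = 0) \<and>
      (\<forall>l. l = n \<or> l < n \<and> Suc l \<notin> J \<longrightarrow> s * a l + t * b l = 0))"
proof -
  have "cfg n a b ` J = (\<lambda>i. hline (cvec n a b i)) ` J" using J by (intro image_cong) (auto simp: cfg_apply)
  moreover have "finite J" using J finite_subset by blast
  moreover have "cvec n a b i \<in> topspace (Euclidean_space (Suc n))" if "i \<in> J" for i
    using cvec_in[OF ab] that J(1) by blast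
  ultimately have "in_common_plane n d (cfg n a b ` J) \<longleftrightarrow>
    (\<exists>c. (\<exists>i\<in>J. c i \<noteq> 0) \<and> (\<forall>l. (\<Sum>i\<in>J. c i * cvec n a b i l) = 0))"
    using in_common_plane_iff_relation[of J d n "cvec n a b"] J(2,3) by presburger
  moreover have "(\<forall>l. l \<ge> n \<or> Suc l \<notin> J \<longrightarrow> s * a l + t * b l = 0) \<longleftrightarrow>
      (\<forall>l. l = n \<or> l < n \<and> Suc l \<notin> J \<longrightarrow> s * a l + t * b l = 0)" for s t
    using ab unfolding supported_def by (metis add_0 linorder_neqE_nat mult_zero_right order_le_less nat_less_le linorder_not_less)
  ultimately show ?thesis unfolding cvec_relation_iff[OF J(1)] by presburger
qed

text \<open>Omitting a fixed point leaves rows \<open>j\<close> and \<open>n\<close> and their 2 by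
  2 determinant; omitting a moving point leaves row \<open>n\<close> of the other one. Hence minor
  \<open>n\<close> is an entry of \<open>b\<close>, because its subset omits \<open>a\<close>, and
  minor \<open>n + 1\<close> is an entry of \<open>a\<close>.\<close>

lemma flat_subsets_cfg:
  assumes n: "n \<ge> 1" and ab: "supported n a" "supported n b"
  shows "flat_subsets (Suc n) (cfg n a b) = gen n ` {j. j \<le> n + 1 \<and> minor n j a b = 0}"
proof -
  have "in_common_plane n (n - 1) (cfg n a b ` gen n j) \<longleftrightarrow> minor n j a b = 0" if j: "j \<le> n + 1" for j
  proof -
    have J: "gen n j \<subseteq> {1..n+2}" "card (gen n j) = n - 1 + 2"
      using gen_in_gens[OF j] n by (auto simp: Gk_gens_def)
    have "in_common_plane n (n - 1) (cfg n a b ` gen n j) \<longleftrightarrow>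
     (\<exists>s t. (s \<noteq> 0 \<or> t \<noteq> 0) \<and> (Suc n \<notin> gen n j \<longrightarrow> s = 0) \<and> (n + 2 \<notin> gen n j \<longrightarrow> t = 0) \<and>
      (\<forall>l. l = n \<or> l < n \<and> Suc l \<notin> gen n j \<longrightarrow> s * a l + t * b l = 0))"
      by (rule in_common_plane_cfg[OF ab J]) (use n in simp)
    also have "\<dots> \<longleftrightarrow> (\<exists>s t. (s \<noteq> 0 \<or> t \<noteq> 0) \<and> (j = n \<longrightarrow> s = 0) \<and> (j = n + 1 \<longrightarrow> t = 0) \<and>
      s * a n + t * b n = 0 \<and> (j < n \<longrightarrow> s * a j + t * b j = 0))"
      by (intro ex_cong1 conj_cong refl) (auto simp: gen_def)
    also have "\<dots> \<longleftrightarrow> minor n j a b = 0"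
    proof (cases "j < n")
      case True
      show ?thesis
      proof
        assume "\<exists>s t. (s \<noteq> 0 \<or> t \<noteq> 0) \<and> (j = n \<longrightarrow> s = 0) \<and> (j = n + 1 \<longrightarrow> t = 0) \<and>
          s * a n + t * b n = 0 \<and> (j < n \<longrightarrow> s * a j + t * b j = 0)"
        then obtain s t where st: "s \<noteq> 0 \<or> t \<noteq> 0" "s * a n + t * b n = 0" "s * a j + t * b j = 0" using True by blast
        have "s * (a j * b n - a n * b j) = (s * a j + t * b j) * b n - (s * a n + t * b n) * b j"
          "t * (a j * b n - a n * b j) = (s * a n + t * b n) * a j - (s * a j + t * b j) * a n" by algebra+
        then show "minor n j a b = 0" using st True by (auto simp: minor_def)
      next
        assume "minor n j a b = 0"
        then have z: "a j * b n = a n * b j" using True by (simp add: minor_def)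
        show "\<exists>s t. (s \<noteq> 0 \<or> t \<noteq> 0) \<and> (j = n \<longrightarrow> s = 0) \<and> (j = n + 1 \<longrightarrow> t = 0) \<and>
          s * a n + t * b n = 0 \<and> (j < n \<longrightarrow> s * a j + t * b j = 0)"
        proof (cases "a n = 0 \<and> b n = 0")
          case F: True
          \<comment> \<open>With row \<open>n\<close> equal to zero, any nonzero vector orthogonal
            to row \<open>j\<close> serves; (1, 1) is taken if that row vanishes too.\<close>
          then show ?thesis using True
            by (intro exI[of _ "if a j = 0 \<and> b j = 0 then 1 else b j"] exI[of _ "if a j = 0 \<and> b j = 0 then 1 else - a j"]) auto
        next
          case False
          then show ?thesis using True z by (intro exI[of _ "b n"] exI[of _ "- a n"]) (auto simp: algebra_simps)
        qed
      qed
    next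
      case False
      then have "j = n \<or> j = n + 1" using j by auto
      then show ?thesis
      proof
        assume "j = n"
        moreover have "(\<exists>t. t \<noteq> 0 \<and> t * b n = 0) \<longleftrightarrow> b n = 0" by (metis mult_eq_0_iff zero_neq_one)
        ultimately show ?thesis by (auto simp: minor_def)
      next
        assume "j = n + 1"
        moreover have "(\<exists>t. t \<noteq> 0 \<and> t * a n = 0) \<longleftrightarrow> a n = 0" by (metis mult_eq_0_iff zero_neq_one)
        ultimately show ?thesis by (auto simp: minor_def)
      qed
    qed
    finally show ?thesis .
  qed
  moreover have "flat_subsets (Suc n) (cfg n a b) = {m \<in> Gk_gens (Suc n). in_common_plane n (n - 1) (cfg n a b ` m)}"
    by (auto simp: flat_subsets_def Gk_gens_def)
  ultimately show ?thesis unfolding Gk_gens_eq by auto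
qed

lemma good_iff:
  assumes n: "n \<ge> 2" and ab: "supported n a" "supported n b"
  shows "good n a b \<longleftrightarrow>
    (\<forall>J. J \<subseteq> {1..n+2} \<and> card J = n \<longrightarrow> \<not> in_common_plane n (n - 2) (cfg n a b ` J))"
proof -
  let ?P = "\<lambda>J. \<exists>s t. (s \<noteq> 0 \<or> t \<noteq> 0) \<and> (Suc n \<notin> J \<longrightarrow> s = 0) \<and> (n + 2 \<notin> J \<longrightarrow> t = 0) \<and>
      (\<forall>l. l = n \<or> l < n \<and> Suc l \<notin> J \<longrightarrow> s * a l + t * b l = 0)"
  have P: "in_common_plane n (n - 2) (cfg n a b ` J) \<longleftrightarrow> ?P J" if "J \<subseteq> {1..n+2}" "card J = n" for J
    by (rule in_common_plane_cfg[OF ab that(1)]) (use that n in auto)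
  have c2: "card ({1..n+2} - {p, q}) = n" if "p \<noteq> q" "p \<in> {1..n+2}" "q \<in> {1..n+2}" for p q
    using that by (simp add: card_Diff_subset)
  show ?thesis
  proof
    assume g: "good n a b"
    have "\<not> ?P J" if J: "J \<subseteq> {1..n+2}" "card J = n" for J
    proof
      assume "?P J"
      then obtain s t where st: "s \<noteq> 0 \<or> t \<noteq> 0" "Suc n \<notin> J \<longrightarrow> s = 0" "n + 2 \<notin> J \<longrightarrow> t = 0"
        "\<And>l. l = n \<or> l < n \<and> Suc l \<notin> J \<Longrightarrow> s * a l + t * b l = 0" by blast
      have "card ({1..n+2} - J) = 2" using J by (simp add: card_Diff_subset finite_subset[OF J(1)])
      then obtain p q where pq: "{1..n+2} - J = {p, q}" "p \<noteq> q" using card_2_iff by metis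
      then have pq': "p \<in> {1..n+2}" "q \<in> {1..n+2}" "p \<notin> J" "q \<notin> J" by blast+
      have J': "l \<in> J" if "l \<in> {1..n+2}" "l \<noteq> p" "l \<noteq> q" for l using that pq by blast
      have zn: "s * a n + t * b n = 0" using st(4) by blast
      have one: False if "t = 0" "r \<in> {p, q}" "r \<le> n" for r
      proof -
        have r: "r - 1 < n" "Suc (r - 1) \<notin> J" using that pq' by auto
        have "s * a (r - 1) = 0" "s * a n = 0" using st(4)[of "r - 1"] r zn that(1) by auto
        then show False using g r(1) st(1) that(1) unfolding good_def by auto
      qed
      have two: False if "s = 0" "r \<in> {p, q}" "r \<le> n" for r
      proof -
        have r: "r - 1 < n" "Suc (r - 1) \<notin> J" using that pq' by auto
        have "t * b (r - 1) = 0" "t * b n = 0" using st(4)[of "r - 1"] r zn that(1) by auto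
        then show False using g r(1) st(1) that(1) unfolding good_def by auto
      qed
      show False
      proof (cases "p \<le> n \<and> q \<le> n")
        case True
        define i j where "i = p - 1" and "j = q - 1"
        have ij: "i < n" "j < n" "i \<noteq> j" using True pq pq' by (auto simp: i_def j_def)
        have z: "s * a i + t * b i = 0" "s * a j + t * b j = 0"
          using st(4)[of i] st(4)[of j] ij pq' by (auto simp: i_def j_def)
        have m: "a x * b y = a y * b x" if "s * a x + t * b x = 0" "s * a y + t * b y = 0" for x y
        proof -
          have "s * (a x * b y - a y * b x) = (s * a x + t * b x) * b y - (s * a y + t * b y) * b x"
            "t * (a x * b y - a y * b x) = (s * a y + t * b y) * a x - (s * a x + t * b x) * a y" by algebra+
          then show ?thesis using that st(1) by auto
        qed
        show False using g ij m z zn unfolding good_def by blast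
      next
        \<comment> \<open>A moving point is omitted, so its coefficient is zero. If a fixed point is
          omitted as well, \<open>one\<close> or \<open>two\<close> applies; otherwise both
          coefficients are zero.\<close>
        case False
        then show False using one two st pq pq' J'
          by (metis (no_types, opaque_lifting) Suc_1 Suc_eq_plus1 add_Suc_right atLeastAtMost_iff insertCI le_SucE not_less_eq_eq)
      qed
    qed
    with P show "\<forall>J. J \<subseteq> {1..n+2} \<and> card J = n \<longrightarrow> \<not> in_common_plane n (n - 2) (cfg n a b ` J)"
      by (metis (no_types, lifting))
  next
    assume "\<forall>J. J \<subseteq> {1..n+2} \<and> card J = n \<longrightarrow> \<not> in_common_plane n (n - 2) (cfg n a b ` J)"
    then have nP: "\<not> ?P ({1..n+2} - {p, q})" if "p \<noteq> q" "p \<in> {1..n+2}" "q \<in> {1..n+2}" for p q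
      using P[of "{1..n+2} - {p, q}"] c2[OF that] by blast
    show "good n a b"
      unfolding good_def
    proof (intro conjI allI impI)
      fix j assume j: "j < n"
      show "a j \<noteq> 0 \<or> a n \<noteq> 0"
      proof (rule ccontr)
        assume "\<not> ?thesis"
        then have "a j = 0" "a n = 0" by auto
        then have "?P ({1..n+2} - {Suc j, n + 2})"
          using j by (intro exI[of _ 1] exI[of _ 0]) auto
        then show False using nP[of "Suc j" "n+2"] j by auto
      qed
      show "b j \<noteq> 0 \<or> b n \<noteq> 0"
      proof (rule ccontr)
        assume "\<not> ?thesis"
        then have "b j = 0" "b n = 0" by auto
        then have "?P ({1..n+2} - {Suc j, Suc n})"
          using j by (intro exI[of _ 0] exI[of _ 1]) auto
        then show False using nP[of "Suc j" "Suc n"] j by auto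
      qed
    next
      fix i j assume ij: "i < n" "j < n" "i \<noteq> j"
      show "a i * b n \<noteq> a n * b i \<or> a j * b n \<noteq> a n * b j \<or> a i * b j \<noteq> a j * b i"
      proof (rule ccontr)
        assume "\<not> ?thesis"
        then have z: "a i * b n = a n * b i" "a j * b n = a n * b j" "a i * b j = a j * b i" by auto
        obtain s t where st: "s \<noteq> 0 \<or> t \<noteq> 0" "s * a n + t * b n = 0" "s * a i + t * b i = 0" "s * a j + t * b j = 0"
        proof -
          \<comment> \<open>Any nonzero one of the three rows provides the relation, since the other
            two are proportional to it.\<close>
          consider x where "x \<in> {n, i, j}" "a x \<noteq> 0 \<or> b x \<noteq> 0" | "\<And>x. x \<in> {n, i, j} \<Longrightarrow> a x = 0 \<and> b x = 0" by blast
          then show thesis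
          proof cases
            case (1 x)
            have "b x * a y + - a x * b y = 0" if "y \<in> {n, i, j}" for y
              using z 1(1) that by (auto simp: algebra_simps)
            then show thesis using that[of "b x" "- a x"] 1 by auto
          qed (use that[of 1 1] in auto)
        qed
        have "?P ({1..n+2} - {Suc i, Suc j})"
          by (intro exI[of _ s] exI[of _ t]) (use st ij in auto)
        then show False using nP[of "Suc i" "Suc j"] ij by auto
      qed
    qed
  qed
qed

lemma good_nonzero:
  assumes "n \<ge> 1" "good n a b" shows "a \<noteq> 0" "b \<noteq> 0"
  using assms by (auto simp: good_def Suc_le_eq)

text \<open>Two equal points are contained in some set of \<open>n\<close> points, as
  \<open>n \<ge> 2\<close>, and would make it dependent.\<close>

lemma good_inj_on:
  assumes n: "n \<ge> 2" and ab: "supported n a" "supported n b" and g: "good n a b"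
  shows "inj_on (cfg n a b) {1..n+2}"
proof (rule inj_onI, rule ccontr)
  fix p q assume pq: "p \<in> {1..n+2}" "q \<in> {1..n+2}" "cfg n a b p = cfg n a b q" "p \<noteq> q"
  obtain J where J: "{p, q} \<subseteq> J" "J \<subseteq> {1..n+2}" "card J = n"
    using exists_subset_between[of "{p, q}" n "{1..n+2}"] pq n by auto
  have fJ: "finite J" using J finite_subset by blast
  have "cvec n a b p \<in> hline (cvec n a b q)" using pq mem_hline by (metis cfg_apply)
  then obtain r where r: "cvec n a b p = (\<lambda>i. r * cvec n a b q i)" unfolding hline_eq by blast
  let ?c = "\<lambda>l. if l = p then 1 else if l = q then - r else (0::real)"
  have "(\<Sum>i\<in>J. ?c i * cvec n a b i l) = 0" for l
  proof -
    have "(\<Sum>i\<in>J. ?c i * cvec n a b i l) = (\<Sum>i\<in>{p,q}. ?c i * cvec n a b i l)"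
      by (rule sum.mono_neutral_right) (use J fJ in auto)
    then show ?thesis using pq r by simp
  qed
  moreover have "p \<in> J" "?c p \<noteq> 0" using J by auto
  ultimately have "(\<exists>i\<in>J. ?c i \<noteq> 0) \<and> (\<forall>l. (\<Sum>i\<in>J. ?c i * cvec n a b i l) = 0)"
    by (intro conjI allI bexI[of _ p])
  then have "\<exists>c. (\<exists>i\<in>J. c i \<noteq> 0) \<and> (\<forall>l. (\<Sum>i\<in>J. c i * cvec n a b i l) = 0)" by (rule exI[of _ ?c])
  moreover have "cfg n a b ` J = (\<lambda>i. hline (cvec n a b i)) ` J" using J by (intro image_cong) (auto simp: cfg_apply)
  moreover have "card J = n - 2 + 2" "n - 2 < n" using J n by auto
  moreover have "cvec n a b i \<in> topspace (Euclidean_space (Suc n))" if "i \<in> J" for i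
    using cvec_in[OF ab] that J(2) by blast
  ultimately have "in_common_plane n (n - 2) (cfg n a b ` J)"
    using in_common_plane_iff_relation[of J "n - 2" n "cvec n a b"] fJ by presburger
  then show False using good_iff[OF n ab] g J by blast
qed

lemma nonzero_vectors_iff: "a \<in> nonzero_vectors n \<longleftrightarrow> supported n a \<and> a \<noteq> 0"
  by (auto simp: nonzero_vectors_def topspace_Euclidean_space supported_def Suc_le_eq)

lemma topspace_RP: "topspace (RP n) = hline ` nonzero_vectors n"
  unfolding RP_def topspace_quotient_topology by (auto simp: nonzero_vectors_def)

definition RC :: "nat \<Rightarrow> (nat \<Rightarrow> (nat \<Rightarrow> real) set) topology" where
  "RC n = reduced_config_space (Suc n)"

lemma topspace_RC_cfg:
  assumes n: "n \<ge> 2" and ab: "supported n a" "supported n b" "a \<noteq> 0" "b \<noteq> 0"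
  shows "cfg n a b \<in> topspace (RC n) \<longleftrightarrow> good n a b"
proof -
  have e: "evec i \<in> nonzero_vectors n" if "i < n" for i
    using that by (auto simp: nonzero_vectors_iff supported_def evec_def fun_eq_iff)
  have "cfg n a b \<in> (\<Pi>\<^sub>E i\<in>{1..Suc n + 1}. topspace (RP n))"
    unfolding topspace_RP using ab e by (auto simp: cfg_def ypt_eq nonzero_vectors_iff)
  moreover have "cfg n a b i = ypt i" if "i \<in> {1..n}" for i using that by (simp add: cfg_def)
  ultimately show ?thesis
    unfolding RC_def reduced_config_space_def config_space_def
    using good_iff[OF n ab(1,2)] good_inj_on[OF n ab(1,2)] by (auto simp: PiE_def)
qed

lemma RC_cases:
  assumes n: "n \<ge> 2" and x: "x \<in> topspace (RC n)"
  obtains a b where "supported n a" "supported n b" "good n a b" "x = cfg n a b"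
proof -
  have x': "x \<in> (\<Pi>\<^sub>E i\<in>{1..Suc n + 1}. topspace (RP n))" "\<forall>i\<in>{1..n}. x i = ypt i"
    using x unfolding RC_def reduced_config_space_def config_space_def by auto
  have "x (Suc n) \<in> topspace (RP n)" "x (n + 2) \<in> topspace (RP n)" using x'(1) by auto
  then obtain a b where ab: "a \<in> nonzero_vectors n" "b \<in> nonzero_vectors n" "x (Suc n) = hline a" "x (n + 2) = hline b"
    unfolding topspace_RP by blast
  have e: "x = cfg n a b"
  proof
    fix i show "x i = cfg n a b i"
    proof (cases "i \<in> {1..n+2}")
      case True
      then consider "i \<in> {1..n}" | "i = Suc n" | "i = n + 2" by fastforce
      then show ?thesis by cases (use x'(2) ab in \<open>auto simp: cfg_def\<close>)
    next
      case False
      then show ?thesis using x'(1) by (auto simp: cfg_def PiE_def extensional_def)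
    qed
  qed
  show thesis
    by (rule that[OF _ _ _ e]) (use ab x topspace_RC_cfg[OF n] e in \<open>auto simp: nonzero_vectors_iff\<close>)
qed

lemma cfg_in_RC: "n \<ge> 2 \<Longrightarrow> supported n a \<Longrightarrow> supported n b \<Longrightarrow> good n a b \<Longrightarrow> cfg n a b \<in> topspace (RC n)"
  using topspace_RC_cfg good_nonzero by (metis one_le_numeral order_trans)

lemma hline_scale:
  assumes "c \<noteq> 0" shows "hline (\<lambda>i. c * a i) = hline a"
proof -
  have 1: "(\<lambda>i. d * a i) = (\<lambda>i. (d / c) * (c * a i))" for d by (rule ext) (simp add: assms)
  have 2: "(\<lambda>i. d * (c * a i)) = (\<lambda>i. (d * c) * a i)" for d by (rule ext) (rule mult.assoc[symmetric])
  show ?thesis unfolding hline_eq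
  proof (intro equalityI subsetI; elim rangeE)
    fix x d assume "x = (\<lambda>i. d * (c * a i))"
    then show "x \<in> range (\<lambda>d i. d * a i)" unfolding 2 by (rule range_eqI)
  next
    fix x d assume "x = (\<lambda>i. d * a i)"
    then show "x \<in> range (\<lambda>d i. d * (c * a i))" unfolding 1[of d] by (rule range_eqI)
  qed
qed

lemma hline_eq_imp:
  assumes "hline a = hline a'" "a \<noteq> 0"
  obtains c where "c \<noteq> 0" "a = (\<lambda>i. c * a' i)"
proof -
  have "a \<in> hline a'" using mem_hline assms by metis
  then obtain c where "a = (\<lambda>i. c * a' i)" unfolding hline_eq by blast
  then show thesis using that[of c] assms(2) by (auto simp: fun_eq_iff)
qed

lemma cfg_scale: "c \<noteq> 0 \<Longrightarrow> d \<noteq> 0 \<Longrightarrow> cfg n (\<lambda>i. c * a i) (\<lambda>i. d * b i) = cfg n a b"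
  by (simp add: cfg_def hline_scale cong: if_cong)

subsection \<open>Continuity in terms of coordinates\<close>

text \<open>In this direction homogeneous coordinates suffice, because the map from vectors to lines
  is continuous. In the other direction they are not functions of the configuration, and the entries
  \<open>pm\<close> take their place.\<close>

lemma continuous_map_cfg:
  assumes n: "n \<ge> 2"
    and a: "\<And>i. i \<le> n \<Longrightarrow> continuous_map T euclideanreal (\<lambda>z. a z i)"
    and b: "\<And>i. i \<le> n \<Longrightarrow> continuous_map T euclideanreal (\<lambda>z. b z i)"
    and g: "\<And>z. z \<in> topspace T \<Longrightarrow> supported n (a z) \<and> supported n (b z) \<and> good n (a z) (b z)"
  shows "continuous_map T (RC n) (\<lambda>z. cfg n (a z) (b z))"
proof -
  have h: "continuous_map T (RP n) (\<lambda>z. hline (c z))"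
    if c: "\<And>i. i \<le> n \<Longrightarrow> continuous_map T euclideanreal (\<lambda>z. c z i)"
      and v: "\<And>z. z \<in> topspace T \<Longrightarrow> supported n (c z) \<and> c z \<noteq> 0" for c
  proof -
    have "continuous_map T euclideanreal (\<lambda>z. c z i)" for i
    proof (cases "i \<le> n")
      case False
      have "continuous_map T euclideanreal (\<lambda>z. 0)" by simp
      then show ?thesis
        by (rule continuous_map_eq) (use v False in \<open>auto simp: supported_def\<close>)
    qed (rule c)
    then have "continuous_map T (subtopology (Euclidean_space (Suc n)) (nonzero_vectors n)) c"
      using v unfolding Euclidean_space_def
      by (auto simp: continuous_map_in_subtopology continuous_map_componentwise_UNIV nonzero_vectors_iff supported_def)
    moreover have "continuous_map (subtopology (Euclidean_space (Suc n)) (nonzero_vectors n)) (RP n) hline"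
      unfolding RP_def by (rule quotient_imp_continuous_map[OF quotient_map_quotient_topology])
    ultimately show ?thesis using continuous_map_compose[of T _ c "RP n" hline] by (simp add: o_def)
  qed
  have nz: "a z \<noteq> 0" "b z \<noteq> 0" if "z \<in> topspace T" for z
    using good_nonzero[of n "a z" "b z"] g[OF that] n by auto
  have in_RC: "cfg n (a z) (b z) \<in> topspace (RC n)" if "z \<in> topspace T" for z
    using cfg_in_RC n g that by blast
  have yp: "ypt i \<in> topspace (RP n)" if "i \<in> {1..n}" for i
  proof -
    have "evec (i - 1) \<in> nonzero_vectors n"
      using that by (auto simp: nonzero_vectors_iff supported_def evec_def fun_eq_iff)
    then show ?thesis unfolding topspace_RP using that by (auto simp: ypt_eq)
  qed
  have "continuous_map T (product_topology (\<lambda>_. RP n) {1..n+2}) (\<lambda>z. cfg n (a z) (b z))"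
    unfolding continuous_map_componentwise
  proof (intro conjI ballI)
    show "(\<lambda>z. cfg n (a z) (b z)) ` topspace T \<subseteq> extensional {1..n+2}" by (auto simp: cfg_def)
    fix i assume i: "i \<in> {1..n+2}"
    then consider "i \<in> {1..n}" | "i = Suc n" | "i = n + 2" by fastforce
    then show "continuous_map T (RP n) (\<lambda>z. cfg n (a z) (b z) i)"
    proof cases
      case 1 then show ?thesis using yp by (simp add: cfg_def)
    next
      case 2
      show ?thesis by (rule continuous_map_eq[OF h[of a]]) (use a g nz 2 in \<open>auto simp: cfg_def\<close>)
    next
      case 3
      show ?thesis by (rule continuous_map_eq[OF h[of b]]) (use b g nz 3 in \<open>auto simp: cfg_def\<close>)
    qed
  qed
  then show ?thesis
    using in_RC unfolding RC_def reduced_config_space_def config_space_def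
    by (auto simp: continuous_map_in_subtopology)
qed

section \<open>Continuous functions of a configuration\<close>

text \<open>Entries of the orthogonal projection onto a line: continuous functions of the line that
  determine all ratios of homogeneous coordinates.\<close>

definition nrm :: "nat \<Rightarrow> (nat \<Rightarrow> real) \<Rightarrow> real" where
  "nrm n a = (\<Sum>l\<le>n. (a l)\<^sup>2)"

definition pm :: "nat \<Rightarrow> (nat \<Rightarrow> real) set \<Rightarrow> nat \<Rightarrow> nat \<Rightarrow> real" where
  "pm n L i j = (let v = SOME v. v \<in> nonzero_vectors n \<and> L = hline v in v i * v j / nrm n v)"

lemma nrm_pos: "supported n a \<Longrightarrow> a \<noteq> 0 \<Longrightarrow> nrm n a > 0"
proof -
  assume a: "supported n a" "a \<noteq> 0"
  then obtain l where l: "a l \<noteq> 0" by (auto simp: fun_eq_iff)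
  then have "l \<le> n" using a(1) by (metis linorder_not_less supported_def)
  then show ?thesis unfolding nrm_def using l by (intro sum_pos2[of _ l]) auto
qed

text \<open>Numerator and denominator both scale by the square of the factor between two
  representatives.\<close>

lemma pm_hline:
  assumes "supported n a" "a \<noteq> 0" shows "pm n (hline a) i j = a i * a j / nrm n a"
proof -
  define v where "v = (SOME v. v \<in> nonzero_vectors n \<and> hline a = hline v)"
  have "v \<in> nonzero_vectors n \<and> hline a = hline v"
    unfolding v_def by (rule someI[of _ a]) (use assms in \<open>simp add: nonzero_vectors_iff\<close>)
  then obtain c where c: "c \<noteq> 0" "a = (\<lambda>i. c * v i)" using hline_eq_imp assms by metis
  have "nrm n a = c\<^sup>2 * nrm n v" by (simp add: nrm_def c(2) power_mult_distrib sum_distrib_left)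
  then have "a i * a j / nrm n a = v i * v j / nrm n v"
    using c by (simp add: power2_eq_square)
  then show ?thesis unfolding pm_def v_def Let_def by simp
qed

lemma continuous_map_pm: "continuous_map (RP n) euclideanreal (\<lambda>L. pm n L i j)"
  unfolding RP_def
proof (rule continuous_compose_quotient_map[OF quotient_map_quotient_topology])
  let ?T = "subtopology (Euclidean_space (Suc n)) (nonzero_vectors n)"
  have pr: "continuous_map ?T euclideanreal (\<lambda>v. v l)" for l
    unfolding Euclidean_space_def by (intro continuous_map_from_subtopology continuous_map_product_projection) auto
  have nv: "nrm n v > 0" if "v \<in> topspace ?T" for v
    using that by (intro nrm_pos) (auto simp: nonzero_vectors_iff)
  have "continuous_map ?T euclideanreal (\<lambda>v. v i * v j / nrm n v)"
    unfolding nrm_def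
    by (intro continuous_intros pr) (use nv in \<open>force simp: nrm_def\<close>)+
  then show "continuous_map ?T euclideanreal ((\<lambda>L. pm n L i j) \<circ> hline)"
    by (rule continuous_map_eq) (auto simp: pm_hline nonzero_vectors_iff)
qed

definition Aq :: "nat \<Rightarrow> (nat \<Rightarrow> (nat \<Rightarrow> real) set) \<Rightarrow> nat \<Rightarrow> nat \<Rightarrow> real" where
  "Aq n x = pm n (x (Suc n))"

definition Bq :: "nat \<Rightarrow> (nat \<Rightarrow> (nat \<Rightarrow> real) set) \<Rightarrow> nat \<Rightarrow> nat \<Rightarrow> real" where
  "Bq n x = pm n (x (n + 2))"

lemma continuous_map_proj:
  assumes "i \<in> {1..n+2}" shows "continuous_map (RC n) (RP n) (\<lambda>x. x i)"
  unfolding RC_def reduced_config_space_def config_space_def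
  using assms by (auto intro!: continuous_map_from_subtopology continuous_map_product_projection)

lemma continuous_map_Aq [continuous_intros]: "continuous_map (RC n) euclideanreal (\<lambda>x. Aq n x i j)"
  unfolding Aq_def
  using continuous_map_compose[OF continuous_map_proj[of "Suc n" n] continuous_map_pm] by (simp add: o_def)

lemma continuous_map_Bq [continuous_intros]: "continuous_map (RC n) euclideanreal (\<lambda>x. Bq n x i j)"
  unfolding Bq_def
  using continuous_map_compose[OF continuous_map_proj[of "n+2" n] continuous_map_pm] by (simp add: o_def)

lemma Aq_cfg: "supported n a \<Longrightarrow> a \<noteq> 0 \<Longrightarrow> Aq n (cfg n a b) i j = a i * a j / nrm n a"
  by (simp add: Aq_def cfg_def pm_hline)

lemma Bq_cfg: "supported n b \<Longrightarrow> b \<noteq> 0 \<Longrightarrow> Bq n (cfg n a b) i j = b i * b j / nrm n b"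
  by (simp add: Bq_def cfg_def pm_hline)

text \<open>With \<open>f\<^sub>j\<close> the \<open>j\<close>-th minor, \<open>Eq\<close> is \<open>a\<^sub>n b\<^sub>n f\<^sub>j\<close> and \<open>Fq\<close> is \<open>f\<^sub>i f\<^sub>j\<close>, both made homogeneous of
  degree \<open>0\<close>.\<close>

definition Eq :: "nat \<Rightarrow> nat \<Rightarrow> (nat \<Rightarrow> (nat \<Rightarrow> real) set) \<Rightarrow> real" where
  "Eq n j x = Aq n x j n * Bq n x n n - Aq n x n n * Bq n x j n"

definition Fq :: "nat \<Rightarrow> nat \<Rightarrow> nat \<Rightarrow> (nat \<Rightarrow> (nat \<Rightarrow> real) set) \<Rightarrow> real" where
  "Fq n i j x = Aq n x i j * Bq n x n n - Aq n x i n * Bq n x j n - Aq n x j n * Bq n x i n + Aq n x n n * Bq n x i j"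

text \<open>The normalised square of the 2 by 2 determinant of rows \<open>i\<close> and
  \<open>j\<close>. The determinant depends on the representatives of the two lines; its square is a
  polynomial in the projection entries.\<close>

definition Gq :: "nat \<Rightarrow> nat \<Rightarrow> nat \<Rightarrow> (nat \<Rightarrow> (nat \<Rightarrow> real) set) \<Rightarrow> real" where
  "Gq n i j x = Aq n x i i * Bq n x j j - 2 * Aq n x i j * Bq n x i j + Aq n x j j * Bq n x i i"

lemma continuous_map_EFG [continuous_intros]:
  "continuous_map (RC n) euclideanreal (Eq n j)"
  "continuous_map (RC n) euclideanreal (Fq n i j)"
  "continuous_map (RC n) euclideanreal (Gq n i j)"
proof -
  have "continuous_map (RC n) euclideanreal (\<lambda>x. Eq n j x)" "continuous_map (RC n) euclideanreal (\<lambda>x. Fq n i j x)"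
    "continuous_map (RC n) euclideanreal (\<lambda>x. Gq n i j x)"
    unfolding Eq_def Fq_def Gq_def by (intro continuous_intros)+
  then show "continuous_map (RC n) euclideanreal (Eq n j)" "continuous_map (RC n) euclideanreal (Fq n i j)"
    "continuous_map (RC n) euclideanreal (Gq n i j)" by auto
qed

definition cpt :: "nat \<Rightarrow> (nat \<Rightarrow> real) \<Rightarrow> (nat \<Rightarrow> real) \<Rightarrow> bool" where
  "cpt n a b \<longleftrightarrow> supported n a \<and> supported n b \<and> good n a b"

context
  fixes n :: nat and a b
  assumes n: "n \<ge> 2" and c: "cpt n a b"
begin

lemma cpt_nrm: "nrm n a > 0" "nrm n b > 0" "supported n a" "supported n b" "a \<noteq> 0" "b \<noteq> 0" "good n a b"
  "cfg n a b \<in> topspace (RC n)"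
proof -
  show "supported n a" "supported n b" "good n a b" using c by (auto simp: cpt_def)
  then show "a \<noteq> 0" "b \<noteq> 0" using good_nonzero n by (metis One_nat_def Suc_1 Suc_leD)+
  then show "nrm n a > 0" "nrm n b > 0" using nrm_pos \<open>supported n a\<close> \<open>supported n b\<close> by auto
  show "cfg n a b \<in> topspace (RC n)" using cfg_in_RC n \<open>supported n a\<close> \<open>supported n b\<close> \<open>good n a b\<close> by auto
qed

lemma Eq_cfg: "j < n \<Longrightarrow> Eq n j (cfg n a b) = a n * b n * minor n j a b / (nrm n a * nrm n b)"
  using cpt_nrm by (simp add: Eq_def Aq_cfg Bq_cfg minor_def field_simps)

lemma Fq_cfg: "i < n \<Longrightarrow> j < n \<Longrightarrow> Fq n i j (cfg n a b) = minor n i a b * minor n j a b / (nrm n a * nrm n b)"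
  using cpt_nrm by (simp add: Fq_def Aq_cfg Bq_cfg minor_def field_simps)

lemma Gq_cfg: "Gq n i j (cfg n a b) = (a i * b j - a j * b i)\<^sup>2 / (nrm n a * nrm n b)"
  using cpt_nrm by (simp add: Gq_def Aq_cfg Bq_cfg field_simps power2_eq_square)

lemma Eq_cfg_sign: "j < n \<Longrightarrow> Eq n j (cfg n a b) > 0 \<longleftrightarrow> a n * b n * minor n j a b > 0"
  "j < n \<Longrightarrow> Eq n j (cfg n a b) < 0 \<longleftrightarrow> a n * b n * minor n j a b < 0"
  using mult_pos_pos[OF cpt_nrm(1,2)] not_less_iff_gr_or_eq[of "nrm n a * nrm n b" 0]
  by (simp_all only: Eq_cfg zero_less_divide_iff divide_less_0_iff) auto

lemma Fq_cfg_sign: "i < n \<Longrightarrow> j < n \<Longrightarrow> Fq n i j (cfg n a b) > 0 \<longleftrightarrow> minor n i a b * minor n j a b > 0"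
  "i < n \<Longrightarrow> j < n \<Longrightarrow> Fq n i j (cfg n a b) < 0 \<longleftrightarrow> minor n i a b * minor n j a b < 0"
  using mult_pos_pos[OF cpt_nrm(1,2)] not_less_iff_gr_or_eq[of "nrm n a * nrm n b" 0]
  by (simp_all only: Fq_cfg zero_less_divide_iff divide_less_0_iff) auto

lemma Gq_cfg_0: "Gq n i j (cfg n a b) = 0 \<longleftrightarrow> a i * b j = a j * b i"
  using cpt_nrm by (simp add: Gq_cfg)

lemma Aq_cfg_0: "Aq n (cfg n a b) i i = 0 \<longleftrightarrow> a i = 0"
  using cpt_nrm by (simp add: Aq_cfg)

lemma Bq_cfg_0: "Bq n (cfg n a b) i i = 0 \<longleftrightarrow> b i = 0"
  using cpt_nrm by (simp add: Bq_cfg)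

end

lemma RC_cpt_cases:
  assumes "n \<ge> 2" "x \<in> topspace (RC n)"
  obtains a b where "cpt n a b" "x = cfg n a b"
  using RC_cases[OF assms] by (metis cpt_def)

lemma minor_scale: "minor n j (\<lambda>i. c * a i) (\<lambda>i. d * b i) = (if j < n then c * d else if j = n then d else c) * minor n j a b"
  by (simp add: minor_def algebra_simps)

lemma cpt_scale:
  assumes "cpt n a b" "c \<noteq> 0" "d \<noteq> 0" shows "cpt n (\<lambda>i. c * a i) (\<lambda>i. d * b i)"
proof -
  have "(c * a i) * (d * b j) = (c * a j) * (d * b i) \<longleftrightarrow> a i * b j = a j * b i" for i j
  proof -
    have "(c * a i) * (d * b j) = (c * a j) * (d * b i) \<longleftrightarrow> (c * d) * (a i * b j) = (c * d) * (a j * b i)"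
      by (simp only: mult_ac)
    then show ?thesis using assms by simp
  qed
  then show ?thesis using assms unfolding cpt_def supported_def good_def by auto
qed

subsection \<open>Regions with a unique homotopy class of paths between any two points\<close>

text \<open>The homotopies may leave \<open>U\<close>: what matters is that paths in
  \<open>U\<close> with the same ends have the same class in the whole space.\<close>

definition sconn :: "'a topology \<Rightarrow> 'a set \<Rightarrow> bool" where
  "sconn X U \<longleftrightarrow> U \<subseteq> topspace X \<and>
    (\<forall>x\<in>U. \<forall>y\<in>U. \<exists>p. pathin X p \<and> p ` {0..1} \<subseteq> U \<and> p 0 = x \<and> p 1 = y) \<and>
    (\<forall>p q. pathin X p \<and> pathin X q \<and> p ` {0..1} \<subseteq> U \<and> q ` {0..1} \<subseteq> U \<and> p 0 = q 0 \<and> p 1 = q 1 \<longrightarrow> phom X p q)"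

text \<open>In the chart the straight line homotopy stays in the convex set \<open>K\<close>.
  Continuity of the inverse chart \<rho> is expressed along coordinatewise continuous maps from
  plane parameter spaces, those of homotopies, so that no topology on \<open>K\<close> has to be set
  up.\<close>

lemma sconn_convex_chart:
  fixes \<kappa> :: "'a \<Rightarrow> 'i \<Rightarrow> real"
  assumes U: "U \<subseteq> topspace X"
    and \<kappa>: "\<And>i. continuous_map (subtopology X U) euclideanreal (\<lambda>x. \<kappa> x i)"
    and K: "\<And>x. x \<in> U \<Longrightarrow> \<kappa> x \<in> K" "\<And>u w s. u \<in> K \<Longrightarrow> w \<in> K \<Longrightarrow> 0 \<le> s \<Longrightarrow> s \<le> 1 \<Longrightarrow> (\<lambda>i. (1 - s) * u i + s * w i) \<in> K"
    and \<rho>: "\<And>u. u \<in> K \<Longrightarrow> \<rho> u \<in> U" "\<And>x. x \<in> U \<Longrightarrow> \<rho> (\<kappa> x) = x"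
    and cont: "\<And>T :: (real \<times> real) topology. \<And>u. (\<And>i. continuous_map T euclideanreal (\<lambda>z. u z i)) \<Longrightarrow> (\<And>z. z \<in> topspace T \<Longrightarrow> u z \<in> K) \<Longrightarrow>
       continuous_map T X (\<lambda>z. \<rho> (u z))"
  shows "sconn X U"
proof -
  have kp: "continuous_map I01 euclideanreal (\<lambda>t. \<kappa> (p t) i)" if "pathin X p" "p ` {0..1} \<subseteq> U" for p i
  proof -
    have "continuous_map I01 (subtopology X U) p"
      using that by (auto simp: pathin_def continuous_map_in_subtopology)
    then show ?thesis using continuous_map_compose[OF _ \<kappa>[of i], of I01 p] unfolding o_def by blast
  qed
  let ?T = "prod_topology I01 I01"
  have ct: "continuous_map ?T euclideanreal (\<lambda>z. (1 - fst z) * f (snd z) + fst z * g (snd z))"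
    if "continuous_map I01 euclideanreal f" "continuous_map I01 euclideanreal g" for f g
  proof -
    have s: "continuous_map ?T I01 snd" by (rule continuous_map_snd)
    have f: "continuous_map ?T euclideanreal fst"
      using continuous_map_fst[of I01 I01] by (simp add: continuous_map_in_subtopology)
    have "continuous_map ?T euclideanreal (\<lambda>z. f (snd z))" "continuous_map ?T euclideanreal (\<lambda>z. g (snd z))"
      using continuous_map_compose[OF s that(1)] continuous_map_compose[OF s that(2)] by (simp_all add: o_def)
    then show ?thesis using f by (intro continuous_intros) auto
  qed
  show ?thesis
    unfolding sconn_def
  proof (intro conjI ballI allI impI)
    fix x y assume xy: "x \<in> U" "y \<in> U"
    let ?p = "\<lambda>t. \<rho> (\<lambda>i. (1 - t) * \<kappa> x i + t * \<kappa> y i)"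
    have c: "continuous_map ?T X (\<lambda>z. \<rho> (\<lambda>i. (1 - fst z) * \<kappa> x i + fst z * \<kappa> y i))"
      by (rule cont, rule ct) (use xy K in auto)
    \<comment> \<open>The path is an edge of a homotopy between two constant paths, since
      \<open>cont\<close> speaks of plane parameters only.\<close>
    have "continuous_map I01 ?T (\<lambda>t. (t, 0))"
      by (auto simp: prod_topology_subtopology_eu continuous_map_in_subtopology intro!: continuous_intros)
    then have "pathin X ?p"
      using continuous_map_compose[OF _ c, of I01 "\<lambda>t. (t, 0)"] unfolding pathin_def o_def fst_conv by blast
    moreover have "?p ` {0..1} \<subseteq> U" using K \<rho> xy by auto
    ultimately show "\<exists>p. pathin X p \<and> p ` {0..1} \<subseteq> U \<and> p 0 = x \<and> p 1 = y"
      using \<rho>(2) xy by (intro exI[of _ ?p]) auto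
  next
    fix p q assume pq: "pathin X p \<and> pathin X q \<and> p ` {0..1} \<subseteq> U \<and> q ` {0..1} \<subseteq> U \<and> p 0 = q 0 \<and> p 1 = q 1"
    let ?h = "\<lambda>z. \<rho> (\<lambda>i. (1 - fst z) * \<kappa> (p (snd z)) i + fst z * \<kappa> (q (snd z)) i)"
    have "continuous_map ?T X ?h"
    proof (rule cont)
      fix i show "continuous_map ?T euclideanreal (\<lambda>z. (1 - fst z) * \<kappa> (p (snd z)) i + fst z * \<kappa> (q (snd z)) i)"
        by (rule ct[of "\<lambda>t. \<kappa> (p t) i" "\<lambda>t. \<kappa> (q t) i"]) (rule kp; use pq in blast)+
    next
      fix z assume "z \<in> topspace ?T"
      then have "p (snd z) \<in> U" "q (snd z) \<in> U" "0 \<le> fst z" "fst z \<le> 1" using pq by auto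
      then show "(\<lambda>i. (1 - fst z) * \<kappa> (p (snd z)) i + fst z * \<kappa> (q (snd z)) i) \<in> K" using K by blast
    qed
    moreover have "?h (0, t) = p t" "?h (1, t) = q t" if "t \<in> {0..1}" for t
      using that pq \<rho>(2) by (auto simp: image_subset_iff)
    moreover have "?h (s, 0) = p 0" "?h (s, 1) = p 1" for s
    proof -
      have "(1 - s) * r + s * r = r" for r :: real by (simp add: algebra_simps)
      moreover have "p 0 \<in> U" "p 1 \<in> U" using pq by (auto simp: image_subset_iff)
      ultimately show "?h (s, 0) = p 0" "?h (s, 1) = p 1" using pq \<rho>(2) by auto
    qed
    ultimately show "phom X p q" unfolding phom_iff by (intro exI[of _ ?h]) auto
  qed (rule U)
qed

lemma openin_less:
  assumes "continuous_map X euclideanreal f" "continuous_map X euclideanreal g"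
  shows "openin X {x \<in> topspace X. f x < g x}"
proof -
  have "continuous_map X euclideanreal (\<lambda>x. g x - f x)" by (intro continuous_intros assms)
  then have "openin X {x \<in> topspace X. g x - f x \<in> {0<..}}" by (rule openin_continuous_map_preimage) simp
  then show ?thesis by simp
qed

lemma openin_neq:
  assumes "continuous_map X euclideanreal f" "continuous_map X euclideanreal g"
  shows "openin X {x \<in> topspace X. f x \<noteq> g x}"
proof -
  have "continuous_map X euclideanreal (\<lambda>x. g x - f x)" by (intro continuous_intros assms)
  then have "openin X {x \<in> topspace X. g x - f x \<in> - {0}}" by (rule openin_continuous_map_preimage) (simp add: open_Compl)
  moreover have "{x \<in> topspace X. g x - f x \<in> - {0}} = {x \<in> topspace X. f x \<noteq> g x}" by auto
  ultimately show ?thesis by simp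
qed

lemma openin_conj:
  "openin X {x \<in> topspace X. P x} \<Longrightarrow> openin X {x \<in> topspace X. Q x} \<Longrightarrow> openin X {x \<in> topspace X. P x \<and> Q x}"
  using openin_Int[of X "{x \<in> topspace X. P x}" "{x \<in> topspace X. Q x}"]
  by (simp add: Collect_conj_eq[symmetric] Int_def conj_ac cong: conj_cong)

lemma openin_ball:
  assumes "finite I" "\<And>i. i \<in> I \<Longrightarrow> openin X {x \<in> topspace X. P i x}"
  shows "openin X {x \<in> topspace X. \<forall>i\<in>I. P i x}"
  using assms
proof (induction I rule: finite_induct)
  case (insert i I)
  then have "openin X {x \<in> topspace X. P i x \<and> (\<forall>j\<in>I. P j x)}" by (intro openin_conj) auto
  then show ?case by simp
qed simp

lemma openin_if: "(c \<Longrightarrow> openin X {x \<in> topspace X. P x}) \<Longrightarrow> (\<not> c \<Longrightarrow> openin X {x \<in> topspace X. Q x}) \<Longrightarrow>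
   openin X {x \<in> topspace X. if c then P x else Q x}"
  by (cases c) auto

lemma openin_imp: "(c \<Longrightarrow> openin X {x \<in> topspace X. P x}) \<Longrightarrow> openin X {x \<in> topspace X. c \<longrightarrow> P x}"
  by (cases c) auto

text \<open>For \<open>Q = {}\<close> this is the chamber labelled \<open>S\<close>. Signs at
  indices in \<open>Q\<close> are free, so \<open>Q = {j}\<close> adds the wall \<open>j\<close> and
  the chamber behind it.\<close>

definition regA :: "nat \<Rightarrow> nat set \<Rightarrow> nat set \<Rightarrow> (nat \<Rightarrow> (nat \<Rightarrow> real) set) set" where
  "regA n Q S = {x \<in> topspace (RC n). Aq n x n n \<noteq> 0 \<and> Bq n x n n \<noteq> 0 \<and>
     (\<forall>i\<in>{..<n} - Q. if i \<in> S then Eq n i x < 0 else 0 < Eq n i x)}"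

text \<open>Only products with minor 0 occur, so \<open>S\<close> matters up to complement and the
  signs of \<open>a n\<close> and \<open>b n\<close> are free, as is needed when crossing
  \<open>a n = 0\<close> or \<open>b n = 0\<close>. The index 0 itself contributes that minor 0 is
  nonzero.\<close>

definition regF :: "nat \<Rightarrow> nat set \<Rightarrow> (nat \<Rightarrow> (nat \<Rightarrow> real) set) set" where
  "regF n S = {x \<in> topspace (RC n). \<forall>i\<in>{..<n}. if i \<in> S \<longleftrightarrow> 0 \<in> S then 0 < Fq n i 0 x else Fq n i 0 x < 0}"

text \<open>\<open>Wreg n S j\<close> consists of the chamber \<open>S\<close>, a wall of type \<open>j\<close> bounding it and the chamber on the
  other side.\<close>

definition Wreg :: "nat \<Rightarrow> nat set \<Rightarrow> nat \<Rightarrow> (nat \<Rightarrow> (nat \<Rightarrow> real) set) set" where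
  "Wreg n S j = (if j < n then regA n {j} S else if j = n then {x \<in> regF n S. Aq n x n n \<noteq> 0}
     else {x \<in> regF n S. Bq n x n n \<noteq> 0})"

lemma openin_regA: "openin (RC n) (regA n Q S)"
  unfolding regA_def
  by (intro openin_conj openin_ball openin_if openin_less openin_neq continuous_intros) auto

lemma openin_regF: "openin (RC n) (regF n S)"
  unfolding regF_def
  by (intro openin_conj openin_ball openin_if openin_less openin_neq continuous_intros) auto

lemma regF_subset: "regF n S \<subseteq> topspace (RC n)"
  by (auto simp: regF_def)

lemma openin_Wreg: "openin (RC n) (Wreg n S j)"
proof -
  have e: "{x \<in> regF n S. P x} = regF n S \<inter> {x \<in> topspace (RC n). P x}" for P using regF_subset by blast
  have "openin (RC n) {x \<in> regF n S. Aq n x n n \<noteq> 0}" "openin (RC n) {x \<in> regF n S. Bq n x n n \<noteq> 0}"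
    unfolding e by (intro openin_Int openin_regF openin_neq continuous_intros; simp)+
  then show ?thesis unfolding Wreg_def using openin_regA by auto
qed

lemma cfg_in_regA:
  assumes "n \<ge> 2" "cpt n a b"
  shows "cfg n a b \<in> regA n Q S \<longleftrightarrow> a n \<noteq> 0 \<and> b n \<noteq> 0 \<and>
    (\<forall>i\<in>{..<n} - Q. if i \<in> S then a n * b n * minor n i a b < 0 else a n * b n * minor n i a b > 0)"
  unfolding regA_def using assms by (auto simp: Aq_cfg_0 Bq_cfg_0 Eq_cfg_sign cpt_nrm)

lemma cfg_in_regF:
  assumes "n \<ge> 2" "cpt n a b"
  shows "cfg n a b \<in> regF n S \<longleftrightarrow>
    (\<forall>i<n. if i \<in> S \<longleftrightarrow> 0 \<in> S then minor n i a b * minor n 0 a b > 0 else minor n i a b * minor n 0 a b < 0)"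
  unfolding regF_def using assms by (auto simp: Fq_cfg_sign cpt_nrm)

section \<open>Convex charts of chambers and walls\<close>

lemma convex_comb_less:
  assumes "x < c" "y < (c::real)" "0 \<le> s" "s \<le> 1" shows "(1 - s) * x + s * y < c"
proof -
  have "(1 - s) * x + s * y \<in> {..<c}"
    using convexD[OF convex_real_interval(4)[of c], of x y "1 - s" s] assms by simp
  then show ?thesis by simp
qed

lemma convex_comb_gr:
  assumes "c < x" "c < (y::real)" "0 \<le> s" "s \<le> 1" shows "c < (1 - s) * x + s * y"
  using convex_comb_less[of "-x" "-c" "-y" s] assms by (simp add: algebra_simps)

lemma convex_comb_same: "(1 - s) * x + s * x = (x::real)"
  by (simp add: algebra_simps)

lemma cptI:
  assumes "\<And>i. i > n \<Longrightarrow> a i = 0" "\<And>i. i > n \<Longrightarrow> b i = 0" "good n a b" shows "cpt n a b"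
  using assms by (simp add: cpt_def supported_def)

lemma cpt_out: "cpt n a b \<Longrightarrow> i > n \<Longrightarrow> a i = 0 \<and> b i = 0"
  by (simp add: cpt_def supported_def)

lemma regA_cases:
  assumes n: "n \<ge> 2" and x: "x \<in> regA n Q S"
  obtains a b where "cpt n a b" "a n = 1" "b n = 1" "x = cfg n a b"
proof -
  obtain a b where ab: "cpt n a b" "x = cfg n a b" using RC_cpt_cases[OF n] x regA_def by blast
  then have nz: "a n \<noteq> 0" "b n \<noteq> 0" using x cfg_in_regA[OF n ab(1)] by auto
  then show thesis
    using that[of "\<lambda>i. (1 / a n) * a i" "\<lambda>i. (1 / b n) * b i"] cpt_scale[OF ab(1), of "1 / a n" "1 / b n"]
      cfg_scale[of "1 / a n" "1 / b n" n a b] ab by simp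
qed

text \<open>After scaling to \<open>a n = b n = 1\<close> the minors are the differences
  \<open>a i - b i\<close>, so the sign conditions cut out a convex set.\<close>

lemma sconn_regA:
  assumes n: "n \<ge> 2" and Q: "Q = {} \<or> (\<exists>j. Q = {j})"
  shows "sconn (RC n) (regA n Q S)"
proof -
  define \<kappa> where "\<kappa> x = (\<lambda>(c, i). if c then Aq n x i n / Aq n x n n else Bq n x i n / Bq n x n n)" for x
  define K :: "(bool \<times> nat \<Rightarrow> real) set" where "K = {u. (\<forall>i>n. u (True, i) = 0 \<and> u (False, i) = 0) \<and> u (True, n) = 1 \<and> u (False, n) = 1 \<and>
     (\<forall>i\<in>{..<n} - Q. if i \<in> S then u (True, i) - u (False, i) < 0 else u (True, i) - u (False, i) > 0)}"
  define \<rho> where "\<rho> u = cfg n (\<lambda>i. u (True, i)) (\<lambda>i. u (False, i))" for u :: "bool \<times> nat \<Rightarrow> real"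
  have \<kappa>_cfg: "\<kappa> (cfg n a b) = (\<lambda>(c, i). if c then a i else b i)" if "cpt n a b" "a n = 1" "b n = 1" for a b
    using that cpt_nrm[OF n that(1)] by (auto simp: \<kappa>_def Aq_cfg Bq_cfg)
  have Kc: "cpt n (\<lambda>i. u (True, i)) (\<lambda>i. u (False, i))" if "u \<in> K" for u
  proof (rule cptI)
    have "u (True, i) \<noteq> u (False, i) \<or> u (True, j) \<noteq> u (False, j)" if "i < n" "j < n" "i \<noteq> j" for i j
    proof -
      \<comment> \<open>At most one index is free, so of any two minors one is nonzero; this secures
        general position.\<close>
      have "i \<notin> Q \<or> j \<notin> Q" using Q that by auto
      moreover have "u (True, l) \<noteq> u (False, l)" if "l < n" "l \<notin> Q" for l
        using \<open>u \<in> K\<close> that unfolding K_def by (auto split: if_splits dest!: bspec[of _ _ l])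
      ultimately show ?thesis using that by blast
    qed
    then show "good n (\<lambda>i. u (True, i)) (\<lambda>i. u (False, i))"
      using that unfolding good_def K_def by auto
  qed (use that in \<open>auto simp: K_def\<close>)
  have lamK: "minor n i (\<lambda>i. u (True, i)) (\<lambda>i. u (False, i)) = u (True, i) - u (False, i)" if "u \<in> K" "i < n" for u i
    using that by (simp add: minor_def K_def)
  show ?thesis
  proof (rule sconn_convex_chart[of _ _ \<kappa> K \<rho>])
    show U: "regA n Q S \<subseteq> topspace (RC n)" by (auto simp: regA_def)
    show "continuous_map (subtopology (RC n) (regA n Q S)) euclideanreal (\<lambda>x. \<kappa> x i)" for i
      unfolding \<kappa>_def by (cases i; cases "fst i"; simp)
        (intro continuous_intros continuous_map_from_subtopology; auto simp: regA_def)+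
    show "\<kappa> x \<in> K" if x: "x \<in> regA n Q S" for x
    proof -
      obtain a b where ab: "cpt n a b" "a n = 1" "b n = 1" "x = cfg n a b" using regA_cases[OF n x] by blast
      have "\<forall>i\<in>{..<n} - Q. if i \<in> S then minor n i a b < 0 else minor n i a b > 0"
        using x[unfolded ab(4) cfg_in_regA[OF n ab(1)] ab(2,3)] by (simp cong: if_cong)
      then have "if i \<in> S then a i < b i else b i < a i" if "i \<in> {..<n} - Q" for i
        using that ab(2,3) by (auto simp: minor_def dest!: bspec[of _ _ i] split: if_splits)
      then show ?thesis using ab cpt_out[OF ab(1)] by (auto simp: \<kappa>_cfg K_def)
    qed
    show "(\<lambda>i. (1 - s) * u i + s * w i) \<in> K" if "u \<in> K" "w \<in> K" "0 \<le> s" "s \<le> 1" for u w s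
    proof -
      have e: "((1 - s) * u (True, i) + s * w (True, i)) - ((1 - s) * u (False, i) + s * w (False, i))
        = (1 - s) * (u (True, i) - u (False, i)) + s * (w (True, i) - w (False, i))" for i
        by (simp add: algebra_simps)
      have "if i \<in> S then (1 - s) * (u (True, i) - u (False, i)) + s * (w (True, i) - w (False, i)) < 0
          else (1 - s) * (u (True, i) - u (False, i)) + s * (w (True, i) - w (False, i)) > 0"
        if i: "i \<in> {..<n} - Q" for i
      proof -
        have "if i \<in> S then u (True, i) - u (False, i) < 0 else u (True, i) - u (False, i) > 0"
          "if i \<in> S then w (True, i) - w (False, i) < 0 else w (True, i) - w (False, i) > 0"
          using \<open>u \<in> K\<close> \<open>w \<in> K\<close> i unfolding K_def by blast+
        then show ?thesis using \<open>0 \<le> s\<close> \<open>s \<le> 1\<close> convex_comb_less convex_comb_gr by (cases "i \<in> S") presburger+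
      qed
      then show ?thesis using that unfolding K_def mem_Collect_eq e
        by (auto simp: convex_comb_same[of s 1, simplified])
    qed
    show "\<rho> u \<in> regA n Q S" if "u \<in> K" for u
      unfolding \<rho>_def cfg_in_regA[OF n Kc[OF that]] using that lamK[OF that] by (simp add: K_def cong: if_cong)
    show "\<rho> (\<kappa> x) = x" if x: "x \<in> regA n Q S" for x
    proof -
      obtain a b where ab: "cpt n a b" "a n = 1" "b n = 1" "x = cfg n a b" using regA_cases[OF n x] by blast
      show ?thesis unfolding ab(4) \<rho>_def \<kappa>_cfg[OF ab(1-3)] by simp
    qed
    show "continuous_map T (RC n) (\<lambda>z. \<rho> (u z))"
      if "\<And>i. continuous_map T euclideanreal (\<lambda>z. u z i)" "\<And>z. z \<in> topspace T \<Longrightarrow> u z \<in> K"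
      for T :: "(real \<times> real) topology" and u
      unfolding \<rho>_def by (rule continuous_map_cfg[OF n]) (use that Kc cpt_def in auto)
  qed
qed

lemma regF_casesB:
  assumes n: "n \<ge> 2" and x: "x \<in> regF n S" "Bq n x n n \<noteq> 0"
  obtains a b where "cpt n a b" "minor n 0 a b = 1" "b n = 1" "x = cfg n a b"
proof -
  obtain a b where ab: "cpt n a b" "x = cfg n a b" using RC_cpt_cases[OF n] x regF_subset by blast
  then have nz: "b n \<noteq> 0" "minor n 0 a b \<noteq> 0"
    using x cfg_in_regF[OF n ab(1), of S] n Bq_cfg_0[OF n ab(1)] by (auto dest!: spec[of _ 0])
  then have "minor n 0 (\<lambda>i. (b n / minor n 0 a b) * a i) (\<lambda>i. (1 / b n) * b i) = 1"
    unfolding minor_scale using n by simp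
  then show thesis
    using nz that[of "\<lambda>i. (b n / minor n 0 a b) * a i" "\<lambda>i. (1 / b n) * b i"]
      cpt_scale[OF ab(1), of "b n / minor n 0 a b" "1 / b n"] cfg_scale[of "b n / minor n 0 a b" "1 / b n" n a b] ab n
    by simp
qed

lemma regF_casesA:
  assumes n: "n \<ge> 2" and x: "x \<in> regF n S" "Aq n x n n \<noteq> 0"
  obtains a b where "cpt n a b" "minor n 0 a b = 1" "a n = 1" "x = cfg n a b"
proof -
  obtain a b where ab: "cpt n a b" "x = cfg n a b" using RC_cpt_cases[OF n] x regF_subset by blast
  then have nz: "a n \<noteq> 0" "minor n 0 a b \<noteq> 0"
    using x cfg_in_regF[OF n ab(1), of S] n Aq_cfg_0[OF n ab(1)] by (auto dest!: spec[of _ 0])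
  then have "minor n 0 (\<lambda>i. (1 / a n) * a i) (\<lambda>i. (a n / minor n 0 a b) * b i) = 1"
    unfolding minor_scale using n by simp
  then show thesis
    using nz that[of "\<lambda>i. (1 / a n) * a i" "\<lambda>i. (a n / minor n 0 a b) * b i"]
      cpt_scale[OF ab(1), of "1 / a n" "a n / minor n 0 a b"] cfg_scale[of "1 / a n" "a n / minor n 0 a b" n a b] ab n
    by simp
qed

text \<open>Scaled to \<open>b n = 1\<close> and minor 0 equal to 1, a configuration is given by its
  minors, \<open>a n\<close> and the \<open>b i\<close>; then \<open>a i\<close> is minor
  \<open>i\<close> plus \<open>a n * b i\<close>. With the minors as coordinates the sign conditions
  are convex, and \<open>a n\<close> may pass through zero.\<close>

lemma sconn_regFB:
  assumes n: "n \<ge> 2"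
  shows "sconn (RC n) {x \<in> regF n S. Bq n x n n \<noteq> 0}"
proof -
  let ?U = "{x \<in> regF n S. Bq n x n n \<noteq> 0}"
  define \<kappa> where "\<kappa> x = (\<lambda>(c, i). if c then if i < n then Fq n i 0 x / Fq n 0 0 x else if i = n then Eq n 0 x / Fq n 0 0 x else 0
     else Bq n x i n / Bq n x n n)" for x
  define K :: "(bool \<times> nat \<Rightarrow> real) set" where "K = {u. (\<forall>i>n. u (True, i) = 0 \<and> u (False, i) = 0) \<and> u (True, 0) = 1 \<and> u (False, n) = 1 \<and>
     (\<forall>i<n. if i \<in> S \<longleftrightarrow> 0 \<in> S then 0 < u (True, i) else u (True, i) < 0)}"
  define aa where "aa u = (\<lambda>i. if i < n then u (True, i) + u (True, n) * u (False, i) else u (True, i))" for u :: "bool \<times> nat \<Rightarrow> real"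
  define bb where "bb u = (\<lambda>i. u (False, i))" for u :: "bool \<times> nat \<Rightarrow> real"
  define \<rho> where "\<rho> u = cfg n (aa u) (bb u)" for u
  have \<kappa>_cfg: "\<kappa> (cfg n a b) = (\<lambda>(c, i). if c then if i < n then minor n i a b else a i else b i)"
    if "cpt n a b" "minor n 0 a b = 1" "b n = 1" for a b
    using that cpt_nrm[OF n that(1)] cpt_out[OF that(1)] n by (auto simp: \<kappa>_def Fq_cfg[OF n] Eq_cfg[OF n] Bq_cfg)
  have lamK: "minor n i (aa u) (bb u) = u (True, i)" if "u \<in> K" "i < n" for u i
    using that by (simp add: minor_def K_def aa_def bb_def)
  have nzK: "u (True, i) \<noteq> 0" if "u \<in> K" "i < n" for u i
    using that unfolding K_def by (auto split: if_splits)
  have Kc: "cpt n (aa u) (bb u)" if u: "u \<in> K" for u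
  proof (rule cptI)
    have "aa u i * bb u n \<noteq> aa u n * bb u i" if "i < n" for i
      using lamK[OF u that] nzK[OF u that] that by (simp add: minor_def)
    moreover have "bb u n = 1" using u by (simp add: K_def bb_def)
    ultimately show "good n (aa u) (bb u)" unfolding good_def by (metis mult_zero_left zero_neq_one mult.right_neutral)
  qed (use u in \<open>auto simp: K_def aa_def bb_def\<close>)
  show ?thesis
  proof (rule sconn_convex_chart[of _ _ \<kappa> K \<rho>])
    show U: "?U \<subseteq> topspace (RC n)" by (auto simp: regF_def)
    have F0: "Fq n 0 0 x \<noteq> 0" if "x \<in> ?U" for x using that n unfolding regF_def by (auto dest!: bspec[of _ _ 0])
    show "continuous_map (subtopology (RC n) ?U) euclideanreal (\<lambda>x. \<kappa> x i)" for i
    proof -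
      obtain c m where i: "i = (c, m)" by force
      show ?thesis
        unfolding \<kappa>_def i using F0
        by (cases c; cases "m < n"; cases "m = n"; simp only: prod.case if_True if_False)
          (intro continuous_intros continuous_map_from_subtopology; auto)+
    qed
    show "\<kappa> x \<in> K" if x: "x \<in> ?U" for x
    proof -
      obtain a b where ab: "cpt n a b" "minor n 0 a b = 1" "b n = 1" "x = cfg n a b" using regF_casesB[OF n] x by blast
      have "\<forall>i<n. if i \<in> S \<longleftrightarrow> 0 \<in> S then minor n i a b > 0 else minor n i a b < 0"
        using x[unfolded ab(4)] ab(2) by (simp add: cfg_in_regF[OF n ab(1)] cong: if_cong)
      then show ?thesis using ab cpt_out[OF ab(1)] n by (auto simp: \<kappa>_cfg K_def)
    qed
    show "(\<lambda>i. (1 - s) * u i + s * w i) \<in> K" if "u \<in> K" "w \<in> K" "0 \<le> s" "s \<le> 1" for u w s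
      using that unfolding K_def mem_Collect_eq
      by (auto simp: convex_comb_same[of s 1, simplified] intro!: convex_comb_less convex_comb_gr)
    show "\<rho> u \<in> ?U" if "u \<in> K" for u
    proof -
      have "\<rho> u \<in> regF n S"
        unfolding \<rho>_def cfg_in_regF[OF n Kc[OF that]] using that lamK[OF that] n by (auto simp: K_def)
      moreover have "Bq n (\<rho> u) n n \<noteq> 0"
        unfolding \<rho>_def Bq_cfg_0[OF n Kc[OF that]] using that by (simp add: K_def bb_def)
      ultimately show ?thesis by simp
    qed
    show "\<rho> (\<kappa> x) = x" if x: "x \<in> ?U" for x
    proof -
      obtain a b where ab: "cpt n a b" "minor n 0 a b = 1" "b n = 1" "x = cfg n a b" using regF_casesB[OF n] x by blast
      have "aa (\<kappa> x) = a" "bb (\<kappa> x) = b"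
        unfolding ab(4) \<kappa>_cfg[OF ab(1-3)] using ab(3) by (auto simp: aa_def bb_def minor_def fun_eq_iff)
      then show ?thesis using ab by (simp add: \<rho>_def)
    qed
    show "continuous_map T (RC n) (\<lambda>z. \<rho> (u z))"
      if u: "\<And>i. continuous_map T euclideanreal (\<lambda>z. u z i)" "\<And>z. z \<in> topspace T \<Longrightarrow> u z \<in> K"
      for T :: "(real \<times> real) topology" and u
      unfolding \<rho>_def
    proof (rule continuous_map_cfg[OF n])
      show "continuous_map T euclideanreal (\<lambda>z. aa (u z) i)" for i
        unfolding aa_def by (cases "i < n"; simp) (intro continuous_intros u(1))+
      show "continuous_map T euclideanreal (\<lambda>z. bb (u z) i)" for i
        unfolding bb_def by (rule u(1))
    qed (use u(2) Kc cpt_def in auto)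
  qed
qed

text \<open>The mirror image of \<open>sconn_regFB\<close>: with \<open>a n = 1\<close> the
  coordinates are the \<open>a i\<close>, the minors and \<open>b n\<close>, and \<open>b i\<close>
  is \<open>a i * b n\<close> minus minor \<open>i\<close>.\<close>

lemma sconn_regFA:
  assumes n: "n \<ge> 2"
  shows "sconn (RC n) {x \<in> regF n S. Aq n x n n \<noteq> 0}"
proof -
  let ?U = "{x \<in> regF n S. Aq n x n n \<noteq> 0}"
  define \<kappa> where "\<kappa> x = (\<lambda>(c, i). if c then Aq n x i n / Aq n x n n else
     if i < n then Fq n i 0 x / Fq n 0 0 x else if i = n then Eq n 0 x / Fq n 0 0 x else 0)" for x
  define K :: "(bool \<times> nat \<Rightarrow> real) set" where "K = {u. (\<forall>i>n. u (True, i) = 0 \<and> u (False, i) = 0) \<and> u (False, 0) = 1 \<and> u (True, n) = 1 \<and>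
     (\<forall>i<n. if i \<in> S \<longleftrightarrow> 0 \<in> S then 0 < u (False, i) else u (False, i) < 0)}"
  define aa where "aa u = (\<lambda>i. u (True, i))" for u :: "bool \<times> nat \<Rightarrow> real"
  define bb where "bb u = (\<lambda>i. if i < n then u (True, i) * u (False, n) - u (False, i) else u (False, i))" for u :: "bool \<times> nat \<Rightarrow> real"
  define \<rho> where "\<rho> u = cfg n (aa u) (bb u)" for u
  have \<kappa>_cfg: "\<kappa> (cfg n a b) = (\<lambda>(c, i). if c then a i else if i < n then minor n i a b else b i)"
    if "cpt n a b" "minor n 0 a b = 1" "a n = 1" for a b
    using that cpt_nrm[OF n that(1)] cpt_out[OF that(1)] n by (auto simp: \<kappa>_def Fq_cfg[OF n] Eq_cfg[OF n] Aq_cfg)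
  have lamK: "minor n i (aa u) (bb u) = u (False, i)" if "u \<in> K" "i < n" for u i
    using that by (simp add: minor_def K_def aa_def bb_def)
  have nzK: "u (False, i) \<noteq> 0" if "u \<in> K" "i < n" for u i
    using that unfolding K_def by (auto split: if_splits)
  have Kc: "cpt n (aa u) (bb u)" if u: "u \<in> K" for u
  proof (rule cptI)
    have "aa u i * bb u n \<noteq> aa u n * bb u i" if "i < n" for i
      using lamK[OF u that] nzK[OF u that] that by (simp add: minor_def)
    moreover have "aa u n = 1" using u by (simp add: K_def aa_def)
    ultimately show "good n (aa u) (bb u)" unfolding good_def by (metis mult_zero_right zero_neq_one mult.left_neutral)
  qed (use u in \<open>auto simp: K_def aa_def bb_def\<close>)
  show ?thesis
  proof (rule sconn_convex_chart[of _ _ \<kappa> K \<rho>])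
    show U: "?U \<subseteq> topspace (RC n)" by (auto simp: regF_def)
    have F0: "Fq n 0 0 x \<noteq> 0" if "x \<in> ?U" for x using that n unfolding regF_def by (auto dest!: bspec[of _ _ 0])
    show "continuous_map (subtopology (RC n) ?U) euclideanreal (\<lambda>x. \<kappa> x i)" for i
    proof -
      obtain c m where i: "i = (c, m)" by force
      show ?thesis
        unfolding \<kappa>_def i using F0
        by (cases c; cases "m < n"; cases "m = n"; simp only: prod.case if_True if_False)
          (intro continuous_intros continuous_map_from_subtopology; auto)+
    qed
    show "\<kappa> x \<in> K" if x: "x \<in> ?U" for x
    proof -
      obtain a b where ab: "cpt n a b" "minor n 0 a b = 1" "a n = 1" "x = cfg n a b" using regF_casesA[OF n] x by blast
      have "\<forall>i<n. if i \<in> S \<longleftrightarrow> 0 \<in> S then minor n i a b > 0 else minor n i a b < 0"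
        using x[unfolded ab(4)] ab(2) by (simp add: cfg_in_regF[OF n ab(1)] cong: if_cong)
      then show ?thesis using ab cpt_out[OF ab(1)] n by (auto simp: \<kappa>_cfg K_def)
    qed
    show "(\<lambda>i. (1 - s) * u i + s * w i) \<in> K" if "u \<in> K" "w \<in> K" "0 \<le> s" "s \<le> 1" for u w s
      using that unfolding K_def mem_Collect_eq
      by (auto simp: convex_comb_same[of s 1, simplified] intro!: convex_comb_less convex_comb_gr)
    show "\<rho> u \<in> ?U" if "u \<in> K" for u
    proof -
      have "\<rho> u \<in> regF n S"
        unfolding \<rho>_def cfg_in_regF[OF n Kc[OF that]] using that lamK[OF that] n by (auto simp: K_def)
      moreover have "Aq n (\<rho> u) n n \<noteq> 0"
        unfolding \<rho>_def Aq_cfg_0[OF n Kc[OF that]] using that by (simp add: K_def aa_def)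
      ultimately show ?thesis by simp
    qed
    show "\<rho> (\<kappa> x) = x" if x: "x \<in> ?U" for x
    proof -
      obtain a b where ab: "cpt n a b" "minor n 0 a b = 1" "a n = 1" "x = cfg n a b" using regF_casesA[OF n] x by blast
      have "aa (\<kappa> x) = a" "bb (\<kappa> x) = b"
        unfolding ab(4) \<kappa>_cfg[OF ab(1-3)] using ab(3) by (auto simp: aa_def bb_def minor_def fun_eq_iff)
      then show ?thesis using ab by (simp add: \<rho>_def)
    qed
    show "continuous_map T (RC n) (\<lambda>z. \<rho> (u z))"
      if u: "\<And>i. continuous_map T euclideanreal (\<lambda>z. u z i)" "\<And>z. z \<in> topspace T \<Longrightarrow> u z \<in> K"
      for T :: "(real \<times> real) topology" and u
      unfolding \<rho>_def
    proof (rule continuous_map_cfg[OF n])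
      show "continuous_map T euclideanreal (\<lambda>z. bb (u z) i)" for i
        unfolding bb_def by (cases "i < n"; simp) (intro continuous_intros u(1))+
      show "continuous_map T euclideanreal (\<lambda>z. aa (u z) i)" for i
        unfolding aa_def by (rule u(1))
    qed (use u(2) Kc cpt_def in auto)
  qed
qed

lemma sconn_Wreg: "n \<ge> 2 \<Longrightarrow> sconn (RC n) (Wreg n S j)"
  unfolding Wreg_def using sconn_regA sconn_regFA sconn_regFB by simp

text \<open>
  The configurations whose lines \<open>(a\<^sub>i : b\<^sub>i)\<close>, \<open>i < n\<close>, together with the two coordinate axes are
  pairwise different. They contain the stratum \<open>a\<^sub>n = b\<^sub>n = 0\<close>. Coordinates are
  the point \<open>(a\<^sub>n, b\<^sub>n)\<close>, the \<open>b\<^sub>i\<close> and the slopes \<open>a\<^sub>i / b\<^sub>i\<close> after the normalisation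
  \<open>a\<^sub>0 = b\<^sub>0 = 1\<close>; slope number \<open>n + 1\<close> is that of the wall \<open>a\<^sub>n = 0\<close>.
\<close>

definition UU :: "nat \<Rightarrow> (nat \<Rightarrow> (nat \<Rightarrow> real) set) set" where
  "UU n = {x \<in> topspace (RC n). (\<forall>i\<in>{..<n}. Aq n x i i \<noteq> 0 \<and> Bq n x i i \<noteq> 0) \<and>
     (\<forall>i\<in>{..<n}. \<forall>j\<in>{..<n}. i \<noteq> j \<longrightarrow> Gq n i j x \<noteq> 0)}"

definition ua where "ua n x = Aq n x n 0 / Aq n x 0 0"
definition va where "va n x = Bq n x n 0 / Bq n x 0 0"
definition ba where "ba n x i = Bq n x i 0 / Bq n x 0 0"
definition ra where "ra n x i = (if i < n then (Aq n x i 0 / Aq n x 0 0) / (Bq n x i 0 / Bq n x 0 0) else 0)"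

text \<open>The index \<open>n\<close> is absent because its wall \<open>b n = 0\<close> has
  infinite slope in the plane of \<open>(a n, b n)\<close>; every other wall is the line of points
  with \<open>a n\<close> equal to its slope times \<open>b n\<close>.\<close>

definition slopes :: "nat \<Rightarrow> nat set" where "slopes n = {..n+1} - {n}"

text \<open>The cell of \<open>x\<close> in \<open>UU n\<close>, given by the signs of the
  \<open>b i\<close> and the order of the slopes; as slope \<open>n + 1\<close> is zero, the order
  includes the signs of the slopes. The last coordinates are free, so the cell extends to all sides
  of the walls meeting in the stratum.\<close>

definition UC :: "nat \<Rightarrow> (nat \<Rightarrow> (nat \<Rightarrow> real) set) \<Rightarrow> (nat \<Rightarrow> (nat \<Rightarrow> real) set) set" where
  "UC n x = {y \<in> UU n. (\<forall>i\<in>{..<n}. if 0 < ba n x i then 0 < ba n y i else ba n y i < 0) \<and>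
     (\<forall>i\<in>slopes n. \<forall>j\<in>slopes n. ra n x i < ra n x j \<longrightarrow> ra n y i < ra n y j)}"

lemma UU_subset: "UU n \<subseteq> topspace (RC n)"
  by (auto simp: UU_def)

lemma cfg_in_UU:
  assumes "n \<ge> 2" "cpt n a b"
  shows "cfg n a b \<in> UU n \<longleftrightarrow> (\<forall>i<n. a i \<noteq> 0 \<and> b i \<noteq> 0) \<and> (\<forall>i<n. \<forall>j<n. i \<noteq> j \<longrightarrow> a i * b j \<noteq> a j * b i)"
  unfolding UU_def using assms by (auto simp: Aq_cfg_0 Bq_cfg_0 Gq_cfg_0 cpt_nrm)

lemma UU_cases:
  assumes n: "n \<ge> 2" and x: "x \<in> UU n"
  obtains a b where "cpt n a b" "a 0 = 1" "b 0 = 1" "x = cfg n a b"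
proof -
  obtain a b where ab: "cpt n a b" "x = cfg n a b" using RC_cpt_cases[OF n] x UU_subset by blast
  then have nz: "a 0 \<noteq> 0" "b 0 \<noteq> 0" using x cfg_in_UU[OF n ab(1)] n by auto
  then show thesis
    using that[of "\<lambda>i. (1 / a 0) * a i" "\<lambda>i. (1 / b 0) * b i"] cpt_scale[OF ab(1), of "1 / a 0" "1 / b 0"]
      cfg_scale[of "1 / a 0" "1 / b 0" n a b] ab by simp
qed

lemma UU_coords:
  assumes n: "n \<ge> 2" and ab: "cpt n a b" "a 0 = 1" "b 0 = 1"
  shows "ua n (cfg n a b) = a n" "va n (cfg n a b) = b n" "ba n (cfg n a b) i = b i"
    "ra n (cfg n a b) i = (if i < n then a i / b i else 0)"
  using ab cpt_nrm[OF n ab(1)] by (auto simp: ua_def va_def ba_def ra_def Aq_cfg Bq_cfg)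

lemma openin_UU: "openin (RC n) (UU n)"
  unfolding UU_def
  by (intro openin_conj openin_ball openin_imp openin_neq continuous_intros) auto

lemma UU_nz:
  assumes n: "n \<ge> 2" and x: "x \<in> UU n" and i: "i < n"
  shows "Aq n x i 0 \<noteq> 0" "Bq n x i 0 \<noteq> 0" "ba n x i \<noteq> 0" "ra n x i \<noteq> 0"
proof -
  obtain a b where ab: "cpt n a b" "a 0 = 1" "b 0 = 1" "x = cfg n a b" using UU_cases[OF n x] by blast
  then have "a i \<noteq> 0 \<and> b i \<noteq> 0" using x cfg_in_UU[OF n ab(1)] i by auto
  then show "Aq n x i 0 \<noteq> 0" "Bq n x i 0 \<noteq> 0" "ba n x i \<noteq> 0" "ra n x i \<noteq> 0"
    using ab UU_coords[OF n ab(1-3)] cpt_nrm[OF n ab(1)] i by (auto simp: Aq_cfg Bq_cfg)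
qed

lemma UU_inj:
  assumes n: "n \<ge> 2" and x: "x \<in> UU n"
  shows "inj_on (ra n x) (slopes n)"
proof (rule inj_onI, rule ccontr)
  fix i j assume ij: "i \<in> slopes n" "j \<in> slopes n" "ra n x i = ra n x j" "i \<noteq> j"
  obtain a b where ab: "cpt n a b" "a 0 = 1" "b 0 = 1" "x = cfg n a b" using UU_cases[OF n x] by blast
  note u = cfg_in_UU[OF n ab(1), THEN iffD1, OF x[unfolded ab(4)]]
  show False
  proof (cases "i < n \<and> j < n")
    case True
    then have "a i * b j = a j * b i" using ij(3) u ab UU_coords[OF n ab(1-3)] by (simp add: field_simps)
    then show False using u True ij(4) by blast
  next
    case False
    then have "i < n \<and> j = n + 1 \<or> j < n \<and> i = n + 1" using ij by (auto simp: slopes_def)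
    then show False using ij(3) UU_nz(4)[OF n x] by (auto simp: ra_def)
  qed
qed

lemma continuous_map_UU:
  assumes n: "n \<ge> 2"
  shows "continuous_map (subtopology (RC n) (UU n)) euclideanreal (ua n)"
    "continuous_map (subtopology (RC n) (UU n)) euclideanreal (va n)"
    "continuous_map (subtopology (RC n) (UU n)) euclideanreal (\<lambda>x. ba n x i)"
    "continuous_map (subtopology (RC n) (UU n)) euclideanreal (\<lambda>x. ra n x i)"
proof -
  note nz = UU_nz(1,2)[OF n]
  have n0: "0 < n" using n by simp
  have "continuous_map (subtopology (RC n) (UU n)) euclideanreal (\<lambda>x. ua n x)"
    unfolding ua_def using nz n0 by (intro continuous_intros continuous_map_from_subtopology) auto
  then show "continuous_map (subtopology (RC n) (UU n)) euclideanreal (ua n)" by simp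
  have "continuous_map (subtopology (RC n) (UU n)) euclideanreal (\<lambda>x. va n x)"
    unfolding va_def using nz n0 by (intro continuous_intros continuous_map_from_subtopology) auto
  then show "continuous_map (subtopology (RC n) (UU n)) euclideanreal (va n)" by simp
  show "continuous_map (subtopology (RC n) (UU n)) euclideanreal (\<lambda>x. ba n x i)"
    unfolding ba_def using nz n0 by (intro continuous_intros continuous_map_from_subtopology) auto
  show "continuous_map (subtopology (RC n) (UU n)) euclideanreal (\<lambda>x. ra n x i)"
    unfolding ra_def using nz n0
    by (cases "i < n"; simp) (intro continuous_intros continuous_map_from_subtopology; auto)
qed

lemma openin_UC:
  assumes n: "n \<ge> 2" shows "openin (RC n) (UC n x)"
proof -
  let ?Y = "subtopology (RC n) (UU n)"
  have t: "topspace ?Y = UU n" using UU_subset by (auto simp: topspace_subtopology)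
  have "openin ?Y {y \<in> topspace ?Y. (\<forall>i\<in>{..<n}. if 0 < ba n x i then 0 < ba n y i else ba n y i < 0) \<and>
     (\<forall>i\<in>slopes n. \<forall>j\<in>slopes n. ra n x i < ra n x j \<longrightarrow> ra n y i < ra n y j)}"
    by (intro openin_conj openin_ball openin_if openin_imp openin_less continuous_map_UU[OF n])
      (auto simp: slopes_def)
  then have "openin ?Y (UC n x)" unfolding t UC_def by simp
  then show ?thesis using openin_UU openin_trans_full by blast
qed

lemma UC_refl:
  assumes n: "n \<ge> 2" and x: "x \<in> UU n" shows "x \<in> UC n x"
  using x UU_nz(3)[OF n x] unfolding UC_def by force

text \<open>Only one implication is built into the cell; as the slopes at \<open>x\<close> are
  pairwise different, it becomes an equivalence.\<close>

lemma UC_order: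
  assumes n: "n \<ge> 2" and x: "x \<in> UU n" and y: "y \<in> UC n x" and ij: "i \<in> slopes n" "j \<in> slopes n"
  shows "ra n y i < ra n y j \<longleftrightarrow> ra n x i < ra n x j"
proof (cases "i = j")
  case False
  then have "ra n x i \<noteq> ra n x j" using UU_inj[OF n x] ij by (meson inj_onD)
  then show ?thesis using y ij unfolding UC_def by (metis (mono_tags, lifting) linorder_less_linear mem_Collect_eq order_less_asym')
qed simp

lemma UC_sign:
  assumes n: "n \<ge> 2" and y: "y \<in> UC n x" and i: "i < n"
  shows "0 < ba n y i \<longleftrightarrow> 0 < ba n x i"
  using y i unfolding UC_def by (auto split: if_splits dest!: bspec[of _ _ i])

text \<open>Signs of the \<open>b i\<close> and comparisons of slopes are linear in the coordinates
  slope, \<open>b i\<close>, \<open>a n\<close>, \<open>b n\<close>, so the cell is convex in them.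
  In terms of \<open>a i\<close> and \<open>b i\<close> a comparison of slopes would not be
  linear.\<close>

lemma sconn_UC:
  assumes n: "n \<ge> 2" and x0: "x0 \<in> UU n" shows "sconn (RC n) (UC n x0)"
proof -
  let ?U = "UC n x0"
  define \<kappa> where "\<kappa> x = (\<lambda>(c, i). if c then if i < n then ra n x i else if i = n then ua n x else 0 else ba n x i)" for x
  let ?r = "\<lambda>u i. if i < n then u (True, i) else 0 :: real"
  define K :: "(bool \<times> nat \<Rightarrow> real) set" where "K = {u. (\<forall>i>n. u (True, i) = 0 \<and> u (False, i) = 0) \<and> u (True, 0) = 1 \<and> u (False, 0) = 1 \<and>
     (\<forall>i\<in>{..<n}. if 0 < ba n x0 i then 0 < u (False, i) else u (False, i) < 0) \<and>
     (\<forall>i\<in>slopes n. \<forall>j\<in>slopes n. ra n x0 i < ra n x0 j \<longrightarrow> 0 < ?r u j - ?r u i)}"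
  define aa where "aa u = (\<lambda>i. if i < n then u (True, i) * u (False, i) else u (True, i))" for u :: "bool \<times> nat \<Rightarrow> real"
  define bb where "bb u = (\<lambda>i. u (False, i))" for u :: "bool \<times> nat \<Rightarrow> real"
  define \<rho> where "\<rho> u = cfg n (aa u) (bb u)" for u
  have \<kappa>_cfg: "\<kappa> (cfg n a b) = (\<lambda>(c, i). if c then if i < n then a i / b i else a i else b i)"
    if "cpt n a b" "a 0 = 1" "b 0 = 1" for a b
    using that cpt_out[OF that(1)] UU_coords[OF n that] by (auto simp: \<kappa>_def fun_eq_iff)
  have bK: "u (False, i) \<noteq> 0" if "u \<in> K" "i < n" for u i
    using that unfolding K_def by (auto split: if_splits dest!: bspec[of _ _ i])
  have rK: "?r u i \<noteq> ?r u j" if u: "u \<in> K" and ij: "i \<in> slopes n" "j \<in> slopes n" "i \<noteq> j" for u i j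
  proof -
    have "ra n x0 i \<noteq> ra n x0 j" using UU_inj[OF n x0] ij by (meson inj_onD)
    moreover have "0 < ?r u m - ?r u l" if "l \<in> slopes n" "m \<in> slopes n" "ra n x0 l < ra n x0 m" for l m
      using u that unfolding K_def by blast
    ultimately have "0 < ?r u j - ?r u i \<or> 0 < ?r u i - ?r u j" using ij(1,2) by (meson linorder_neqE)
    then show ?thesis by argo
  qed
  have rK0: "u (True, i) \<noteq> 0" if "u \<in> K" "i < n" for u i
    using rK[OF that(1), of i "n+1"] that by (auto simp: slopes_def)
  have gK: "(\<forall>i<n. aa u i \<noteq> 0 \<and> bb u i \<noteq> 0) \<and> (\<forall>i<n. \<forall>j<n. i \<noteq> j \<longrightarrow> aa u i * bb u j \<noteq> aa u j * bb u i)"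
    if u: "u \<in> K" for u
  proof -
    have "u (True, i) \<noteq> u (True, j)" if "i < n" "j < n" "i \<noteq> j" for i j
      using rK[OF u, of i j] that by (simp add: slopes_def)
    then show ?thesis using bK[OF u] rK0[OF u] by (auto simp: aa_def bb_def)
  qed
  have Kc: "cpt n (aa u) (bb u)" if u: "u \<in> K" for u
  proof (rule cptI)
    show "good n (aa u) (bb u)" using gK[OF u] unfolding good_def by blast
  qed (use u in \<open>auto simp: K_def aa_def bb_def\<close>)
  have aK: "aa u 0 = 1" "bb u 0 = 1" if "u \<in> K" for u using that n by (auto simp: K_def aa_def bb_def)
  show ?thesis
  proof (rule sconn_convex_chart[of _ _ \<kappa> K \<rho>])
    show U: "?U \<subseteq> topspace (RC n)" by (auto simp: UC_def UU_def)
    have s: "continuous_map (subtopology (RC n) ?U) euclideanreal f"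
      if "continuous_map (subtopology (RC n) (UU n)) euclideanreal f" for f
      by (rule continuous_map_from_subtopology_mono[OF that]) (auto simp: UC_def)
    show "continuous_map (subtopology (RC n) ?U) euclideanreal (\<lambda>x. \<kappa> x i)" for i
      unfolding \<kappa>_def by (cases i; cases "fst i"; cases "snd i < n"; cases "snd i = n"; simp)
        (intro s continuous_map_UU[OF n])+
    show "\<kappa> x \<in> K" if x: "x \<in> ?U" for x
    proof -
      have xU: "x \<in> UU n" using x by (simp add: UC_def)
      obtain a b where ab: "cpt n a b" "a 0 = 1" "b 0 = 1" "x = cfg n a b" using UU_cases[OF n xU] by blast
      have "?r (\<kappa> x) i = ra n x i" "\<kappa> x (False, i) = ba n x i" for i by (auto simp: \<kappa>_def ra_def)
      then have "(\<forall>i\<in>{..<n}. if 0 < ba n x0 i then 0 < \<kappa> x (False, i) else \<kappa> x (False, i) < 0) \<and>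
        (\<forall>i\<in>slopes n. \<forall>j\<in>slopes n. ra n x0 i < ra n x0 j \<longrightarrow> 0 < ?r (\<kappa> x) j - ?r (\<kappa> x) i)"
        using x unfolding UC_def by auto
      moreover have "(\<forall>i>n. \<kappa> x (True, i) = 0 \<and> \<kappa> x (False, i) = 0) \<and> \<kappa> x (True, 0) = 1 \<and> \<kappa> x (False, 0) = 1"
        using ab cpt_out[OF ab(1)] n by (auto simp: \<kappa>_cfg)
      ultimately show ?thesis unfolding K_def by blast
    qed
    show "(\<lambda>i. (1 - s) * u i + s * w i) \<in> K" if uw: "u \<in> K" "w \<in> K" "0 \<le> s" "s \<le> 1" for u w s
    proof -
      let ?w = "\<lambda>i. (1 - s) * u i + s * w i"
      have e: "?r ?w j - ?r ?w i = (1 - s) * (?r u j - ?r u i) + s * (?r w j - ?r w i)" for i j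
        by (simp add: algebra_simps)
      have 1: "\<forall>i\<in>slopes n. \<forall>j\<in>slopes n. ra n x0 i < ra n x0 j \<longrightarrow> 0 < ?r ?w j - ?r ?w i"
        unfolding e using uw unfolding K_def by (intro ballI impI convex_comb_gr) auto
      have 2: "\<forall>i\<in>{..<n}. if 0 < ba n x0 i then 0 < ?w (False, i) else ?w (False, i) < 0"
        using uw unfolding K_def by (auto intro!: convex_comb_less convex_comb_gr)
      have 3: "(\<forall>i>n. ?w (True, i) = 0 \<and> ?w (False, i) = 0) \<and> ?w (True, 0) = 1 \<and> ?w (False, 0) = 1"
        using uw unfolding K_def by (auto simp: convex_comb_same[of s 1, simplified])
      show ?thesis unfolding K_def using 1 2 3 by blast
    qed
    show "\<rho> u \<in> ?U" if u: "u \<in> K" for u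
    proof -
      have U: "\<rho> u \<in> UU n" unfolding \<rho>_def cfg_in_UU[OF n Kc[OF u]] by (rule gK[OF u])
      have "ra n (\<rho> u) i = ?r u i" "ba n (\<rho> u) i = u (False, i)" for i
        unfolding \<rho>_def UU_coords[OF n Kc[OF u] aK[OF u]] using bK[OF u] by (auto simp: aa_def bb_def)
      then show ?thesis using u U unfolding UC_def K_def by auto
    qed
    show "\<rho> (\<kappa> x) = x" if x: "x \<in> ?U" for x
    proof -
      have xU: "x \<in> UU n" using x by (simp add: UC_def)
      obtain a b where ab: "cpt n a b" "a 0 = 1" "b 0 = 1" "x = cfg n a b" using UU_cases[OF n xU] by blast
      have "\<forall>i<n. b i \<noteq> 0" using xU ab cfg_in_UU[OF n ab(1)] by auto
      then have "aa (\<kappa> x) = a" "bb (\<kappa> x) = b"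
        unfolding ab(4) using ab(1-3) by (auto simp: \<kappa>_cfg aa_def bb_def fun_eq_iff)
      then show ?thesis using ab by (simp add: \<rho>_def)
    qed
    show "continuous_map T (RC n) (\<lambda>z. \<rho> (u z))"
      if u: "\<And>i. continuous_map T euclideanreal (\<lambda>z. u z i)" "\<And>z. z \<in> topspace T \<Longrightarrow> u z \<in> K"
      for T :: "(real \<times> real) topology" and u
      unfolding \<rho>_def
    proof (rule continuous_map_cfg[OF n])
      show "continuous_map T euclideanreal (\<lambda>z. aa (u z) i)" for i
        unfolding aa_def by (cases "i < n"; simp) (intro continuous_intros u(1))+
      show "continuous_map T euclideanreal (\<lambda>z. bb (u z) i)" for i
        unfolding bb_def by (rule u(1))
    qed (use u(2) Kc cpt_def in auto)
  qed
qed

subsection \<open>Strata and chambers\<close>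

text \<open>For \<open>j < n\<close> the normalised square of the minor is used, since the minor
  itself depends on the representatives.\<close>

definition vanish :: "nat \<Rightarrow> nat \<Rightarrow> (nat \<Rightarrow> (nat \<Rightarrow> real) set) \<Rightarrow> bool" where
  "vanish n j x \<longleftrightarrow> (if j < n then Fq n j j x = 0 else if j = n then Bq n x n n = 0 else Aq n x n n = 0)"

definition codim2 :: "nat \<Rightarrow> (nat \<Rightarrow> (nat \<Rightarrow> real) set) \<Rightarrow> bool" where
  "codim2 n x \<longleftrightarrow> Aq n x n n = 0 \<and> Bq n x n n = 0"

lemma vanish_cfg:
  assumes "n \<ge> 2" "cpt n a b" shows "vanish n j (cfg n a b) \<longleftrightarrow> minor n j a b = 0"
  using assms cpt_nrm[OF assms]
  by (auto simp: vanish_def Fq_cfg[OF assms] Aq_cfg_0[OF assms] Bq_cfg_0[OF assms] minor_def)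

lemma codim2_cfg:
  assumes "n \<ge> 2" "cpt n a b" shows "codim2 n (cfg n a b) \<longleftrightarrow> a n = 0 \<and> b n = 0"
  by (simp add: codim2_def Aq_cfg_0[OF assms] Bq_cfg_0[OF assms])

text \<open>If rows \<open>i\<close> and \<open>j\<close> are both parallel to a nonzero row
  \<open>n\<close>, they are parallel to each other, which general position forbids. If one entry of
  row \<open>n\<close> is zero and some row is parallel to it, the other entry vanishes as well.
  Hence walls meet only in the stratum of codimension two.\<close>

lemma good_two_vanish:
  assumes n: "n \<ge> 2" and ab: "cpt n a b" and ij: "i \<le> n+1" "j \<le> n+1" "i \<noteq> j"
    and z: "minor n i a b = 0" "minor n j a b = 0"
  shows "a n = 0 \<and> b n = 0"
proof -
  have g: "good n a b" using ab by (simp add: cpt_def)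
  have key: "a n = 0 \<and> b n = 0" if "i < n" "minor n i a b = 0" "a n = 0 \<or> b n = 0" for i
    using that g unfolding good_def minor_def by auto
  consider "i < n" "j < n" | "i < n" "\<not> j < n" | "\<not> i < n" "j < n" | "\<not> i < n" "\<not> j < n" by blast
  then show ?thesis
  proof cases
    case 1
    then have e: "a i * b n = a n * b i" "a j * b n = a n * b j" using z by (auto simp: minor_def)
    then have m: "a i * b j \<noteq> a j * b i" using g 1 ij(3) unfolding good_def by blast
    have "a n * (a i * b j - a j * b i) = 0" "b n * (a i * b j - a j * b i) = 0"
    proof -
      have "a n * (a i * b j - a j * b i) = a i * (a n * b j) - a j * (a n * b i)" by algebra
      then show "a n * (a i * b j - a j * b i) = 0" unfolding e[symmetric] by simp
      have "b n * (a i * b j - a j * b i) = (a i * b n) * b j - (a j * b n) * b i" by algebra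
      then show "b n * (a i * b j - a j * b i) = 0" unfolding e by simp
    qed
    then show ?thesis using m by simp
  next
    case 2
    then have "a n = 0 \<or> b n = 0" using z(2) by (auto simp: minor_def split: if_splits)
    then show ?thesis using key[OF 2(1) z(1)] by blast
  next
    case 3
    then have "a n = 0 \<or> b n = 0" using z(1) by (auto simp: minor_def split: if_splits)
    then show ?thesis using key[OF 3(2) z(2)] by blast
  next
    case 4 then show ?thesis using z ij by (auto simp: minor_def le_Suc_eq)
  qed
qed

lemma vanish_unique:
  assumes n: "n \<ge> 2" and x: "x \<in> topspace (RC n)" "\<not> codim2 n x"
    and "vanish n i x" "vanish n j x" "i \<le> n+1" "j \<le> n+1"
  shows "i = j"
proof (rule ccontr)
  assume "i \<noteq> j"
  obtain a b where ab: "cpt n a b" "x = cfg n a b" using RC_cpt_cases[OF n x(1)] by blast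
  show False using good_two_vanish[OF n ab(1) assms(6,7) \<open>i \<noteq> j\<close>] assms vanish_cfg[OF n ab(1)] codim2_cfg[OF n ab(1)] ab by simp
qed

lemma regA_iff:
  assumes n: "n \<ge> 2" and ab: "cpt n a b" and S: "S \<subseteq> {..<n}" and nz: "\<And>j. j \<le> n+1 \<Longrightarrow> minor n j a b \<noteq> 0"
  shows "cfg n a b \<in> regA n {} S \<longleftrightarrow> S = {i. i < n \<and> a n * b n * minor n i a b < 0}"
proof -
  have "a n \<noteq> 0" "b n \<noteq> 0" using nz[of n] nz[of "n+1"] by (auto simp: minor_def)
  moreover from this have "a n * b n * minor n i a b \<noteq> 0" if "i < n" for i using nz[of i] that by auto
  moreover have "(\<forall>i\<in>{..<n} - {}. if i \<in> S then a n * b n * minor n i a b < 0 else 0 < a n * b n * minor n i a b) \<longleftrightarrow>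
    (\<forall>i<n. i \<in> S \<longleftrightarrow> a n * b n * minor n i a b < 0)"
    using calculation(3) by (metis DiffI Diff_empty lessThan_iff linorder_neqE order_less_asym')
  ultimately show ?thesis unfolding cfg_in_regA[OF n ab] using S by blast
qed

lemma regA_subset: "regA n Q S \<subseteq> topspace (RC n)" by (auto simp: regA_def)

lemma Wreg_subset: "Wreg n S j \<subseteq> topspace (RC n)"
  using regA_subset regF_subset[of n S] by (auto simp: Wreg_def split: if_splits)

lemma regA_subset_Wreg:
  assumes n: "n \<ge> 2" shows "regA n {} S \<subseteq> Wreg n S j"
proof
  fix x assume x: "x \<in> regA n {} S"
  obtain a b where ab: "cpt n a b" "a n = 1" "b n = 1" "x = cfg n a b" using regA_cases[OF n x] by blast
  have s: "\<forall>i<n. if i \<in> S then minor n i a b < 0 else minor n i a b > 0"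
    using x[unfolded ab(4) cfg_in_regA[OF n ab(1)] ab(2,3)] by (simp cong: if_cong)
  have "if i \<in> S \<longleftrightarrow> 0 \<in> S then minor n i a b * minor n 0 a b > 0 else minor n i a b * minor n 0 a b < 0" if "i < n" for i
    using s[rule_format, OF that] s[rule_format, of 0] n
    by (auto simp: zero_less_mult_iff mult_less_0_iff split: if_splits)
  then have "x \<in> regF n S" unfolding ab(4) cfg_in_regF[OF n ab(1)] by blast
  moreover have "x \<in> regA n {j} S" using x by (auto simp: regA_def)
  moreover have "Aq n x n n \<noteq> 0" "Bq n x n n \<noteq> 0" using x by (auto simp: regA_def)
  ultimately show "x \<in> Wreg n S j" by (simp add: Wreg_def)
qed

text \<open>The region is symmetric in the two chambers that it joins, so a wall can be approached
  from either side.\<close>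

lemma Wreg_acts:
  assumes n: "n \<ge> 2" shows "Wreg n (acts n [j] S) j = Wreg n S j"
proof (cases "j < n")
  case True
  have "i \<in> acts n [j] S \<longleftrightarrow> i \<in> S" if "i < n" "i \<noteq> j" for i
    using acts_single_less[OF True, of i S] that by simp
  then have "regA n {j} (acts n [j] S) = regA n {j} S" unfolding regA_def by (auto cong: if_cong)
  then show ?thesis using True by (simp add: Wreg_def)
next
  case False
  have "(i \<in> acts n [j] S \<longleftrightarrow> 0 \<in> acts n [j] S) \<longleftrightarrow> (i \<in> S \<longleftrightarrow> 0 \<in> S)" if "i < n" "j = n \<or> j = Suc n" for i
    using acts_single_ge[OF that(2)] that(1) n by auto
  moreover have "i \<in> acts n [j] S \<longleftrightarrow> i \<in> S" if "i < n" "\<not> (j = n \<or> j = Suc n)" for i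
    using that False by (auto simp: acts_def flips_def)
  moreover have "0 < n" using n by simp
  ultimately have "(i \<in> acts n [j] S \<longleftrightarrow> 0 \<in> acts n [j] S) \<longleftrightarrow> (i \<in> S \<longleftrightarrow> 0 \<in> S)" if "i < n" for i
    using that by (cases "j = n \<or> j = Suc n") blast+
  then have e: "regF n (acts n [j] S) = regF n S" unfolding regF_def by (auto cong: if_cong)
  show ?thesis unfolding Wreg_def e using False by simp
qed

lemma Wreg_cases:
  assumes n: "n \<ge> 2" and x: "x \<in> Wreg n S j" and S: "S \<subseteq> {..<n}" and j: "j \<le> n+1"
  shows "\<not> codim2 n x \<and> (vanish n j x \<or> x \<in> regA n {} S \<or> x \<in> regA n {} (acts n [j] S))"
proof -
  obtain a b where ab: "cpt n a b" "x = cfg n a b" using RC_cpt_cases[OF n] x Wreg_subset by blast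
  note v = vanish_cfg[OF n ab(1)] and A = cfg_in_regA[OF n ab(1)] and F = cfg_in_regF[OF n ab(1)]
    and z = Aq_cfg_0[OF n ab(1)] Bq_cfg_0[OF n ab(1)]
  show ?thesis
  proof (cases "j < n")
    case True
    then have nz: "a n \<noteq> 0" "b n \<noteq> 0" and s: "\<forall>i\<in>{..<n}-{j}. if i \<in> S then a n * b n * minor n i a b < 0 else a n * b n * minor n i a b > 0"
      using x unfolding ab(2) Wreg_def by (simp_all add: A)
    \<comment> \<open>The free sign at \<open>j\<close> decides which of the two chambers contains
      \<open>x\<close>; all other signs agree on both sides.\<close>
    have "x \<in> regA n {} (if j \<in> S \<longleftrightarrow> a n * b n * minor n j a b < 0 then S else acts n [j] S)" if "minor n j a b \<noteq> 0"
    proof -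
      have m: "i \<in> acts n [j] S \<longleftrightarrow> (i \<in> S \<longleftrightarrow> i \<noteq> j)" if "i < n" for i
        using acts_single_less[OF True] that by simp
      have p: "a n * b n * minor n j a b \<noteq> 0" using that nz by simp
      have "if i \<in> (if j \<in> S \<longleftrightarrow> a n * b n * minor n j a b < 0 then S else acts n [j] S) then a n * b n * minor n i a b < 0 else a n * b n * minor n i a b > 0"
        if i: "i < n" for i
      proof (cases "i = j")
        case True then show ?thesis using p m[OF i] by (auto simp: not_less_iff_gr_or_eq)
      next
        case False then show ?thesis using s i m[OF i] by auto
      qed
      then show ?thesis unfolding ab(2) A using nz by blast
    qed
    moreover have "\<not> codim2 n x" "vanish n j x \<longleftrightarrow> minor n j a b = 0"
      unfolding ab(2) v codim2_cfg[OF n ab(1)] using nz(1) by auto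
    ultimately show ?thesis by (metis (full_types))
  next
    case False
    then have f: "\<And>i. i < n \<Longrightarrow> if i \<in> S \<longleftrightarrow> 0 \<in> S then minor n i a b * minor n 0 a b > 0 else minor n i a b * minor n 0 a b < 0"
      and nz: "if j = n then a n \<noteq> 0 else b n \<noteq> 0"
      using x unfolding ab(2) Wreg_def by (auto simp: F z split: if_splits)
    have jj: "j = n \<or> j = Suc n" using False j by auto
    have n0: "0 < n" using n by simp
    have l0: "minor n 0 a b \<noteq> 0" using f[OF n0] by auto
    have "x \<in> regA n {} (if 0 \<in> S \<longleftrightarrow> a n * b n * minor n 0 a b < 0 then S else acts n [j] S)" if "minor n j a b \<noteq> 0"
    proof -
      have ab0: "a n \<noteq> 0" "b n \<noteq> 0" using that nz jj by (auto simp: minor_def)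
      have "if i \<in> (if 0 \<in> S \<longleftrightarrow> a n * b n * minor n 0 a b < 0 then S else acts n [j] S) then a n * b n * minor n i a b < 0 else a n * b n * minor n i a b > 0"
        if i: "i < n" for i
      proof -
        have m: "i \<in> acts n [j] S \<longleftrightarrow> i \<notin> S" using acts_single_ge[OF jj, of i S] i by simp
        define p where "p = a n * b n"
        have p: "p \<noteq> 0" using ab0 by (simp add: p_def)
        show ?thesis using f[OF i] m p l0 unfolding p_def[symmetric]
          by (auto simp: zero_less_mult_iff mult_less_0_iff split: if_splits)
      qed
      then show ?thesis unfolding ab(2) A using ab0 by blast
    qed
    moreover have "\<not> codim2 n x" using nz unfolding ab(2) codim2_cfg[OF n ab(1)] by presburger
    moreover have "vanish n j x \<longleftrightarrow> minor n j a b = 0" unfolding ab(2) v ..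
    ultimately show ?thesis by (metis (full_types))
  qed
qed

lemma stratum_cases:
  assumes n: "n \<ge> 2" and x: "x \<in> topspace (RC n)"
  obtains "codim2 n x" | j S where "\<not> codim2 n x" "j \<le> n+1" "vanish n j x" "S \<subseteq> {..<n}" "x \<in> Wreg n S j"
    | S where "S \<subseteq> {..<n}" "x \<in> regA n {} S"
proof -
  obtain a b where ab: "cpt n a b" "x = cfg n a b" using RC_cpt_cases[OF n x] by blast
  note v = vanish_cfg[OF n ab(1)] and A = cfg_in_regA[OF n ab(1)] and F = cfg_in_regF[OF n ab(1)]
    and z = Aq_cfg_0[OF n ab(1)] Bq_cfg_0[OF n ab(1)] and c2 = codim2_cfg[OF n ab(1)]
  consider "codim2 n x" | "\<not> codim2 n x" "\<exists>j\<le>n+1. minor n j a b = 0" | "\<not> codim2 n x" "\<forall>j\<le>n+1. minor n j a b \<noteq> 0" by blast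
  then show thesis
  proof cases
    case 1 then show thesis using that(1) by blast
  next
    case 2
    then obtain j where j: "j \<le> n+1" "minor n j a b = 0" by blast
    have nz: "minor n i a b \<noteq> 0" if "i \<le> n+1" "i \<noteq> j" for i
      using good_two_vanish[OF n ab(1) that(1) j(1) that(2) _ j(2)] 2 ab c2 by blast
    show thesis
    proof (cases "j < n")
      case True
      let ?S = "{i. i < n \<and> a n * b n * minor n i a b < 0}"
      have "a n \<noteq> 0" "b n \<noteq> 0" using nz[of n] nz[of "n+1"] True by (auto simp: minor_def)
      moreover have "a n * b n * minor n i a b \<noteq> 0" if "i < n" "i \<noteq> j" for i using nz[of i] that calculation by auto
      ultimately have "x \<in> regA n {j} ?S" unfolding ab(2) A by (auto simp: not_less_iff_gr_or_eq)
      then show thesis using that(2)[of j ?S] j 2 v ab(2) True by (auto simp: Wreg_def)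
    next
      case False
      let ?S = "{i. i < n \<and> minor n i a b * minor n 0 a b < 0}"
      have l: "minor n i a b * minor n 0 a b \<noteq> 0" if "i < n" for i using nz[of i] nz[of 0] that False by auto
      have "minor n 0 a b * minor n 0 a b > 0" using l[of 0] n by (auto simp: zero_less_mult_iff linorder_neq_iff)
      then have "if i \<in> ?S \<longleftrightarrow> 0 \<in> ?S then minor n i a b * minor n 0 a b > 0 else minor n i a b * minor n 0 a b < 0" if "i < n" for i
        using l[OF that] that by (simp add: not_less_iff_gr_or_eq less_not_sym)
      then have "x \<in> regF n ?S" unfolding ab(2) F by blast
      moreover have "if j = n then Aq n x n n \<noteq> 0 else Bq n x n n \<noteq> 0"
        unfolding ab(2) z using nz[of n] nz[of "n+1"] j False by (auto simp: minor_def)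
      ultimately have "x \<in> Wreg n ?S j" using False by (simp add: Wreg_def)
      then show thesis using that(2)[of j ?S] j 2 v ab(2) by auto
    qed
  next
    case 3
    let ?S = "{i. i < n \<and> a n * b n * minor n i a b < 0}"
    have "x \<in> regA n {} ?S" unfolding ab(2) by (subst regA_iff[OF n ab(1)]) (use 3 in auto)
    then show thesis using that(3)[of ?S] by auto
  qed
qed

lemma codim2_UU:
  assumes n: "n \<ge> 2" and x: "x \<in> topspace (RC n)" "codim2 n x" shows "x \<in> UU n"
proof -
  obtain a b where ab: "cpt n a b" "x = cfg n a b" using RC_cpt_cases[OF n x(1)] by blast
  then show ?thesis using x codim2_cfg[OF n ab(1)] unfolding ab(2) cfg_in_UU[OF n ab(1)]
    by (auto simp: cpt_def good_def)
qed

lemma regA_not_vanish: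
  assumes n: "n \<ge> 2" and x: "x \<in> regA n {} S" and j: "j \<le> n+1" shows "\<not> vanish n j x" "\<not> codim2 n x"
proof -
  obtain a b where ab: "cpt n a b" "a n = 1" "b n = 1" "x = cfg n a b" using regA_cases[OF n x] by blast
  have "minor n i a b \<noteq> 0" if "i < n" for i
    using x[unfolded ab(4) cfg_in_regA[OF n ab(1)] ab(2,3)] that by (auto dest!: bspec[of _ _ i] split: if_splits)
  then show "\<not> vanish n j x" "\<not> codim2 n x"
    unfolding ab(4) vanish_cfg[OF n ab(1)] codim2_cfg[OF n ab(1)] using ab j by (cases "j < n"; auto simp: minor_def)+
qed

lemma regA_Eq: "x \<in> regA n {} S \<Longrightarrow> i < n \<Longrightarrow> i \<in> S \<longleftrightarrow> Eq n i x < 0"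
  unfolding regA_def by (auto dest!: bspec[of _ _ i] split: if_splits)

subsection \<open>Sectors around the stratum of codimension two\<close>

text \<open>\<open>wt\<close> records the walls crossed when the point \<open>(a\<^sub>n, b\<^sub>n)\<close> turns around the origin, starting on
  the negative side of the first axis; a point on a wall is assigned to the sector before it.\<close>

definition srt :: "(nat \<Rightarrow> real) \<Rightarrow> nat set \<Rightarrow> nat list" where
  "srt f N = sort_key f (sorted_list_of_set N)"

definition wt :: "nat \<Rightarrow> (nat \<Rightarrow> (nat \<Rightarrow> real) set) \<Rightarrow> nat list" where
  "wt n x = (if va n x \<ge> 0 then srt (ra n x) {j \<in> slopes n. ra n x j * va n x < ua n x}
     else srt (ra n x) (slopes n) @ [n] @ srt (ra n x) {j \<in> slopes n. ra n x j * va n x > ua n x})"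

text \<open>The chamber at the start of the turn, where \<open>a n < 0\<close> and
  \<open>b n\<close> is small and positive: there \<open>a n * b n\<close> times minor
  \<open>j\<close> has the sign opposite to that of \<open>b j\<close>.\<close>

definition ch0 :: "nat \<Rightarrow> (nat \<Rightarrow> (nat \<Rightarrow> real) set) \<Rightarrow> nat set" where
  "ch0 n x = {j. j < n \<and> 0 < ba n x j}"

text \<open>A label for every configuration, also on the walls, where one of the two adjacent
  chambers is picked. On \<open>UU n\<close> the pick follows \<open>wt\<close>, which counts a
  point on a wall to the sector before it; elsewhere a vanishing \<open>Eq\<close> counts as
  positive.\<close>

definition ch :: "nat \<Rightarrow> (nat \<Rightarrow> (nat \<Rightarrow> real) set) \<Rightarrow> nat set" where
  "ch n x = (if x \<in> UU n then acts n (wt n x) (ch0 n x)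
     else if Aq n x n n \<noteq> 0 \<and> Bq n x n n \<noteq> 0 then {j. j < n \<and> Eq n j x < 0}
     else {j. j < n \<and> Fq n j 0 x < 0})"

section \<open>Sorting walls by slope\<close>

lemma finite_slopes: "finite (slopes n)" by (simp add: slopes_def)

lemma srt_props:
  assumes "finite N" shows "set (srt f N) = N" "distinct (srt f N)" "sorted (map f (srt f N))"
  using assms by (auto simp: srt_def)

lemma srt_unique:
  assumes "finite N" "inj_on f N" "set xs = N" "distinct xs" "sorted (map f xs)"
  shows "srt f N = xs"
  by (rule map_sorted_distinct_set_unique[of f]) (use assms srt_props[OF assms(1), of f] in \<open>auto simp: distinct_map\<close>)

lemma srt_insert:
  assumes "finite N" "inj_on f N" "\<And>i. i \<in> N \<Longrightarrow> f i < f j"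
  shows "srt f (insert j N) = srt f N @ [j]"
proof (rule srt_unique)
  have j: "j \<notin> N" using assms(3) by blast
  show "inj_on f (insert j N)" using assms by (force simp: inj_on_def)
  show "distinct (srt f N @ [j])" using srt_props[OF assms(1)] j by auto
  show "sorted (map f (srt f N @ [j]))"
    using srt_props[OF assms(1), of f] assms(3) by (auto simp: sorted_append less_imp_le)
qed (use assms srt_props[OF assms(1)] in auto)

lemma srt_cong:
  assumes N: "finite N" "inj_on f N" and fg: "\<And>i j. i \<in> N \<Longrightarrow> j \<in> N \<Longrightarrow> f i < f j \<longleftrightarrow> g i < g j"
  shows "srt f N = srt g N"
proof (rule srt_unique)
  note p = srt_props[OF N(1), of g]
  have "f i \<le> f j" if "i \<in> N" "j \<in> N" "g i \<le> g j" for i j using fg[of j i] that by (meson not_le)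
  then show "sorted (map f (srt g N))"
    using p(3) p(1) sorted_wrt_mono_rel[of "srt g N" "\<lambda>x y. g x \<le> g y" "\<lambda>x y. f x \<le> f y"]
    unfolding sorted_map by blast
qed (use N srt_props[OF N(1)] in auto)

lemma srt_empty [simp]: "srt f {} = []" by (simp add: srt_def)

lemma slopes_mem: "n + 1 \<in> slopes n" "i < n \<Longrightarrow> i \<in> slopes n" "n \<notin> slopes n" "Suc n \<in> slopes n"
  by (auto simp: slopes_def)

lemma wt_set: "set (wt n x) \<subseteq> {..n+1}"
proof -
  have "set (srt f N) \<subseteq> {..n+1}" if "N \<subseteq> slopes n" for f N
    using that finite_subset[OF that finite_slopes] srt_props(1)[of N f] by (auto simp: slopes_def)
  then show ?thesis unfolding wt_def by auto
qed

text \<open>Across the slit \<open>wt\<close> jumps from the empty word to a full turn, with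
  \<open>L\<close> the sorted slopes \<open>L @ [n] @ L\<close>. The relation for the ordering
  \<open>L @ [n]\<close> says that in the group this turn equals the single letter \<open>n\<close>,
  the transition across the wall that carries the slit.\<close>

lemma slopes_word:
  shows "gel n (srt f (slopes n) @ [n] @ srt f (slopes n)) = gel n [n]"
proof -
  interpret group "Gk (Suc n)" by (rule group_Gk)
  let ?L = "srt f (slopes n) @ [n]"
  have p: "set ?L = {..n+1}" "distinct ?L"
  proof -
    have "slopes n \<union> {n} = {..n+1}" by (auto simp: slopes_def)
    then show "set ?L = {..n+1}" by (simp add: srt_props(1)[OF finite_slopes])
    show "distinct ?L" using srt_props(1,2)[OF finite_slopes[of n], where f=f] slopes_mem(3)[of n] by simp
  qed
  have s: "set (srt f (slopes n) @ [n] @ srt f (slopes n)) \<subseteq> {..n+1}" "set [n] \<subseteq> {..n+1}" using p by auto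
  have "gel n (?L @ ?L) = gel n []" by (rule gel_ordering_square) (use p in auto)
  then have "gel n (srt f (slopes n) @ [n] @ srt f (slopes n)) \<otimes>\<^bsub>Gk (Suc n)\<^esub> gel n [n] = gel n []"
    unfolding gel_append[OF s, symmetric] by simp
  moreover have "gel n [n] \<otimes>\<^bsub>Gk (Suc n)\<^esub> gel n [n] = gel n []"
    unfolding gel_append[OF s(2,2), symmetric] using gel_square[of n n] by simp
  ultimately have "gel n (srt f (slopes n) @ [n] @ srt f (slopes n)) \<otimes>\<^bsub>Gk (Suc n)\<^esub> gel n [n]
     = gel n [n] \<otimes>\<^bsub>Gk (Suc n)\<^esub> gel n [n]" by simp
  then show ?thesis by (rule right_cancel[THEN iffD1, rotated -1]) (rule gel_closed, rule s)+
qed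

text \<open>Among the slopes only the letters \<open>i\<close> and \<open>n + 1\<close> flip sign
  \<open>i\<close>, and they cancel when both occur. The preceding full list together with
  \<open>n\<close> contains three such letters and so adds one flip.\<close>

lemma flips_srt:
  assumes N: "N \<subseteq> slopes n" and i: "i < n"
  shows "flips n (srt f N) i \<longleftrightarrow> (i \<in> N) \<noteq> (n + 1 \<in> N)"
    "flips n (srt f (slopes n) @ [n] @ srt f N) i \<longleftrightarrow> \<not> ((i \<in> N) \<noteq> (n + 1 \<in> N))"
proof -
  have fN: "finite N" using N finite_slopes finite_subset by blast
  have c: "count_list (srt f M) l = (if l \<in> M then 1 else 0)" if "finite M" for M l
    using srt_props[OF that, of f] count_list_distinct by metis
  show "flips n (srt f N) i \<longleftrightarrow> (i \<in> N) \<noteq> (n + 1 \<in> N)"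
    "flips n (srt f (slopes n) @ [n] @ srt f N) i \<longleftrightarrow> \<not> ((i \<in> N) \<noteq> (n + 1 \<in> N))"
    using N i slopes_mem[of n] slopes_mem(2)[OF i] unfolding flips_def by (auto simp: c fN finite_slopes)
qed

section \<open>Chamber labels in the coordinates of the stratum\<close>

context
  fixes n :: nat and x
  assumes n: "n \<ge> 2" and x: "x \<in> UU n"
begin

lemma UU_vanish: "i \<le> n+1 \<Longrightarrow> vanish n i x \<longleftrightarrow> (if i = n then va n x = 0 else ra n x i * va n x = ua n x)"
  and UU_codim2: "codim2 n x \<longleftrightarrow> ua n x = 0 \<and> va n x = 0"
  and UU_Eq: "i < n \<Longrightarrow> Eq n i x < 0 \<longleftrightarrow> ua n x * va n x * (ba n x i * (ra n x i * va n x - ua n x)) < 0"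
  and UU_Fq: "i < n \<Longrightarrow> Fq n i 0 x < 0 \<longleftrightarrow> ba n x i * (ra n x i * va n x - ua n x) * (va n x - ua n x) < 0"
  and UU_Fq': "i < n \<Longrightarrow> Fq n i 0 x > 0 \<longleftrightarrow> ba n x i * (ra n x i * va n x - ua n x) * (va n x - ua n x) > 0"
proof -
  obtain a b where ab: "cpt n a b" "a 0 = 1" "b 0 = 1" "x = cfg n a b" using UU_cases[OF n x] by blast
  have nz: "b i \<noteq> 0" if "i < n" for i using x that unfolding ab(4) cfg_in_UU[OF n ab(1)] by blast
  note c = UU_coords[OF n ab(1-3)]
  have l: "minor n i a b = ba n x i * (ra n x i * va n x - ua n x)" if "i < n" for i
    unfolding ab(4) c using that nz[OF that] by (simp add: minor_def field_simps)
  have l0: "minor n 0 a b = va n x - ua n x" unfolding ab(4) c using n ab by (simp add: minor_def)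
  show "vanish n i x \<longleftrightarrow> (if i = n then va n x = 0 else ra n x i * va n x = ua n x)" if "i \<le> n+1" for i
  proof (cases "i < n")
    case True
    then show ?thesis using l[OF True] nz[OF True] unfolding ab(4) vanish_cfg[OF n ab(1)] by (auto simp: c)
  next
    case False
    then show ?thesis using that unfolding ab(4) vanish_cfg[OF n ab(1)] by (auto simp: c minor_def)
  qed
  show "codim2 n x \<longleftrightarrow> ua n x = 0 \<and> va n x = 0" unfolding ab(4) codim2_cfg[OF n ab(1)] c ..
  show "Eq n i x < 0 \<longleftrightarrow> ua n x * va n x * (ba n x i * (ra n x i * va n x - ua n x)) < 0" if "i < n" for i
    unfolding l[OF that, symmetric] unfolding ab(4) Eq_cfg_sign(2)[OF n ab(1) that] c ..
  have n0: "0 < n" using n by simp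
  show "Fq n i 0 x < 0 \<longleftrightarrow> ba n x i * (ra n x i * va n x - ua n x) * (va n x - ua n x) < 0"
    "Fq n i 0 x > 0 \<longleftrightarrow> ba n x i * (ra n x i * va n x - ua n x) * (va n x - ua n x) > 0" if "i < n" for i
    unfolding l[OF that, symmetric] l0[symmetric] unfolding ab(4) using Fq_cfg_sign[OF n ab(1) that n0] by auto
qed

lemma ch_UU_mem:
  assumes i: "i < n"
  shows "i \<in> ch n x \<longleftrightarrow> (0 < ba n x i) \<noteq>
    (if va n x \<ge> 0 then (ra n x i * va n x < ua n x) \<noteq> (0 < ua n x)
     else \<not> ((ra n x i * va n x > ua n x) \<noteq> (0 > ua n x)))"
proof -
  have r: "ra n x (n+1) = 0" "ra n x (Suc n) = 0" by (auto simp: ra_def)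
  have f: "flips n (srt g {j \<in> slopes n. P j}) i \<longleftrightarrow> P i \<noteq> P (n + 1)"
    "flips n (srt g (slopes n) @ [n] @ srt g {j \<in> slopes n. P j}) i \<longleftrightarrow> \<not> (P i \<noteq> P (n + 1))" for g P
    using flips_srt[of "{j \<in> slopes n. P j}" n i g] i slopes_mem(1)[of n] slopes_mem(2)[OF i] by auto
  have "flips n (wt n x) i \<longleftrightarrow> (if va n x \<ge> 0 then (ra n x i * va n x < ua n x) \<noteq> (0 < ua n x)
     else \<not> ((ra n x i * va n x > ua n x) \<noteq> (0 > ua n x)))"
    unfolding wt_def using f(1)[of "ra n x" "\<lambda>j. ra n x j * va n x < ua n x"]
      f(2)[of "ra n x" "\<lambda>j. ra n x j * va n x > ua n x"] by (simp only: r mult_zero_left if_split) auto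
  then show ?thesis unfolding ch_def acts_def ch0_def using x i by simp
qed

lemma UU_ba0: "ba n x 0 = 1" and UU_ra0: "ra n x 0 = 1" and UU_ba_nz: "i < n \<Longrightarrow> ba n x i \<noteq> 0"
  and UU_ra_nz: "i < n \<Longrightarrow> ra n x i \<noteq> 0"
proof -
  obtain a b where ab: "cpt n a b" "a 0 = 1" "b 0 = 1" "x = cfg n a b" using UU_cases[OF n x] by blast
  show "ba n x 0 = 1" "ra n x 0 = 1" using UU_coords[OF n ab(1-3)] ab n by auto
  show "i < n \<Longrightarrow> ba n x i \<noteq> 0" "i < n \<Longrightarrow> ra n x i \<noteq> 0" using UU_nz[OF n x] by auto
qed

text \<open>Labels on \<open>UU n\<close> come from walls passed, labels elsewhere from signs of
  minors; this makes the two definitions compatible.\<close>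

lemma ch_UU_Eq:
  assumes i: "i < n" and nz: "ua n x \<noteq> 0" "va n x \<noteq> 0" "\<not> vanish n i x"
  shows "i \<in> ch n x \<longleftrightarrow> Eq n i x < 0"
proof -
  have "ra n x i * va n x \<noteq> ua n x" using UU_vanish[of i] nz i by auto
  then show ?thesis unfolding ch_UU_mem[OF i] UU_Eq[OF i] using UU_ba_nz[OF i] nz(1,2)
    by (auto simp: mult_less_0_iff zero_less_mult_iff linorder_neq_iff)
qed

text \<open>On the walls \<open>a n = 0\<close> and \<open>b n = 0\<close> the signs of
  \<open>Eq\<close> are lost. Products with minor 0 still determine the label up to complement,
  which is what the two chambers beside such a wall share.\<close>

lemma ch_UU_Fq:
  assumes z: "ua n x = 0 \<or> va n x = 0" "\<not> codim2 n x"
  shows "(\<forall>i<n. i \<in> ch n x \<longleftrightarrow> Fq n i 0 x < 0) \<or> (\<forall>i<n. i \<in> ch n x \<longleftrightarrow> Fq n i 0 x > 0)"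
proof (cases "va n x = 0")
  case True
  then have u: "ua n x \<noteq> 0" using z UU_codim2 by auto
  have "i \<in> ch n x \<longleftrightarrow> Fq n i 0 x > 0" if i: "i < n" for i
    unfolding ch_UU_mem[OF i] UU_Fq'[OF i] using UU_ba_nz[OF i] u True
    by (auto simp: mult_less_0_iff zero_less_mult_iff linorder_neq_iff)
  then show ?thesis by blast
next
  case False
  then have u: "ua n x = 0" using z by auto
  show ?thesis
  proof (cases "va n x > 0")
    case True
    have "i \<in> ch n x \<longleftrightarrow> Fq n i 0 x > 0" if i: "i < n" for i
      unfolding ch_UU_mem[OF i] UU_Fq'[OF i] using UU_ba_nz[OF i] UU_ra_nz[OF i] u True
      by (auto simp: mult_less_0_iff zero_less_mult_iff linorder_neq_iff)
    then show ?thesis by blast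
  next
    case F: False
    have "i \<in> ch n x \<longleftrightarrow> Fq n i 0 x < 0" if i: "i < n" for i
      unfolding ch_UU_mem[OF i] UU_Fq[OF i] using UU_ba_nz[OF i] UU_ra_nz[OF i] u False F
      by (auto simp: mult_less_0_iff zero_less_mult_iff linorder_neq_iff)
    then show ?thesis by blast
  qed
qed

end

lemma ch_subset: "ch n x \<subseteq> {..<n}"
  by (auto simp: ch_def acts_def)

lemma ch_regA:
  assumes n: "n \<ge> 2" and S: "S \<subseteq> {..<n}" and x: "x \<in> regA n {} S" shows "ch n x = S"
proof -
  have nz: "Aq n x n n \<noteq> 0" "Bq n x n n \<noteq> 0" using x by (auto simp: regA_def)
  have "i \<in> ch n x \<longleftrightarrow> Eq n i x < 0" if i: "i < n" for i
  proof (cases "x \<in> UU n")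
    case True
    have "ua n x \<noteq> 0" "va n x \<noteq> 0"
      using regA_not_vanish(1)[OF n x, of n] regA_not_vanish(1)[OF n x, of "n+1"]
        UU_vanish[OF n True, of n] UU_vanish[OF n True, of "n+1"] by (auto simp: ra_def)
    then show ?thesis using ch_UU_Eq[OF n True i] regA_not_vanish(1)[OF n x, of i] i by simp
  next
    case False then show ?thesis using nz i by (simp add: ch_def)
  qed
  then show ?thesis using regA_Eq[OF x] S ch_subset[of n x] by blast
qed

text \<open>Only points on the wall need an argument: there the signs at indices other than
  \<open>j\<close> survive, and for the last two letters all signs relative to index 0
  survive.\<close>

lemma ch_Wreg:
  assumes n: "n \<ge> 2" and S: "S \<subseteq> {..<n}" and j: "j \<le> n+1" and x: "x \<in> Wreg n S j"
  shows "ch n x = S \<or> ch n x = acts n [j] S"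
proof -
  have xR: "x \<in> topspace (RC n)" using x Wreg_subset by blast
  have n0: "0 < n" using n by simp
  note W = Wreg_cases[OF n x S j]
  show ?thesis
  proof (cases "vanish n j x")
    case False
    then show ?thesis using W ch_regA[OF n] S acts_subset by blast
  next
    case v: True
    show ?thesis
    proof (cases "j < n")
      case True
      then have r: "x \<in> regA n {j} S" using x by (simp add: Wreg_def)
      then have nz: "Aq n x n n \<noteq> 0" "Bq n x n n \<noteq> 0" by (auto simp: regA_def)
      have "i \<in> ch n x \<longleftrightarrow> i \<in> S" if i: "i < n" "i \<noteq> j" for i
      proof -
        have "i \<in> ch n x \<longleftrightarrow> Eq n i x < 0"
        proof (cases "x \<in> UU n")
          case U: True
          have "\<not> vanish n n x" "\<not> vanish n (n+1) x" "\<not> vanish n i x"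
            using vanish_unique[OF n xR conjunct1[OF W] _ v _ j] i True by (auto dest: less_imp_le)
          then show ?thesis using ch_UU_Eq[OF n U i(1)] UU_vanish[OF n U, of n] UU_vanish[OF n U, of "n+1"]
            by (auto simp: ra_def)
        next
          case False then show ?thesis using nz i by (simp add: ch_def)
        qed
        then show ?thesis using r i unfolding regA_def by (auto dest!: bspec[of _ _ i] split: if_splits)
      qed
      then have e: "i \<in> ch n x \<longleftrightarrow> i \<in> S" if "i \<noteq> j" for i using ch_subset[of n x] S that by blast
      show ?thesis
      proof (cases "j \<in> ch n x \<longleftrightarrow> j \<in> S")
        case True
        then have "i \<in> ch n x \<longleftrightarrow> i \<in> S" for i using e by (cases "i = j") auto
        then show ?thesis by blast
      next
        case False
        then have "i \<in> ch n x \<longleftrightarrow> i \<in> acts n [j] S" for i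
          using acts_single_less[OF True, of i S] e[of i] ch_subset[of n x] S by blast
        then show ?thesis by blast
      qed
    next
      case False
      then have jj: "j = n \<or> j = Suc n" using j by auto
      have r: "x \<in> regF n S" using x False by (auto simp: Wreg_def split: if_splits)
      have f: "if i \<in> S \<longleftrightarrow> 0 \<in> S then 0 < Fq n i 0 x else Fq n i 0 x < 0" if "i < n" for i
        using r that unfolding regF_def by auto
      have "(\<forall>i<n. i \<in> ch n x \<longleftrightarrow> Fq n i 0 x < 0) \<or> (\<forall>i<n. i \<in> ch n x \<longleftrightarrow> Fq n i 0 x > 0)"
      proof (cases "x \<in> UU n")
        case U: True
        then show ?thesis using ch_UU_Fq[OF n U] W v UU_vanish[OF n U j] jj by (auto simp: ra_def)
      next
        case U: False
        have "\<not> (Aq n x n n \<noteq> 0 \<and> Bq n x n n \<noteq> 0)" using v jj by (auto simp: vanish_def)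
        then show ?thesis using U by (auto simp: ch_def)
      qed
      then have "(\<forall>i<n. (i \<in> ch n x \<longleftrightarrow> 0 \<in> ch n x) \<longleftrightarrow> (i \<in> S \<longleftrightarrow> 0 \<in> S))"
        using f f[OF n0] n0 by (metis order_less_asym')
      then have "(\<forall>i<n. i \<in> ch n x \<longleftrightarrow> i \<in> S) \<or> (\<forall>i<n. i \<in> ch n x \<longleftrightarrow> i \<notin> S)" by blast
      then show ?thesis using acts_single_ge[OF jj, of _ S] ch_subset[of n x] S by blast
    qed
  qed
qed

lemma ch_codim2:
  assumes n: "n \<ge> 2" and x: "x \<in> topspace (RC n)" "codim2 n x"
  shows "ch n x = ch0 n x" "wt n x = []"
proof -
  have U: "x \<in> UU n" by (rule codim2_UU[OF n x])
  show w: "wt n x = []" using UU_codim2[OF n U] x(2) by (simp add: wt_def)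
  show "ch n x = ch0 n x" using U by (simp add: ch_def w acts_Nil ch0_def subset_eq)
qed

text \<open>A neighbourhood in which all strict inequalities between the coordinates persist.\<close>

definition nb :: "nat \<Rightarrow> (nat \<Rightarrow> (nat \<Rightarrow> real) set) \<Rightarrow> (nat \<Rightarrow> (nat \<Rightarrow> real) set) set" where
  "nb n x = {y \<in> UC n x. (\<forall>i\<in>slopes n. (ra n x i * va n x < ua n x \<longrightarrow> ra n y i * va n y < ua n y) \<and>
      (ua n x < ra n x i * va n x \<longrightarrow> ua n y < ra n y i * va n y)) \<and>
      (0 < va n x \<longrightarrow> 0 < va n y) \<and> (va n x < 0 \<longrightarrow> va n y < 0)}"

section \<open>Continuity of the sector words\<close>

lemma openin_nb:
  assumes n: "n \<ge> 2" shows "openin (RC n) (nb n x)"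
proof -
  let ?Y = "subtopology (RC n) (UC n x)"
  have sub: "UC n x \<subseteq> UU n" by (auto simp: UC_def)
  have t: "topspace ?Y = UC n x" using sub UU_subset by (auto simp: topspace_subtopology)
  have c: "continuous_map ?Y euclideanreal f" if "continuous_map (subtopology (RC n) (UU n)) euclideanreal f" for f
    by (rule continuous_map_from_subtopology_mono[OF that sub])
  note cu = continuous_map_UU[OF n, THEN c]
  have u: "continuous_map ?Y euclideanreal (\<lambda>x. ua n x)" "continuous_map ?Y euclideanreal (\<lambda>x. va n x)"
    using cu(1,2) by simp_all
  have "openin ?Y {y \<in> topspace ?Y. (\<forall>i\<in>slopes n. (ra n x i * va n x < ua n x \<longrightarrow> ra n y i * va n y < ua n y) \<and>
      (ua n x < ra n x i * va n x \<longrightarrow> ua n y < ra n y i * va n y)) \<and>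
      (0 < va n x \<longrightarrow> 0 < va n y) \<and> (va n x < 0 \<longrightarrow> va n y < 0)}"
    by (intro openin_conj openin_ball openin_imp openin_less continuous_intros cu u finite_slopes) auto
  then have "openin ?Y (nb n x)" unfolding t nb_def by simp
  then show ?thesis using openin_UC[OF n] openin_trans_full by blast
qed

lemma nb_refl: "n \<ge> 2 \<Longrightarrow> x \<in> UU n \<Longrightarrow> x \<in> nb n x"
  using UC_refl by (simp add: nb_def)

lemma UC_srt:
  assumes n: "n \<ge> 2" and x: "x \<in> UU n" and y: "y \<in> UC n x" and N: "N \<subseteq> slopes n"
  shows "srt (ra n y) N = srt (ra n x) N"
proof (rule srt_cong)
  have yU: "y \<in> UU n" using y by (simp add: UC_def)
  show "finite N" using N finite_slopes finite_subset by blast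
  show "inj_on (ra n y) N" using UU_inj[OF n yU] N inj_on_subset by blast
  show "ra n y i < ra n y j \<longleftrightarrow> ra n x i < ra n x j" if "i \<in> N" "j \<in> N" for i j
    using UC_order[OF n x y] that N by blast
qed

lemma UC_ch0: "n \<ge> 2 \<Longrightarrow> y \<in> UC n x \<Longrightarrow> ch0 n y = ch0 n x"
  using UC_sign[of n y x] by (auto simp: ch0_def)

text \<open>Strict inequalities persist nearby, so only walls through \<open>x\<close> can change
  sides, and there is at most one. As \<open>x\<close> counts as lying before its wall, the letter
  can only be added; it comes last because the walls passed earlier in the same half turn have
  smaller slope.\<close>

lemma wt_nb:
  assumes n: "n \<ge> 2" and x: "x \<in> UU n" "\<not> codim2 n x" and slit: "\<not> (va n x = 0 \<and> ua n x < 0)"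
    and y: "y \<in> nb n x"
  shows "wt n y = wt n x \<or> (\<exists>j\<le>n+1. vanish n j x \<and> wt n y = wt n x @ [j])"
proof -
  have yC: "y \<in> UC n x" using y by (simp add: nb_def)
  have xR: "x \<in> topspace (RC n)" using x UU_subset by blast
  note s = UC_srt[OF n x(1) yC]
  note inj = UU_inj[OF n x(1)]
  have lt: "ra n y i * va n y < ua n y" if "i \<in> slopes n" "ra n x i * va n x < ua n x" for i
    using y that unfolding nb_def by blast
  have gt: "ra n y i * va n y > ua n y" if "i \<in> slopes n" "ra n x i * va n x > ua n x" for i
    using y that unfolding nb_def by blast
  have key: "srt (ra n y) M = srt (ra n x) N \<or> (\<exists>j\<le>n+1. vanish n j x \<and> srt (ra n y) M = srt (ra n x) N @ [j])"
    if v: "va n x \<noteq> 0" and MN: "N \<subseteq> M" "M \<subseteq> slopes n"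
      and eq: "\<And>i. i \<in> M - N \<Longrightarrow> ra n x i * va n x = ua n x"
      and less: "\<And>i j. i \<in> N \<Longrightarrow> j \<in> M - N \<Longrightarrow> ra n x i < ra n x j" for M N
  proof (cases "M = N")
    case True then show ?thesis using s MN by simp
  next
    case False
    then obtain j where j: "j \<in> M - N" using MN by blast
    have van: "vanish n i x" "i \<le> n+1" if "i \<in> M - N" for i
    proof -
      have "i \<in> slopes n" using that MN(2) by blast
      then show "i \<le> n+1" "vanish n i x"
        using UU_vanish[OF n x(1), of i] eq[OF that] by (auto simp: slopes_def)
    qed
    \<comment> \<open>All members of \<open>M - N\<close> are walls through \<open>x\<close>, and
      off the stratum there is only one such wall.\<close>
    have "M = insert j N" using vanish_unique[OF n xR x(2)] van j MN by blast
    then have "srt (ra n x) M = srt (ra n x) N @ [j]"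
      using srt_insert[of N "ra n x" j] MN inj less j finite_subset[OF _ finite_slopes] inj_on_subset by (metis subset_trans)
    then show ?thesis using van[OF j] s[OF MN(2)] by metis
  qed
  consider "va n x > 0" | "va n x < 0" | "va n x = 0" "ua n x > 0"
    using slit UU_codim2[OF n x(1)] x(2) by linarith
  then show ?thesis
  proof cases
    case 1
    then have v: "va n y > 0" using y by (simp add: nb_def)
    let ?N = "{j \<in> slopes n. ra n x j * va n x < ua n x}" and ?M = "{j \<in> slopes n. ra n y j * va n y < ua n y}"
    have "srt (ra n y) ?M = srt (ra n x) ?N \<or> (\<exists>j\<le>n+1. vanish n j x \<and> srt (ra n y) ?M = srt (ra n x) ?N @ [j])"
    proof (rule key)
      show eq: "ra n x i * va n x = ua n x" if "i \<in> ?M - ?N" for i using gt[of i] that by force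
      show "ra n x i < ra n x j" if "i \<in> ?N" "j \<in> ?M - ?N" for i j
      proof -
        have "ra n x i * va n x < ra n x j * va n x" using that(1) eq[OF that(2)] by simp
        then show ?thesis using 1 by simp
      qed
    qed (use 1 lt in auto)
    then show ?thesis using 1 v by (simp add: wt_def)
  next
    case 2
    then have v: "va n y < 0" using y by (simp add: nb_def)
    let ?N = "{j \<in> slopes n. ra n x j * va n x > ua n x}" and ?M = "{j \<in> slopes n. ra n y j * va n y > ua n y}"
    have "srt (ra n y) ?M = srt (ra n x) ?N \<or> (\<exists>j\<le>n+1. vanish n j x \<and> srt (ra n y) ?M = srt (ra n x) ?N @ [j])"
    proof (rule key)
      show eq: "ra n x i * va n x = ua n x" if "i \<in> ?M - ?N" for i using lt[of i] that by force
      show "ra n x i < ra n x j" if "i \<in> ?N" "j \<in> ?M - ?N" for i j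
      proof -
        have "ra n x i * va n x > ra n x j * va n x" using that(1) eq[OF that(2)] by simp
        then show ?thesis using 2 by (simp add: mult_less_cancel_right)
      qed
    qed (use 2 gt in auto)
    then show ?thesis using 2 v s[of "slopes n"] by (auto simp: wt_def not_le)
  next
    case 3
    have "{j \<in> slopes n. ra n x j * va n x < ua n x} = slopes n" using 3 by auto
    then have wx: "wt n x = srt (ra n x) (slopes n)" using 3 by (simp add: wt_def)
    show ?thesis
    proof (cases "va n y \<ge> 0")
      case True
      have "{j \<in> slopes n. ra n y j * va n y < ua n y} = slopes n" using lt 3 by auto
      then show ?thesis using True wx s[of "slopes n"] by (simp add: wt_def)
    next
      case False
      have e: "{j \<in> slopes n. ra n y j * va n y > ua n y} = {}" using lt 3 by (auto simp: not_less less_imp_le)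
      have "wt n y = wt n x @ [n]" unfolding wx unfolding wt_def e using False s[of "slopes n"] by simp
      moreover have "vanish n n x" using UU_vanish[OF n x(1), of n] 3 by simp
      ultimately show ?thesis by auto
    qed
  qed
qed

text \<open>The exceptional half line: a point on it is at the beginning of the turn, whereas points
  just beyond it with \<open>b n < 0\<close> are at the end of a full turn.\<close>

lemma wt_nb_slit:
  assumes n: "n \<ge> 2" and x: "x \<in> UU n" and slit: "va n x = 0" "ua n x < 0" and y: "y \<in> nb n x"
  shows "wt n x = []" "va n y \<ge> 0 \<Longrightarrow> wt n y = []"
    "va n y < 0 \<Longrightarrow> wt n y = srt (ra n x) (slopes n) @ [n] @ srt (ra n x) (slopes n)"
proof -
  have yC: "y \<in> UC n x" using y by (simp add: nb_def)
  note s = UC_srt[OF n x yC]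
  have gt: "ra n y i * va n y > ua n y" if "i \<in> slopes n" for i
    using y that slit unfolding nb_def by simp
  show "wt n x = []" using slit by (simp add: wt_def)
  have e: "{j \<in> slopes n. ra n y j * va n y < ua n y} = {}" using gt by (auto simp: not_less less_imp_le)
  show "va n y \<ge> 0 \<Longrightarrow> wt n y = []" unfolding wt_def e by simp
  have "{j \<in> slopes n. ra n y j * va n y > ua n y} = slopes n" using gt by auto
  then show "va n y < 0 \<Longrightarrow> wt n y = srt (ra n x) (slopes n) @ [n] @ srt (ra n x) (slopes n)"
    using s[of "slopes n"] by (simp add: wt_def)
qed

subsection \<open>The local system over the configuration space\<close>

definition wj :: "nat \<Rightarrow> (nat \<Rightarrow> (nat \<Rightarrow> real) set) \<Rightarrow> nat" where
  "wj n x = (THE j. j \<le> n+1 \<and> vanish n j x)"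

definition iswall :: "nat \<Rightarrow> (nat \<Rightarrow> (nat \<Rightarrow> real) set) \<Rightarrow> bool" where
  "iswall n x \<longleftrightarrow> \<not> codim2 n x \<and> (\<exists>j\<le>n+1. vanish n j x)"

text \<open>The transition word from \<open>x\<close> to a nearby \<open>y\<close>. At a wall, the
  labels decide whether \<open>y\<close> lies across from the chamber to which \<open>x\<close> was
  assigned. At the stratum all of \<open>wt\<close> is taken, the stratum itself being at the start
  of the turn.\<close>

definition etw :: "nat \<Rightarrow> (nat \<Rightarrow> (nat \<Rightarrow> real) set) \<Rightarrow> (nat \<Rightarrow> (nat \<Rightarrow> real) set) \<Rightarrow> nat list" where
  "etw n x y = (if codim2 n x then wt n y else if iswall n x \<and> ch n x \<noteq> ch n y then [wj n x] else [])"

definition eta where "eta n x y = gel n (etw n x y)"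

definition nbx :: "nat \<Rightarrow> (nat \<Rightarrow> (nat \<Rightarrow> real) set) \<Rightarrow> (nat \<Rightarrow> (nat \<Rightarrow> real) set) set" where
  "nbx n x = (if codim2 n x then UC n x else if iswall n x then Wreg n (ch n x) (wj n x) else regA n {} (ch n x))"

lemma wj_eq:
  assumes "n \<ge> 2" "x \<in> topspace (RC n)" "\<not> codim2 n x" "j \<le> n+1" "vanish n j x"
  shows "wj n x = j"
  unfolding wj_def using assms vanish_unique[OF assms(1-3)] by (intro the_equality) blast+

lemma wj_le:
  assumes "n \<ge> 2" "x \<in> topspace (RC n)" "iswall n x" shows "wj n x \<le> n+1" "vanish n (wj n x) x"
proof -
  obtain j where "\<not> codim2 n x" "j \<le> n+1" "vanish n j x" using assms(3) by (auto simp: iswall_def)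
  then show "wj n x \<le> n+1" "vanish n (wj n x) x" using wj_eq[OF assms(1,2)] by auto
qed

lemma nbx_cases:
  assumes n: "n \<ge> 2" and x: "x \<in> topspace (RC n)"
  obtains "codim2 n x" "x \<in> UU n" "nbx n x = UC n x"
  | j where "\<not> codim2 n x" "iswall n x" "j \<le> n+1" "vanish n j x" "wj n x = j" "nbx n x = Wreg n (ch n x) j" "x \<in> Wreg n (ch n x) j"
  | "\<not> codim2 n x" "\<not> iswall n x" "nbx n x = regA n {} (ch n x)" "x \<in> regA n {} (ch n x)"
proof -
  show thesis
  proof (cases rule: stratum_cases[OF n x])
    case 1
    show thesis by (rule that(1)) (use 1 codim2_UU[OF n x] in \<open>auto simp: nbx_def\<close>)
  next
    case (2 j S)
    have w: "iswall n x" "wj n x = j" using 2 wj_eq[OF n x] by (auto simp: iswall_def)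
    have "x \<in> Wreg n (ch n x) j"
      using ch_Wreg[OF n 2(4) 2(2) 2(5)] 2(5) Wreg_acts[OF n] by metis
    then show thesis by (intro that(2)[of j]) (use 2 w in \<open>auto simp: nbx_def\<close>)
  next
    case (3 S)
    have c: "ch n x = S" using ch_regA[OF n 3] .
    have "\<not> codim2 n x" "\<not> iswall n x" using regA_not_vanish[OF n 3(2)] by (auto simp: iswall_def)
    then show thesis using c 3 by (intro that(3)) (auto simp: nbx_def)
  qed
qed

lemma nbx_props:
  assumes n: "n \<ge> 2" and x: "x \<in> topspace (RC n)"
  shows "openin (RC n) (nbx n x)" "x \<in> nbx n x" "sconn (RC n) (nbx n x)"
  by (cases rule: nbx_cases[OF n x];
      simp add: openin_UC[OF n] UC_refl[OF n] sconn_UC[OF n] openin_Wreg sconn_Wreg[OF n] openin_regA sconn_regA[OF n])+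

lemma nbx_topspace: "n \<ge> 2 \<Longrightarrow> x \<in> topspace (RC n) \<Longrightarrow> y \<in> nbx n x \<Longrightarrow> y \<in> topspace (RC n)"
  using nbx_props(1) openin_subset by blast

lemma etw_set:
  assumes n: "n \<ge> 2" and x: "x \<in> topspace (RC n)" shows "set (etw n x y) \<subseteq> {..n+1}"
  using wt_set[of n y] wj_le[OF n x] unfolding etw_def by auto

lemma etw_wall:
  assumes n: "n \<ge> 2" and x: "x \<in> topspace (RC n)" "\<not> codim2 n x" "j \<le> n+1" "vanish n j x"
  shows "etw n x y = (if ch n x = ch n y then [] else [j])"
  using assms wj_eq[OF assms] by (auto simp: etw_def iswall_def)

text \<open>Links the transition words to the action on labels, so that words along consecutive
  pieces of a path can be composed.\<close>

lemma etw_ch: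
  assumes n: "n \<ge> 2" and x: "x \<in> topspace (RC n)" and y: "y \<in> nbx n x"
  shows "ch n y = acts n (etw n x y) (ch n x)"
proof (cases rule: nbx_cases[OF n x])
  case 1
  then have "y \<in> UU n" "ch0 n y = ch0 n x" using y UC_ch0[OF n] by (auto simp: UC_def)
  then show ?thesis using 1 ch_codim2[OF n x] by (simp add: ch_def etw_def)
next
  case (2 j)
  have "ch n y = ch n x \<or> ch n y = acts n [j] (ch n x)"
    using ch_Wreg[OF n ch_subset 2(3)] y 2(6) by simp
  then show ?thesis unfolding etw_wall[OF n x 2(1,3,4)] by (auto simp: acts_Nil[OF ch_subset])
next
  case 3
  then have "y \<in> regA n {} (ch n x)" using y by simp
  then have "ch n y = ch n x" by (rule ch_regA[OF n ch_subset])
  then show ?thesis using 3(1,2) by (simp add: etw_def acts_Nil[OF ch_subset])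
qed

text \<open>An equality of words and not just of group elements: it is needed for path classes
  before these are known to respect the second relation.\<close>

lemma nb_step:
  assumes n: "n \<ge> 2" and y: "y \<in> UU n" "\<not> codim2 n y" "\<not> (va n y = 0 \<and> ua n y < 0)" and z: "z \<in> nb n y"
  shows "wt n z = wt n y @ etw n y z"
proof -
  have yR: "y \<in> topspace (RC n)" using y UU_subset by blast
  have zU: "z \<in> UU n" "ch0 n z = ch0 n y" using z UC_ch0[OF n] by (auto simp: nb_def UC_def)
  then have c: "ch n y = acts n (wt n y) (ch0 n y)" "ch n z = acts n (wt n z) (ch0 n y)" using y by (auto simp: ch_def)
  from wt_nb[OF n y z] show ?thesis
  proof
    assume "wt n z = wt n y"
    then show ?thesis using c y(2) by (simp add: etw_def)
  next
    assume "\<exists>j\<le>n+1. vanish n j y \<and> wt n z = wt n y @ [j]"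
    then obtain j where j: "j \<le> n+1" "vanish n j y" "wt n z = wt n y @ [j]" by blast
    then have "ch n z = acts n [j] (ch n y)" using c by (simp add: acts_append)
    then have "ch n z \<noteq> ch n y" using acts_single_ne[of n j "ch n y"] j n ch_subset by auto
    then show ?thesis using etw_wall[OF n yR y(2) j(1,2), of z] j(3) by auto
  qed
qed

lemma slit_step:
  assumes n: "n \<ge> 2" and y: "y \<in> UU n" "va n y = 0" "ua n y < 0" and z: "z \<in> nb n y"
  shows "wt n y = []" "va n z \<ge> 0 \<Longrightarrow> wt n z = [] \<and> etw n y z = []"
    "va n z < 0 \<Longrightarrow> wt n z = srt (ra n y) (slopes n) @ [n] @ srt (ra n y) (slopes n) \<and> etw n y z = [n]"
proof -
  note w = wt_nb_slit[OF n y z]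
  have yR: "y \<in> topspace (RC n)" using y UU_subset by blast
  have cd: "\<not> codim2 n y" "vanish n n y" using UU_codim2[OF n y(1)] UU_vanish[OF n y(1), of n] y by auto
  have zU: "z \<in> UU n" "ch0 n z = ch0 n y" using z UC_ch0[OF n] by (auto simp: nb_def UC_def)
  then have c: "ch n y = acts n (wt n y) (ch0 n y)" "ch n z = acts n (wt n z) (ch0 n y)" using y by (auto simp: ch_def)
  show "wt n y = []" by (rule w(1))
  show "va n z \<ge> 0 \<Longrightarrow> wt n z = [] \<and> etw n y z = []" using w c cd by (simp add: etw_def)
  assume "va n z < 0"
  note wz = w(3)[OF this]
  have "ch n z = acts n [n] (ch0 n y)"
    unfolding c(2) wz using slopes_word[of n "ra n y"] wt_set[of n z] unfolding wz
    by (intro acts_gel_eq) auto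
  moreover have "ch n y = ch0 n y" using c(1) w(1) by (simp add: acts_Nil ch0_def subset_eq)
  ultimately have "ch n z \<noteq> ch n y" using acts_single_ne[of n n "ch n y"] n ch_subset[of n y] by auto
  then show "wt n z = srt (ra n y) (slopes n) @ [n] @ srt (ra n y) (slopes n) \<and> etw n y z = [n]"
    using wz etw_wall[OF n yR cd(1) _ cd(2)] by auto
qed

text \<open>At the slit the words differ by a full turn, which \<open>slopes_word\<close> collapses;
  so in the group the law holds all around the stratum.\<close>

lemma gel_nb_step:
  assumes n: "n \<ge> 2" and y: "y \<in> UU n" "\<not> codim2 n y" and z: "z \<in> nb n y"
  shows "gel n (wt n z) = gel n (wt n y) \<otimes>\<^bsub>Gk (Suc n)\<^esub> eta n y z"
proof -
  have yR: "y \<in> topspace (RC n)" using y UU_subset by blast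
  interpret group "Gk (Suc n)" by (rule group_Gk)
  have a: "gel n (wt n y) \<otimes>\<^bsub>Gk (Suc n)\<^esub> eta n y z = gel n (wt n y @ etw n y z)"
    unfolding eta_def using gel_append[OF wt_set etw_set[OF n yR]] by simp
  show ?thesis
  proof (cases "va n y = 0 \<and> ua n y < 0")
    case False
    then show ?thesis using a nb_step[OF n y False z] by simp
  next
    case True
    then show ?thesis using a slit_step[OF n y(1) _ _ z] slopes_word[of n "ra n y"]
      by (cases "va n z \<ge> 0") auto
  qed
qed

text \<open>In a cell around the stratum the cocycle law is \<open>gel_nb_step\<close>; along a wall
  it rests on a letter squared being trivial; inside a chamber all transitions are trivial.\<close>

lemma local_system_eta:
  assumes n: "n \<ge> 2" shows "local_system (Gk (Suc n)) (RC n) (eta n)"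
proof -
  interpret group "Gk (Suc n)" by (rule group_Gk)
  show ?thesis
  proof
    fix x y assume x: "x \<in> topspace (RC n)"
    show "eta n x y \<in> carrier (Gk (Suc n))"
      unfolding eta_def by (rule gel_closed[OF etw_set[OF n x]])
  next
    fix x assume x: "x \<in> topspace (RC n)"
    have cl: "eta n x y \<in> carrier (Gk (Suc n))" for y unfolding eta_def by (rule gel_closed[OF etw_set[OF n x]])
    show "\<exists>V. openin (RC n) V \<and> x \<in> V \<and> (\<forall>y\<in>V. \<exists>V'. openin (RC n) V' \<and> y \<in> V' \<and>
       (\<forall>y'\<in>V'. eta n x y' = eta n x y \<otimes>\<^bsub>Gk (Suc n)\<^esub> eta n y y'))"
    proof (rule exI[of _ "nbx n x"], intro conjI ballI)
      show "openin (RC n) (nbx n x)" "x \<in> nbx n x" using nbx_props(1,2)[OF n x] .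
      fix y assume y: "y \<in> nbx n x"
      have yR: "y \<in> topspace (RC n)" using nbx_topspace[OF n x y] .
      show "\<exists>V'. openin (RC n) V' \<and> y \<in> V' \<and> (\<forall>y'\<in>V'. eta n x y' = eta n x y \<otimes>\<^bsub>Gk (Suc n)\<^esub> eta n y y')"
      proof (cases rule: nbx_cases[OF n x])
        case 1
        then have yU: "y \<in> UU n" using y by (simp add: UC_def)
        show ?thesis
        proof (cases "codim2 n y")
          case True
          then show ?thesis using 1 ch_codim2(2)[OF n yR True] gel_closed[OF wt_set]
            by (intro exI[of _ "topspace (RC n)"]) (auto simp: yR eta_def etw_def gel_Nil)
        next
          case False
          show ?thesis
          proof (intro exI[of _ "nb n y"] conjI ballI)
            fix z assume "z \<in> nb n y"
            then show "eta n x z = eta n x y \<otimes>\<^bsub>Gk (Suc n)\<^esub> eta n y z"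
              using gel_nb_step[OF n yU False] 1 by (simp add: eta_def etw_def)
          qed (use openin_nb[OF n] nb_refl[OF n yU] in auto)
        qed
      next
        case (2 j)
        have yW: "y \<in> Wreg n (ch n x) j" using y 2 by simp
        note ycase = Wreg_cases[OF n yW ch_subset 2(3)]
        show ?thesis
        proof (cases "vanish n j y")
          case True
          have "eta n x z = eta n x y \<otimes>\<^bsub>Gk (Suc n)\<^esub> eta n y z" if z: "z \<in> Wreg n (ch n x) j" for z
          proof -
            have "ch n y = ch n x \<or> ch n y = acts n [j] (ch n x)" "ch n z = ch n x \<or> ch n z = acts n [j] (ch n x)"
              by (rule ch_Wreg[OF n ch_subset 2(3) yW], rule ch_Wreg[OF n ch_subset 2(3) z])
            moreover have "gel n [j] \<otimes>\<^bsub>Gk (Suc n)\<^esub> gel n [j] = \<one>\<^bsub>Gk (Suc n)\<^esub>"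
              using gel_append[of "[j]" n "[j]"] gel_square[OF 2(3)] 2(3) by (simp add: gel_Nil)
            moreover have "gel n [j] \<in> carrier (Gk (Suc n))" using 2(3) by (intro gel_closed) auto
            ultimately show ?thesis
              unfolding eta_def etw_wall[OF n x 2(1,3,4)] etw_wall[OF n yR conjunct1[OF ycase] 2(3) True]
              by (cases "ch n y = ch n x"; cases "ch n z = ch n x") (simp_all add: gel_Nil)
          qed
          then show ?thesis using yW openin_Wreg by (intro exI[of _ "Wreg n (ch n x) j"] conjI ballI)
        next
          case False
          then obtain T where T: "T \<subseteq> {..<n}" "y \<in> regA n {} T" using ycase ch_subset acts_subset by metis
          have "eta n x z = eta n x y \<otimes>\<^bsub>Gk (Suc n)\<^esub> eta n y z" if z: "z \<in> regA n {} T" for z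
          proof -
            have "ch n y = T" "ch n z = T" using ch_regA[OF n T(1)] T(2) z by auto
            moreover have "\<not> iswall n y" "\<not> codim2 n y" using regA_not_vanish[OF n T(2)] by (auto simp: iswall_def)
            ultimately have "etw n x z = etw n x y" "etw n y z = []" using 2(1) by (auto simp: etw_def)
            then show ?thesis using cl by (simp add: eta_def gel_Nil)
          qed
          then show ?thesis using T(2) openin_regA by (intro exI[of _ "regA n {} T"] conjI ballI)
        qed
      next
        case 3
        have "eta n x z = eta n x y \<otimes>\<^bsub>Gk (Suc n)\<^esub> eta n y z" for z
        proof -
          have "\<not> iswall n y" "\<not> codim2 n y" using regA_not_vanish[OF n, of y "ch n x"] y 3(3) by (auto simp: iswall_def)
          then show ?thesis using 3 by (simp add: eta_def etw_def gel_Nil)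
        qed
        then show ?thesis using yR by (intro exI[of _ "topspace (RC n)"] conjI ballI openin_topspace)
      qed
    qed
  qed
qed

subsection \<open>Chamber centres and redirected points\<close>

text \<open>One base point in each chamber: \<open>a\<close> is the last unit vector, so minor
  \<open>i\<close> equals \<open>- b i\<close>. For \<open>S = {..<n}\<close> this is the base
  configuration.\<close>

definition zc :: "nat \<Rightarrow> nat set \<Rightarrow> nat \<Rightarrow> (nat \<Rightarrow> real) set" where
  "zc n S = cfg n (evec n) (\<lambda>i. if i < n then if i \<in> S then 1 else -1 else if i = n then 1 else 0)"

lemma zc_cpt: "n \<ge> 2 \<Longrightarrow> cpt n (evec n) (\<lambda>i. if i < n then if i \<in> S then 1 else -1 else if i = n then 1 else 0)"
  by (auto simp: cpt_def supported_def good_def evec_def)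

lemma zc_in_regA: "n \<ge> 2 \<Longrightarrow> zc n S \<in> regA n {} S"
  unfolding zc_def by (subst cfg_in_regA[OF _ zc_cpt]) (auto simp: minor_def evec_def)

lemma zc_topspace: "n \<ge> 2 \<Longrightarrow> zc n S \<in> topspace (RC n)"
  using zc_in_regA regA_subset by blast

lemma ch_zc: "n \<ge> 2 \<Longrightarrow> S \<subseteq> {..<n} \<Longrightarrow> ch n (zc n S) = S"
  using ch_regA zc_in_regA by blast

lemma zc_in_Wreg:
  assumes "n \<ge> 2" shows "zc n S \<in> Wreg n S j" "zc n (acts n [j] S) \<in> Wreg n S j"
  using regA_subset_Wreg[OF assms] zc_in_regA[OF assms] Wreg_acts[OF assms] by blast+

lemma zc_in_nbx:
  assumes n: "n \<ge> 2" and x: "x \<in> topspace (RC n)" "\<not> codim2 n x" and y: "y \<in> nbx n x"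
  shows "zc n (ch n y) \<in> nbx n x"
proof (cases rule: nbx_cases[OF n x(1)])
  case (2 j)
  then have "ch n y = ch n x \<or> ch n y = acts n [j] (ch n x)"
    using ch_Wreg[OF n ch_subset 2(3)] y by simp
  then show ?thesis using zc_in_Wreg[OF n, where S="ch n x" and j=j] 2(6) by auto
next
  case 3
  then have "y \<in> regA n {} (ch n x)" using y by simp
  then have "ch n y = ch n x" by (rule ch_regA[OF n ch_subset])
  then show ?thesis using zc_in_regA[OF n, where S="ch n x"] 3(3) by simp
qed (use x in auto)

text \<open>Replaces only the pair \<open>(a n, b n)\<close>, in the normalisation
  \<open>a 0 = b 0 = 1\<close>. The cell is kept, so this moves a point around the stratum.\<close>

definition rd :: "nat \<Rightarrow> real \<Rightarrow> real \<Rightarrow> (nat \<Rightarrow> (nat \<Rightarrow> real) set) \<Rightarrow> nat \<Rightarrow> (nat \<Rightarrow> real) set" where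
  "rd n u v y = cfg n (\<lambda>i. if i < n then ra n y i * ba n y i else if i = n then u else 0)
     (\<lambda>i. if i < n then ba n y i else if i = n then v else 0)"

context
  fixes n :: nat and y
  assumes n: "n \<ge> 2" and y: "y \<in> UU n"
begin

lemma rd_cpt: "cpt n (\<lambda>i. if i < n then ra n y i * ba n y i else if i = n then u else 0)
     (\<lambda>i. if i < n then ba n y i else if i = n then v else 0)"
  and rd_UU: "rd n u v y \<in> UU n"
  and rd_coords: "ua n (rd n u v y) = u" "va n (rd n u v y) = v" "i < n \<Longrightarrow> ba n (rd n u v y) i = ba n y i"
    "ra n (rd n u v y) i = ra n y i"
proof -
  have inj: "ra n y i \<noteq> ra n y j" if "i < n" "j < n" "i \<noteq> j" for i j
    using UU_inj[OF n y] that slopes_mem(2) by (meson inj_onD)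
  have nz: "(if i < n then ra n y i * ba n y i else if i = n then u else 0) \<noteq> 0 \<and>
      (if i < n then ba n y i else if i = n then v else 0) \<noteq> 0" if "i < n" for i
    using that UU_ba_nz[OF n y] UU_ra_nz[OF n y] by simp
  have mi: "(if i < n then ra n y i * ba n y i else if i = n then u else 0) * (if j < n then ba n y j else if j = n then v else 0) \<noteq>
     (if j < n then ra n y j * ba n y j else if j = n then u else 0) * (if i < n then ba n y i else if i = n then v else 0)"
    if "i < n" "j < n" "i \<noteq> j" for i j
    using that inj[OF that] UU_ba_nz[OF n y] by simp
  show c: "cpt n (\<lambda>i. if i < n then ra n y i * ba n y i else if i = n then u else 0)
     (\<lambda>i. if i < n then ba n y i else if i = n then v else 0)" for u v
  proof (rule cptI)
    show "good n (\<lambda>i. if i < n then ra n y i * ba n y i else if i = n then u else 0)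
     (\<lambda>i. if i < n then ba n y i else if i = n then v else 0)"
      unfolding good_def using inj UU_ba_nz[OF n y] UU_ra_nz[OF n y] by simp
  qed auto
  show "rd n u v y \<in> UU n" unfolding rd_def cfg_in_UU[OF n c] using nz mi by blast
  have 0: "(if 0 < n then ra n y 0 * ba n y 0 else if 0 = n then u else 0) = 1"
    "(if 0 < n then ba n y 0 else if 0 = n then v else 0) = 1"
    using n UU_ba0[OF n y] UU_ra0[OF n y] by auto
  note co = UU_coords[OF n c[of u v] 0]
  show "ua n (rd n u v y) = u" "va n (rd n u v y) = v" "i < n \<Longrightarrow> ba n (rd n u v y) i = ba n y i"
    unfolding rd_def co by simp_all
  show "ra n (rd n u v y) i = ra n y i"
  proof (cases "i < n")
    case True then show ?thesis unfolding rd_def co using UU_ba_nz[OF n y True] by simp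
  next
    case False then show ?thesis unfolding rd_def co by (simp add: ra_def)
  qed
qed

lemma rd_self: "rd n (ua n y) (va n y) y = y"
proof -
  obtain a b where ab: "cpt n a b" "a 0 = 1" "b 0 = 1" "y = cfg n a b" using UU_cases[OF n y] by blast
  have nz: "b i \<noteq> 0" if "i < n" for i using y that unfolding ab(4) cfg_in_UU[OF n ab(1)] by blast
  note co = UU_coords[OF n ab(1-3)]
  have "(\<lambda>i. if i < n then ra n y i * ba n y i else if i = n then ua n y else 0) = a"
    "(\<lambda>i. if i < n then ba n y i else if i = n then va n y else 0) = b"
    unfolding ab(4) co using nz cpt_out[OF ab(1)] by (auto simp: fun_eq_iff)
  then show ?thesis unfolding rd_def using ab(4) by simp
qed

lemma rd_codim2: "codim2 n (rd n u v y) \<longleftrightarrow> u = 0 \<and> v = 0"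
  using UU_codim2[OF n rd_UU] rd_coords by simp

lemma rd_UC: "rd n u v y \<in> UC n x \<longleftrightarrow> y \<in> UC n x"
  using y rd_UU[of u v] unfolding UC_def by (auto simp: rd_coords cong: if_cong)

end

lemma UC_eq:
  assumes n: "n \<ge> 2" and x: "x \<in> UU n" and y: "y \<in> UC n x" shows "UC n y = UC n x"
proof -
  have s: "(0 < ba n y i) = (0 < ba n x i)" if "i < n" for i using UC_sign[OF n y that] .
  have r: "(ra n y i < ra n y j) = (ra n x i < ra n x j)" if "i \<in> slopes n" "j \<in> slopes n" for i j
    using UC_order[OF n x y that] .
  show ?thesis unfolding UC_def using s r by (auto cong: if_cong)
qed

lemma pathin_rd:
  assumes n: "n \<ge> 2" and p: "pathin (RC n) p" "p ` {0..1} \<subseteq> UU n"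
    and u: "continuous_on {0..1} u" and v: "continuous_on {0..1} v"
  shows "pathin (RC n) (\<lambda>t. rd n (u t) (v t) (p t))"
  unfolding pathin_def rd_def
proof (rule continuous_map_cfg[OF n])
  have "continuous_map I01 (subtopology (RC n) (UU n)) p"
    using p by (auto simp: pathin_def continuous_map_in_subtopology)
  note c = continuous_map_compose[OF this, unfolded o_def]
  have uv: "continuous_map I01 euclideanreal u" "continuous_map I01 euclideanreal v" using u v by auto
  show "continuous_map I01 euclideanreal (\<lambda>t. if i < n then ra n (p t) i * ba n (p t) i else if i = n then u t else 0)" for i
    using uv continuous_map_real_mult[OF c[OF continuous_map_UU(4)[OF n, of i]] c[OF continuous_map_UU(3)[OF n, of i]]]
    by (cases "i < n"; cases "i = n") simp_all
  show "continuous_map I01 euclideanreal (\<lambda>t. if i < n then ba n (p t) i else if i = n then v t else 0)" for i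
    using uv c[OF continuous_map_UU(3)[OF n, of i]]
    by (cases "i < n"; cases "i = n") simp_all
  fix t assume "t \<in> topspace I01"
  then have "p t \<in> UU n" using p by auto
  then show "supported n (\<lambda>i. if i < n then ra n (p t) i * ba n (p t) i else if i = n then u t else 0) \<and>
    supported n (\<lambda>i. if i < n then ba n (p t) i else if i = n then v t else 0) \<and>
    good n (\<lambda>i. if i < n then ra n (p t) i * ba n (p t) i else if i = n then u t else 0)
      (\<lambda>i. if i < n then ba n (p t) i else if i = n then v t else 0)"
    using rd_cpt[OF n] unfolding cpt_def by blast
qed

text \<open>The normalisation \<open>a 0 = b 0 = 1\<close> gives index 0 the slope 1 and a positive
  sign, while slope \<open>n + 1\<close> is zero. So only patterns containing 0 and orders with
  \<open>n + 1\<close> before 0 can occur, and all of these do.\<close>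

lemma codim2_realize:
  assumes n: "n \<ge> 2" and T: "T \<subseteq> {..<n}" "0 \<in> T"
    and L: "set L = slopes n" "distinct L" "L = L1 @ [n+1] @ L2" "0 \<in> set L2"
  obtains x where "x \<in> topspace (RC n)" "codim2 n x" "ch0 n x = T" "srt (ra n x) (slopes n) = L"
proof -
  define pos where "pos i = (THE p. p < length L \<and> L ! p = i)" for i
  have pos: "pos (L ! p) = p" if "p < length L" for p
    unfolding pos_def using that L(2) nth_eq_iff_index_eq by (intro the_equality) blast+
  have posn: "pos (n+1) = length L1"
    using pos[of "length L1"] L(3) by (simp add: nth_append)
  obtain p0 where p0: "p0 < length L2" "L2 ! p0 = 0" using L(4) by (auto simp: in_set_conv_nth)
  have pos0: "pos 0 = length L1 + 1 + p0" using pos[of "length L1 + 1 + p0"] L(3) p0 by (simp add: nth_append)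
  \<comment> \<open>Positions in \<open>L\<close>, shifted and rescaled so that \<open>n + 1\<close>
    gets slope 0 and index 0 gets slope 1.\<close>
  define r where "r i = (real (pos i) - real (length L1)) / (1 + real p0)" for i
  have r0: "r 0 = 1" "r (n+1) = 0" using pos0 posn by (auto simp: r_def)
  have rL: "r (L ! p) < r (L ! q) \<longleftrightarrow> p < q" if "p < length L" "q < length L" for p q
  proof -
    have "0 < 1 + real p0" by simp
    then show ?thesis using pos that by (simp add: r_def divide_less_cancel)
  qed
  have inj: "r i \<noteq> r j" if "i \<in> slopes n" "j \<in> slopes n" "i \<noteq> j" for i j
  proof -
    have "i \<in> set L" "j \<in> set L" using that L(1) by auto
    then obtain p q where pq: "p < length L" "q < length L" "L ! p = i" "L ! q = j" unfolding in_set_conv_nth by blast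
    then have "p \<noteq> q" using that(3) by blast
    then have "p < q \<or> q < p" by linarith
    then show ?thesis using rL[of p q] rL[of q p] pq by auto
  qed
  define b where "b i = (if i < n then if i \<in> T then 1 else -1 else 0 :: real)" for i
  define a where "a i = (if i < n then r i * b i else 0)" for i
  have rn: "r i \<noteq> 0" if "i < n" for i using inj[of i "n+1"] slopes_mem[of n] slopes_mem(2)[OF that] that r0 by auto
  have c: "cpt n a b"
  proof (rule cptI)
    have "a i * b j \<noteq> a j * b i" if "i < n" "j < n" "i \<noteq> j" for i j
      using inj[of i j] that slopes_mem(2) by (auto simp: a_def b_def)
    then show "good n a b" unfolding good_def using rn by (auto simp: a_def b_def)
  qed (auto simp: a_def b_def)
  have n1: "a 0 = 1" "b 0 = 1" using n T r0 by (auto simp: a_def b_def)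
  note co = UU_coords[OF n c n1]
  have x: "cfg n a b \<in> topspace (RC n)" using cpt_nrm[OF n c] by blast
  have cd: "codim2 n (cfg n a b)" using codim2_cfg[OF n c] by (simp add: a_def b_def)
  have ra: "ra n (cfg n a b) i = r i" if "i \<in> slopes n" for i
  proof (cases "i < n")
    case True
    then show ?thesis unfolding co(4) by (simp add: a_def b_def)
  next
    case False
    then have "i = n + 1" using that by (auto simp: slopes_def)
    then show ?thesis unfolding co(4) using r0 by simp
  qed
  show thesis
  proof (rule that[OF x cd])
    show "ch0 n (cfg n a b) = T" unfolding ch0_def co using T by (auto simp: b_def)
    show "srt (ra n (cfg n a b)) (slopes n) = L"
    proof (rule srt_unique[OF finite_slopes _ L(1,2)])
      show "inj_on (ra n (cfg n a b)) (slopes n)" by (rule UU_inj[OF n codim2_UU[OF n x cd]])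
      have "ra n (cfg n a b) (L ! p) \<le> ra n (cfg n a b) (L ! q)" if "p \<le> q" "q < length L" for p q
      proof (cases "p = q")
        case False
        then have "r (L ! p) < r (L ! q)" using rL[of p q] that by simp
        moreover have "L ! p \<in> slopes n" "L ! q \<in> slopes n" using that L(1) nth_mem[of p L] nth_mem[of q L] by auto
        ultimately show ?thesis by (simp only: ra less_imp_le)
      qed simp
      then show "sorted (map (ra n (cfg n a b)) L)" by (simp add: sorted_iff_nth_mono)
    qed
  qed
qed

subsection \<open>Path classes in the configuration space\<close>

definition joined :: "'a topology \<Rightarrow> 'a \<Rightarrow> 'a \<Rightarrow> bool" where
  "joined X x y \<longleftrightarrow> (\<exists>p. pathin X p \<and> p 0 = x \<and> p 1 = y)"

lemma joined_sym: "joined X x y \<Longrightarrow> joined X y x"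
  unfolding joined_def using pathin_rev by (metis rev_ends)

lemma joined_trans: "joined X x y \<Longrightarrow> joined X y z \<Longrightarrow> joined X x z"
  unfolding joined_def using pathin_join by (metis join_ends)

lemma joined_sconn: "sconn X U \<Longrightarrow> x \<in> U \<Longrightarrow> y \<in> U \<Longrightarrow> joined X x y"
  unfolding sconn_def joined_def by blast

text \<open>Off the stratum every point reaches a chamber centre inside its neighbourhood; centres
  are joined through walls, adding one element to the label at a time; points of the stratum are
  first pushed off it.\<close>

lemma path_connected_RC:
  assumes n: "n \<ge> 2" shows "path_connected_space (RC n)"
proof -
  have W: "joined (RC n) (zc n S) (zc n (acts n [j] S))" for S j
    using joined_sconn[OF sconn_Wreg[OF n]] zc_in_Wreg[OF n] by blast
  have z: "joined (RC n) (zc n {}) (zc n S)" if "finite S" "S \<subseteq> {..<n}" for S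
    using that
  proof (induction S rule: finite_induct)
    case empty
    show ?case by (rule joined_sconn[OF sconn_regA[OF n, where Q="{}"]]) (use zc_in_regA[OF n] in auto)
  next
    case (insert j S)
    have "acts n [j] S = insert j S"
      using insert.prems insert.hyps acts_single_less[of j n _ S] by blast
    then show ?case using joined_trans[OF insert.IH W[of S j]] insert.prems by simp
  qed
  have 1: "joined (RC n) (zc n {}) x" if x: "x \<in> topspace (RC n)" "\<not> codim2 n x" for x
  proof -
    have "joined (RC n) x (zc n (ch n x))"
      by (rule joined_sconn[OF nbx_props(3)[OF n x(1)] nbx_props(2)[OF n x(1)] zc_in_nbx[OF n x nbx_props(2)[OF n x(1)]]])
    moreover have "joined (RC n) (zc n {}) (zc n (ch n x))"
      using z[of "ch n x"] ch_subset finite_subset[OF ch_subset] by blast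
    ultimately show ?thesis using joined_sym joined_trans by metis
  qed
  have 2: "joined (RC n) (zc n {}) x" if x: "x \<in> topspace (RC n)" for x
  proof (cases "codim2 n x")
    case True
    have U: "x \<in> UU n" by (rule codim2_UU[OF n x True])
    have y: "rd n 1 0 x \<in> UC n x" using rd_UC[OF n U] UC_refl[OF n U] by simp
    have "joined (RC n) (zc n {}) (rd n 1 0 x)"
      by (rule 1) (use rd_UU[OF n U] UU_subset rd_codim2[OF n U] in auto)
    moreover have "joined (RC n) (rd n 1 0 x) x" by (rule joined_sconn[OF sconn_UC[OF n U] y UC_refl[OF n U]])
    ultimately show ?thesis by (rule joined_trans)
  qed (use 1 x in blast)
  have "joined (RC n) x y" if "x \<in> topspace (RC n)" "y \<in> topspace (RC n)" for x y
    using 2 that joined_sym joined_trans by metis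
  then show ?thesis unfolding path_connected_space_def joined_def by blast
qed

locale pointed_config =
  fixes n :: nat and x0
  assumes n: "n \<ge> 2" and x0: "x0 \<in> topspace (RC n)"
begin

abbreviation "PG \<equiv> fundamental_group (RC n) x0"
abbreviation "cl \<equiv> path_class (RC n) x0"

sublocale G: local_system "Gk (Suc n)" "RC n" "eta n"
  by (rule local_system_eta[OF n])

sublocale P: group PG
  by (rule group_fundamental_group[OF x0])

lemmas pcs = path_connected_RC[OF n] x0
lemmas cl_closed = path_class_closed[OF pcs]
lemmas cl_cong = path_class_cong[OF pcs]
lemmas cl_join = path_class_join[OF pcs]
lemmas cl_const = path_class_const[OF pcs]

lemma cl_part:
  assumes "pathin (RC n) p" "a \<in> {0..1}" "b \<in> {0..1}" "c \<in> {0..1}"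
  shows "cl (path_part a c p) = cl (path_part a b p) \<otimes>\<^bsub>PG\<^esub> cl (path_part b c p)"
  using cl_cong[OF phom_part_join[OF assms]] cl_join[OF pathin_part[OF assms(1,2,3)] pathin_part[OF assms(1,3,4)]] by simp

text \<open>In an \<open>sconn\<close> region the chosen path is immaterial
  (\<open>theta_path\<close>), so paths in the region can be handled by their ends alone.\<close>

definition theta where
  "theta U x y = cl (SOME p. pathin (RC n) p \<and> p ` {0..1} \<subseteq> U \<and> p 0 = x \<and> p 1 = y)"

lemma theta_path:
  assumes U: "sconn (RC n) U" and p: "pathin (RC n) p" "p ` {0..1} \<subseteq> U"
  shows "cl p = theta U (p 0) (p 1)"
proof -
  define q where "q = (SOME q. pathin (RC n) q \<and> q ` {0..1} \<subseteq> U \<and> q 0 = p 0 \<and> q 1 = p 1)"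
  have q: "pathin (RC n) q \<and> q ` {0..1} \<subseteq> U \<and> q 0 = p 0 \<and> q 1 = p 1"
    unfolding q_def by (rule someI[of "\<lambda>q. pathin (RC n) q \<and> q ` {0..1} \<subseteq> U \<and> q 0 = p 0 \<and> q 1 = p 1" p])
      (use p in auto)
  have "\<forall>p q. pathin (RC n) p \<and> pathin (RC n) q \<and> p ` {0..1} \<subseteq> U \<and> q ` {0..1} \<subseteq> U \<and> p 0 = q 0 \<and> p 1 = q 1 \<longrightarrow> phom (RC n) p q"
    using U unfolding sconn_def by blast
  then have "phom (RC n) p q" using p q by simp
  then show ?thesis unfolding theta_def q_def by (rule cl_cong)
qed

lemma sconn_path:
  assumes "sconn (RC n) U" "x \<in> U" "y \<in> U"
  obtains p where "pathin (RC n) p" "p ` {0..1} \<subseteq> U" "p 0 = x" "p 1 = y"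
  using assms unfolding sconn_def by blast

lemma theta_closed: "sconn (RC n) U \<Longrightarrow> x \<in> U \<Longrightarrow> y \<in> U \<Longrightarrow> theta U x y \<in> carrier PG"
  using sconn_path[of U x y] theta_path cl_closed by metis

lemma theta_mult:
  assumes U: "sconn (RC n) U" "x \<in> U" "y \<in> U" "z \<in> U"
  shows "theta U x y \<otimes>\<^bsub>PG\<^esub> theta U y z = theta U x z"
proof -
  obtain p where p: "pathin (RC n) p" "p ` {0..1} \<subseteq> U" "p 0 = x" "p 1 = y" using sconn_path U by metis
  obtain q where q: "pathin (RC n) q" "q ` {0..1} \<subseteq> U" "q 0 = y" "q 1 = z" using sconn_path U by metis
  have j: "pathin (RC n) (path_join p q)" using p q by (intro pathin_join) auto
  have "path_join p q ` {0..1} \<subseteq> U"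
    using p(2) q(2) by (auto simp: path_join_def image_subset_iff)
  then have "cl (path_join p q) = theta U x z" using theta_path[OF U(1) j] p q by simp
  then show ?thesis using cl_join[OF p(1) q(1)] theta_path[OF U(1) p(1,2)] theta_path[OF U(1) q(1,2)] p q by simp
qed

lemma theta_refl: "sconn (RC n) U \<Longrightarrow> x \<in> U \<Longrightarrow> theta U x x = \<one>\<^bsub>PG\<^esub>"
  using theta_mult[of U x x x] theta_closed[of U x x] by (metis P.r_cancel_one')

lemma theta_inv: "sconn (RC n) U \<Longrightarrow> x \<in> U \<Longrightarrow> y \<in> U \<Longrightarrow> inv\<^bsub>PG\<^esub> theta U x y = theta U y x"
  using theta_mult[of U y x y] theta_refl theta_closed by (metis P.inv_equality)

lemma theta_subset:
  assumes "sconn (RC n) U" "sconn (RC n) V" "U \<subseteq> V" "x \<in> U" "y \<in> U"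
  shows "theta U x y = theta V x y"
proof -
  obtain p where p: "pathin (RC n) p" "p ` {0..1} \<subseteq> U" "p 0 = x" "p 1 = y" using sconn_path assms by metis
  then show ?thesis using theta_path[OF assms(1) p(1,2)] theta_path[OF assms(2) p(1)] assms(3) by auto
qed

section \<open>Path classes of words\<close>

definition gam :: "nat set \<Rightarrow> nat \<Rightarrow> _" where
  "gam S j = theta (Wreg n S j) (zc n S) (zc n (acts n [j] S))"

lemma gam_closed: "gam S j \<in> carrier PG"
  unfolding gam_def using theta_closed sconn_Wreg[OF n] zc_in_Wreg[OF n] by blast

text \<open>Both crossings take place in the same region, so going through a wall and back is
  trivial: the first relation of the group, for path classes.\<close>

lemma gam_square:
  assumes "S \<subseteq> {..<n}" shows "gam S j \<otimes>\<^bsub>PG\<^esub> gam (acts n [j] S) j = \<one>\<^bsub>PG\<^esub>"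
  unfolding gam_def Wreg_acts[OF n] acts_single_twice[OF assms]
  using theta_mult[OF sconn_Wreg[OF n]] theta_refl[OF sconn_Wreg[OF n]] zc_in_Wreg[OF n] by metis

text \<open>The path class obtained by following the word from centre to centre, starting in chamber
  \<open>S\<close>. It is multiplicative in the groupoid sense only: the second factor of
  \<open>Psi_append\<close> starts in another chamber.\<close>

fun Psi :: "nat set \<Rightarrow> nat list \<Rightarrow> _" where
  "Psi S [] = \<one>\<^bsub>PG\<^esub>"
| "Psi S (j # js) = gam S j \<otimes>\<^bsub>PG\<^esub> Psi (acts n [j] S) js"

lemma Psi_closed [simp]: "Psi S js \<in> carrier PG"
  by (induction js arbitrary: S) (auto simp: gam_closed)

lemma acts_Cons: "acts n (j # js) S = acts n js (acts n [j] S)"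
  using acts_append[of n "[j]" js S] by simp

lemma Psi_append: "S \<subseteq> {..<n} \<Longrightarrow> Psi S (us @ vs) = Psi S us \<otimes>\<^bsub>PG\<^esub> Psi (acts n us S) vs"
proof (induction us arbitrary: S)
  case (Cons j us)
  then show ?case using Cons.IH[OF acts_subset] by (simp add: P.m_assoc gam_closed acts_Cons[of j us])
qed (simp add: acts_Nil)

lemma Psi_single: "Psi S [j] = gam S j"
  by (simp add: gam_closed)

lemma acts_rev: "S \<subseteq> {..<n} \<Longrightarrow> acts n (rev js) (acts n js S) = S"
proof -
  assume S: "S \<subseteq> {..<n}"
  have "flips n (rev js) i = flips n js i" for i by (simp add: flips_def)
  then show ?thesis using S by (auto simp: acts_def)
qed

lemma Psi_rev: "S \<subseteq> {..<n} \<Longrightarrow> Psi S js \<otimes>\<^bsub>PG\<^esub> Psi (acts n js S) (rev js) = \<one>\<^bsub>PG\<^esub>"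
proof (induction js arbitrary: S)
  case (Cons j js)
  let ?T = "acts n [j] S"
  have "Psi (acts n (j # js) S) (rev (j # js)) = Psi (acts n js ?T) (rev js) \<otimes>\<^bsub>PG\<^esub> gam ?T j"
    using Psi_append[OF acts_subset] acts_rev[OF acts_subset, of js "[j]" S]
    by (simp add: acts_Cons[of j js] gam_closed)
  then have "Psi S (j # js) \<otimes>\<^bsub>PG\<^esub> Psi (acts n (j # js) S) (rev (j # js)) =
     gam S j \<otimes>\<^bsub>PG\<^esub> ((Psi ?T js \<otimes>\<^bsub>PG\<^esub> Psi (acts n js ?T) (rev js)) \<otimes>\<^bsub>PG\<^esub> gam ?T j)"
    by (simp add: P.m_assoc gam_closed)
  also have "\<dots> = \<one>\<^bsub>PG\<^esub>" using Cons.IH[OF acts_subset] gam_square[OF Cons.prems] by (simp add: gam_closed)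
  finally show ?case .
qed (simp add: acts_Nil)

lemma Psi_rev_inv: "S \<subseteq> {..<n} \<Longrightarrow> Psi (acts n js S) (rev js) = inv\<^bsub>PG\<^esub> Psi S js"
  using Psi_rev[of S js] by (metis P.inv_equality P.inv_inv Psi_closed P.inv_closed)

text \<open>The way from a point off the stratum to the centre of its chamber. Expressed relative to
  these ways, short paths become words.\<close>

definition A0 where "A0 y = theta (nbx n y) y (zc n (ch n y))"

lemma A0_closed:
  assumes "y \<in> topspace (RC n)" "\<not> codim2 n y" shows "A0 y \<in> carrier PG"
  unfolding A0_def using theta_closed nbx_props[OF n assms(1)] zc_in_nbx[OF n assms] by blast

lemma nbx_not_codim2:
  assumes x: "x \<in> topspace (RC n)" "\<not> codim2 n x" and y: "y \<in> nbx n x"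
  shows "\<not> codim2 n y"
proof (cases rule: nbx_cases[OF n x(1)])
  case (2 j)
  then have "y \<in> Wreg n (ch n x) j" using y by simp
  then show ?thesis using Wreg_cases[OF n _ ch_subset 2(3)] by blast
next
  case 3
  then have "y \<in> regA n {} (ch n x)" using y by simp
  then show ?thesis using regA_not_vanish(2)[OF n] by blast
qed (use x in auto)

text \<open>The neighbourhood of \<open>y\<close> is contained in that of \<open>x\<close>, so the
  way to the centre may be taken in the latter.\<close>

lemma A0_nbx:
  assumes x: "x \<in> topspace (RC n)" "\<not> codim2 n x" and y: "y \<in> nbx n x"
  shows "A0 y = theta (nbx n x) y (zc n (ch n y))"
proof -
  have yR: "y \<in> topspace (RC n)" using nbx_topspace[OF n x(1) y] .
  have sub: ?thesis if "nbx n y \<subseteq> nbx n x"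
    unfolding A0_def
    by (rule theta_subset[OF nbx_props(3)[OF n yR] nbx_props(3)[OF n x(1)] that nbx_props(2)[OF n yR]
        zc_in_nbx[OF n yR nbx_not_codim2[OF x y] nbx_props(2)[OF n yR]]])
  show ?thesis
  proof (cases rule: nbx_cases[OF n x(1)])
    case (2 j)
    then have yW: "y \<in> Wreg n (ch n x) j" using y by simp
    have c: "ch n y = ch n x \<or> ch n y = acts n [j] (ch n x)" by (rule ch_Wreg[OF n ch_subset 2(3) yW])
    then have W: "Wreg n (ch n y) j = Wreg n (ch n x) j" using Wreg_acts[OF n] by auto
    note yc = Wreg_cases[OF n yW ch_subset 2(3)]
    show ?thesis
    proof (cases "vanish n j y")
      case True
      have "wj n y = j" by (rule wj_eq[OF n yR conjunct1[OF yc] 2(3) True])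
      moreover have "iswall n y" using yc True 2(3) by (auto simp: iswall_def)
      ultimately have "nbx n y = Wreg n (ch n y) j" using yc by (simp add: nbx_def)
      then show ?thesis using sub W 2(6) by simp
    next
      case False
      then obtain T where T: "T \<subseteq> {..<n}" "y \<in> regA n {} T" using yc ch_subset acts_subset by metis
      have "nbx n y = regA n {} (ch n y)" using regA_not_vanish[OF n T(2)] by (auto simp: nbx_def iswall_def)
      then have "nbx n y \<subseteq> Wreg n (ch n y) j" using regA_subset_Wreg[OF n] by simp
      then show ?thesis using sub W 2(6) by simp
    qed
  next
    case 3
    then have yA: "y \<in> regA n {} (ch n x)" using y by simp
    then have "ch n y = ch n x" by (rule ch_regA[OF n ch_subset])
    then have "nbx n y = nbx n x" using regA_not_vanish[OF n yA] 3(3) by (auto simp: nbx_def iswall_def)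
    then show ?thesis using sub by simp
  qed (use x in auto)
qed

text \<open>The path is replaced by a detour over the two chamber centres; between them it either
  rests or crosses the wall once.\<close>

lemma theta_nbx:
  assumes x: "x \<in> topspace (RC n)" "\<not> codim2 n x" and y: "y \<in> nbx n x"
  shows "theta (nbx n x) x y = A0 x \<otimes>\<^bsub>PG\<^esub> Psi (ch n x) (etw n x y) \<otimes>\<^bsub>PG\<^esub> inv\<^bsub>PG\<^esub> A0 y"
proof -
  let ?U = "nbx n x" and ?zx = "zc n (ch n x)" and ?zy = "zc n (ch n y)"
  note U = nbx_props(3,2)[OF n x(1)]
  have z: "?zx \<in> ?U" "?zy \<in> ?U" using zc_in_nbx[OF n x] U(2) y by auto
  have yR: "y \<in> topspace (RC n)" using nbx_topspace[OF n x(1) y] .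
  have "theta ?U ?zx ?zy = Psi (ch n x) (etw n x y)"
  proof (cases "ch n x = ch n y")
    case True
    then show ?thesis using x theta_refl[OF U(1) z(1)] by (simp add: etw_def)
  next
    case False
    show ?thesis
    proof (cases rule: nbx_cases[OF n x(1)])
      case (2 j)
      then have "ch n y = acts n [j] (ch n x)" using False ch_Wreg[OF n ch_subset 2(3)] y by metis
      then show ?thesis using 2 etw_wall[OF n x 2(3,4)] False by (simp add: Psi_single gam_def del: Psi.simps)
    next
      case 3
      then show ?thesis using False y ch_regA[OF n ch_subset] by metis
    qed (use x in auto)
  qed
  then have "A0 x \<otimes>\<^bsub>PG\<^esub> Psi (ch n x) (etw n x y) \<otimes>\<^bsub>PG\<^esub> inv\<^bsub>PG\<^esub> A0 y =
     theta ?U x ?zx \<otimes>\<^bsub>PG\<^esub> theta ?U ?zx ?zy \<otimes>\<^bsub>PG\<^esub> theta ?U ?zy y"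
    using A0_nbx[OF x U(2)] A0_nbx[OF x y] theta_inv[OF U(1) y z(2)] by simp
  also have "\<dots> = theta ?U x y" using theta_mult[OF U(1)] U(2) z y by simp
  finally show ?thesis by simp
qed

subsection \<open>Turning around the stratum of codimension two\<close>

text \<open>Along a path that avoids this stratum, and crosses the slit behind which \<open>wt\<close> jumps only in
  the direction where \<open>wt\<close> is continuous, the following quantity does not change.\<close>

lemma cl_sector_path:
  assumes w: "pathin (RC n) w" "w ` {0..1} \<subseteq> UC n x" and x: "x \<in> UU n"
    and cd: "\<And>t. t \<in> {0..1} \<Longrightarrow> \<not> codim2 n (w t)"
    and slit: "\<And>t. t \<in> {0..1} \<Longrightarrow> \<not> (va n (w t) = 0 \<and> ua n (w t) < 0) \<or> (\<forall>s\<in>{0..1}. va n (w s) \<ge> 0)"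
  shows "theta (UC n x) (w 0) (w 1) = A0 (w 0) \<otimes>\<^bsub>PG\<^esub> inv\<^bsub>PG\<^esub> Psi (ch0 n x) (wt n (w 0)) \<otimes>\<^bsub>PG\<^esub>
    (Psi (ch0 n x) (wt n (w 1)) \<otimes>\<^bsub>PG\<^esub> inv\<^bsub>PG\<^esub> A0 (w 1))"
proof -
  let ?S = "ch0 n x"
  have wR: "w t \<in> topspace (RC n)" if "t \<in> {0..1}" for t using pathin_topspace[OF w(1) that] .
  have wU: "w t \<in> UU n" "ch0 n (w t) = ?S" if "t \<in> {0..1}" for t
    using w(2) that UC_ch0[OF n] by (auto simp: UC_def image_subset_iff)
  have S: "?S \<subseteq> {..<n}" by (auto simp: ch0_def)
  note Ac = A0_closed[OF wR cd]
  have chw: "ch n (w t) = acts n (wt n (w t)) ?S" if "t \<in> {0..1}" for t using wU[OF that] by (simp add: ch_def)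
  \<comment> \<open>The part of the path up to time \<open>t\<close>, then to the centre, then back
    along the sector word to the centre of \<open>?S\<close>. Its constancy is the claim.\<close>
  define B where "B t = cl (path_part 0 t w) \<otimes>\<^bsub>PG\<^esub> (A0 (w t) \<otimes>\<^bsub>PG\<^esub> inv\<^bsub>PG\<^esub> Psi ?S (wt n (w t)))" for t
  have loc: "\<forall>t\<in>{0..1}. eventually (\<lambda>t'. B t = B t') (at t within {0..1})"
  proof
    fix t :: real assume t: "t \<in> {0..1}"
    let ?V = "nbx n (w t) \<inter> nb n (w t)"
    have V: "openin (RC n) ?V" "w t \<in> ?V"
      using nbx_props[OF n wR[OF t]] openin_nb[OF n] nb_refl[OF n wU(1)[OF t]] by auto
    obtain N where N: "open N" "t \<in> N" "\<And>s. s \<in> N \<inter> {0..1} \<Longrightarrow> w s \<in> ?V"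
      using G.continuous_map_nbhd[OF w(1)[unfolded pathin_def] V t] by blast
    obtain r where r: "r > 0" "ball t r \<subseteq> N" using N(1,2) open_contains_ball by blast
    have "B t = B s" if s: "s \<in> ball t r" "s \<in> {0..1}" for s
    proof -
      have "path_part t s w ` {0..1} \<subseteq> ?V"
      proof
        fix y assume "y \<in> path_part t s w ` {0..1}"
        then obtain q where q: "q \<in> {0..1}" "y = w (t + q * (s - t))" by (auto simp: path_part_def)
        have "t + q * (s - t) \<in> ball t r"
          using convexD[OF convex_ball[of t r], of t s "1 - q" q] s r(1) q(1) by (auto simp: algebra_simps)
        then show "y \<in> ?V" using N(3) r(2) affine_in_01[OF t s(2) q(1)] q(2) by blast
      qed
      then have th: "cl (path_part t s w) = theta (nbx n (w t)) (w t) (w s)"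
        using theta_path[OF nbx_props(3)[OF n wR[OF t]] pathin_part[OF w(1) t s(2)]] by auto
      have ws: "w s \<in> nbx n (w t)" "w s \<in> nb n (w t)" using N(3) s r(2) by blast+
      have e: "wt n (w s) = wt n (w t) @ etw n (w t) (w s)"
      proof (cases "va n (w t) = 0 \<and> ua n (w t) < 0")
        case True
        then have "va n (w s) \<ge> 0" using slit[OF t] s(2) by blast
        then show ?thesis using slit_step[OF n wU(1)[OF t] _ _ ws(2)] True by auto
      next
        case False
        show ?thesis by (rule nb_step[OF n wU(1)[OF t] cd[OF t] False ws(2)])
      qed
      have Ps: "Psi ?S (wt n (w s)) = Psi ?S (wt n (w t)) \<otimes>\<^bsub>PG\<^esub> Psi (ch n (w t)) (etw n (w t) (w s))"
        unfolding e Psi_append[OF S] chw[OF t] ..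
      have z: "(0::real) \<in> {0..1}" by simp
      have "B s = cl (path_part 0 t w) \<otimes>\<^bsub>PG\<^esub> cl (path_part t s w) \<otimes>\<^bsub>PG\<^esub>
          (A0 (w s) \<otimes>\<^bsub>PG\<^esub> inv\<^bsub>PG\<^esub> Psi ?S (wt n (w s)))"
        unfolding B_def cl_part[OF w(1) z t s(2)] ..
      also have "\<dots> = B t"
        unfolding th theta_nbx[OF wR[OF t] cd[OF t] ws(1)] Ps B_def
        using Ac[OF t t] Ac[OF s(2) s(2)] cl_closed[OF pathin_part[OF w(1) z t]]
        by (simp add: P.m_assoc P.inv_mult_group P.mult_inv_cancel)
      finally show ?thesis by simp
    qed
    then show "eventually (\<lambda>t'. B t = B t') (at t within {0..1})"
      unfolding eventually_at_topological using r(1) by (intro exI[of _ "ball t r"]) auto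
  qed
  have "B 0 = B 1" by (rule connected_local_const[OF _ _ _ loc]) auto
  moreover have "cl (path_part 0 0 w) = \<one>\<^bsub>PG\<^esub>" unfolding path_part_def using cl_const[OF wR[of 0]] by simp
  moreover have A: "A0 (w 0) \<in> carrier PG" "A0 (w 1) \<in> carrier PG" using Ac[of 0] Ac[of 1] by auto
  ultimately have eq: "A0 (w 0) \<otimes>\<^bsub>PG\<^esub> inv\<^bsub>PG\<^esub> Psi ?S (wt n (w 0)) =
      cl w \<otimes>\<^bsub>PG\<^esub> (A0 (w 1) \<otimes>\<^bsub>PG\<^esub> inv\<^bsub>PG\<^esub> Psi ?S (wt n (w 1)))"
    by (simp add: B_def)
  have "cl w = theta (UC n x) (w 0) (w 1)" by (rule theta_path[OF sconn_UC[OF n x] w])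
  then show ?thesis unfolding eq using A cl_closed[OF w(1)] by (simp add: P.m_assoc P.mult_inv_cancel)
qed

definition sect where
  "sect x y y' \<longleftrightarrow> theta (UC n x) y y' = A0 y \<otimes>\<^bsub>PG\<^esub> inv\<^bsub>PG\<^esub> Psi (ch0 n x) (wt n y) \<otimes>\<^bsub>PG\<^esub>
    (Psi (ch0 n x) (wt n y') \<otimes>\<^bsub>PG\<^esub> inv\<^bsub>PG\<^esub> A0 y')"

lemma UC_RC: "y \<in> UC n x \<Longrightarrow> y \<in> topspace (RC n)"
  using UU_subset by (auto simp: UC_def)

lemma sect_trans:
  assumes x: "x \<in> UU n" and y: "y1 \<in> UC n x" "y2 \<in> UC n x" "y3 \<in> UC n x"
    "\<not> codim2 n y1" "\<not> codim2 n y2" "\<not> codim2 n y3"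
    and s: "sect x y1 y2" "sect x y2 y3"
  shows "sect x y1 y3"
proof -
  have A: "A0 y1 \<in> carrier PG" "A0 y2 \<in> carrier PG" "A0 y3 \<in> carrier PG"
    using A0_closed y UC_RC by auto
  have "theta (UC n x) y1 y3 = theta (UC n x) y1 y2 \<otimes>\<^bsub>PG\<^esub> theta (UC n x) y2 y3"
    using theta_mult[OF sconn_UC[OF n x] y(1-3)] by simp
  also have "\<dots> = A0 y1 \<otimes>\<^bsub>PG\<^esub> inv\<^bsub>PG\<^esub> Psi (ch0 n x) (wt n y1) \<otimes>\<^bsub>PG\<^esub>
    (Psi (ch0 n x) (wt n y3) \<otimes>\<^bsub>PG\<^esub> inv\<^bsub>PG\<^esub> A0 y3)"
    using s A unfolding sect_def by (simp add: P.m_assoc P.mult_inv_cancel)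
  finally show ?thesis unfolding sect_def .
qed

text \<open>In the plane of \<open>(a n, b n)\<close> the segment from a point off the slit to (1,
  0) avoids the slit and the origin. After that the pair is kept at (1, 0) while the other
  coordinates are moved to those of \<open>x\<close>.\<close>

lemma sect_to_axis:
  assumes x: "x \<in> UU n" and y: "y \<in> UC n x" "\<not> codim2 n y" "\<not> (va n y = 0 \<and> ua n y < 0)"
  shows "sect x y (rd n 1 0 x)"
proof -
  have yU: "y \<in> UU n" using y(1) by (simp add: UC_def)
  let ?u = "\<lambda>t. (1 - t) * ua n y + t" and ?v = "\<lambda>t. (1 - t) * va n y"
  let ?w = "\<lambda>t. rd n (?u t) (?v t) y"
  have c: "pathin (RC n) (\<lambda>_. y)" using UC_RC[OF y(1)] by (simp add: pathin_const_eq)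
  have "pathin (RC n) ?w"
    by (rule pathin_rd[OF n c]) (use yU in \<open>auto intro!: continuous_intros\<close>)
  moreover have "?w ` {0..1} \<subseteq> UC n x" using rd_UC[OF n yU] y(1) by auto
  moreover have nz: "\<not> (?v t = 0 \<and> ?u t \<le> 0)" if t: "t \<in> {0..1}" for t
  proof
    assume a: "?v t = 0 \<and> ?u t \<le> 0"
    show False
    proof (cases "t = 1")
      case False
      then have v: "va n y = 0" using a by simp
      then have "ua n y > 0" using y(2,3) UU_codim2[OF n yU] by auto
      then have "(1 - t) * ua n y > 0" using t False by auto
      then show False using a t by auto
    qed (use a in auto)
  qed
  moreover have "\<not> codim2 n (?w t)" if "t \<in> {0..1}" for t
    using nz[OF that] rd_codim2[OF n yU] by auto
  moreover have "\<not> (va n (?w t) = 0 \<and> ua n (?w t) < 0)" if "t \<in> {0..1}" for t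
    using nz[OF that] rd_coords[OF n yU] by auto
  ultimately have 1: "sect x (?w 0) (?w 1)"
    unfolding sect_def by (intro cl_sector_path x) auto
  have w01: "?w 0 = y" "?w 1 = rd n 1 0 y" using rd_self[OF n yU] by auto
  obtain p where p: "pathin (RC n) p" "p ` {0..1} \<subseteq> UC n x" "p 0 = y" "p 1 = x"
    using sconn_path[OF sconn_UC[OF n x] y(1) UC_refl[OF n x]] by blast
  have pU: "p t \<in> UU n" if "t \<in> {0..1}" for t using p(2) that by (auto simp: UC_def image_subset_iff)
  let ?q = "\<lambda>t. rd n 1 0 (p t)"
  have "pathin (RC n) ?q"
    by (rule pathin_rd[OF n p(1)]) (use pU in auto)
  moreover have "?q ` {0..1} \<subseteq> UC n x" using rd_UC[OF n pU] p(2) by (auto simp: image_subset_iff)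
  moreover have "\<not> codim2 n (?q t)" "\<not> (va n (?q t) = 0 \<and> ua n (?q t) < 0)" if "t \<in> {0..1}" for t
    using rd_codim2[OF n pU[OF that]] rd_coords[OF n pU[OF that]] by auto
  ultimately have 2: "sect x (?q 0) (?q 1)"
    unfolding sect_def by (intro cl_sector_path x) auto
  have q01: "?q 0 = rd n 1 0 y" "?q 1 = rd n 1 0 x" using p by auto
  show ?thesis
    by (rule sect_trans[OF x y(1) _ _ y(2) _ _ 1[unfolded w01] 2[unfolded q01]])
      (use rd_UC[OF n yU] y(1) rd_UC[OF n x] UC_refl[OF n x] rd_codim2[OF n yU] rd_codim2[OF n x] in auto)
qed

text \<open>A point on the slit is first moved to the side \<open>b n > 0\<close>, towards which
  \<open>wt\<close> does not jump.\<close>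

lemma sect_axis:
  assumes x: "x \<in> UU n" and y: "y \<in> UC n x" "\<not> codim2 n y"
  shows "sect x y (rd n 1 0 x)"
proof (cases "va n y = 0 \<and> ua n y < 0")
  case False then show ?thesis using sect_to_axis[OF x y] by blast
next
  case True
  have yU: "y \<in> UU n" using y(1) by (simp add: UC_def)
  let ?w = "\<lambda>t. rd n (ua n y) t y"
  have c: "pathin (RC n) (\<lambda>_. y)" using UC_RC[OF y(1)] by (simp add: pathin_const_eq)
  have "pathin (RC n) ?w"
    by (rule pathin_rd[OF n c]) (use yU in \<open>auto intro!: continuous_intros\<close>)
  moreover have "?w ` {0..1} \<subseteq> UC n x" using rd_UC[OF n yU] y(1) by auto
  moreover have "\<not> codim2 n (?w t)" for t
    using rd_codim2[OF n yU] True by auto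
  moreover have "va n (?w t) \<ge> 0" if "t \<in> {0..1}" for t
    using that rd_coords[OF n yU] by auto
  ultimately have 1: "sect x (?w 0) (?w 1)"
    unfolding sect_def by (intro cl_sector_path x) auto
  have w0: "?w 0 = y" using rd_self[OF n yU] True by simp
  have w1: "?w 1 \<in> UC n x" "\<not> codim2 n (?w 1)" "\<not> (va n (?w 1) = 0 \<and> ua n (?w 1) < 0)"
    using rd_UC[OF n yU] y(1) rd_codim2[OF n yU] rd_coords[OF n yU] by auto
  show ?thesis
    by (rule sect_trans[OF x y(1) w1(1) _ y(2) w1(2) _ 1[unfolded w0] sect_to_axis[OF x w1]])
      (use rd_UC[OF n x] UC_refl[OF n x] rd_codim2[OF n x] in auto)
qed

lemma sect_all:
  assumes x: "x \<in> UU n" and y: "y \<in> UC n x" "\<not> codim2 n y" and z: "z \<in> UC n x" "\<not> codim2 n z"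
  shows "sect x y z"
proof -
  let ?a = "rd n 1 0 x"
  have a: "?a \<in> UC n x" "\<not> codim2 n ?a" using rd_UC[OF n x] UC_refl[OF n x] rd_codim2[OF n x] by auto
  have A: "A0 z \<in> carrier PG" "A0 ?a \<in> carrier PG" using A0_closed z a UC_RC by auto
  have "theta (UC n x) ?a z = inv\<^bsub>PG\<^esub> theta (UC n x) z ?a"
    using theta_inv[OF sconn_UC[OF n x] z(1) a(1)] by simp
  then have "sect x ?a z"
    using sect_axis[OF x z] A unfolding sect_def by (simp add: P.inv_mult_group P.m_assoc)
  then show ?thesis using sect_trans[OF x y(1) a(1) z(1) y(2) a(2) z(2) sect_axis[OF x y]] by blast
qed

text \<open>For a short step across the slit two words are available: the letter \<open>n\<close> of
  the local crossing, and the difference of sector words, which goes around the stratum. Both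
  compute the one path class that the cell allows.\<close>

lemma slopes_relation:
  assumes x: "x \<in> topspace (RC n)" "codim2 n x"
  shows "Psi (ch0 n x) (srt (ra n x) (slopes n) @ [n] @ srt (ra n x) (slopes n)) = Psi (ch0 n x) [n]"
proof -
  have xU: "x \<in> UU n" by (rule codim2_UU[OF n x])
  let ?y = "rd n (-1) 0 x" and ?S = "ch0 n x" and ?L = "srt (ra n x) (slopes n)"
  have yU: "?y \<in> UU n" and yC: "?y \<in> UC n x" and yn: "\<not> codim2 n ?y" and yc: "ua n ?y = -1" "va n ?y = 0"
    using rd_UU[OF n xU] rd_UC[OF n xU] UC_refl[OF n xU] rd_codim2[OF n xU] rd_coords[OF n xU] by auto
  have yR: "?y \<in> topspace (RC n)" using yC UC_RC by blast
  let ?V = "nbx n ?y \<inter> nb n ?y"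
  have V: "openin (RC n) ?V" "?y \<in> ?V"
    using nbx_props[OF n yR] openin_nb[OF n] nb_refl[OF n yU] by auto
  let ?w = "\<lambda>t. rd n (-1) (-t) x"
  have c: "pathin (RC n) (\<lambda>_. x)" using x by (simp add: pathin_const_eq)
  have w: "pathin (RC n) ?w"
    by (rule pathin_rd[OF n c]) (use xU in \<open>auto intro!: continuous_intros\<close>)
  obtain N where N: "open N" "0 \<in> N" "\<And>s. s \<in> N \<inter> {0..1} \<Longrightarrow> ?w s \<in> ?V"
    using G.continuous_map_nbhd[OF w[unfolded pathin_def] V(1), of 0] V(2) by auto
  obtain r where r: "r > 0" "ball 0 r \<subseteq> N" using N(1,2) open_contains_ball by blast
  \<comment> \<open>Small enough for the step to stay where the crossing of wall \<open>n\<close> is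
    local.\<close>
  define e where "e = min 1 (r / 2)"
  have e: "0 < e" "e \<le> 1" "e < r" using r by (auto simp: e_def)
  let ?z = "?w e"
  have wV: "?w s \<in> ?V" if "0 \<le> s" "s \<le> e" for s
    using N(3) r(2) that e by (auto simp: subset_eq dist_real_def)
  have zC: "?z \<in> UC n x" and zn: "\<not> codim2 n ?z" and zv: "va n ?z < 0"
    using rd_UC[OF n xU] UC_refl[OF n xU] rd_codim2[OF n xU] rd_coords[OF n xU] e by auto
  have zR: "?z \<in> topspace (RC n)" using zC UC_RC by blast
  have ss: "wt n ?y = []" "wt n ?z = srt (ra n ?y) (slopes n) @ [n] @ srt (ra n ?y) (slopes n)" "etw n ?y ?z = [n]"
    using slit_step[OF n yU yc(2) _ conjunct2[OF wV[of e, unfolded Int_iff]]] yc zv e by auto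
  have sr: "srt (ra n ?y) (slopes n) = ?L" using UC_srt[OF n xU yC] by simp
  have cy: "ch n ?y = ?S"
    using yU ss(1) UC_ch0[OF n yC] by (simp add: ch_def acts_Nil ch0_def subset_eq)
  have p: "pathin (RC n) (path_part 0 e ?w)" using w e by (intro pathin_part) auto
  have pV: "path_part 0 e ?w s \<in> ?V" if "s \<in> {0..1}" for s
    unfolding path_part_def using that e by (intro wV) (auto simp: mult_left_le_one_le)
  have "path_part 0 e ?w ` {0..1} \<subseteq> UC n x"
    unfolding path_part_def using rd_UC[OF n xU] UC_refl[OF n xU] by auto
  moreover have "path_part 0 e ?w ` {0..1} \<subseteq> nbx n ?y" using pV by blast
  ultimately have "theta (UC n x) ?y ?z = theta (nbx n ?y) ?y ?z"
    using theta_path[OF sconn_UC[OF n xU] p] theta_path[OF nbx_props(3)[OF n yR] p] by simp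
  also have "\<dots> = A0 ?y \<otimes>\<^bsub>PG\<^esub> Psi ?S [n] \<otimes>\<^bsub>PG\<^esub> inv\<^bsub>PG\<^esub> A0 ?z"
    using theta_nbx[OF yR yn, of ?z] wV[of e] e unfolding ss cy by auto
  finally have "A0 ?y \<otimes>\<^bsub>PG\<^esub> Psi ?S [n] \<otimes>\<^bsub>PG\<^esub> inv\<^bsub>PG\<^esub> A0 ?z =
     A0 ?y \<otimes>\<^bsub>PG\<^esub> inv\<^bsub>PG\<^esub> Psi ?S [] \<otimes>\<^bsub>PG\<^esub> (Psi ?S (?L @ [n] @ ?L) \<otimes>\<^bsub>PG\<^esub> inv\<^bsub>PG\<^esub> A0 ?z)"
    using sect_all[OF xU yC yn zC zn] unfolding sect_def ss sr by simp
  moreover have "A0 ?y \<in> carrier PG" "A0 ?z \<in> carrier PG" using A0_closed yR yn zR zn by auto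
  moreover define X where "X = Psi ?S [n]"
  moreover define Y where "Y = Psi ?S (?L @ [n] @ ?L)"
  moreover have "X \<in> carrier PG" "Y \<in> carrier PG" unfolding X_def Y_def by (rule Psi_closed)+
  ultimately have "A0 ?y \<otimes>\<^bsub>PG\<^esub> (X \<otimes>\<^bsub>PG\<^esub> inv\<^bsub>PG\<^esub> A0 ?z) = A0 ?y \<otimes>\<^bsub>PG\<^esub> (Y \<otimes>\<^bsub>PG\<^esub> inv\<^bsub>PG\<^esub> A0 ?z)"
    by (simp add: P.m_assoc)
  then show ?thesis
    using \<open>A0 ?y \<in> carrier PG\<close> \<open>A0 ?z \<in> carrier PG\<close> \<open>X \<in> carrier PG\<close> \<open>Y \<in> carrier PG\<close>
    unfolding X_def[symmetric] Y_def[symmetric] by simp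
qed

end

context pointed_config
begin

section \<open>The relations of the group hold for path classes\<close>

lemma acts_square: "S \<subseteq> {..<n} \<Longrightarrow> acts n (js @ js) S = S"
  by (auto simp: acts_def flips_def)

text \<open>Reading a closed word from another of its chambers gives a conjugate, and conjugates of
  the unit are trivial.\<close>

lemma Psi_rotate:
  assumes S: "S \<subseteq> {..<n}" and a: "acts n (u @ v) S = S" and P: "Psi S (u @ v) = \<one>\<^bsub>PG\<^esub>"
  shows "Psi (acts n u S) (v @ u) = \<one>\<^bsub>PG\<^esub>"
proof -
  have "Psi S u \<otimes>\<^bsub>PG\<^esub> Psi (acts n u S) v = \<one>\<^bsub>PG\<^esub>" using P Psi_append[OF S] by simp
  then have "Psi (acts n u S) v \<otimes>\<^bsub>PG\<^esub> Psi S u = \<one>\<^bsub>PG\<^esub>" by (rule P.inv_comm) simp_all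
  then show ?thesis using a Psi_append[OF acts_subset, of u S v u] by (simp add: acts_append)
qed

lemma Psi_reverse:
  assumes S: "S \<subseteq> {..<n}" and a: "acts n w S = S" and P: "Psi S w = \<one>\<^bsub>PG\<^esub>"
  shows "Psi S (rev w) = \<one>\<^bsub>PG\<^esub>"
  using Psi_rev[OF S, of w] a P by simp

lemma acts_slopes:
  assumes S: "S \<subseteq> {..<n}" and L: "set L = slopes n" "distinct L"
  shows "acts n L S = S"
proof -
  have "\<not> flips n L i" if "i < n" for i
    using L slopes_mem[of n] slopes_mem(2)[OF that] that by (simp add: flips_def count_list_distinct)
  then show ?thesis using S by (auto simp: acts_def)
qed

text \<open>The two words are rotations of each other by \<open>L\<close>, which fixes every label,
  so both are read from the same chamber.\<close>

lemma Psi_slopes_rotate: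
  assumes S: "S \<subseteq> {..<n}" and L: "set L = slopes n" "distinct L"
  shows "Psi S ((L @ [n]) @ (L @ [n])) = \<one>\<^bsub>PG\<^esub> \<longleftrightarrow> Psi S (([n] @ L) @ ([n] @ L)) = \<one>\<^bsub>PG\<^esub>"
proof
  assume "Psi S ((L @ [n]) @ (L @ [n])) = \<one>\<^bsub>PG\<^esub>"
  then show "Psi S (([n] @ L) @ ([n] @ L)) = \<one>\<^bsub>PG\<^esub>"
    using Psi_rotate[OF S, of L "[n] @ L @ [n]"] acts_square[OF S, of "L @ [n]"] acts_slopes[OF S L] by simp
next
  assume "Psi S (([n] @ L) @ ([n] @ L)) = \<one>\<^bsub>PG\<^esub>"
  moreover have "acts n ([n] @ L @ [n]) S = S"
    using acts_single_twice[OF S, of n] acts_slopes[OF acts_subset L] by (simp add: acts_append del: append_Cons)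
  ultimately show "Psi S ((L @ [n]) @ (L @ [n])) = \<one>\<^bsub>PG\<^esub>"
    using Psi_rotate[OF S, of "[n] @ L @ [n]" L] acts_square[OF S, of "[n] @ L"] by simp
qed

text \<open>Rotating by the letter \<open>n\<close> moves the starting chamber to the complementary
  label.\<close>

lemma Psi_slopes_turn:
  assumes S: "S \<subseteq> {..<n}" and L: "set L = slopes n" "distinct L" and P: "Psi S ((L @ [n]) @ (L @ [n])) = \<one>\<^bsub>PG\<^esub>"
  shows "Psi (acts n [n] S) ((L @ [n]) @ (L @ [n])) = \<one>\<^bsub>PG\<^esub>"
  using Psi_rotate[OF S, of "[n]" "L @ [n] @ L"] acts_square[OF S, of "[n] @ L"] Psi_slopes_rotate[OF S L] P by simp

lemma Psi_slopes_base:
  assumes S: "S \<subseteq> {..<n}" "0 \<in> S" and L: "set L = slopes n" "distinct L" "L = L1 @ [n+1] @ L2" "0 \<in> set L2"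
  shows "Psi S ((L @ [n]) @ (L @ [n])) = \<one>\<^bsub>PG\<^esub>"
proof -
  obtain x where x: "x \<in> topspace (RC n)" "codim2 n x" "ch0 n x = S" "srt (ra n x) (slopes n) = L"
    by (rule codim2_realize[OF n S L])
  have "Psi S (L @ [n] @ L) = Psi S [n]" using slopes_relation[OF x(1,2)] x(3,4) by simp
  moreover have "acts n (L @ [n] @ L) S = acts n [n] S"
    using acts_slopes[OF S(1) L(1,2)] acts_slopes[OF acts_subset L(1,2)] by (simp add: acts_append del: append_Cons)
  ultimately have "Psi S ((L @ [n] @ L) @ [n]) = gam S n \<otimes>\<^bsub>PG\<^esub> gam (acts n [n] S) n"
    unfolding Psi_append[OF S(1)] by (simp add: gam_closed)
  then show ?thesis using gam_square[OF S(1)] by simp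
qed

text \<open>The stratum itself supplies the relation for labels containing 0 and orders with
  \<open>n + 1\<close> before 0. Turning by \<open>n\<close> complements the label, and reading the
  word backwards reverses the order; together these reach all cases.\<close>

lemma Psi_slopes:
  assumes S: "S \<subseteq> {..<n}" and L: "set L = slopes n" "distinct L"
  shows "Psi S ((L @ [n]) @ (L @ [n])) = \<one>\<^bsub>PG\<^esub>"
proof -
  have n0: "0 < n" using n by simp
  have 1: "Psi T ((L @ [n]) @ (L @ [n])) = \<one>\<^bsub>PG\<^esub>"
    if T: "T \<subseteq> {..<n}" and L: "set L = slopes n" "distinct L" "L = L1 @ [n+1] @ L2" "0 \<in> set L2" for T L L1 L2
  proof (cases "0 \<in> T")
    case True then show ?thesis using Psi_slopes_base[OF T True L] by simp
  next
    case False
    then have "0 \<in> acts n [n] T" using acts_single_ge[of n n 0 T] n0 by simp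
    then have "Psi (acts n [n] T) ((L @ [n]) @ (L @ [n])) = \<one>\<^bsub>PG\<^esub>" by (intro Psi_slopes_base[OF acts_subset _ L])
    then show ?thesis using Psi_slopes_turn[OF acts_subset L(1,2), of "[n]" T] acts_single_twice[OF T] by simp
  qed
  have "n + 1 \<in> set L" "0 \<in> set L" using L slopes_mem(1)[of n] slopes_mem(2)[OF n0] by auto
  then obtain L1 L2 where L12: "L = L1 @ [n+1] @ L2" by (metis split_list append_Cons append_Nil)
  then have "0 \<in> set L1 \<or> 0 \<in> set L2" using \<open>0 \<in> set L\<close> by auto
  then show ?thesis
  proof
    assume "0 \<in> set L2" then show ?thesis using 1[OF S L L12] by simp
  next
    assume 0: "0 \<in> set L1"
    have r: "set (rev L) = slopes n" "distinct (rev L)" "rev L = rev L2 @ [n+1] @ rev L1" "0 \<in> set (rev L1)"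
      using L L12 0 by auto
    have "Psi S (([n] @ rev L) @ ([n] @ rev L)) = \<one>\<^bsub>PG\<^esub>"
      using 1[OF S r] Psi_slopes_rotate[OF S r(1,2)] by blast
    then have "Psi S (rev (([n] @ rev L) @ ([n] @ rev L))) = \<one>\<^bsub>PG\<^esub>"
      by (rule Psi_reverse[OF S acts_square[OF S]])
    then show ?thesis by simp
  qed
qed

text \<open>Any ordering of all letters becomes, after a rotation, an ordering of the slopes
  followed by \<open>n\<close>.\<close>

lemma Psi_ordering:
  assumes S: "S \<subseteq> {..<n}" and js: "distinct js" "set js = {..n+1}"
  shows "Psi S (js @ js) = \<one>\<^bsub>PG\<^esub>"
proof -
  have "n \<in> set js" using js by auto
  then obtain us vs where uv: "js = us @ [n] @ vs" by (metis split_list append_Cons append_Nil)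
  have nn: "n \<notin> set (vs @ us)" using js(1) uv by auto
  have "set js = insert n (set (vs @ us))" using uv by auto
  then have L: "set (vs @ us) = slopes n" "distinct (vs @ us)"
    using nn js(2) uv js(1) unfolding slopes_def by auto
  let ?T = "acts n us S" and ?u = "[n] @ vs @ us @ [n] @ vs"
  have "Psi ?T (?u @ us) = \<one>\<^bsub>PG\<^esub>"
    using Psi_slopes[OF acts_subset L] Psi_slopes_rotate[OF acts_subset L] by simp
  then have 1: "Psi (acts n ?u ?T) (us @ ?u) = \<one>\<^bsub>PG\<^esub>"
    by (rule Psi_rotate[OF acts_subset, rotated]) (use acts_square[OF acts_subset, of "[n] @ vs @ us"] in simp)
  have "acts n ?u ?T = acts n (js @ js) S" unfolding uv by (simp add: acts_append[symmetric])
  then show ?thesis using 1 acts_square[OF S, of js] uv by simp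
qed

lemma Psi_gel:
  assumes S: "S \<subseteq> {..<n}" and "set xs \<subseteq> {..n+1}" "set ys \<subseteq> {..n+1}" "gel n xs = gel n ys"
  shows "Psi S xs = Psi S ys"
proof (rule gel_eq_imp[of n "Psi S" xs ys, OF _ _ assms(2-4)])
  fix u v :: "nat list" and j :: nat
  have "Psi S (u @ [j, j] @ v) = Psi S u \<otimes>\<^bsub>PG\<^esub> ((gam (acts n u S) j \<otimes>\<^bsub>PG\<^esub> gam (acts n [j] (acts n u S)) j) \<otimes>\<^bsub>PG\<^esub>
     Psi (acts n [j] (acts n [j] (acts n u S))) v)"
    unfolding Psi_append[OF S] by (simp add: gam_closed P.m_assoc)
  also have "\<dots> = Psi S (u @ v)"
    unfolding Psi_append[OF S] gam_square[OF acts_subset] acts_single_twice[OF acts_subset] by simp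
  finally show "Psi S (u @ [j, j] @ v) = Psi S (u @ v)" .
next
  fix u v js :: "nat list" assume js: "distinct js" "set js = {..n+1}"
  have "Psi T ((js @ js) @ v) = Psi T v" if T: "T \<subseteq> {..<n}" for T
    unfolding Psi_append[OF T, of "js @ js"] Psi_ordering[OF T js] acts_square[OF T] by simp
  then show "Psi S (u @ (js @ js) @ v) = Psi S (u @ v)"
    unfolding Psi_append[OF S] using acts_subset by metis
qed

text \<open>On the stratum no chamber is distinguished by position, so the way leads over the point
  with last coordinates (1, 0) to its centre, and back along its sector word to the centre of
  \<open>ch0\<close>.\<close>

definition AA where
  "AA x = (if codim2 n x then theta (UC n x) x (rd n 1 0 x) \<otimes>\<^bsub>PG\<^esub> A0 (rd n 1 0 x) \<otimes>\<^bsub>PG\<^esub>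
     inv\<^bsub>PG\<^esub> Psi (ch0 n x) (wt n (rd n 1 0 x)) else A0 x)"

section \<open>Words of arbitrary paths\<close>

lemma axis_props:
  assumes x: "x \<in> topspace (RC n)" "codim2 n x"
  shows "x \<in> UU n" "rd n 1 0 x \<in> UC n x" "\<not> codim2 n (rd n 1 0 x)" "rd n 1 0 x \<in> topspace (RC n)" "x \<in> UC n x"
    "A0 (rd n 1 0 x) \<in> carrier PG"
proof -
  show U: "x \<in> UU n" by (rule codim2_UU[OF n x])
  show "rd n 1 0 x \<in> UC n x" "\<not> codim2 n (rd n 1 0 x)" "x \<in> UC n x"
    using rd_UC[OF n U] UC_refl[OF n U] rd_codim2[OF n U] by auto
  then show "rd n 1 0 x \<in> topspace (RC n)" "A0 (rd n 1 0 x) \<in> carrier PG" using UC_RC A0_closed by auto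
qed

lemma AA_closed:
  assumes x: "x \<in> topspace (RC n)" shows "AA x \<in> carrier PG"
proof (cases "codim2 n x")
  case True
  note a = axis_props[OF x True]
  show ?thesis using a(6) theta_closed[OF sconn_UC[OF n a(1)] a(5,2)] by (simp add: AA_def True)
next
  case False then show ?thesis using A0_closed x by (simp add: AA_def)
qed

lemma theta_UC:
  assumes x: "x \<in> topspace (RC n)" "codim2 n x" and y: "y \<in> UC n x"
  shows "theta (UC n x) x y = AA x \<otimes>\<^bsub>PG\<^esub> Psi (ch0 n x) (wt n y) \<otimes>\<^bsub>PG\<^esub> inv\<^bsub>PG\<^esub> AA y"
proof -
  note a = axis_props[OF x]
  note U = sconn_UC[OF n a(1)]
  have main: "theta (UC n x) x y = AA x \<otimes>\<^bsub>PG\<^esub> Psi (ch0 n x) (wt n y) \<otimes>\<^bsub>PG\<^esub> inv\<^bsub>PG\<^esub> A0 y"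
    if y: "y \<in> UC n x" "\<not> codim2 n y" for y
  proof -
    have A: "A0 y \<in> carrier PG" using A0_closed UC_RC y by auto
    have "theta (UC n x) x y = theta (UC n x) x (rd n 1 0 x) \<otimes>\<^bsub>PG\<^esub> theta (UC n x) (rd n 1 0 x) y"
      using theta_mult[OF U a(5,2) y(1)] by simp
    then show ?thesis
      using sect_all[OF a(1,2,3) y] A a(6) theta_closed[OF U a(5,2)] x(2)
      unfolding sect_def AA_def by (simp add: P.m_assoc)
  qed
  show ?thesis
  proof (cases "codim2 n y")
    case False then show ?thesis using main[OF y] by (simp add: AA_def)
  next
    case True
    have yR: "y \<in> topspace (RC n)" using UC_RC[OF y] .
    note b = axis_props[OF yR True]
    have e: "UC n y = UC n x" "ch0 n y = ch0 n x" using UC_eq[OF n a(1) y] UC_ch0[OF n y] by auto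
    let ?r = "rd n 1 0 y"
    have r: "?r \<in> UC n x" using b(2) e by simp
    have t: "theta (UC n x) y ?r = AA y \<otimes>\<^bsub>PG\<^esub> Psi (ch0 n x) (wt n ?r) \<otimes>\<^bsub>PG\<^esub> inv\<^bsub>PG\<^esub> A0 ?r"
      using b(6) theta_closed[OF U y r] True unfolding AA_def e by (simp add: P.m_assoc)
    have "theta (UC n x) x y = theta (UC n x) x ?r \<otimes>\<^bsub>PG\<^esub> inv\<^bsub>PG\<^esub> theta (UC n x) y ?r"
      using theta_mult[OF U a(5) r y] theta_inv[OF U y r] by simp
    also have "\<dots> = AA x \<otimes>\<^bsub>PG\<^esub> inv\<^bsub>PG\<^esub> AA y"
      unfolding main[OF r b(3)] t using b(6) AA_closed[OF x(1)] AA_closed[OF yR]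
      by (simp add: P.m_assoc P.inv_mult_group P.mult_inv_cancel)
    finally show ?thesis using ch_codim2(2)[OF n yR True] AA_closed[OF x(1)] by simp
  qed
qed

lemma theta_local:
  assumes x: "x \<in> topspace (RC n)" and y: "y \<in> nbx n x"
  shows "theta (nbx n x) x y = AA x \<otimes>\<^bsub>PG\<^esub> Psi (ch n x) (etw n x y) \<otimes>\<^bsub>PG\<^esub> inv\<^bsub>PG\<^esub> AA y"
proof (cases "codim2 n x")
  case True
  then have "nbx n x = UC n x" "etw n x y = wt n y" by (simp_all add: nbx_def etw_def)
  then show ?thesis using theta_UC[OF x True] y ch_codim2(1)[OF n x True] by simp
next
  case False
  then show ?thesis using theta_nbx[OF x False y] nbx_not_codim2[OF x False y] by (simp add: AA_def)
qed

text \<open>The word is assembled from the transition words of a subdivision. One word carries the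
  path class, the change of label and the holonomy at once, and this ties the two constructions
  together.\<close>

lemma path_has_word:
  assumes p: "pathin (RC n) p"
  shows "\<exists>w. set w \<subseteq> {..n+1} \<and> cl p = AA (p 0) \<otimes>\<^bsub>PG\<^esub> Psi (ch n (p 0)) w \<otimes>\<^bsub>PG\<^esub> inv\<^bsub>PG\<^esub> AA (p 1) \<and>
    ch n (p 1) = acts n w (ch n (p 0)) \<and> G.hol p = gel n w"
proof -
  obtain g where g: "G.solution p {0..1} g" using G.solution_path[OF p] by blast
  have pR: "p t \<in> topspace (RC n)" if "t \<in> {0..1}" for t using pathin_topspace[OF p that] .
  note Ac = AA_closed[OF pR]
  let ?Q = "\<lambda>a b w. set w \<subseteq> {..n+1} \<and> cl (path_part a b p) = AA (p a) \<otimes>\<^bsub>PG\<^esub> Psi (ch n (p a)) w \<otimes>\<^bsub>PG\<^esub> inv\<^bsub>PG\<^esub> AA (p b) \<and>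
    ch n (p b) = acts n w (ch n (p a)) \<and> G.hol (path_part a b p) = gel n w"
  have join: "?Q a c (w @ w')" if abc: "a \<in> {0..1}" "b \<in> {0..1}" "c \<in> {0..1}" and w: "?Q a b w" "?Q b c w'" for a b c w w'
  proof -
    have "cl (path_part a c p) = AA (p a) \<otimes>\<^bsub>PG\<^esub> Psi (ch n (p a)) (w @ w') \<otimes>\<^bsub>PG\<^esub> inv\<^bsub>PG\<^esub> AA (p c)"
      unfolding cl_part[OF p abc] Psi_append[OF ch_subset] using w Ac[OF abc(1)] Ac[OF abc(2)] Ac[OF abc(3)]
      by (simp add: P.m_assoc P.mult_inv_cancel)
    moreover have "G.hol (path_part a c p) = gel n (w @ w')"
    proof -
      have "G.hol (path_part a c p) = G.hol (path_part a b p) \<otimes>\<^bsub>Gk (Suc n)\<^esub> G.hol (path_part b c p)"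
        unfolding G.hol_part[OF g abc(1,3)] G.hol_part[OF g abc(1,2)] G.hol_part[OF g abc(2,3)]
        using G.solution_closed[OF g] abc by (simp add: G.m_assoc G.mult_inv_cancel)
      then show ?thesis using w gel_append by simp
    qed
    ultimately show ?thesis using w by (auto simp: acts_append)
  qed
  have "\<forall>a b. True \<longrightarrow> 0 \<le> (0::real)" by simp
  have "(0::real) \<in> {0..1} \<and> (1::real) \<in> {0..1} \<longrightarrow> (\<exists>w. ?Q 0 1 w)"
  \<comment> \<open>The range of the ends is part of the predicate because bisection also considers
    intervals that stick out of the unit interval.\<close>
  proof (rule Bolzano[of 0 1 "\<lambda>a b. a \<in> {0..1} \<and> b \<in> {0..1} \<longrightarrow> (\<exists>w. ?Q a b w)"])
    fix a b c :: real
    assume ab: "a \<in> {0..1} \<and> b \<in> {0..1} \<longrightarrow> (\<exists>w. ?Q a b w)" and bc: "b \<in> {0..1} \<and> c \<in> {0..1} \<longrightarrow> (\<exists>w. ?Q b c w)"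
      and le: "a \<le> b" "b \<le> c"
    show "a \<in> {0..1} \<and> c \<in> {0..1} \<longrightarrow> (\<exists>w. ?Q a c w)"
    proof
      assume ac: "a \<in> {0..1} \<and> c \<in> {0..1}"
      then have b: "b \<in> {0..1}" using le by auto
      obtain w where w: "?Q a b w" using ab ac b by blast
      obtain w' where w': "?Q b c w'" using bc ac b by blast
      show "\<exists>w. ?Q a c w" using join[OF conjunct1[OF ac] b conjunct2[OF ac] w w'] by (rule exI[of "?Q a c"])
    qed
  next
    fix t :: real assume "0 \<le> t" "t \<le> 1"
    then have t: "t \<in> {0..1}" by simp
    obtain M where M: "open M" "t \<in> M" "\<forall>s\<in>M \<inter> {0..1}. g s = g t \<otimes>\<^bsub>Gk (Suc n)\<^esub> eta n (p t) (p s)"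
      using G.solutionD[OF g t] by blast
    obtain N where N: "open N" "t \<in> N" "\<And>s. s \<in> N \<inter> {0..1} \<Longrightarrow> p s \<in> nbx n (p t)"
      using G.continuous_map_nbhd[OF p[unfolded pathin_def] nbx_props(1,2)[OF n pR[OF t]] t] by blast
    obtain r where r: "r > 0" "ball t r \<subseteq> M \<inter> N" using M(1,2) N(1,2) open_contains_ball by (metis IntI open_Int)
    have step: "?Q t s (etw n (p t) (p s))" if s: "s \<in> ball t r" "s \<in> {0..1}" for s
    proof -
      have "path_part t s p ` {0..1} \<subseteq> nbx n (p t)"
      proof
        fix y assume "y \<in> path_part t s p ` {0..1}"
        then obtain q where q: "q \<in> {0..1}" "y = p (t + q * (s - t))" by (auto simp: path_part_def)
        have "t + q * (s - t) \<in> ball t r"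
          using convexD[OF convex_ball[of t r], of t s "1 - q" q] s r(1) q(1) by (auto simp: algebra_simps)
        then show "y \<in> nbx n (p t)" using N(3) r(2) affine_in_01[OF t s(2) q(1)] q(2) by blast
      qed
      then have "cl (path_part t s p) = theta (nbx n (p t)) (p t) (p s)"
        using theta_path[OF nbx_props(3)[OF n pR[OF t]] pathin_part[OF p t s(2)]] by simp
      moreover have ps: "p s \<in> nbx n (p t)" using N(3) s r(2) by blast
      moreover have "G.hol (path_part t s p) = eta n (p t) (p s)"
      proof -
        have "g s = g t \<otimes>\<^bsub>Gk (Suc n)\<^esub> eta n (p t) (p s)" using M(3) s r(2) by blast
        moreover have "eta n (p t) (p s) \<in> carrier (Gk (Suc n))" using G.eta_closed pR t s(2) by blast
        ultimately show ?thesis unfolding G.hol_part[OF g t s(2)]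
          using G.solution_closed[OF g t] by (simp add: G.mult_inv_cancel)
      qed
      ultimately show ?thesis
        using theta_local[OF pR[OF t] ps] etw_ch[OF n pR[OF t] ps] etw_set[OF n pR[OF t]] by (simp add: eta_def)
    qed
    \<comment> \<open>Transitions are given from \<open>t\<close> outwards only, so the part of the
      interval before \<open>t\<close> is treated as a reversed path.\<close>
    have bwd: "?Q s t (rev (etw n (p t) (p s)))" if s: "s \<in> ball t r" "s \<in> {0..1}" for s
    proof -
      let ?w = "etw n (p t) (p s)"
      have Q: "?Q t s ?w" by (rule step[OF s])
      then have c: "ch n (p s) = acts n ?w (ch n (p t))" by blast
      have one: "cl (path_part s t p) \<otimes>\<^bsub>PG\<^esub> cl (path_part t s p) = \<one>\<^bsub>PG\<^esub>"
        unfolding cl_part[OF p s(2) t s(2), symmetric] using cl_const[OF pR[OF s(2)]] by (simp add: path_part_def)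
      have "cl (path_part s t p) = inv\<^bsub>PG\<^esub> cl (path_part t s p)"
        using P.inv_equality[OF one cl_closed[OF pathin_part[OF p t s(2)]] cl_closed[OF pathin_part[OF p s(2) t]]] by simp
      also have "\<dots> = AA (p s) \<otimes>\<^bsub>PG\<^esub> inv\<^bsub>PG\<^esub> Psi (ch n (p t)) ?w \<otimes>\<^bsub>PG\<^esub> inv\<^bsub>PG\<^esub> AA (p t)"
        using Q Ac[OF t] Ac[OF s(2)] by (simp add: P.inv_mult_group P.m_assoc)
      also have "inv\<^bsub>PG\<^esub> Psi (ch n (p t)) ?w = Psi (ch n (p s)) (rev ?w)"
        unfolding c using Psi_rev_inv[OF ch_subset] by simp
      finally have 1: "cl (path_part s t p) = AA (p s) \<otimes>\<^bsub>PG\<^esub> Psi (ch n (p s)) (rev ?w) \<otimes>\<^bsub>PG\<^esub> inv\<^bsub>PG\<^esub> AA (p t)" .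
      have "G.hol (path_part s t p) = inv\<^bsub>Gk (Suc n)\<^esub> G.hol (path_part t s p)"
        unfolding G.hol_part[OF g s(2) t] G.hol_part[OF g t s(2)]
        using G.solution_closed[OF g t] G.solution_closed[OF g s(2)] by (simp add: G.inv_mult_group)
      then have 2: "G.hol (path_part s t p) = gel n (rev ?w)" using Q gel_rev by simp
      have 3: "ch n (p t) = acts n (rev ?w) (ch n (p s))" unfolding c using acts_rev[OF ch_subset] by simp
      have 0: "set (rev ?w) \<subseteq> {..n+1}" using etw_set[OF n pR[OF t]] by simp
      show ?thesis by (intro conjI 0 1 2 3)
    qed
    have near: "\<exists>w. ?Q a b w" if ab: "a \<le> t \<and> t \<le> b \<and> b - a < r" "a \<in> {0..1}" "b \<in> {0..1}" for a b
    proof -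
      have "a \<in> ball t r" "b \<in> ball t r" using ab(1) by (auto simp: dist_real_def)
      then have "?Q a b (rev (etw n (p t) (p a)) @ etw n (p t) (p b))"
        by (rule join[OF ab(2) t ab(3) bwd[OF _ ab(2)] step[OF _ ab(3)]])
      then show ?thesis by (rule exI[of "?Q a b"])
    qed
    show "\<exists>d>0. \<forall>a b. a \<le> t \<and> t \<le> b \<and> b - a < d \<longrightarrow> a \<in> {0..1} \<and> b \<in> {0..1} \<longrightarrow> (\<exists>w. ?Q a b w)"
    proof (intro exI[of _ r] conjI allI impI)
      fix a b assume "a \<le> t \<and> t \<le> b \<and> b - a < r" "a \<in> {0..1} \<and> b \<in> {0..1}"
      then show "\<exists>w. ?Q a b w" by (elim conjE) (rule near, simp_all)
    qed (rule r(1))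
  qed simp
  then show ?thesis by simp
qed

text \<open>Over the region of a single wall the local system has a flat section with two values,
  the unit and the letter, so any path across has the letter as its holonomy.\<close>

lemma letter_path:
  assumes S: "S \<subseteq> {..<n}" and j: "j \<le> n+1"
  obtains p where "pathin (RC n) p" "p 0 = zc n S" "p 1 = zc n (acts n [j] S)" "G.hol p = gel n [j]"
proof -
  let ?U = "Wreg n S j"
  obtain p where p: "pathin (RC n) p" "p ` {0..1} \<subseteq> ?U" "p 0 = zc n S" "p 1 = zc n (acts n [j] S)"
    using sconn_path[OF sconn_Wreg[OF n] zc_in_Wreg[OF n]] by blast
  define tau where "tau y = (if ch n y = S then gel n [] else gel n [j])" for y
  have one: "gel n [] = \<one>\<^bsub>Gk (Suc n)\<^esub>" by (rule gel_Nil)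
  have gj: "gel n [j] \<in> carrier (Gk (Suc n))" using j by (intro gel_closed) auto
  have jj: "gel n [j] \<otimes>\<^bsub>Gk (Suc n)\<^esub> gel n [j] = \<one>\<^bsub>Gk (Suc n)\<^esub>"
    using gel_append[of "[j]" n "[j]"] gel_square[OF j] j by (simp add: gel_Nil)
  have "G.hol p = inv\<^bsub>Gk (Suc n)\<^esub> tau (p 0) \<otimes>\<^bsub>Gk (Suc n)\<^esub> tau (p 1)"
  proof (rule G.hol_trivial[OF p(1,2)])
    show "tau y \<in> carrier (Gk (Suc n))" for y using gj one by (simp add: tau_def)
    fix y assume y: "y \<in> ?U"
    have yR: "y \<in> topspace (RC n)" using y Wreg_subset by blast
    note yc = Wreg_cases[OF n y S j]
    have c: "ch n z = S \<or> ch n z = acts n [j] S" if "z \<in> ?U" for z by (rule ch_Wreg[OF n S j that])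
    have ne: "acts n [j] S \<noteq> S" using acts_single_ne[of n j S] n j S by auto
    show "\<exists>V. openin (RC n) V \<and> y \<in> V \<and> (\<forall>z\<in>V \<inter> ?U. tau z = tau y \<otimes>\<^bsub>Gk (Suc n)\<^esub> eta n y z)"
    proof (cases "vanish n j y")
      case True
      have "tau z = tau y \<otimes>\<^bsub>Gk (Suc n)\<^esub> eta n y z" if z: "z \<in> ?U" for z
        unfolding eta_def etw_wall[OF n yR conjunct1[OF yc] j True] tau_def
        using c[OF y] c[OF z] ne gj jj one by (cases "ch n y = S"; cases "ch n z = S") simp_all
      then show ?thesis using yR by (intro exI[of _ "topspace (RC n)"] conjI openin_topspace) blast+
    next
      case False
      then obtain T where T: "T \<subseteq> {..<n}" "y \<in> regA n {} T" using yc S acts_subset by metis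
      have "tau z = tau y \<otimes>\<^bsub>Gk (Suc n)\<^esub> eta n y z" if z: "z \<in> regA n {} T" for z
      proof -
        have "ch n y = T" "ch n z = T" using ch_regA[OF n T(1)] T(2) z by auto
        then have "tau z = tau y" by (simp add: tau_def)
        moreover have "etw n y z = []" using regA_not_vanish[OF n T(2)] by (auto simp: etw_def iswall_def)
        moreover have "tau y \<in> carrier (Gk (Suc n))" using gj one by (simp add: tau_def)
        ultimately show ?thesis by (simp add: eta_def one)
      qed
      then show ?thesis using T(2) openin_regA by (intro exI[of _ "regA n {} T"] conjI) blast+
    qed
  qed
  moreover have "ch n (p 0) = S" "ch n (p 1) = acts n [j] S" using p ch_zc[OF n] S acts_subset by auto
  moreover have "acts n [j] S \<noteq> S" using acts_single_ne[of n j S] n j S by auto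
  ultimately have "G.hol p = gel n [j]" using gj by (simp add: tau_def one)
  then show thesis using that p by blast
qed

lemma word_path:
  assumes "S \<subseteq> {..<n}" "set js \<subseteq> {..n+1}"
  shows "\<exists>p. pathin (RC n) p \<and> p 0 = zc n S \<and> p 1 = zc n (acts n js S) \<and> G.hol p = gel n js"
  using assms
proof (induction js arbitrary: S)
  case Nil
  have c: "pathin (RC n) (\<lambda>_. zc n S)" using zc_topspace[OF n] by (simp add: pathin_const_eq)
  from G.solution_path[OF c] obtain g where g: "G.solution (\<lambda>_. zc n S) {0..1::real} g" by (rule exE)
  have "G.hol (path_part 0 0 (\<lambda>_. zc n S)) = inv\<^bsub>Gk (Suc n)\<^esub> g 0 \<otimes>\<^bsub>Gk (Suc n)\<^esub> g 0" by (rule G.hol_part[OF g]) auto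
  moreover have "path_part 0 0 (\<lambda>_. zc n S) = (\<lambda>_. zc n S)" by (simp add: path_part_def)
  moreover have "g 0 \<in> carrier (Gk (Suc n))" using G.solution_closed[OF g, of 0] by simp
  ultimately have "G.hol (\<lambda>_. zc n S) = gel n []" by (simp add: gel_Nil)
  then show ?case using c acts_Nil[OF Nil(1)] by (intro exI[of _ "\<lambda>_. zc n S"]) simp
next
  case (Cons j js)
  obtain p where p: "pathin (RC n) p" "p 0 = zc n S" "p 1 = zc n (acts n [j] S)" "G.hol p = gel n [j]"
    using letter_path[OF Cons.prems(1)] Cons.prems(2) by (metis atMost_iff insert_subset list.simps(15))
  obtain q where q: "pathin (RC n) q" "q 0 = zc n (acts n [j] S)" "q 1 = zc n (acts n js (acts n [j] S))" "G.hol q = gel n js"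
    using Cons.IH[OF acts_subset] Cons.prems(2) by (metis insert_subset list.simps(15))
  have "G.hol (path_join p q) = gel n ([j] @ js)"
    using G.hol_join[OF p(1) q(1)] p q gel_append[of "[j]" n js] Cons.prems(2) by simp
  moreover have "pathin (RC n) (path_join p q)" using pathin_join p q by metis
  ultimately show ?case using p q acts_Cons[of j js S] by (intro exI[of _ "path_join p q"]) simp
qed

section \<open>Holonomy identifies loop classes with the stabiliser\<close>

lemma hol_rev:
  assumes p: "pathin (RC n) p" shows "G.hol (path_rev p) = inv\<^bsub>Gk (Suc n)\<^esub> G.hol p"
proof -
  obtain g where g: "G.solution p {0..1} g" using G.solution_path[OF p] by blast
  have "path_rev p = path_part 1 0 p" by (simp add: path_rev_def path_part_def)
  then have "G.hol (path_rev p) = inv\<^bsub>Gk (Suc n)\<^esub> g 1 \<otimes>\<^bsub>Gk (Suc n)\<^esub> g 0" using G.hol_part[OF g, of 1 0] by simp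
  then show ?thesis using G.hol_eq[OF g] G.solution_closed[OF g, of 0] G.solution_closed[OF g, of 1]
    by (simp add: G.inv_mult_group)
qed

lemma hol_loop:
  assumes p: "p \<in> loops_at (RC n) x0"
  obtains w where "set w \<subseteq> {..n+1}" "acts n w {} = {}" "G.hol p = gel n w"
    "loop_class (RC n) x0 p = AA x0 \<otimes>\<^bsub>PG\<^esub> Psi (ch n x0) w \<otimes>\<^bsub>PG\<^esub> inv\<^bsub>PG\<^esub> AA x0"
proof -
  have p': "pathin (RC n) p" "p 0 = x0" "p 1 = x0" using p by (auto simp: loops_at_iff)
  obtain w where w: "set w \<subseteq> {..n+1}" "cl p = AA x0 \<otimes>\<^bsub>PG\<^esub> Psi (ch n x0) w \<otimes>\<^bsub>PG\<^esub> inv\<^bsub>PG\<^esub> AA x0"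
    "ch n x0 = acts n w (ch n x0)" "G.hol p = gel n w" using path_has_word[OF p'(1)] p'(2,3) by metis
  have "acts n w {} = {}" using w(3) acts_trivial_iff'[OF ch_subset, of n w x0] by simp
  then show thesis using that w path_class_loop[OF pcs p] by metis
qed

text \<open>Equal holonomies mean that the two words are equal in the group, and the loop class
  depends on its word only through that element.\<close>

lemma hol_loop_inj:
  assumes "p \<in> loops_at (RC n) x0" "q \<in> loops_at (RC n) x0" "G.hol p = G.hol q"
  shows "loop_class (RC n) x0 p = loop_class (RC n) x0 q"
proof -
  obtain w where w: "set w \<subseteq> {..n+1}" "G.hol p = gel n w"
    "loop_class (RC n) x0 p = AA x0 \<otimes>\<^bsub>PG\<^esub> Psi (ch n x0) w \<otimes>\<^bsub>PG\<^esub> inv\<^bsub>PG\<^esub> AA x0" using hol_loop[OF assms(1)] by metis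
  obtain v where v: "set v \<subseteq> {..n+1}" "G.hol q = gel n v"
    "loop_class (RC n) x0 q = AA x0 \<otimes>\<^bsub>PG\<^esub> Psi (ch n x0) v \<otimes>\<^bsub>PG\<^esub> inv\<^bsub>PG\<^esub> AA x0" using hol_loop[OF assms(2)] by metis
  have "Psi (ch n x0) w = Psi (ch n x0) v" by (rule Psi_gel[OF ch_subset w(1) v(1)]) (use w v assms in simp)
  then show ?thesis using w(3) v(3) by simp
qed

text \<open>The base point need not be a chamber centre, so a path \<open>q\<close> to the centre is
  inserted. Its holonomy conjugates the result, which the word \<open>rev w @ js @ w\<close>
  compensates.\<close>

lemma hol_loop_surj:
  assumes h: "h \<in> sign_stab n"
  shows "\<exists>p\<in>loops_at (RC n) x0. G.hol p = h"
proof -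
  let ?S = "ch n x0" and ?G = "Gk (Suc n)"
  obtain q where q: "pathin (RC n) q" "q 0 = x0" "q 1 = zc n ?S"
    using path_connected_RC[OF n] x0 zc_topspace[OF n] unfolding path_connected_space_def by blast
  obtain w where w: "set w \<subseteq> {..n+1}" "ch n (q 1) = acts n w (ch n (q 0))" "G.hol q = gel n w"
    using path_has_word[OF q(1)] by blast
  have "acts n w ?S = ?S" using w(2) q ch_zc[OF n ch_subset] by simp
  then have w0: "acts n w {} = {}" using acts_trivial_iff'[OF ch_subset] by blast
  obtain js where js: "set js \<subseteq> {..n+1}" "acts n js {} = {}" "h = gel n js" using h unfolding sign_stab_def by blast
  let ?l = "rev w @ js @ w"
  have l: "set ?l \<subseteq> {..n+1}" using w js by auto
  have "acts n (rev w) {} = {}" using w0 unfolding acts_trivial_iff by (simp add: flips_def)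
  then have "acts n ?l {} = {}" using w0 js(2) by (simp add: acts_append)
  then have "acts n ?l ?S = ?S" using acts_trivial_iff'[OF ch_subset] by blast
  then obtain p where p: "pathin (RC n) p" "p 0 = zc n ?S" "p 1 = zc n ?S" "G.hol p = gel n ?l"
    using word_path[OF ch_subset l] by metis
  let ?r = "path_join (path_join q p) (path_rev q)"
  have j: "pathin (RC n) (path_join q p)" using q p by (intro pathin_join) auto
  have r: "?r \<in> loops_at (RC n) x0"
    using j q p pathin_rev[OF q(1)] by (simp add: loops_at_iff pathin_join)
  have "G.hol ?r = G.hol q \<otimes>\<^bsub>?G\<^esub> G.hol p \<otimes>\<^bsub>?G\<^esub> inv\<^bsub>?G\<^esub> G.hol q"
    using G.hol_join[OF j pathin_rev[OF q(1)]] G.hol_join[OF q(1) p(1)] hol_rev[OF q(1)] q p by simp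
  also have "\<dots> = h"
  proof -
    have wc: "gel n w \<in> carrier ?G" "gel n js \<in> carrier ?G" using gel_closed w js by auto
    have "gel n ?l = inv\<^bsub>?G\<^esub> gel n w \<otimes>\<^bsub>?G\<^esub> (gel n js \<otimes>\<^bsub>?G\<^esub> gel n w)"
      using gel_append[of "rev w" n "js @ w"] gel_append[OF js(1) w(1)] gel_rev[OF w(1)] w js by simp
    then show ?thesis using p(4) w(3) js(3) wc by (simp add: G.m_assoc G.mult_inv_cancel)
  qed
  finally show ?thesis using r by blast
qed

theorem sign_stab_iso: "(Gk (Suc n))\<lparr>carrier := sign_stab n\<rparr> \<cong> PG"
proof -
  let ?H = "(Gk (Suc n))\<lparr>carrier := sign_stab n\<rparr>"
  define f where "f C = G.hol (SOME p. p \<in> loops_at (RC n) x0 \<and> C = loop_class (RC n) x0 p)" for C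
  have f: "f (loop_class (RC n) x0 p) = G.hol p" if p: "p \<in> loops_at (RC n) x0" for p
  proof -
    define q where "q = (SOME q. q \<in> loops_at (RC n) x0 \<and> loop_class (RC n) x0 p = loop_class (RC n) x0 q)"
    have "q \<in> loops_at (RC n) x0 \<and> loop_class (RC n) x0 p = loop_class (RC n) x0 q"
      unfolding q_def
      by (rule someI[of "\<lambda>q. q \<in> loops_at (RC n) x0 \<and> loop_class (RC n) x0 p = loop_class (RC n) x0 q" p]) (use p in simp)
    then have "phom (RC n) p q" using loop_class_eq_iff[OF p, of q] by simp
    then show ?thesis unfolding f_def q_def[symmetric] using G.hol_phom by simp
  qed
  have "f \<in> iso PG ?H"
  proof (rule isoI)
    show "f \<in> hom PG ?H"
    proof (rule homI)
      fix x assume "x \<in> carrier PG"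
      then obtain p where p: "p \<in> loops_at (RC n) x0" "x = loop_class (RC n) x0 p" unfolding fundamental_group_carrier by blast
      obtain w where "set w \<subseteq> {..n+1}" "acts n w {} = {}" "G.hol p = gel n w" using hol_loop[OF p(1)] by metis
      then show "f x \<in> carrier ?H" using f p unfolding sign_stab_def by auto
    next
      fix x y assume "x \<in> carrier PG" "y \<in> carrier PG"
      then obtain p q where pq: "p \<in> loops_at (RC n) x0" "x = loop_class (RC n) x0 p" "q \<in> loops_at (RC n) x0" "y = loop_class (RC n) x0 q"
        unfolding fundamental_group_carrier by blast
      then show "f (x \<otimes>\<^bsub>PG\<^esub> y) = f x \<otimes>\<^bsub>?H\<^esub> f y"
        using f join_loops[OF pq(1,3)] G.hol_join[of p q] by (simp add: fundamental_group_mult loops_at_iff)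
    qed
    show "bij_betw f (carrier PG) (carrier ?H)"
    proof (rule bij_betw_imageI)
      show "inj_on f (carrier PG)"
      proof (rule inj_onI)
        fix x y assume "x \<in> carrier PG" "y \<in> carrier PG" and e: "f x = f y"
        then obtain p q where pq: "p \<in> loops_at (RC n) x0" "x = loop_class (RC n) x0 p" "q \<in> loops_at (RC n) x0" "y = loop_class (RC n) x0 q"
          unfolding fundamental_group_carrier by blast
        then show "x = y" using hol_loop_inj[OF pq(1,3)] f e by simp
      qed
      show "f ` carrier PG = carrier ?H"
      proof (intro equalityI subsetI)
        fix h assume "h \<in> f ` carrier PG"
        then obtain p where p: "p \<in> loops_at (RC n) x0" "h = f (loop_class (RC n) x0 p)" unfolding fundamental_group_carrier by blast
        obtain w where "set w \<subseteq> {..n+1}" "acts n w {} = {}" "G.hol p = gel n w" using hol_loop[OF p(1)] by metis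
        then show "h \<in> carrier ?H" using f p unfolding sign_stab_def by auto
      next
        fix h assume "h \<in> carrier ?H"
        then obtain p where "p \<in> loops_at (RC n) x0" "G.hol p = h" using hol_loop_surj by auto
        then have "h = f (loop_class (RC n) x0 p)" "loop_class (RC n) x0 p \<in> carrier PG"
          using f unfolding fundamental_group_carrier by auto
        then show "h \<in> f ` carrier PG" by (rule image_eqI)
      qed
    qed
  qed
  then have "PG \<cong> ?H" unfolding is_iso_def by blast
  then show ?thesis using P.iso_sym by blast
qed

end

subsection \<open>Smooth functions and perturbations\<close>

lemma smooth_fun_differentiable: "smooth_fun f \<Longrightarrow> f differentiable (at x)"
  unfolding smooth_fun_def by (metis funpow_0)

lemma smooth_fun_DERIV: "smooth_fun f \<Longrightarrow> (f has_real_derivative deriv f x) (at x)"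
  using smooth_fun_differentiable DERIV_deriv_iff_real_differentiable by blast

lemma smooth_fun_continuous: "smooth_fun f \<Longrightarrow> continuous_on S f"
  by (meson smooth_fun_differentiable continuous_at_imp_continuous_on differentiable_imp_continuous_within)

lemma smooth_fun_deriv_continuous:
  assumes "smooth_fun f" shows "continuous_on S (deriv f)"
proof -
  have "(deriv ^^ 1) f differentiable (at x)" for x using assms smooth_fun_def by blast
  then show ?thesis
    by (simp add: continuous_at_imp_continuous_on differentiable_imp_continuous_within)
qed

text \<open>The operator \<open>deriv\<close> chooses among the possible derivative values, and
  these are the same for both functions.\<close>

lemma deriv_add_const: "deriv (\<lambda>t. f t + c :: real) = deriv f"
proof
  fix x
  have "((\<lambda>t. f t + c) has_field_derivative D) (at x) \<longleftrightarrow> (f has_field_derivative D) (at x)" for D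
  proof
    assume "((\<lambda>t. f t + c) has_field_derivative D) (at x)"
    then have "((\<lambda>t. (f t + c) + (- c)) has_field_derivative D + 0) (at x)" by (intro DERIV_add DERIV_const)
    then show "(f has_field_derivative D) (at x)" by simp
  next
    assume "(f has_field_derivative D) (at x)"
    then have "((\<lambda>t. f t + c) has_field_derivative D + 0) (at x)" by (intro DERIV_add DERIV_const)
    then show "((\<lambda>t. f t + c) has_field_derivative D) (at x)" by simp
  qed
  then show "deriv (\<lambda>t. f t + c) x = deriv f x" by (simp add: deriv_def)
qed

lemma derivs_add_const: "(deriv ^^ m) (\<lambda>t. f t + c) = (\<lambda>t. (deriv ^^ m) f t + (if m = 0 then c else 0 :: real))"
  by (cases m) (simp_all add: funpow_Suc_right deriv_add_const del: funpow.simps)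

lemma smooth_fun_add_const: "smooth_fun f \<Longrightarrow> smooth_fun (\<lambda>t. f t + c)"
  unfolding smooth_fun_def derivs_add_const by (intro allI differentiable_add differentiable_const) blast

lemma deriv_poly: "deriv (poly p) = poly (pderiv p)" for p :: "real poly"
  by (rule ext) (rule DERIV_imp_deriv, rule poly_DERIV)

lemma smooth_fun_poly: "smooth_fun (poly p)" for p :: "real poly"
proof -
  have "(deriv ^^ m) (poly p) = poly ((pderiv ^^ m) p)" for m
    by (induction m) (simp_all add: deriv_poly)
  then show ?thesis unfolding smooth_fun_def
    by (metis poly_DERIV real_differentiable_def)
qed

lemma smooth_fun_const: "smooth_fun (\<lambda>_. c)"
proof -
  have "(\<lambda>_. c) = poly [:c:]" by (rule ext) simp
  then show ?thesis using smooth_fun_poly[of "[:c:]"] by metis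
qed

subsection \<open>Lifts of paths\<close>

lemma evec_nonzero: "i < n \<Longrightarrow> evec i \<in> nonzero_vectors n"
  by (auto simp: nonzero_vectors_iff supported_def evec_def fun_eq_iff)

lemma lift_cfg:
  assumes n: "n \<ge> 2" and x: "x \<in> topspace (RC n)"
    and u: "\<And>i. i \<in> {1..n+2} \<Longrightarrow> u i \<in> nonzero_vectors n \<and> x i = hline (u i)"
  shows "x = cfg n (u (Suc n)) (u (n+2))" "cpt n (u (Suc n)) (u (n+2))"
proof -
  obtain a b where ab: "cpt n a b" "x = cfg n a b" using RC_cpt_cases[OF n x] by blast
  have "hline (u (Suc n)) = hline a" "hline (u (n+2)) = hline b"
    using u[of "Suc n"] u[of "n+2"] ab(2) by (auto simp: cfg_def)
  then show e: "x = cfg n (u (Suc n)) (u (n+2))" unfolding ab(2) cfg_def by (simp cong: if_cong)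
  have nz: "u (Suc n) \<in> nonzero_vectors n" "u (n+2) \<in> nonzero_vectors n" using u[of "Suc n"] u[of "n+2"] by auto
  then have "good n (u (Suc n)) (u (n+2))" using x topspace_RC_cfg[OF n] unfolding e nonzero_vectors_iff by blast
  then show "cpt n (u (Suc n)) (u (n+2))" using nz by (simp add: cpt_def nonzero_vectors_iff)
qed

lemma smooth_lift_cfg:
  assumes n: "n \<ge> 2" and X: "\<gamma> ` {0..1} \<subseteq> topspace (RC n)" and v: "smooth_lift (Suc n) \<gamma> v" and t: "t \<in> {0..1}"
  shows "\<gamma> t = cfg n (v t (Suc n)) (v t (n+2))" "cpt n (v t (Suc n)) (v t (n+2))"
proof -
  have x: "\<gamma> t \<in> topspace (RC n)" using X t by blast
  have u: "v t i \<in> nonzero_vectors n \<and> \<gamma> t i = hline (v t i)" if "i \<in> {1..n+2}" for i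
    using v t that unfolding smooth_lift_def by auto
  show "\<gamma> t = cfg n (v t (Suc n)) (v t (n+2))" "cpt n (v t (Suc n)) (v t (n+2))" by (rule lift_cfg[OF n x u]; assumption)+
qed

lemma flat_cfg:
  assumes n: "n \<ge> 2" and ab: "cpt n a b"
  shows "flat_subsets (Suc n) (cfg n a b) = gen n ` {j. j \<le> n + 1 \<and> minor n j a b = 0}"
  using flat_subsets_cfg[of n a b] n ab by (simp add: cpt_def)

lemma flat_cfg_mem:
  assumes n: "n \<ge> 2" and ab: "cpt n a b" and j: "j \<le> n+1"
  shows "gen n j \<in> flat_subsets (Suc n) (cfg n a b) \<longleftrightarrow> minor n j a b = 0"
proof
  assume "gen n j \<in> flat_subsets (Suc n) (cfg n a b)"
  then obtain i where i: "i \<le> n+1" "minor n i a b = 0" "gen n j = gen n i" unfolding flat_cfg[OF n ab] by auto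
  then have "i = j" using inj_onD[OF inj_on_gen[of n], of j i] j by auto
  then show "minor n j a b = 0" using i by simp
qed (use j in \<open>auto simp: flat_cfg[OF n ab]\<close>)

lemma smooth_lift_coord:
  assumes v: "smooth_lift (Suc n) \<gamma> v" and i: "i \<in> {Suc n, n + 2}" and j: "j \<le> n"
  shows "smooth_fun (\<lambda>t. v t i j)"
  using v i j unfolding smooth_lift_def by auto

lemma smooth_path_pathin:
  assumes n: "n \<ge> 2" and g: "smooth_path (Suc n) (RC n) \<gamma>"
  shows "pathin (RC n) \<gamma>"
proof -
  obtain v where X: "\<gamma> ` {0..1} \<subseteq> topspace (RC n)" and v: "smooth_lift (Suc n) \<gamma> v" using g unfolding smooth_path_def by blast
  note c = smooth_lift_cfg[OF n X v]
  have "continuous_map I01 (RC n) (\<lambda>t. cfg n (v t (Suc n)) (v t (n+2)))"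
  proof (rule continuous_map_cfg[OF n])
    show "continuous_map I01 euclideanreal (\<lambda>t. v t (Suc n) i)" "continuous_map I01 euclideanreal (\<lambda>t. v t (n+2) i)" if "i \<le> n" for i
      using smooth_fun_continuous[OF smooth_lift_coord[OF v _ that]] by auto
  qed (use c(2) in \<open>auto simp: cpt_def\<close>)
  then show ?thesis unfolding pathin_def by (rule continuous_map_eq) (use c(1) in auto)
qed

text \<open>One sum of squares for each clause of \<open>good\<close>: the condition becomes
  positivity of a single continuous function.\<close>

definition good_fun :: "nat \<Rightarrow> (nat \<Rightarrow> real) \<Rightarrow> (nat \<Rightarrow> real) \<Rightarrow> real" where
  "good_fun n a b = (\<Prod>j<n. (a j)\<^sup>2 + (a n)\<^sup>2) * (\<Prod>j<n. (b j)\<^sup>2 + (b n)\<^sup>2) *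
    (\<Prod>i<n. \<Prod>j\<in>{..<n} - {i}. (a i * b n - a n * b i)\<^sup>2 + (a j * b n - a n * b j)\<^sup>2 + (a i * b j - a j * b i)\<^sup>2)"

lemma good_fun_pos: "good n a b \<longleftrightarrow> good_fun n a b > 0"
proof -
  have "good_fun n a b \<ge> 0" unfolding good_fun_def by (intro mult_nonneg_nonneg prod_nonneg) auto
  moreover have "good_fun n a b = 0 \<longleftrightarrow> \<not> good n a b"
    unfolding good_fun_def good_def
    by (auto simp: sum_power2_eq_zero_iff add_nonneg_eq_0_iff)
  ultimately show ?thesis by linarith
qed

lemma good_fun_continuous:
  assumes "\<And>i. i \<le> n \<Longrightarrow> continuous_on S (\<lambda>t. a t i)" "\<And>i. i \<le> n \<Longrightarrow> continuous_on S (\<lambda>t. b t i)"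
  shows "continuous_on S (\<lambda>t. good_fun n (a t) (b t))"
  unfolding good_fun_def
  by (intro continuous_on_mult continuous_on_prod continuous_on_add continuous_on_diff continuous_on_power assms) auto

text \<open>On the compact interval the positive function has a positive minimum, and uniform
  continuity in time and size of the perturbation keeps it positive for small
  \<open>h\<close>.\<close>

lemma good_perturb:
  assumes a: "\<And>i. i \<le> n \<Longrightarrow> continuous_on {0..1::real} (\<lambda>t. a t i)" and b: "\<And>i. i \<le> n \<Longrightarrow> continuous_on {0..1} (\<lambda>t. b t i)"
    and g: "\<And>t. t \<in> {0..1} \<Longrightarrow> good n (a t) (b t)"
  shows "\<exists>e>0. \<forall>h t. \<bar>h\<bar> < e \<longrightarrow> t \<in> {0..1} \<longrightarrow> good n (\<lambda>i. a t i + h * c i) (\<lambda>i. b t i + h * d i)"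
proof -
  let ?K = "{0..1} \<times> {-1..1} :: (real \<times> real) set"
  let ?F = "\<lambda>z. good_fun n (\<lambda>i. a (fst z) i + snd z * c i) (\<lambda>i. b (fst z) i + snd z * d i)"
  have ca: "continuous_on ?K (\<lambda>z. a (fst z) i + snd z * c i)" if "i \<le> n" for i
    by (intro continuous_intros continuous_on_compose2[OF a[OF that]]) auto
  have cb: "continuous_on ?K (\<lambda>z. b (fst z) i + snd z * d i)" if "i \<le> n" for i
    by (intro continuous_intros continuous_on_compose2[OF b[OF that]]) auto
  have "continuous_on ?K ?F"
    by (rule good_fun_continuous[where a = "\<lambda>z i. a (fst z) i + snd z * c i" and b = "\<lambda>z i. b (fst z) i + snd z * d i"])
      (rule ca cb, assumption)+
  then have uc: "uniformly_continuous_on ?K ?F" by (intro compact_uniformly_continuous compact_Times) auto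
  have c0: "continuous_on {0..1} (\<lambda>t. ?F (t, 0))"
    using good_fun_continuous[of n _ a b, OF a b] by simp
  obtain t0 where t0: "t0 \<in> {0..1}" "\<And>t. t \<in> {0..1} \<Longrightarrow> ?F (t0, 0) \<le> ?F (t, 0)"
    using continuous_attains_inf[OF _ _ c0] by auto
  have pos: "?F (t0, 0) > 0" using g[OF t0(1)] by (simp add: good_fun_pos)
  obtain e where e: "e > 0" "\<And>z z'. z \<in> ?K \<Longrightarrow> z' \<in> ?K \<Longrightarrow> dist z' z < e \<Longrightarrow> dist (?F z') (?F z) < ?F (t0, 0)"
    using spec[OF uc[unfolded uniformly_continuous_on_def], of "?F (t0, 0)"] pos by blast
  show ?thesis
  proof (intro exI[of _ "min e 1"] conjI allI impI)
    fix h t :: real assume h: "\<bar>h\<bar> < min e 1" and t: "t \<in> {0..1}"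
    have "dist (?F (t, h)) (?F (t, 0)) < ?F (t0, 0)"
      by (rule e(2)) (use h t in \<open>auto simp: dist_Pair_Pair dist_real_def\<close>)
    then have "?F (t, h) > 0" using t0(2)[OF t] by (auto simp: dist_real_def)
    then show "good n (\<lambda>i. a t i + h * c i) (\<lambda>i. b t i + h * d i)" by (simp add: good_fun_pos)
  qed (use e in auto)
qed

lemma minor_continuous:
  assumes "\<And>i. i \<le> n \<Longrightarrow> continuous_on S (\<lambda>t. a t i)" "\<And>i. i \<le> n \<Longrightarrow> continuous_on S (\<lambda>t. b t i)"
  shows "continuous_on S (\<lambda>t. minor n j (a t) (b t))"
proof (cases "j < n")
  case True
  then show ?thesis unfolding minor_def by (simp) (intro continuous_intros assms; simp)
next
  case False
  then show ?thesis unfolding minor_def using assms(1)[of n] assms(2)[of n] by (cases "j = n") simp_all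
qed

lemma same_sign_interval:
  fixes f :: "real \<Rightarrow> real"
  assumes "continuous_on {p..q} f" "p \<le> q" "\<And>t. t \<in> {p..q} \<Longrightarrow> f t \<noteq> 0"
  shows "f p * f q > 0"
proof (rule ccontr)
  assume "\<not> ?thesis"
  moreover have "f p \<noteq> 0" "f q \<noteq> 0" using assms by auto
  ultimately have "f p < 0 \<and> 0 < f q \<or> 0 < f p \<and> f q < 0" by (auto simp: zero_less_mult_iff linorder_neq_iff)
  then have "\<exists>t. p \<le> t \<and> t \<le> q \<and> f t = 0"
  proof
    assume "f p < 0 \<and> 0 < f q" then show ?thesis using IVT'[of f p 0 q] assms by auto
  next
    assume "0 < f p \<and> f q < 0" then show ?thesis using IVT2'[of f q 0 p] assms by auto
  qed
  then show False using assms(3) by auto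
qed

text \<open>Without a change of sign, pushing the minor towards zero would create two zeros.\<close>

lemma stable_value_sign_change:
  assumes n: "n \<ge> 2" and X: "\<gamma> ` {0..1} \<subseteq> topspace (RC n)" and v: "smooth_lift (Suc n) \<gamma> v"
    and st: "\<delta> > 0" "\<epsilon> > 0"
      "\<And>\<gamma>' w. smooth_path (Suc n) (RC n) \<gamma>' \<Longrightarrow> smooth_lift (Suc n) \<gamma>' w \<Longrightarrow> lifts_close (Suc n) r \<epsilon> v w \<Longrightarrow>
        \<exists>!s. s \<in> {0..1} \<and> \<bar>s - t\<bar> < \<delta> \<and> gen n j \<in> flat_subsets (Suc n) (\<gamma>' s)"
    and t: "0 < t" "t < 1" and j: "j \<le> n+1"
    and z: "minor n j (v t (Suc n)) (v t (n+2)) = 0"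
    and other: "\<And>i. i \<le> n+1 \<Longrightarrow> i \<noteq> j \<Longrightarrow> minor n i (v t (Suc n)) (v t (n+2)) \<noteq> 0"
    and ss: "0 \<le> s1" "s1 < t" "t < s2" "s2 \<le> 1" "t - s1 < \<delta>" "s2 - t < \<delta>"
    and nz: "minor n j (v s1 (Suc n)) (v s1 (n+2)) \<noteq> 0" "minor n j (v s2 (Suc n)) (v s2 (n+2)) \<noteq> 0"
  shows "minor n j (v s1 (Suc n)) (v s1 (n+2)) * minor n j (v s2 (Suc n)) (v s2 (n+2)) < 0"
proof (rule ccontr)
  define a where "a t = v t (Suc n)" for t
  define b where "b t = v t (n+2)" for t
  note c = smooth_lift_cfg[OF n X v]
  have cpt: "cpt n (a s) (b s)" if "s \<in> {0..1}" for s using c(2)[OF that] by (simp add: a_def b_def)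
  have sm: "smooth_fun (\<lambda>t. a t i)" "smooth_fun (\<lambda>t. b t i)" if "i \<le> n" for i
    unfolding a_def b_def using smooth_lift_coord[OF v _ that] by auto
  note ct = smooth_fun_continuous[OF sm(1)] smooth_fun_continuous[OF sm(2)]
  let ?f = "\<lambda>s. minor n j (a s) (b s)"
  assume "\<not> minor n j (v s1 (Suc n)) (v s1 (n+2)) * minor n j (v s2 (Suc n)) (v s2 (n+2)) < 0"
  then have same: "?f s1 * ?f s2 > 0" using nz unfolding a_def b_def
    by (auto simp: mult_less_0_iff zero_less_mult_iff linorder_neq_iff)
  define sg where "sg = sgn (?f s1)"
  have sg1: "sg * ?f s1 > 0" "sg * ?f s2 > 0" "\<bar>sg\<bar> = 1"
    using same by (auto simp: sg_def sgn_real_def zero_less_mult_iff)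
  \<comment> \<open>Constants are added to the coordinates, which leaves all derivatives unchanged,
    so that \<open>sg\<close> times the minor drops by \<open>h * g s\<close>. For
    \<open>j < n\<close> the change passes through the factor \<open>b n\<close>, nonzero at
    \<open>t\<close> because minor \<open>n\<close> is; \<open>kb\<close> corrects its sign.\<close>
  define kb where "kb = sgn (b t n)"
  define da where "da i = (if j < n then if i = j then - sg * kb else 0 else if j = Suc n \<and> i = n then - sg else 0)" for i
  define db where "db i = (if j = n \<and> i = n then - sg else 0)" for i
  define g where "g s = (if j < n then kb * b s n else 1)" for s
  have lamp: "minor n j (\<lambda>i. a s i + h * da i) (\<lambda>i. b s i + h * db i) = ?f s - h * sg * g s" for s h
    using j by (auto simp: minor_def da_def db_def g_def algebra_simps le_Suc_eq)
  have gt: "g t > 0"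
  proof (cases "j < n")
    case True
    have "b t n \<noteq> 0" using other[of n] True by (simp add: minor_def b_def)
    then show ?thesis using True by (auto simp: g_def kb_def sgn_real_def)
  qed (simp add: g_def)
  have kb1: "\<bar>kb\<bar> \<le> 1" by (simp add: kb_def sgn_real_def)
  have dab: "\<bar>da i\<bar> \<le> 1" "\<bar>db i\<bar> \<le> 1" for i using sg1(3) kb1 by (auto simp: da_def db_def abs_mult)
  have "\<And>t. t \<in> {0..1} \<Longrightarrow> good n (a t) (b t)" using cpt by (simp add: cpt_def)
  from good_perturb[of n a b, OF ct this] obtain e where e: "e > 0" "\<And>h t. \<bar>h\<bar> < e \<Longrightarrow> t \<in> {0..1} \<Longrightarrow> good n (\<lambda>i. a t i + h * da i) (\<lambda>i. b t i + h * db i)"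
    by blast
  define G where "G = 1 + \<bar>g s1\<bar> + \<bar>g s2\<bar>"
  have G: "G > 0" "\<bar>g s1\<bar> \<le> G" "\<bar>g s2\<bar> \<le> G" by (auto simp: G_def)
  \<comment> \<open>Small enough for general position, for closeness of the lifts, and to keep the
    signs at \<open>s1\<close> and \<open>s2\<close>, where the minor moves by at most
    \<open>h * G\<close>.\<close>
  define h where "h = Min {e, \<epsilon>, \<bar>?f s1\<bar> / G, \<bar>?f s2\<bar> / G} / 2"
  have M: "Min {e, \<epsilon>, \<bar>?f s1\<bar> / G, \<bar>?f s2\<bar> / G} > 0"
    using e st nz G by (simp add: a_def b_def)
  have "h < Min {e, \<epsilon>, \<bar>?f s1\<bar> / G, \<bar>?f s2\<bar> / G}" "0 < h" using M unfolding h_def by linarith+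
  then have h: "0 < h" "h < e" "h < \<epsilon>" "h < \<bar>?f s1\<bar> / G" "h < \<bar>?f s2\<bar> / G"
    by (simp_all only: Min_gr_iff finite.intros insert_not_empty ball_simps simp_thms not_False_eq_True)
  define wa where "wa s = (\<lambda>i. a s i + h * da i)" for s
  define wb where "wb s = (\<lambda>i. b s i + h * db i)" for s
  define w where "w s i = (if i = Suc n then wa s else if i = n + 2 then wb s else v s i)" for s i
  define \<gamma>' where "\<gamma>' s = cfg n (wa s) (wb s)" for s
  have wc: "cpt n (wa s) (wb s)" if s: "s \<in> {0..1}" for s
  proof (rule cptI)
    show "good n (wa s) (wb s)" unfolding wa_def wb_def using e(2) h s by simp
  qed (use cpt_out[OF cpt[OF s]] j in \<open>auto simp: wa_def wb_def da_def db_def\<close>)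
  have lift: "smooth_lift (Suc n) \<gamma>' w"
    unfolding smooth_lift_def
  proof (intro conjI ballI allI impI)
    fix i l assume i: "i \<in> {1..Suc n + 1}" and l: "l < Suc n"
    show "smooth_fun (\<lambda>t. w t i l)"
    proof (cases "i = Suc n \<or> i = n + 2")
      case True
      then show ?thesis using smooth_fun_add_const[OF sm(1)[of l]] smooth_fun_add_const[OF sm(2)[of l]] l
        by (auto simp: w_def wa_def wb_def)
    next
      case False
      then show ?thesis using v i l unfolding smooth_lift_def w_def by auto
    qed
  next
    fix s i assume s: "s \<in> {0..1::real}" and i: "i \<in> {1..Suc n + 1}"
    note nrm = cpt_nrm[OF n wc[OF s]]
    have vs: "v s i \<in> nonzero_vectors n" "\<gamma> s i = hline (v s i)" using v s i unfolding smooth_lift_def by auto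
    show "w s i \<in> nonzero_vectors (Suc n - 1)"
      using nrm vs by (simp add: w_def nonzero_vectors_iff)
    have "\<gamma> s i = \<gamma>' s i" if "i \<le> n" using c(1)[OF s] i that by (simp add: \<gamma>'_def cfg_def)
    then show "\<gamma>' s i = hline (w s i)" using i vs by (auto simp: w_def \<gamma>'_def cfg_def le_Suc_eq)
  qed
  have path: "smooth_path (Suc n) (RC n) \<gamma>'"
    unfolding smooth_path_def using lift cpt_nrm(8)[OF n wc] by (auto simp: \<gamma>'_def)
  have close: "lifts_close (Suc n) r \<epsilon> v w"
    unfolding lifts_close_def
  proof (intro allI ballI impI)
    fix m i l :: nat and s :: real
    have bd: "\<bar>if m = 0 then h * x else 0\<bar> < \<epsilon>" if "\<bar>x\<bar> \<le> 1" for x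
    proof -
      have "\<bar>h * x\<bar> \<le> h" using that h(1) by (simp add: abs_mult mult_left_le)
      then show ?thesis using h st by auto
    qed
    consider "i = Suc n" | "i = n + 2" | "i \<noteq> Suc n" "i \<noteq> n + 2" by blast
    then show "\<bar>(deriv ^^ m) (\<lambda>t. w t i l) s - (deriv ^^ m) (\<lambda>t. v t i l) s\<bar> < \<epsilon>"
    proof cases
      case 1
      have "(\<lambda>t. w t i l) = (\<lambda>t. v t i l + h * da l)" using 1 by (simp add: w_def wa_def a_def)
      then show ?thesis using bd[OF dab(1)[of l]] by (simp add: derivs_add_const)
    next
      case 2
      have "(\<lambda>t. w t i l) = (\<lambda>t. v t i l + h * db l)" using 2 by (simp add: w_def wb_def b_def)
      then show ?thesis using bd[OF dab(2)[of l]] by (simp add: derivs_add_const)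
    next
      case 3
      then have "(\<lambda>t. w t i l) = (\<lambda>t. v t i l)" by (simp add: w_def)
      then show ?thesis using st by simp
    qed
  qed
  let ?F = "\<lambda>s. minor n j (wa s) (wb s)"
  have F: "?F s = ?f s - h * sg * g s" for s unfolding wa_def wb_def by (rule lamp)
  have cF: "continuous_on S ?F" for S
    unfolding wa_def wb_def by (intro minor_continuous continuous_intros ct)
  have ft: "?f t = 0" using z by (simp add: a_def b_def)
  have Ft: "sg * ?F t < 0"
  proof -
    have "sg * ?F t = - (h * (sg * sg) * g t)" unfolding F ft by simp
    moreover have "sg * sg = 1" using sg1(3) by (metis abs_mult_self_eq mult_1)
    ultimately show ?thesis using h(1) gt by simp
  qed
  have Fs: "sg * ?F s > 0" if "sg * ?f s > 0" "\<bar>g s\<bar> \<le> G" "h < \<bar>?f s\<bar> / G" for s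
  proof -
    have "h * \<bar>g s\<bar> \<le> h * G" using that(2) h(1) by (simp add: mult_left_mono)
    also have "\<dots> < \<bar>?f s\<bar>" using that(3) G(1) by (simp add: field_simps)
    also have "\<bar>?f s\<bar> = sg * ?f s" using that(1) sg1(3) by (metis abs_mult abs_of_pos mult_1)
    finally have "h * \<bar>g s\<bar> < sg * ?f s" .
    moreover have "sg * ?F s = sg * ?f s - h * (sg * sg) * g s" unfolding F by (simp add: algebra_simps)
    moreover have "sg * sg = 1" using sg1(3) by (metis abs_mult_self_eq mult_1)
    moreover have "h * g s \<le> h * \<bar>g s\<bar>" using h(1) by (simp add: mult_left_mono)
    ultimately show ?thesis by simp
  qed
  have F1: "sg * ?F s1 > 0" and F2: "sg * ?F s2 > 0" using Fs sg1 G h by auto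
  have cs: "continuous_on S (\<lambda>s. sg * ?F s)" for S by (intro continuous_intros cF)
  obtain z1 where z1: "s1 \<le> z1" "z1 \<le> t" "sg * ?F z1 = 0"
    using IVT2'[of "\<lambda>s. sg * ?F s" t 0 s1] F1 Ft ss cs by auto
  obtain z2 where z2: "t \<le> z2" "z2 \<le> s2" "sg * ?F z2 = 0"
    using IVT'[of "\<lambda>s. sg * ?F s" t 0 s2] F2 Ft ss cs by auto
  have ne: "z1 \<noteq> t" "z2 \<noteq> t" using z1 z2 Ft by auto
  have sg0: "sg \<noteq> 0" using sg1(3) by auto
  have fl: "gen n j \<in> flat_subsets (Suc n) (\<gamma>' s) \<longleftrightarrow> ?F s = 0" if "s \<in> {0..1}" for s
    unfolding \<gamma>'_def by (rule flat_cfg_mem[OF n wc[OF that] j])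
  have "\<exists>!s. s \<in> {0..1} \<and> \<bar>s - t\<bar> < \<delta> \<and> gen n j \<in> flat_subsets (Suc n) (\<gamma>' s)" by (rule st(3)[OF path lift close])
  moreover have "z1 \<in> {0..1} \<and> \<bar>z1 - t\<bar> < \<delta> \<and> gen n j \<in> flat_subsets (Suc n) (\<gamma>' z1)"
    using z1 ss t sg0 fl[of z1] by auto
  moreover have "z2 \<in> {0..1} \<and> \<bar>z2 - t\<bar> < \<delta> \<and> gen n j \<in> flat_subsets (Suc n) (\<gamma>' z2)"
    using z2 ss t sg0 fl[of z2] by auto
  ultimately have "z1 = z2" by blast
  then show False using ne z1 z2 by auto
qed

text \<open>The flag \<open>c\<close> says whether the sign of \<open>f\<close> changes at
  \<open>t\<close>. Both cases are needed: crossing an unrelated wall leaves the sign alone.\<close>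

definition sign_at :: "(real \<Rightarrow> real) \<Rightarrow> real \<Rightarrow> bool \<Rightarrow> bool" where
  "sign_at f t c \<longleftrightarrow> (\<exists>e>0. \<forall>s s'. t - e < s \<and> s < t \<and> t < s' \<and> s' < t + e \<longrightarrow> (if c then f s * f s' < 0 else f s * f s' > 0))"

text \<open>Between points of \<open>Z\<close> the sign is constant, so each point contributes
  according to its flag; the induction splits off the last point.\<close>

lemma sign_parity:
  assumes "finite Z" "p < q" "continuous_on {p..q} f" "Z \<subseteq> {p<..<q}"
    "\<And>t. t \<in> {p..q} - Z \<Longrightarrow> f t \<noteq> 0" "\<And>t. t \<in> Z \<Longrightarrow> sign_at f t (c t)"
  shows "f p * f q > 0 \<longleftrightarrow> even (card {t \<in> Z. c t})"
  using assms
proof (induction Z arbitrary: q rule: finite_linorder_max_induct)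
  case empty
  then show ?case using same_sign_interval[of p q f] by auto
next
  case (insert t Z)
  have tpq: "p < t" "t < q" and ZI: "Z \<subseteq> {p<..<q}" using insert.prems by auto
  obtain e where e: "e > 0" "\<And>s s'. t - e < s \<and> s < t \<and> t < s' \<and> s' < t + e \<Longrightarrow> (if c t then f s * f s' < 0 else f s * f s' > 0)"
    using insert.prems(5)[of t] unfolding sign_at_def by auto
  \<comment> \<open>A bound below \<open>t\<close> for the start, the earlier points and the
    validity range of \<open>sign_at\<close>; the sample point \<open>u\<close> to the left of
    \<open>t\<close> is taken above it.\<close>
  define m where "m = Max (insert p (insert (t - e) Z))"
  have fin: "finite (insert p (insert (t - e) Z))" using insert.hyps(1) by simp
  have m: "p \<le> m" "t - e \<le> m" "\<And>z. z \<in> Z \<Longrightarrow> z \<le> m" "m < t"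
    unfolding m_def using Max_ge[OF fin] Max_less_iff[OF fin] insert.hyps tpq e(1) by auto
  define u where "u = (m + t) / 2"
  have u: "m < u" "u < t" using m(4) by (auto simp: u_def)
  define u' where "u' = min ((t + e / 2)) ((t + q) / 2)"
  have u': "t < u'" "u' < t + e" "u' < q" using e(1) tpq by (auto simp: u'_def min_def)
  have IH: "f p * f u > 0 \<longleftrightarrow> even (card {t \<in> Z. c t})"
  proof (rule insert.IH)
    show "p < u" using m u by simp
    show "continuous_on {p..u} f" by (rule continuous_on_subset[OF insert.prems(2)]) (use u tpq in auto)
    show "Z \<subseteq> {p<..<u}" using ZI m(3) u by fastforce
    show "f s \<noteq> 0" if "s \<in> {p..u} - Z" for s by (rule insert.prems(4)) (use that u tpq in auto)
    show "sign_at f s (c s)" if "s \<in> Z" for s using insert.prems(5) that by blast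
  qed
  have 1: "if c t then f u * f u' < 0 else f u * f u' > 0" by (rule e(2)) (use u u' m in auto)
  have 2: "f u' * f q > 0"
  proof (rule same_sign_interval[where f = f])
    show "continuous_on {u'..q} f" by (rule continuous_on_subset[OF insert.prems(2)]) (use u' tpq in auto)
    show "f s \<noteq> 0" if "s \<in> {u'..q}" for s
    proof (rule insert.prems(4))
      have "s \<notin> Z" using m(3)[of s] that u' m(4) by auto
      then show "s \<in> {p..q} - insert t Z" using that u' tpq by auto
    qed
  qed (use u' in simp)
  have p0: "f p \<noteq> 0"
  proof (rule insert.prems(4))
    show "p \<in> {p..q} - insert t Z" using insert.prems(3) tpq by auto
  qed
  have "t \<notin> Z" using insert.hyps by auto
  then have card: "card {s \<in> insert t Z. c s} = (if c t then Suc (card {s \<in> Z. c s}) else card {s \<in> Z. c s})"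
    using insert.hyps by (simp add: Collect_conj_eq insert_Collect[symmetric] Int_insert_left_if1 conj_disj_distribR Collect_disj_eq)
  have "f p * f q > 0 \<longleftrightarrow> (if c t then \<not> f p * f u > 0 else f p * f u > 0)"
    using 1 2 p0 by (auto simp: zero_less_mult_iff mult_less_0_iff split: if_splits)
  then show ?case unfolding card using IH by auto
qed

text \<open>The sign of \<open>Eq n i\<close> is that of the product of the minors \<open>i\<close>,
  \<open>n\<close> and \<open>n + 1\<close>. Near \<open>t\<close> all minors except number
  \<open>j\<close> keep their signs, and stability forces that one to change.\<close>

lemma stable_crossing_sign:
  assumes n: "n \<ge> 2" and X: "\<gamma> ` {0..1} \<subseteq> topspace (RC n)" and fin: "finite (singular_values (Suc n) \<gamma>)"
    and ty: "flat_subsets (Suc n) (\<gamma> t) = {gen n j}" and j: "j \<le> n + 1"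
    and st: "stable_value (Suc n) (RC n) \<gamma> (gen n j) t" and t: "0 < t" "t < 1" and i: "i < n"
  shows "sign_at (\<lambda>s. Eq n i (\<gamma> s)) t (j = i \<or> j = n \<or> j = Suc n)"
proof -
  from st[unfolded stable_value_def] obtain v \<delta> r \<epsilon> where v: "smooth_lift (Suc n) \<gamma> v" and de: "\<delta> > 0" "\<epsilon> > 0"
    and stab0: "\<forall>\<gamma>' w. smooth_path (Suc n) (RC n) \<gamma>' \<and> smooth_lift (Suc n) \<gamma>' w \<and> lifts_close (Suc n) r \<epsilon> v w \<longrightarrow>
        (\<exists>!s. s \<in> {0..1} \<and> \<bar>s - t\<bar> < \<delta> \<and> gen n j \<in> flat_subsets (Suc n) (\<gamma>' s))"
    by (elim exE conjE) (rule that)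
  note stab = stab0[rule_format, OF conjI[OF _ conjI]]
  define a where "a s = v s (Suc n)" for s
  define b where "b s = v s (n+2)" for s
  have c: "\<gamma> s = cfg n (a s) (b s)" "cpt n (a s) (b s)" if "s \<in> {0..1}" for s
    unfolding a_def b_def by (rule smooth_lift_cfg[OF n X v that])+
  have cl: "continuous_on S (\<lambda>s. minor n l (a s) (b s))" for S l
    unfolding a_def b_def by (intro minor_continuous smooth_fun_continuous smooth_lift_coord[OF v]) auto
  have fl: "gen n l \<in> flat_subsets (Suc n) (\<gamma> s) \<longleftrightarrow> minor n l (a s) (b s) = 0" if "s \<in> {0..1}" "l \<le> n+1" for s l
    unfolding c(1)[OF that(1)] by (rule flat_cfg_mem[OF n c(2)[OF that(1)] that(2)])
  obtain e0 where e0: "e0 > 0" "\<And>s. s \<in> singular_values (Suc n) \<gamma> \<Longrightarrow> s \<noteq> t \<Longrightarrow> e0 \<le> dist t s"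
    using finite_set_avoid[OF fin, of t] by blast
  define e where "e = min (min e0 \<delta>) (min t (1 - t))"
  have e: "e > 0" "e \<le> e0" "e \<le> \<delta>" "e \<le> t" "e \<le> 1 - t" using e0(1) de t by (auto simp: e_def)
  have t01: "t \<in> {0..1}" using t by simp
  have nz: "minor n l (a s) (b s) \<noteq> 0" if "t - e < s" "s < t + e" "l \<le> n + 1" "s \<noteq> t \<or> l \<noteq> j" for s l
  proof (cases "s = t")
    case True
    then have "gen n l \<noteq> gen n j" using inj_onD[OF inj_on_gen[of n], of l j] that(3,4) j by auto
    then show ?thesis using fl[OF t01 that(3)] ty True by auto
  next
    case False
    have s: "s \<in> {0..1}" using that e by auto
    have "s \<notin> singular_values (Suc n) \<gamma>" using e0(2)[of s] False that(1,2) e by (auto simp: dist_real_def)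
    then have "flat_subsets (Suc n) (\<gamma> s) = {}" using s by (auto simp: singular_values_def singular_config_def)
    then show ?thesis using fl[OF s that(3)] by auto
  qed
  show ?thesis unfolding sign_at_def
  proof (intro exI[of _ e] conjI allI impI)
    fix s s' assume "t - e < s \<and> s < t \<and> t < s' \<and> s' < t + e"
    then have s: "t - e < s" "s < t" "t < s'" "s' < t + e" by auto
    then have s01: "s \<in> {0..1}" "s' \<in> {0..1}" using e by auto
    let ?p = "\<lambda>l. minor n l (a s) (b s) * minor n l (a s') (b s')"
    have pos: "?p l > 0" if "l \<le> n + 1" "l \<noteq> j" for l
    proof (rule same_sign_interval[where f = "\<lambda>s. minor n l (a s) (b s)"])
      show "minor n l (a x) (b x) \<noteq> 0" if "x \<in> {s..s'}" for x
        by (rule nz) (use that s \<open>l \<le> n + 1\<close> \<open>l \<noteq> j\<close> in auto)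
    qed (use s cl in auto)
    have neg: "?p j < 0"
      unfolding a_def b_def
    proof (rule stable_value_sign_change[OF n X v de stab t j])
      show "minor n j (v t (Suc n)) (v t (n+2)) = 0" using fl[OF t01 j] ty by (simp add: a_def b_def)
      show "minor n i (v t (Suc n)) (v t (n+2)) \<noteq> 0" if "i \<le> n+1" "i \<noteq> j" for i
        using nz[of t i] that e by (simp add: a_def b_def)
      show "minor n j (v s (Suc n)) (v s (n+2)) \<noteq> 0" "minor n j (v s' (Suc n)) (v s' (n+2)) \<noteq> 0"
        using nz[of s j] nz[of s' j] s j by (simp_all add: a_def b_def)
    qed (use s s01 e in auto)
    define N where "N = nrm n (a s) * nrm n (b s) * (nrm n (a s') * nrm n (b s'))"
    note nn = cpt_nrm(1,2)[OF n c(2)[OF s01(1)]] cpt_nrm(1,2)[OF n c(2)[OF s01(2)]]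
    have N: "N > 0" using nn by (simp add: N_def)
    have E: "Eq n i (\<gamma> s) * Eq n i (\<gamma> s') = ?p n * ?p (Suc n) * ?p i / N"
      using nn i by (simp add: c(1)[OF s01(1)] c(1)[OF s01(2)] Eq_cfg[OF n c(2)[OF s01(1)] i] Eq_cfg[OF n c(2)[OF s01(2)] i] N_def minor_def field_simps)
    have sg: "Eq n i (\<gamma> s) * Eq n i (\<gamma> s') < 0 \<longleftrightarrow> ?p n * ?p (Suc n) * ?p i < 0"
      "Eq n i (\<gamma> s) * Eq n i (\<gamma> s') > 0 \<longleftrightarrow> ?p n * ?p (Suc n) * ?p i > 0"
      unfolding E using N by (simp_all add: divide_less_0_iff zero_less_divide_iff)
    consider "j = i" | "j = n" | "j = Suc n" | "j \<noteq> i" "j \<noteq> n" "j \<noteq> Suc n" by blast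
    then show "if j = i \<or> j = n \<or> j = Suc n then Eq n i (\<gamma> s) * Eq n i (\<gamma> s') < 0 else Eq n i (\<gamma> s) * Eq n i (\<gamma> s') > 0"
    proof cases
      case 1
      have "?p n > 0" "?p (Suc n) > 0" using pos[of n] pos[of "Suc n"] 1 i by auto
      then have "?p n * ?p (Suc n) * ?p i < 0" using neg 1 by (simp only: mult_pos_neg mult_pos_pos)
      then show ?thesis using 1 sg by simp
    next
      case 2
      have "?p i > 0" "?p (Suc n) > 0" using pos[of i] pos[of "Suc n"] 2 i by auto
      then have "?p n * ?p (Suc n) * ?p i < 0" using neg 2 by (simp only: mult_neg_pos)
      then show ?thesis using 2 sg by simp
    next
      case 3
      have "?p i > 0" "?p n > 0" using pos[of i] pos[of n] 3 i by auto
      then have "?p n * ?p (Suc n) * ?p i < 0" using neg 3 by (simp only: mult_neg_pos mult_pos_neg)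
      then show ?thesis using 3 sg by simp
    next
      case 4
      have "?p i > 0" "?p n > 0" "?p (Suc n) > 0" using pos[of i] pos[of n] pos[of "Suc n"] 4 i by auto
      then have "?p n * ?p (Suc n) * ?p i > 0" by (simp only: mult_pos_pos)
      then show ?thesis using 4 sg by simp
    qed
  qed (rule e(1))
qed

lemma count_list_map_three:
  assumes "distinct L" "i < n"
  shows "count_list (map f L) i + count_list (map f L) n + count_list (map f L) (Suc n) =
    card {t \<in> set L. f t = i \<or> f t = n \<or> f t = Suc n}"
  using assms(1)
proof (induction L)
  case (Cons x L)
  have "{t \<in> set (x # L). f t = i \<or> f t = n \<or> f t = Suc n} =
    (if f x = i \<or> f x = n \<or> f x = Suc n then insert x {t \<in> set L. f t = i \<or> f t = n \<or> f t = Suc n}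
     else {t \<in> set L. f t = i \<or> f t = n \<or> f t = Suc n})" by auto
  moreover have "x \<notin> {t \<in> set L. f t = i \<or> f t = n \<or> f t = Suc n}" using Cons.prems by simp
  ultimately show ?case using Cons assms(2) by (auto simp: card_insert_if)
qed simp

text \<open>Along a closed path each \<open>Eq n i\<close> returns to its nonzero value, so it
  changes sign an even number of times; the changes occur exactly at the letters \<open>i\<close>,
  \<open>n\<close> and \<open>n + 1\<close>.\<close>

lemma Gk_tilde_subset:
  assumes n: "n \<ge> 2" shows "Gk_tilde (Suc n) \<subseteq> sign_stab n"
proof
  fix g assume "g \<in> Gk_tilde (Suc n)"
  then obtain \<gamma> where g: "g = Gk_elem (Suc n) (path_word (Suc n) \<gamma>)" and gs: "good_stable_path (Suc n) (RC n) \<gamma>"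
    and ends: "\<gamma> 0 = \<gamma> 1"
    unfolding Gk_tilde_def RC_def by auto
  define Z where "Z = singular_values (Suc n) \<gamma>"
  have sp: "smooth_path (Suc n) (RC n) \<gamma>" and fin: "finite Z" and ns: "\<not> singular_config (Suc n) (\<gamma> 0)" "\<not> singular_config (Suc n) (\<gamma> 1)"
    and ty: "\<And>t. t \<in> Z \<Longrightarrow> \<exists>m. has_type (Suc n) \<gamma> t m \<and> stable_value (Suc n) (RC n) \<gamma> m t"
    using gs unfolding good_stable_path_def Z_def by auto
  have X: "\<gamma> ` {0..1} \<subseteq> topspace (RC n)" using sp unfolding smooth_path_def by blast
  have ZI: "Z \<subseteq> {0<..<1}"
  proof
    fix t assume t: "t \<in> Z"
    then have "t \<noteq> 0" "t \<noteq> 1" "t \<in> {0..1}" using ns by (auto simp: Z_def singular_values_def)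
    then show "t \<in> {0<..<1}" by auto
  qed
  have "\<exists>j\<le>n+1. flat_subsets (Suc n) (\<gamma> t) = {gen n j} \<and> stable_value (Suc n) (RC n) \<gamma> (gen n j) t" if t: "t \<in> Z" for t
  proof -
    obtain m where m: "flat_subsets (Suc n) (\<gamma> t) = {m}" "stable_value (Suc n) (RC n) \<gamma> m t"
      using ty[OF t] unfolding has_type_def by blast
    have "\<gamma> t \<in> topspace (RC n)" using X ZI t by fastforce
    then obtain a b where ab: "cpt n a b" "\<gamma> t = cfg n a b" using RC_cpt_cases[OF n] by blast
    have "m \<in> gen n ` {j. j \<le> n + 1 \<and> minor n j a b = 0}" using m(1) flat_cfg[OF n ab(1)] ab(2) by auto
    then obtain j where "m = gen n j" "j \<le> n + 1" by auto
    then show ?thesis using m by blast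
  qed
  then obtain jj where jj: "\<And>t. t \<in> Z \<Longrightarrow> jj t \<le> n + 1 \<and> flat_subsets (Suc n) (\<gamma> t) = {gen n (jj t)} \<and> stable_value (Suc n) (RC n) \<gamma> (gen n (jj t)) t"
    by metis
  define js where "js = map jj (sorted_list_of_set Z)"
  have sl: "set (sorted_list_of_set Z) = Z" "distinct (sorted_list_of_set Z)" using fin by auto
  have the: "(THE m. has_type (Suc n) \<gamma> t m) = gen n (jj t)" if "t \<in> Z" for t
    using jj[OF that] by (intro the_equality) (auto simp: has_type_def)
  have "path_word (Suc n) \<gamma> = map (gen n) js"
    unfolding path_word_def js_def map_map Z_def[symmetric]
    by (rule map_cong) (use the sl in auto)
  then have gj: "g = gel n js" by (simp add: g gel_def)
  have sub: "set js \<subseteq> {..n+1}" using jj sl by (auto simp: js_def)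
  have "\<not> flips n js i" if i: "i < n" for i
  proof -
    define f where "f s = Eq n i (\<gamma> s)" for s
    have "continuous_map (top_of_set {0..1}) euclideanreal (Eq n i \<circ> \<gamma>)"
      using smooth_path_pathin[OF n sp] continuous_map_EFG(1)[of n i] unfolding pathin_def by (rule continuous_map_compose)
    then have cf: "continuous_on {0..1} f" by (simp add: f_def o_def[abs_def])
    have f0: "f s \<noteq> 0" if s: "s \<in> {0..1} - Z" for s
    proof -
      have "\<gamma> s \<in> topspace (RC n)" using X s by auto
      then obtain a b where ab: "cpt n a b" "\<gamma> s = cfg n a b" using RC_cpt_cases[OF n] by blast
      have "flat_subsets (Suc n) (\<gamma> s) = {}" using s by (auto simp: Z_def singular_values_def singular_config_def)
      then have l: "minor n l a b \<noteq> 0" if "l \<le> n+1" for l using flat_cfg_mem[OF n ab(1) that] ab(2) by auto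
      show ?thesis unfolding f_def ab(2) Eq_cfg[OF n ab(1) i]
        using cpt_nrm(1,2)[OF n ab(1)] l[of i] l[of n] l[of "Suc n"] i by (simp add: minor_def)
    qed
    have "f 0 * f 1 > 0 \<longleftrightarrow> even (card {t \<in> Z. jj t = i \<or> jj t = n \<or> jj t = Suc n})"
    proof (rule sign_parity[OF fin _ cf ZI f0])
      show "sign_at f t (jj t = i \<or> jj t = n \<or> jj t = Suc n)" if t: "t \<in> Z" for t
        unfolding f_def using jj[OF t] stable_crossing_sign[OF n X _ _ _ _ _ _ i, of t "jj t"] ZI t fin[unfolded Z_def] by auto
    qed auto
    moreover have "f 0 * f 1 > 0"
    proof -
      have "f 0 \<noteq> 0" by (rule f0) (use ZI in auto)
      then show ?thesis using ends by (auto simp: f_def zero_less_mult_iff)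
    qed
    ultimately show ?thesis unfolding flips_def js_def count_list_map_three[OF sl(2) i] sl(1) by simp
  qed
  then show "g \<in> sign_stab n" unfolding gj sign_stab_def acts_trivial_iff using sub by blast
qed

subsection \<open>Simple zeros are stable\<close>

text \<open>Near a simple zero the derivative is bounded away from zero. A function close in value
  and derivative is still strictly monotone there and still has opposite signs at two points around
  \<open>t\<close>.\<close>

lemma simple_zero_stable:
  fixes F F' :: "real \<Rightarrow> real"
  assumes F: "\<And>s. (F has_real_derivative F' s) (at s)" and c: "continuous_on UNIV F'"
    and t: "0 < t" "t < 1" and z: "F t = 0" "F' t \<noteq> 0"
  obtains \<delta> \<rho> where "\<delta> > 0" "\<rho> > 0"
    "\<And>G G'. (\<And>s. s \<in> {0..1} \<Longrightarrow> (G has_real_derivative G' s) (at s)) \<Longrightarrow>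
      (\<And>s. s \<in> {0..1} \<Longrightarrow> \<bar>G s - F s\<bar> < \<rho> \<and> \<bar>G' s - F' s\<bar> < \<rho>) \<Longrightarrow>
      \<exists>!s. s \<in> {0..1} \<and> \<bar>s - t\<bar> < \<delta> \<and> G s = 0"
proof -
  define \<sigma> where "\<sigma> = sgn (F' t)"
  have sg: "\<bar>\<sigma>\<bar> = 1" "\<sigma> * F' t > 0" "\<sigma> \<noteq> 0" using z(2) by (auto simp: \<sigma>_def sgn_real_def)
  define \<mu> where "\<mu> = \<sigma> * F' t / 2"
  have mu: "\<mu> > 0" using sg by (simp add: \<mu>_def)
  have "isCont (\<lambda>s. \<sigma> * F' s) t" using c by (intro continuous_intros) (simp add: continuous_on_eq_continuous_at)
  then obtain d where d: "d > 0" "\<And>s. \<bar>s - t\<bar> < d \<Longrightarrow> \<bar>\<sigma> * F' s - \<sigma> * F' t\<bar> < \<mu>"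
    using mu unfolding continuous_at_eps_delta dist_real_def by metis
  define \<delta> where "\<delta> = min d (min t (1 - t))"
  have de: "\<delta> > 0" "\<delta> \<le> d" "\<delta> \<le> t" "\<delta> \<le> 1 - t" using d t by (auto simp: \<delta>_def)
  have in01: "s \<in> {0..1}" if "\<bar>s - t\<bar> < \<delta>" for s using that de by auto
  have Fp: "\<sigma> * F' s > \<mu>" if "\<bar>s - t\<bar> < \<delta>" for s
  proof -
    have "\<bar>\<sigma> * F' s - \<sigma> * F' t\<bar> < \<mu>" by (rule d(2)) (use that de in linarith)
    moreover have "\<sigma> * F' t = 2 * \<mu>" by (simp add: \<mu>_def)
    ultimately show ?thesis by linarith
  qed
  have inc: "\<sigma> * H p < \<sigma> * H q" if pq: "p < q" "\<bar>p - t\<bar> < \<delta>" "\<bar>q - t\<bar> < \<delta>"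
    and H: "\<And>s. s \<in> {0..1} \<Longrightarrow> (H has_real_derivative H' s) (at s)" "\<And>s. \<bar>s - t\<bar> < \<delta> \<Longrightarrow> \<sigma> * H' s > 0" for p q H H'
  proof (rule DERIV_pos_imp_increasing[OF pq(1)])
    fix s assume "p \<le> s" "s \<le> q"
    then have s: "\<bar>s - t\<bar> < \<delta>" using pq by auto
    show "\<exists>y. ((\<lambda>s. \<sigma> * H s) has_real_derivative y) (at s) \<and> 0 < y"
      by (intro exI[of _ "\<sigma> * H' s"] conjI DERIV_cmult H(1) H(2) in01 s)
  qed
  define p where "p = t - \<delta> / 2"
  define q where "q = t + \<delta> / 2"
  have pq: "p < t" "t < q" "\<bar>p - t\<bar> < \<delta>" "\<bar>q - t\<bar> < \<delta>" "\<bar>t - t\<bar> < \<delta>" using de by (auto simp: p_def q_def)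
  have Fpq: "\<sigma> * F p < 0" "\<sigma> * F q > 0"
    using inc[OF pq(1,3,5), of F F'] inc[OF pq(2,5,4), of F F'] F Fp mu z(1) by fastforce+
  \<comment> \<open>The bound \<mu>, half of the derivative at \<open>t\<close>, preserves
    monotonicity; the values at \<open>p\<close> and \<open>q\<close> preserve the signs.\<close>
  define \<rho> where "\<rho> = min \<mu> (min (- (\<sigma> * F p)) (\<sigma> * F q))"
  have rho: "\<rho> > 0" "\<rho> \<le> \<mu>" "\<rho> \<le> - (\<sigma> * F p)" "\<rho> \<le> \<sigma> * F q" using mu Fpq by (auto simp: \<rho>_def)
  show thesis
  proof (rule that[OF de(1) rho(1)])
    fix G G' assume G: "\<And>s. s \<in> {0..1} \<Longrightarrow> (G has_real_derivative G' s) (at s)"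
      and cl: "\<And>s. s \<in> {0..1} \<Longrightarrow> \<bar>G s - F s\<bar> < \<rho> \<and> \<bar>G' s - F' s\<bar> < \<rho>"
    have ms: "\<bar>\<sigma> * x - \<sigma> * y\<bar> = \<bar>x - y\<bar>" for x y
      using sg(1) by (metis abs_mult mult_1 right_diff_distrib)
    have G'p: "\<sigma> * G' s > 0" if "\<bar>s - t\<bar> < \<delta>" for s
      using Fp[OF that] cl[OF in01[OF that]] ms[of "G' s" "F' s"] rho by linarith
    have Gp: "\<sigma> * G p < 0" using cl[OF in01[OF pq(3)]] ms[of "G p" "F p"] rho by linarith
    have Gq: "\<sigma> * G q > 0" using cl[OF in01[OF pq(4)]] ms[of "G q" "F q"] rho by linarith
    have "continuous_on {p..q} (\<lambda>s. \<sigma> * G s)"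
    proof (intro continuous_intros continuous_at_imp_continuous_on ballI)
      fix s assume "s \<in> {p..q}"
      then have "s \<in> {0..1}" using pq in01[of s] by (auto simp: abs_less_iff)
      then show "isCont G s" using G DERIV_isCont by blast
    qed
    then obtain s where s: "p \<le> s" "s \<le> q" "\<sigma> * G s = 0" using IVT'[of "\<lambda>s. \<sigma> * G s" p 0 q] Gp Gq pq by auto
    have s': "\<bar>s - t\<bar> < \<delta>" using s pq by (auto simp: abs_less_iff)
    show "\<exists>!s. s \<in> {0..1} \<and> \<bar>s - t\<bar> < \<delta> \<and> G s = 0"
    proof (rule ex1I[of _ s])
      show "s \<in> {0..1} \<and> \<bar>s - t\<bar> < \<delta> \<and> G s = 0" using s s' sg(3) in01 by auto
      fix u assume u: "u \<in> {0..1} \<and> \<bar>u - t\<bar> < \<delta> \<and> G u = 0"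
      show "u = s"
      proof (rule ccontr)
        assume "u \<noteq> s"
        then consider "u < s" | "s < u" by linarith
        then show False
        proof cases
          case 1 then show False using inc[of u s G G', OF 1 _ s' G G'p] u s(3) by simp
        next
          case 2 then show False using inc[of s u G G', OF 2 s' _ G G'p] u s(3) by simp
        qed
      qed
    qed
  qed
qed

definition dminor :: "nat \<Rightarrow> nat \<Rightarrow> (nat \<Rightarrow> real) \<Rightarrow> (nat \<Rightarrow> real) \<Rightarrow> (nat \<Rightarrow> real) \<Rightarrow> (nat \<Rightarrow> real) \<Rightarrow> real" where
  "dminor n j a b a' b' = (if j < n then a' j * b n + a j * b' n - (a' n * b j + a n * b' j) else if j = n then b' n else a' n)"

lemma minor_deriv:
  assumes "\<And>i. i \<le> n \<Longrightarrow> ((\<lambda>t. a t i) has_real_derivative a' i) (at t)" "\<And>i. i \<le> n \<Longrightarrow> ((\<lambda>t. b t i) has_real_derivative b' i) (at t)"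
  shows "((\<lambda>t. minor n j (a t) (b t)) has_real_derivative dminor n j (a t) (b t) a' b') (at t)"
proof -
  consider "j < n" | "j = n" | "j > n" by linarith
  then show ?thesis
  proof cases
    case 1
    have "((\<lambda>t. a t j * b t n - a t n * b t j) has_real_derivative (a' j * b t n + b' n * a t j) - (a' n * b t j + b' j * a t n)) (at t)"
      by (intro DERIV_diff DERIV_mult assms) (use 1 in auto)
    then show ?thesis using 1 by (simp add: minor_def dminor_def algebra_simps)
  qed (use assms(1)[of n] assms(2)[of n] in \<open>simp_all add: minor_def dminor_def\<close>)
qed

section \<open>Minors of close lifts\<close>

lemma prod_close:
  fixes x y x' y' :: real
  assumes "\<bar>x\<bar> \<le> M" "\<bar>y\<bar> \<le> M" "\<bar>x' - x\<bar> < e" "\<bar>y' - y\<bar> < e" "e \<le> 1"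
  shows "\<bar>x' * y' - x * y\<bar> \<le> (2 * M + 1) * e"
proof -
  have "\<bar>x' * y' - x * y\<bar> = \<bar>(x' - x) * y' + x * (y' - y)\<bar>" by (simp add: algebra_simps)
  also have "\<dots> \<le> \<bar>x' - x\<bar> * \<bar>y'\<bar> + \<bar>x\<bar> * \<bar>y' - y\<bar>" by (metis abs_mult abs_triangle_ineq)
  also have "\<dots> \<le> e * (M + 1) + M * e" using assms by (intro add_mono mult_mono) auto
  finally show ?thesis by (simp add: algebra_simps)
qed

text \<open>A minor combines two products and its derivative four, each controlled by
  \<open>prod_close\<close>; hence the factor 4.\<close>

lemma minor_close:
  assumes M: "\<And>i. i \<le> n \<Longrightarrow> \<bar>a i\<bar> \<le> M \<and> \<bar>b i\<bar> \<le> M \<and> \<bar>da i\<bar> \<le> M \<and> \<bar>db i\<bar> \<le> M"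
    and c: "\<And>i. i \<le> n \<Longrightarrow> \<bar>a' i - a i\<bar> < e \<and> \<bar>b' i - b i\<bar> < e \<and> \<bar>da' i - da i\<bar> < e \<and> \<bar>db' i - db i\<bar> < e"
    and e: "e \<le> 1"
  shows "\<bar>minor n j a' b' - minor n j a b\<bar> \<le> 4 * ((2 * M + 1) * e) \<and> \<bar>dminor n j a' b' da' db' - dminor n j a b da db\<bar> \<le> 4 * ((2 * M + 1) * e)"
proof -
  define K where "K = (2 * M + 1) * e"
  have e0: "e > 0" using c[of n] abs_ge_zero le_less_trans by blast
  have "0 \<le> M" using M[of n] abs_ge_zero order_trans by blast
  then have eK: "e \<le> K" using e0 by (simp add: K_def algebra_simps)
  note pc = prod_close[OF _ _ _ _ e, of _ M, folded K_def]
  consider "j < n" | "j = n" | "j > n" by linarith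
  then show ?thesis unfolding K_def[symmetric]
  proof cases
    case 1
    have "\<bar>a' j * b' n - a j * b n\<bar> \<le> K" "\<bar>a' n * b' j - a n * b j\<bar> \<le> K"
      "\<bar>da' j * b' n - da j * b n\<bar> \<le> K" "\<bar>a' j * db' n - a j * db n\<bar> \<le> K"
      "\<bar>da' n * b' j - da n * b j\<bar> \<le> K" "\<bar>a' n * db' j - a n * db j\<bar> \<le> K"
      using 1 M[of j] M[of n] c[of j] c[of n] by (auto intro!: pc)
    then show "\<bar>minor n j a' b' - minor n j a b\<bar> \<le> 4 * K \<and> \<bar>dminor n j a' b' da' db' - dminor n j a b da db\<bar> \<le> 4 * K"
      using 1 unfolding minor_def dminor_def by (simp only: if_True) linarith
  qed (use c[of n] eK e0 in \<open>auto simp: minor_def dminor_def\<close>)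
qed

lemma bounded_family:
  fixes f :: "'i \<Rightarrow> real \<Rightarrow> real"
  assumes "finite I" "\<And>i. i \<in> I \<Longrightarrow> continuous_on {0..1} (f i)"
  obtains M where "M > 0" "\<And>i t. i \<in> I \<Longrightarrow> t \<in> {0..1} \<Longrightarrow> \<bar>f i t\<bar> \<le> M"
proof -
  have "bounded (\<Union>i\<in>I. f i ` {0..1})"
    using assms by (intro bounded_UN ballI compact_imp_bounded compact_continuous_image) auto
  then obtain M where "M > 0" "\<And>x. x \<in> (\<Union>i\<in>I. f i ` {0..1}) \<Longrightarrow> norm x \<le> M" unfolding bounded_pos by blast
  then show thesis using that[of M] by fastforce
qed

text \<open>Closeness of the lifts and their first derivatives (\<open>r = 1\<close>) makes the
  minor and its derivative close, since the lift is bounded on the unit interval.\<close>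

lemma stable_value_simple_zero:
  assumes n: "n \<ge> 2" and v: "smooth_lift (Suc n) \<gamma> v" and j: "j \<le> n + 1" and t: "0 < t" "t < 1"
    and z: "minor n j (v t (Suc n)) (v t (n+2)) = 0"
    and d: "((\<lambda>t. minor n j (v t (Suc n)) (v t (n+2))) has_real_derivative D) (at t)" "D \<noteq> 0"
  shows "stable_value (Suc n) (RC n) \<gamma> (gen n j) t"
proof -
  define F where "F s = minor n j (v s (Suc n)) (v s (n+2))" for s
  define dv where "dv u s i l = deriv (\<lambda>t. u t i l) s" for u :: "real \<Rightarrow> nat \<Rightarrow> nat \<Rightarrow> real" and s i l
  define F' where "F' s = dminor n j (v s (Suc n)) (v s (n+2)) (dv v s (Suc n)) (dv v s (n+2))" for s
  have DF: "((\<lambda>s. minor n j (u s (Suc n)) (u s (n+2))) has_real_derivative dminor n j (u s (Suc n)) (u s (n+2)) (dv u s (Suc n)) (dv u s (n+2))) (at s)"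
    if "smooth_lift (Suc n) \<gamma>' u" for u \<gamma>' s
    unfolding dv_def by (intro minor_deriv smooth_fun_DERIV smooth_lift_coord[OF that]) auto
  have cv: "continuous_on S (\<lambda>s. v s i l)" "continuous_on S (\<lambda>s. dv v s i l)" if "i \<in> {Suc n, n+2}" "l \<le> n" for i l S
    unfolding dv_def using smooth_fun_continuous[OF smooth_lift_coord[OF v that]] smooth_fun_deriv_continuous[OF smooth_lift_coord[OF v that]] by auto
  have cF': "continuous_on UNIV F'"
  proof (cases "j < n")
    case True then show ?thesis unfolding F'_def dminor_def by (simp) (intro continuous_intros cv; simp)
  next
    case False then show ?thesis unfolding F'_def dminor_def using cv(2)[of "Suc n" n] cv(2)[of "n+2" n] by (cases "j = n") simp_all
  qed
  have F: "(F has_real_derivative F' s) (at s)" for s unfolding F_def[abs_def] F'_def by (rule DF[OF v])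
  have "F' t = D" by (rule DERIV_unique[OF F]) (use d(1) in \<open>simp add: F_def[abs_def]\<close>)
  then have F't: "F' t \<noteq> 0" "F t = 0" using d(2) z by (auto simp: F_def)
  obtain \<delta> \<rho> where dr: "\<delta> > 0" "\<rho> > 0" and st: "\<And>G G'. (\<And>s. s \<in> {0..1} \<Longrightarrow> (G has_real_derivative G' s) (at s)) \<Longrightarrow>
      (\<And>s. s \<in> {0..1} \<Longrightarrow> \<bar>G s - F s\<bar> < \<rho> \<and> \<bar>G' s - F' s\<bar> < \<rho>) \<Longrightarrow>
      \<exists>!s. s \<in> {0..1} \<and> \<bar>s - t\<bar> < \<delta> \<and> G s = 0"
    using simple_zero_stable[OF F cF' t F't(2,1)] by blast
  define f where "f = (\<lambda>(m::nat, i, l) s. if m = 0 then v s i l else dv v s i l)"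
  obtain M where M: "M > 0" "\<And>x s. x \<in> {0::nat, 1} \<times> {Suc n, n+2} \<times> {..n} \<Longrightarrow> s \<in> {0..1} \<Longrightarrow> \<bar>f x s\<bar> \<le> M"
  proof (rule bounded_family[of "{0::nat, 1} \<times> {Suc n, n+2} \<times> {..n}" f])
    fix x assume x: "x \<in> {0::nat, 1} \<times> {Suc n, n+2} \<times> {..n}"
    obtain m i l where e: "x = (m, i, l)" by (cases x)
    have il: "i \<in> {Suc n, n+2}" "l \<le> n" using x e by auto
    show "continuous_on {0..1} (f x)" unfolding e f_def using cv[OF il] by (cases "m = 0") simp_all
  qed auto
  have Mb: "\<bar>v s i l\<bar> \<le> M" "\<bar>dv v s i l\<bar> \<le> M" if "i \<in> {Suc n, n+2}" "l \<le> n" "s \<in> {0..1}" for i l s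
    using M(2)[of "(0, i, l)" s] M(2)[of "(1, i, l)" s] that by (auto simp: f_def)
  \<comment> \<open>Chosen against the bound of \<open>minor_close\<close>, using
    \<open>4 * (2 * M + 1) < 8 * (M + 1)\<close>.\<close>
  define \<epsilon> where "\<epsilon> = min 1 (\<rho> / (8 * (M + 1)))"
  have eps: "\<epsilon> > 0" "\<epsilon> \<le> 1" using M(1) dr by (auto simp: \<epsilon>_def)
  have "4 * ((2 * M + 1) * \<epsilon>) < 8 * (M + 1) * \<epsilon>" using eps(1) by (simp add: algebra_simps)
  also have "\<dots> \<le> 8 * (M + 1) * (\<rho> / (8 * (M + 1)))" using M(1) by (intro mult_left_mono) (auto simp: \<epsilon>_def)
  also have "\<dots> = \<rho>" using M(1) by simp
  finally have er: "4 * ((2 * M + 1) * \<epsilon>) < \<rho>" .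
  show ?thesis
    unfolding stable_value_def
  proof (rule exI[of _ v], rule conjI[OF v], rule exI[of _ \<delta>], rule conjI[OF dr(1)],
      rule exI[of _ "1::nat"], rule exI[of _ \<epsilon>], rule conjI[OF eps(1)], intro allI impI)
    fix \<gamma>' w assume "smooth_path (Suc n) (RC n) \<gamma>' \<and> smooth_lift (Suc n) \<gamma>' w \<and> lifts_close (Suc n) 1 \<epsilon> v w"
    then have X: "\<gamma>' ` {0..1} \<subseteq> topspace (RC n)" and w: "smooth_lift (Suc n) \<gamma>' w" and cl: "lifts_close (Suc n) 1 \<epsilon> v w"
      unfolding smooth_path_def by auto
    have close: "\<bar>w s i l - v s i l\<bar> < \<epsilon>" "\<bar>dv w s i l - dv v s i l\<bar> < \<epsilon>" if "i \<in> {Suc n, n+2}" "l \<le> n" "s \<in> {0..1}" for i l s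
    proof -
      have *: "\<bar>(deriv ^^ m) (\<lambda>t. w t i l) s - (deriv ^^ m) (\<lambda>t. v t i l) s\<bar> < \<epsilon>" if "m \<le> 1" for m
        using cl that \<open>i \<in> _\<close> \<open>l \<le> n\<close> \<open>s \<in> _\<close> unfolding lifts_close_def by auto
      show "\<bar>w s i l - v s i l\<bar> < \<epsilon>" using *[of 0] by simp
      show "\<bar>dv w s i l - dv v s i l\<bar> < \<epsilon>" using *[of 1] by (simp add: dv_def)
    qed
    let ?G = "\<lambda>s. minor n j (w s (Suc n)) (w s (n+2))"
    let ?G' = "\<lambda>s. dminor n j (w s (Suc n)) (w s (n+2)) (dv w s (Suc n)) (dv w s (n+2))"
    have ex: "\<exists>!s. s \<in> {0..1} \<and> \<bar>s - t\<bar> < \<delta> \<and> ?G s = 0"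
    proof (rule st[where G = ?G and G' = ?G'])
      fix s assume s: "s \<in> {0..1::real}"
      show "(?G has_real_derivative ?G' s) (at s)" by (rule DF[OF w])
      have "\<bar>?G s - F s\<bar> \<le> 4 * ((2 * M + 1) * \<epsilon>) \<and> \<bar>?G' s - F' s\<bar> \<le> 4 * ((2 * M + 1) * \<epsilon>)"
        unfolding F_def F'_def by (rule minor_close[OF _ _ eps(2)]) (use Mb close s in simp_all)
      then show "\<bar>?G s - F s\<bar> < \<rho> \<and> \<bar>?G' s - F' s\<bar> < \<rho>" using er by linarith
    qed
    have fl: "gen n j \<in> flat_subsets (Suc n) (\<gamma>' s) \<longleftrightarrow> ?G s = 0" if s: "s \<in> {0..1}" for s
      unfolding smooth_lift_cfg(1)[OF n X w s] by (rule flat_cfg_mem[OF n smooth_lift_cfg(2)[OF n X w s] j])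
    have "s \<in> {0..1} \<and> \<bar>s - t\<bar> < \<delta> \<and> gen n j \<in> flat_subsets (Suc n) (\<gamma>' s) \<longleftrightarrow>
      s \<in> {0..1} \<and> \<bar>s - t\<bar> < \<delta> \<and> ?G s = 0" for s
      using fl by blast
    then show "\<exists>!s. s \<in> {0..1} \<and> \<bar>s - t\<bar> < \<delta> \<and> gen n j \<in> flat_subsets (Suc n) (\<gamma>' s)"
      using ex by (simp only:)
  qed
qed

subsection \<open>Realising words by polynomial paths\<close>

text \<open>A failure of a clause of \<open>good\<close> makes two minors vanish: \<open>j\<close>
  and \<open>n + 1\<close>, \<open>j\<close> and \<open>n\<close>, or \<open>i\<close> and
  \<open>j\<close>.\<close>

lemma good_minors:
  assumes "\<And>i j. i \<le> n + 1 \<Longrightarrow> j \<le> n + 1 \<Longrightarrow> i \<noteq> j \<Longrightarrow> minor n i a b \<noteq> 0 \<or> minor n j a b \<noteq> 0"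
  shows "good n a b"
  unfolding good_def
proof (intro conjI allI impI)
  show "a j \<noteq> 0 \<or> a n \<noteq> 0" if "j < n" for j using assms[of j "Suc n"] that by (auto simp: minor_def)
  show "b j \<noteq> 0 \<or> b n \<noteq> 0" if "j < n" for j using assms[of j n] that by (auto simp: minor_def)
  show "a i * b n \<noteq> a n * b i \<or> a j * b n \<noteq> a n * b j \<or> a i * b j \<noteq> a j * b i" if "i < n" "j < n" "i \<noteq> j" for i j
    using assms[of i j] that by (auto simp: minor_def)
qed

lemma sgn_prod_neg:
  fixes c :: "nat \<Rightarrow> real"
  assumes "finite A" "\<And>p. p \<in> A \<Longrightarrow> c p > 0"
  shows "sgn (\<Prod>p\<in>A. - c p) = (-1) ^ card A"
  using assms by (induction A) (auto simp: sgn_mult)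

lemma card_positions: "card {p. p < length js \<and> js ! p = j} = count_list js j"
proof -
  have "card {p. p < length js \<and> js ! p = j} = length (filter (\<lambda>x. j = x) js)"
    by (simp add: length_filter_conv_card eq_commute)
  then show ?thesis by (simp add: count_list_eq_length_filter)
qed

locale realised_word =
  fixes n :: nat and js :: "nat list"
  assumes n: "n \<ge> 2" and js: "set js \<subseteq> {..n+1}" and even: "acts n js {} = {}"
begin

text \<open>Equally spaced times, one for each letter of the word; the added ones keep both ends of
  the unit interval free.\<close>

definition tm :: "nat \<Rightarrow> real" where "tm p = (real p + 1) / (real (length js) + 1)"

definition Fz :: "nat \<Rightarrow> real poly" where
  "Fz j = (\<Prod>p\<in>{p. p < length js \<and> js ! p = j}. [:- tm p, 1:])"

definition corr :: "nat \<Rightarrow> real \<Rightarrow> real" where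
  "corr i t = - poly (Fz n) t * poly (Fz (Suc n)) t / poly (Fz i) t"

text \<open>This factor is negative on \<open>[0,1]\<close> and makes \<open>f\<^sub>i = - f\<^sub>n f\<^sub>n\<^sub>+\<^sub>1\<close> at both ends.\<close>

definition qz :: "nat \<Rightarrow> real poly" where "qz i = [:corr i 0, corr i 1 - corr i 0:]"

definition fz :: "nat \<Rightarrow> real poly" where
  "fz i = (if i < n then qz i * Fz i else Fz i)"

text \<open>The squared length of the pair of the last two polynomials. Multiplying by it allows the
  coordinates to be solved for without division; it is positive on the unit interval because letters
  \<open>n\<close> and \<open>n + 1\<close> have different times.\<close>

definition Dz :: "real poly" where "Dz = (fz n)\<^sup>2 + (fz (Suc n))\<^sup>2"

text \<open>A solution of \<open>a\<^sub>i f\<^sub>n - b\<^sub>i f\<^sub>n\<^sub>+\<^sub>1 = D f\<^sub>i\<close>; the multiple of \<open>(f\<^sub>n\<^sub>+\<^sub>1, f\<^sub>n)\<close> that is added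
  yields the base configuration at the ends.\<close>

definition Az :: "nat \<Rightarrow> real poly" where
  "Az i = (if i < n then fz i * fz n + fz (Suc n) * (fz n)\<^sup>2 else fz (Suc n) * Dz)"

definition Bz :: "nat \<Rightarrow> real poly" where
  "Bz i = (if i < n then - (fz i * fz (Suc n)) + (fz n)\<^sup>2 * fz n else fz n * Dz)"

definition az :: "real \<Rightarrow> nat \<Rightarrow> real" where "az t i = (if i \<le> n then poly (Az i) t else 0)"
definition bz :: "real \<Rightarrow> nat \<Rightarrow> real" where "bz t i = (if i \<le> n then poly (Bz i) t else 0)"

definition Pz :: "nat \<Rightarrow> real poly" where "Pz j = (if j < n then Dz\<^sup>2 * fz j else Dz * fz j)"

lemma minor_az: "j \<le> n + 1 \<Longrightarrow> minor n j (az t) (bz t) = poly (Pz j) t"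
proof -
  assume j: "j \<le> n + 1"
  consider "j < n" | "j = n" | "j = Suc n" using j by linarith
  then show ?thesis
  proof cases
    case 1
    have "Az j * Bz n - Az n * Bz j = Dz * fz j * ((fz n)\<^sup>2 + (fz (Suc n))\<^sup>2)"
      using 1 by (simp add: Az_def Bz_def algebra_simps power2_eq_square)
    also have "\<dots> = Pz j" unfolding Dz_def[symmetric] using 1 by (simp add: Pz_def power2_eq_square algebra_simps)
    finally have "poly (Az j * Bz n - Az n * Bz j) t = poly (Pz j) t" by (rule arg_cong)
    then show ?thesis using 1 by (simp add: minor_def az_def bz_def)
  qed (simp_all add: minor_def az_def bz_def Az_def Bz_def Pz_def mult.commute)
qed

section \<open>Zeros and signs of the polynomials\<close>

lemma tm01: "p < length js \<Longrightarrow> 0 < tm p \<and> tm p < 1"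
  by (simp add: tm_def)

lemma tm_less: "p < q \<Longrightarrow> tm p < tm q"
  by (simp add: tm_def divide_strict_right_mono)

lemma tm_inj: "tm p = tm q \<longleftrightarrow> p = q"
  using tm_less[of p q] tm_less[of q p] by (cases p q rule: linorder_cases) auto

lemma poly_Fz_0: "poly (Fz j) t = 0 \<longleftrightarrow> (\<exists>p<length js. js ! p = j \<and> t = tm p)"
  by (auto simp: Fz_def poly_prod)

lemma poly_Fz_1: "poly (Fz j) 1 > 0"
  unfolding Fz_def poly_prod by (rule prod_pos) (auto simp: tm01)

lemma sgn_Fz_0: "sgn (poly (Fz j) 0) = (-1) ^ count_list js j"
  using sgn_prod_neg[of "{p. p < length js \<and> js ! p = j}" tm] by (simp add: Fz_def poly_prod tm01 card_positions)

text \<open>Here it matters that the word lies in the stabiliser: the sign of \<open>Fz j\<close> at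
  0 is given by the parity of the count of \<open>j\<close>, and the three parities add up to an
  even number. At 1 all factors are positive.\<close>

lemma corr_neg: assumes i: "i < n" shows "corr i 0 < 0" "corr i 1 < 0"
proof -
  have "even (count_list js i + count_list js n + count_list js (Suc n))"
    using even i unfolding acts_trivial_iff flips_def by blast
  moreover have "sgn (corr i 0) = - ((-1) ^ (count_list js i + count_list js n + count_list js (Suc n)))"
    by (simp add: corr_def sgn_mult sgn_divide sgn_Fz_0 power_add) (simp add: field_simps)
  ultimately show "corr i 0 < 0" by (simp add: sgn_1_neg[symmetric])
  show "corr i 1 < 0" using poly_Fz_1 by (simp add: corr_def)
qed

text \<open>An affine interpolation of two negative values, so the correcting factor introduces no
  zeros on the unit interval.\<close>

lemma poly_qz_neg: assumes j: "j < n" and t: "t \<in> {0..1}" shows "poly (qz j) t < 0"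
proof -
  have "poly (qz j) t = (1 - t) * corr j 0 + t * corr j 1" by (simp add: qz_def algebra_simps)
  also have "\<dots> < 0"
  proof (cases "t = 0")
    case False
    then have "t * corr j 1 < 0" "(1 - t) * corr j 0 \<le> 0" using corr_neg[OF j] t by (auto simp: mult_pos_neg mult_nonneg_nonpos)
    then show ?thesis by linarith
  qed (use corr_neg[OF j] in simp)
  finally show ?thesis .
qed

lemma poly_fz_0: "t \<in> {0..1} \<Longrightarrow> poly (fz j) t = 0 \<longleftrightarrow> (\<exists>p<length js. js ! p = j \<and> t = tm p)"
  using poly_qz_neg[of j t] by (auto simp: fz_def poly_Fz_0)

lemma fz_unique: "t \<in> {0..1} \<Longrightarrow> poly (fz i) t = 0 \<Longrightarrow> poly (fz j) t = 0 \<Longrightarrow> i = j"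
  by (auto simp: poly_fz_0 tm_inj)

lemma Dz_pos: "t \<in> {0..1} \<Longrightarrow> poly Dz t > 0"
  using fz_unique[of t n "Suc n"] by (auto simp: Dz_def sum_power2_gt_zero_iff)

lemma Pz_0: "t \<in> {0..1} \<Longrightarrow> poly (Pz j) t = 0 \<longleftrightarrow> (\<exists>p<length js. js ! p = j \<and> t = tm p)"
  using Dz_pos[of t] by (simp add: Pz_def poly_fz_0[symmetric])

lemma cpt_az: assumes t: "t \<in> {0..1}" shows "cpt n (az t) (bz t)"
proof (rule cptI)
  show "good n (az t) (bz t)"
  proof (rule good_minors)
    fix i j assume ij: "i \<le> n + 1" "j \<le> n + 1" "i \<noteq> j"
    then show "minor n i (az t) (bz t) \<noteq> 0 \<or> minor n j (az t) (bz t) \<noteq> 0"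
      unfolding minor_az[OF ij(1)] minor_az[OF ij(2)] Pz_0[OF t] by (auto simp: tm_inj)
  qed
qed (auto simp: az_def bz_def)

definition \<gamma>z :: "real \<Rightarrow> nat \<Rightarrow> (nat \<Rightarrow> real) set" where "\<gamma>z t = cfg n (az t) (bz t)"

text \<open>Once polynomial \<open>i\<close> is minus the product of the last two, the entries
  \<open>a i\<close> with \<open>i < n\<close> vanish and all \<open>b i\<close> equal
  \<open>b n\<close>: the base configuration up to scaling.\<close>

lemma ends:
  assumes t: "t = 0 \<or> t = 1" shows "\<gamma>z t = base_config (Suc n)"
proof -
  have nz: "poly (Fz j) t \<noteq> 0" if "j \<le> n + 1" for j
    using t tm01 by (fastforce simp: poly_Fz_0)
  have f: "poly (fz i) t = - poly (fz n) t * poly (fz (Suc n)) t" if i: "i < n" for i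
  proof -
    have "poly (qz i) t = corr i t" using t by (auto simp: qz_def)
    then have "poly (fz i) t = corr i t * poly (Fz i) t" using i by (simp add: fz_def)
    also have "\<dots> = - poly (Fz n) t * poly (Fz (Suc n)) t" using nz[of i] i by (simp add: corr_def)
    finally show ?thesis by (simp add: fz_def)
  qed
  let ?c = "poly (fz (Suc n)) t * poly Dz t" and ?d = "poly (fz n) t * poly Dz t"
  have t01: "t \<in> {0..1}" using t by auto
  have D: "poly Dz t \<noteq> 0" using Dz_pos[OF t01] by simp
  have cd: "?c \<noteq> 0" "?d \<noteq> 0" using nz[of n] nz[of "Suc n"] D by (auto simp: fz_def)
  have a: "az t = (\<lambda>i. ?c * evec n i)"
  proof
    fix i show "az t i = ?c * evec n i"
      using f[of i] by (auto simp: az_def Az_def evec_def power2_eq_square)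
  qed
  have b: "bz t = (\<lambda>i. ?d * (if i < n then if i \<in> {..<n} then 1 else -1 else if i = n then 1 else 0))"
  proof
    fix i show "bz t i = ?d * (if i < n then if i \<in> {..<n} then 1 else -1 else if i = n then 1 else 0)"
      using f[of i] by (auto simp: bz_def Bz_def Dz_def power2_eq_square algebra_simps)
  qed
  have "\<gamma>z t = zc n {..<n}" unfolding \<gamma>z_def a b zc_def by (rule cfg_scale[OF cd])
  also have "\<dots> = base_config (Suc n)"
  proof
    fix j
    have "(\<lambda>i. if i < n then if i \<in> {..<n} then 1 else -1 else if i = n then 1 else (0::real)) = (\<lambda>i. if i < Suc n then 1 else 0)"
      by auto
    then show "zc n {..<n} j = base_config (Suc n) j"
      unfolding zc_def cfg_def base_config_def by (simp add: restrict_def ypt_eq) (auto simp: le_Suc_eq)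
  qed
  finally show ?thesis .
qed

section \<open>The path is good and stable and spells the word\<close>

definition vz :: "real \<Rightarrow> nat \<Rightarrow> nat \<Rightarrow> real" where "vz t i = cvec n (az t) (bz t) i"

lemma smooth_vz: "smooth_lift (Suc n) \<gamma>z vz"
  unfolding smooth_lift_def
proof (intro conjI ballI allI impI)
  fix i l assume i: "i \<in> {1..Suc n + 1}" and l: "l < Suc n"
  consider "i \<le> n" | "i = Suc n" | "i = n + 2" using i by fastforce
  then show "smooth_fun (\<lambda>t. vz t i l)"
  proof cases
    case 1 then show ?thesis by (simp add: vz_def cvec_def smooth_fun_const)
  next
    case 2
    have "(\<lambda>t. vz t i l) = poly (Az l)" using 2 l by (simp add: vz_def cvec_def az_def)
    then show ?thesis by (simp add: smooth_fun_poly)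
  next
    case 3
    have "(\<lambda>t. vz t i l) = poly (Bz l)" using 3 l by (simp add: vz_def cvec_def bz_def)
    then show ?thesis by (simp add: smooth_fun_poly)
  qed
next
  fix t i assume t: "t \<in> {0..1::real}" and i: "i \<in> {1..Suc n + 1}"
  note nrm = cpt_nrm[OF n cpt_az[OF t]]
  show "\<gamma>z t i = hline (vz t i)" unfolding \<gamma>z_def vz_def by (rule cfg_apply) (use i in auto)
  show "vz t i \<in> nonzero_vectors (Suc n - 1)"
  proof (cases "i \<le> n")
    case True then show ?thesis using evec_nonzero[of "i - 1" n] i by (simp add: vz_def cvec_def)
  next
    case False then show ?thesis using nrm by (simp add: vz_def cvec_def nonzero_vectors_iff)
  qed
qed

lemma flat_z: "t \<in> {0..1} \<Longrightarrow> flat_subsets (Suc n) (\<gamma>z t) = gen n ` {j. \<exists>p<length js. js ! p = j \<and> t = tm p}"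
proof -
  assume t: "t \<in> {0..1}"
  have "js ! p \<le> n + 1" if "p < length js" for p using js nth_mem[OF that] by auto
  then have "{j. j \<le> n + 1 \<and> minor n j (az t) (bz t) = 0} = {j. \<exists>p<length js. js ! p = j \<and> t = tm p}"
    using minor_az Pz_0[OF t] by fastforce
  then show ?thesis unfolding \<gamma>z_def flat_cfg[OF n cpt_az[OF t]] by simp
qed

lemma flat_tm: "p < length js \<Longrightarrow> flat_subsets (Suc n) (\<gamma>z (tm p)) = {gen n (js ! p)}"
  using tm01[of p] by (subst flat_z) (auto simp: tm_inj)

lemma singular_z: "singular_values (Suc n) \<gamma>z = tm ` {..<length js}"
proof -
  have "tm p \<in> {0..1}" if "p < length js" for p using tm01[OF that] by auto
  then show ?thesis by (auto simp: singular_values_def singular_config_def flat_z)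
qed

lemma word_z: "path_word (Suc n) \<gamma>z = map (gen n) js"
proof -
  have "sorted_list_of_set (singular_values (Suc n) \<gamma>z) = map tm [0..<length js]"
  proof -
    have "sorted (map tm [0..<length js])"
      by (auto simp: sorted_iff_nth_mono_less intro: less_imp_le tm_less)
    moreover have "distinct (map tm [0..<length js])" by (auto simp: distinct_map inj_on_def tm_inj)
    moreover have "set (map tm [0..<length js]) = singular_values (Suc n) \<gamma>z" by (auto simp: singular_z)
    ultimately show ?thesis using sorted_list_of_set.idem_if_sorted_distinct by metis
  qed
  moreover have "(THE m. has_type (Suc n) \<gamma>z (tm p) m) = gen n (js ! p)" if "p < length js" for p
    using flat_tm[OF that] by (intro the_equality) (auto simp: has_type_def)
  ultimately have "path_word (Suc n) \<gamma>z = map (\<lambda>p. gen n (js ! p)) [0..<length js]"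
    unfolding path_word_def by (simp add: o_def)
  also have "\<dots> = map (gen n) (map ((!) js) [0..<length js])" by simp
  finally show ?thesis by (simp only: map_nth)
qed

text \<open>The times are distinct, so the zero of the minor is simple; its derivative there is the
  value of the cofactor \<open>R\<close>.\<close>

lemma stable_z:
  assumes p: "p < length js" shows "stable_value (Suc n) (RC n) \<gamma>z (gen n (js ! p)) (tm p)"
proof -
  define j where "j = js ! p"
  have j: "j \<le> n + 1" using js nth_mem[OF p] by (auto simp: j_def)
  have t: "tm p \<in> {0..1}" using tm01[OF p] by auto
  define A where "A = {q. q < length js \<and> js ! q = j}"
  define R where "R = (if j < n then Dz\<^sup>2 * qz j else Dz) * (\<Prod>q\<in>A - {p}. [:- tm q, 1:])"
  have "p \<in> A" "finite A" using p by (auto simp: A_def j_def)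
  then have "Fz j = [:- tm p, 1:] * (\<Prod>q\<in>A - {p}. [:- tm q, 1:])"
    unfolding Fz_def A_def[symmetric] by (simp add: prod.remove)
  then have PR: "Pz j = [:- tm p, 1:] * R" by (simp only: Pz_def fz_def R_def mult.assoc mult.left_commute split: if_split) blast
  have "poly (\<Prod>q\<in>A - {p}. [:- tm q, 1:]) (tm p) \<noteq> 0" using \<open>finite A\<close> by (auto simp: poly_prod tm_inj)
  then have R: "poly R (tm p) \<noteq> 0" using Dz_pos[OF t] poly_qz_neg[OF _ t, of j] by (auto simp: R_def)
  have lz: "(\<lambda>t. minor n j (vz t (Suc n)) (vz t (n+2))) = poly (Pz j)"
    using minor_az[OF j] by (auto simp: vz_def cvec_def)
  have "pderiv (Pz j) = [:- tm p, 1:] * pderiv R + R * pderiv [:- tm p, 1:]" unfolding PR by (rule pderiv_mult)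
  then have "poly (pderiv (Pz j)) (tm p) = poly R (tm p)" by (simp add: pderiv_pCons)
  then have d: "((\<lambda>t. minor n j (vz t (Suc n)) (vz t (n+2))) has_real_derivative poly R (tm p)) (at (tm p))"
    unfolding lz by (metis poly_DERIV)
  show ?thesis unfolding j_def[symmetric]
  proof (rule stable_value_simple_zero[OF n smooth_vz j _ _ _ d R])
    show "minor n j (vz (tm p) (Suc n)) (vz (tm p) (n+2)) = 0" using fun_cong[OF lz, of "tm p"] PR by simp
  qed (use tm01[OF p] in auto)
qed

lemma gel_in_Gk_tilde: "gel n js \<in> Gk_tilde (Suc n)"
proof -
  have 0: "\<not> singular_config (Suc n) (\<gamma>z t)" if "t = 0 \<or> t = 1" for t
  proof -
    have "t \<notin> singular_values (Suc n) \<gamma>z" unfolding singular_z using that tm01 by fastforce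
    then show ?thesis using that by (auto simp: singular_values_def)
  qed
  have "smooth_path (Suc n) (RC n) \<gamma>z"
    unfolding smooth_path_def using smooth_vz cpt_nrm(8)[OF n cpt_az] by (auto simp: \<gamma>z_def)
  moreover have "\<exists>m. has_type (Suc n) \<gamma>z t m \<and> stable_value (Suc n) (RC n) \<gamma>z m t" if "t \<in> singular_values (Suc n) \<gamma>z" for t
  proof -
    obtain p where p: "p < length js" "t = tm p" using \<open>t \<in> _\<close> by (auto simp: singular_z)
    then show ?thesis using stable_z[OF p(1)] flat_tm[OF p(1)] by (auto simp: has_type_def)
  qed
  moreover have "finite (singular_values (Suc n) \<gamma>z)" by (simp add: singular_z)
  ultimately have gs: "good_stable_path (Suc n) (RC n) \<gamma>z" unfolding good_stable_path_def using 0 by blast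
  have "gel n js = Gk_elem (Suc n) (path_word (Suc n) \<gamma>z)" by (simp add: gel_def word_z)
  then show ?thesis unfolding Gk_tilde_def RC_def[symmetric] using gs ends by blast
qed

end

lemma Gk_tilde_eq: "n \<ge> 2 \<Longrightarrow> Gk_tilde (Suc n) = sign_stab n"
proof
  assume n: "n \<ge> 2"
  show "sign_stab n \<subseteq> Gk_tilde (Suc n)"
  proof
    fix g assume "g \<in> sign_stab n"
    then obtain js where js: "g = gel n js" "set js \<subseteq> {..n+1}" "acts n js {} = {}" unfolding sign_stab_def by blast
    have "realised_word n js" by unfold_locales (use n js in auto)
    then show "g \<in> Gk_tilde (Suc n)" using realised_word.gel_in_Gk_tilde js(1) by simp
  qed
qed (rule Gk_tilde_subset)

theorem theorem1:
  fixes k :: nat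
  assumes "k \<ge> 3"
  shows "subgroup (Gk_tilde k) (Gk k) \<and>
         card (rcosets\<^bsub>Gk k\<^esub> (Gk_tilde k)) = 2 ^ (k - 1) \<and>
         (\<forall>x \<in> topspace (reduced_config_space k).
            (Gk k)\<lparr>carrier := Gk_tilde k\<rparr> \<cong> fundamental_group (reduced_config_space k) x)"
proof -
  obtain n where k: "k = Suc n" and n: "n \<ge> 2" using assms by (cases k) auto
  have "(Gk k)\<lparr>carrier := Gk_tilde k\<rparr> \<cong> fundamental_group (reduced_config_space k) x"
    if "x \<in> topspace (reduced_config_space k)" for x
  proof -
    interpret pointed_config n x by unfold_locales (use n that in \<open>simp_all add: k RC_def\<close>)
    show ?thesis using sign_stab_iso unfolding k Gk_tilde_eq[OF n] RC_def .
  qed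
  then show ?thesis
    using subgroup_sign_stab card_rcosets_sign_stab n by (simp add: k Gk_tilde_eq)
qed

end
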